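(* Let $b_i,\sigma_i,f_i$, $i=1,2,3$, be bounded $\mathbb F$-adapted processes and $h$ a bounded $\mathcal F_T$-measurable random variable. Consider the linear FBSDE $$\mathcal X_t=1+\int_0^t(b_1\mathcal X_s+b_2\mathcal Y_s+b_3\mathcal Z_s)\,ds+\int_0^t(\sigma_1\mathcal X_s+\sigma_2\mathcal Y_s+\sigma_3\mathcal Z_s)\,dB_s,$$ $$\mathcal Y_t=h\mathcal X_T+\int_t^T(f_1\mathcal X_s+f_2\mathcal Y_s+f_3\mathcal Z_s)\,ds-\int_t^T\mathcal Z_s\,dB_s,\qquad t\in[0,T],\tag{L}$$ and the characteristic BSDE $$\hat Y_t=h+\int_t^T\big[F_s(\hat Y_s)+G_s(\hat Y_s)\hat Z_s+\Lambda_s(\hat Y_s)|\hat Z_s|^2\big]ds-\int_t^T\hat Z_s\,dB_s,\qquad t\in[0,T].\tag{C}$$ (i) If (C) has a solution $(\hat Y,\hat Z)$ such that both $\hat Y$ and $(1-\sigma_3\hat Y)^{-1}$ are bounded, then (L) has a solution $(\mathcal X,\mathcal Y,\mathcal Z)\in\bigcup_{q>1}\mathbb L^q$ such that $\mathcal X\ne0$ and $$\mathcal Y=\hat Y\mathcal X,\qquad \mathcal Z=\frac{\hat Z+\hat Y(\sigma_1+\sigma_2\hat Y)}{1-\sigma_3\hat Y}\,\mathcal X.$$ (ii) Conversely, if (L) has a solution $(\mathcal X,\mathcal Y,\mathcal Z)\in\bigcup_{q>1}\mathbb L^q$ such that, for some constant $C$, $$|\mathcal Y_t|\le C|\mathcal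 X_t|,\qquad|\mathcal X_t|\le C|\mathcal X_t-\sigma_3\mathcal Y_t|,$$ then $\mathcal X\ne0$, and the processes $$\hat Y:=\mathcal Y/\mathcal X,\qquad\hat Z:=\big[\mathcal Z-\hat Y(\sigma_1\mathcal X+\sigma_2\mathcal Y+\sigma_3\mathcal Z)\big]/\mathcal X$$ satisfy (C), and both $\hat Y$ and $(1-\sigma_3\hat Y)^{-1}$ are bounded.
   Context: Setting: $T>0$ is fixed, $B$ is a one-dimensional standard Brownian motion on $(\Omega,\mathcal F,\mathbb P)$, $\mathbb F=(\mathcal F_t)$ is its natural filtration augmented by the $\mathbb P$-null sets, and all processes are real-valued and $\mathbb F$-progressively measurable. The time argument of $b_i,\sigma_i,f_i$ is suppressed. "Bounded" means bounded by a deterministic constant uniformly in $(t,\omega)$; $\mathcal X\neq 0$ means that $\mathcal X_t\ne0$ for all $t\in[0,T]$, a.s. Notation: $$F_s(y)=f_1+f_2y+y(b_1+b_2y)+\frac{(f_3+b_3y)\,y(\sigma_1+\sigma_2y)}{1-\sigma_3y},\quad G_s(y)=\frac{(\sigma_1+f_3)+(\sigma_2+b_3)y}{1-\sigma_3y},\quad\Lambda_s(y)=\frac{\sigma_3}{1-\sigma_3y},$$ with coefficients evaluated at time $s$. For $q\ge1$, $\mathbb L^q$ is the space of $\Theta=(X,Y,Z)$ with $$\|\Theta\|_{\mathbb L^q}^q:=\mathbb E\Big\{\sup_{0\le t\le T}[|X_t|^q+|Y_t|^q]+\Big(\int_0^T|Z_t|^2dt\Big)^{q/2}\Big\}<\infty.$$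 *)

theory Defs
  imports "HOL-Probability.Probability"
begin

text \<open>Processes are functions \<open>X t \<omega>\<close> of type \<open>real \<Rightarrow> 'a \<Rightarrow> real\<close>; only their values for
  \<open>t \<in> {0..T}\<close> matter.\<close>

locale brownian_motion = prob_space M
  for M :: "'a measure" +
  fixes T :: real and B :: "real \<Rightarrow> 'a \<Rightarrow> real"
  assumes B_measurable: "\<And>t. t \<in> {0..T} \<Longrightarrow> B t \<in> borel_measurable M"
    and B_zero: "AE \<omega> in M. B 0 \<omega> = 0"
    and B_increment: "\<And>s t. 0 \<le> s \<Longrightarrow> s < t \<Longrightarrow> t \<le> T \<Longrightarrow>
      distributed M lborel (\<lambda>\<omega>. B t \<omega> - B s \<omega>) (normal_density 0 (sqrt (t - s)))"
    and B_indep: "\<And>(n::nat) (\<tau>::nat \<Rightarrow> real).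
      0 \<le> \<tau> 0 \<Longrightarrow> (\<And>i. i < n \<Longrightarrow> \<tau> i < \<tau> (Suc i)) \<Longrightarrow> \<tau> n \<le> T \<Longrightarrow>
      indep_vars (\<lambda>_. borel) (\<lambda>i \<omega>. B (\<tau> (Suc i)) \<omega> - B (\<tau> i) \<omega>) {..<n}"
    and B_continuous: "AE \<omega> in M. continuous_on {0..T} (\<lambda>t. B t \<omega>)"

text \<open>Only the space and the measurable sets of \<open>augmented_filtration M B t\<close> are meaningful, not
  its emeasure. Completeness of \<open>M\<close> is not required.\<close>

definition augmented_filtration ::
  "'a measure \<Rightarrow> (real \<Rightarrow> 'a \<Rightarrow> real) \<Rightarrow> real \<Rightarrow> 'a measure" where
  "augmented_filtration M B t =
     sigma (space M)
       ({B s -` A \<inter> space M | s A. s \<in> {0..t} \<and> A \<in> sets borel} \<union> null_sets M)"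

definition progressive :: "(real \<Rightarrow> 'a measure) \<Rightarrow> real \<Rightarrow> (real \<Rightarrow> 'a \<Rightarrow> real) \<Rightarrow> bool" where
  "progressive \<F> T X \<longleftrightarrow>
     (\<forall>t\<in>{0..T}. (\<lambda>(s, \<omega>). X s \<omega>)
        \<in> borel_measurable (restrict_space borel {0..t} \<Otimes>\<^sub>M \<F> t))"

definition bounded_process :: "'a measure \<Rightarrow> real \<Rightarrow> (real \<Rightarrow> 'a \<Rightarrow> real) \<Rightarrow> bool" where
  "bounded_process M T X \<longleftrightarrow> (\<exists>K. AE \<omega> in M. \<forall>t\<in>{0..T}. \<bar>X t \<omega>\<bar> \<le> K)"

definition nonzero_process :: "'a measure \<Rightarrow> real \<Rightarrow> (real \<Rightarrow> 'a \<Rightarrow> real) \<Rightarrow> bool" where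
  "nonzero_process M T X \<longleftrightarrow> (AE \<omega> in M. \<forall>t\<in>{0..T}. X t \<omega> \<noteq> 0)"

text \<open>Since \<open>inverse 0 = 0\<close>, boundedness of \<open>1 / X\<close> must include \<open>X \<noteq> 0\<close> explicitly.\<close>

definition bounded_inverse :: "'a measure \<Rightarrow> real \<Rightarrow> (real \<Rightarrow> 'a \<Rightarrow> real) \<Rightarrow> bool" where
  "bounded_inverse M T X \<longleftrightarrow>
     nonzero_process M T X \<and> bounded_process M T (\<lambda>t \<omega>. inverse (X t \<omega>))"

text \<open>A list of triples \<open>(u, v, \<xi>)\<close> represents the simple integrand given by the sum of the
  \<open>\<xi> * indicator {u<..v}\<close>. The intervals may overlap, which does not change the class of simple
  integrands or the value of the integral.\<close>

type_synonym 'a simple_integrand = "(real \<times> real \<times> ('a \<Rightarrow> real)) list"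

definition simple_integrand ::
  "(real \<Rightarrow> 'a measure) \<Rightarrow> real \<Rightarrow> 'a simple_integrand \<Rightarrow> bool" where
  "simple_integrand \<F> T S \<longleftrightarrow>
     (\<forall>(u, v, \<xi>) \<in> set S. 0 \<le> u \<and> u \<le> v \<and> v \<le> T \<and>
        \<xi> \<in> borel_measurable (\<F> u) \<and> (\<exists>K. \<forall>\<omega>\<in>space (\<F> u). \<bar>\<xi> \<omega>\<bar> \<le> K))"

definition simple_process :: "'a simple_integrand \<Rightarrow> real \<Rightarrow> 'a \<Rightarrow> real" where
  "simple_process S s \<omega> = (\<Sum>(u, v, \<xi>)\<leftarrow>S. \<xi> \<omega> * indicator {u<..v} s)"

definition simple_integral ::
  "(real \<Rightarrow> 'a \<Rightarrow> real) \<Rightarrow> 'a simple_integrand \<Rightarrow> real \<Rightarrow> 'a \<Rightarrow> real" where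
  "simple_integral B S t \<omega> = (\<Sum>(u, v, \<xi>)\<leftarrow>S. \<xi> \<omega> * (B (min v t) \<omega> - B (min u t) \<omega>))"

definition null_in_prob :: "'a measure \<Rightarrow> (nat \<Rightarrow> 'a \<Rightarrow> ennreal) \<Rightarrow> bool" where
  "null_in_prob M D \<longleftrightarrow>
     (\<forall>n. D n \<in> borel_measurable M) \<and>
     (\<forall>\<epsilon>>0. (\<lambda>n. measure M {\<omega> \<in> space M. ennreal \<epsilon> < D n \<omega>}) \<longlonglongrightarrow> 0)"

definition int_square :: "real \<Rightarrow> (real \<Rightarrow> 'a \<Rightarrow> real) \<Rightarrow> 'a \<Rightarrow> ennreal" where
  "int_square T Z \<omega> = (\<integral>\<^sup>+ s\<in>{0..T}. ennreal ((Z s \<omega>)\<^sup>2) \<partial>lborel)"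

text \<open>\<open>has_ito_integral M \<F> B T H I\<close>: the integrand \<open>H\<close> is progressive with almost surely square
  integrable paths, and \<open>I\<close> is a continuous version of the process of integrals of \<open>H\<close> against
  \<open>B\<close> over \<open>{0..t}\<close>, that is, the limit in probability at each \<open>t\<close> of the integrals of simple
  integrands approximating \<open>H\<close>. This determines \<open>I\<close> up to indistinguishability.\<close>

definition has_ito_integral ::
  "'a measure \<Rightarrow> (real \<Rightarrow> 'a measure) \<Rightarrow> (real \<Rightarrow> 'a \<Rightarrow> real) \<Rightarrow> real \<Rightarrow>
   (real \<Rightarrow> 'a \<Rightarrow> real) \<Rightarrow> (real \<Rightarrow> 'a \<Rightarrow> real) \<Rightarrow> bool" where
  "has_ito_integral M \<F> B T H I \<longleftrightarrow>
     progressive \<F> T H \<and>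
     (AE \<omega> in M. int_square T H \<omega> < \<infinity>) \<and>
     progressive \<F> T I \<and>
     (AE \<omega> in M. continuous_on {0..T} (\<lambda>t. I t \<omega>)) \<and>
     (\<exists>S. (\<forall>n. simple_integrand \<F> T (S n)) \<and>
          null_in_prob M (\<lambda>n. int_square T (\<lambda>s \<omega>. simple_process (S n) s \<omega> - H s \<omega>)) \<and>
          (\<forall>t\<in>{0..T}.
             null_in_prob M (\<lambda>n \<omega>. ennreal \<bar>simple_integral B (S n) t \<omega> - I t \<omega>\<bar>)))"

definition ennreal_powr :: "ennreal \<Rightarrow> real \<Rightarrow> ennreal" where
  "ennreal_powr x p = (if x = \<infinity> then \<infinity> else ennreal (enn2real x powr p))"

definition Lq_space ::
  "'a measure \<Rightarrow> (real \<Rightarrow> 'a measure) \<Rightarrow> real \<Rightarrow> real \<Rightarrow>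
   ((real \<Rightarrow> 'a \<Rightarrow> real) \<times> (real \<Rightarrow> 'a \<Rightarrow> real) \<times> (real \<Rightarrow> 'a \<Rightarrow> real)) set" where
  "Lq_space M \<F> T q = {(X, Y, Z).
     progressive \<F> T X \<and> progressive \<F> T Y \<and> progressive \<F> T Z \<and>
     (\<integral>\<^sup>+ \<omega>. (SUP t\<in>{0..T}. ennreal (\<bar>X t \<omega>\<bar> powr q + \<bar>Y t \<omega>\<bar> powr q))
              + ennreal_powr (int_square T Z \<omega>) (q / 2) \<partial>M) < \<infinity>}"

text \<open>The coefficients \<open>b i\<close>, \<open>\<sigma> i\<close>, \<open>f i\<close> are used for \<open>i = 1, 2, 3\<close> only. Because the Lebesgue
  integral of a non-integrable function is \<open>0\<close>, pathwise integrability of the drivers is part of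
  the notion of solution; that of the squared diffusion terms is part of
  \<open>has_ito_integral\<close>.\<close>

definition solves_linear_fbsde ::
  "'a measure \<Rightarrow> (real \<Rightarrow> 'a measure) \<Rightarrow> (real \<Rightarrow> 'a \<Rightarrow> real) \<Rightarrow> real \<Rightarrow>
   (nat \<Rightarrow> real \<Rightarrow> 'a \<Rightarrow> real) \<Rightarrow> (nat \<Rightarrow> real \<Rightarrow> 'a \<Rightarrow> real) \<Rightarrow>
   (nat \<Rightarrow> real \<Rightarrow> 'a \<Rightarrow> real) \<Rightarrow> ('a \<Rightarrow> real) \<Rightarrow>
   (real \<Rightarrow> 'a \<Rightarrow> real) \<Rightarrow> (real \<Rightarrow> 'a \<Rightarrow> real) \<Rightarrow> (real \<Rightarrow> 'a \<Rightarrow> real) \<Rightarrow> bool" where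
  "solves_linear_fbsde M \<F> B T b \<sigma> f h X Y Z \<longleftrightarrow>
     progressive \<F> T X \<and> progressive \<F> T Y \<and> progressive \<F> T Z \<and>
     (AE \<omega> in M. set_integrable lborel {0..T}
        (\<lambda>s. b 1 s \<omega> * X s \<omega> + b 2 s \<omega> * Y s \<omega> + b 3 s \<omega> * Z s \<omega>)) \<and>
     (AE \<omega> in M. set_integrable lborel {0..T}
        (\<lambda>s. f 1 s \<omega> * X s \<omega> + f 2 s \<omega> * Y s \<omega> + f 3 s \<omega> * Z s \<omega>)) \<and>
     (\<exists>I J.
        has_ito_integral M \<F> B T
          (\<lambda>s \<omega>. \<sigma> 1 s \<omega> * X s \<omega> + \<sigma> 2 s \<omega> * Y s \<omega> + \<sigma> 3 s \<omega> * Z s \<omega>) I \<and>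
        has_ito_integral M \<F> B T Z J \<and>
        (AE \<omega> in M. \<forall>t\<in>{0..T}.
           X t \<omega> = 1
             + (LBINT s:{0..t}. b 1 s \<omega> * X s \<omega> + b 2 s \<omega> * Y s \<omega> + b 3 s \<omega> * Z s \<omega>)
             + I t \<omega> \<and>
           Y t \<omega> = h \<omega> * X T \<omega>
             + (LBINT s:{t..T}. f 1 s \<omega> * X s \<omega> + f 2 s \<omega> * Y s \<omega> + f 3 s \<omega> * Z s \<omega>)
             - (J T \<omega> - J t \<omega>)))"

definition char_F ::
  "(nat \<Rightarrow> real \<Rightarrow> 'a \<Rightarrow> real) \<Rightarrow> (nat \<Rightarrow> real \<Rightarrow> 'a \<Rightarrow> real) \<Rightarrow>
   (nat \<Rightarrow> real \<Rightarrow> 'a \<Rightarrow> real) \<Rightarrow> real \<Rightarrow> 'a \<Rightarrow> real \<Rightarrow> real" where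
  "char_F b \<sigma> f s \<omega> y =
     f 1 s \<omega> + f 2 s \<omega> * y + y * (b 1 s \<omega> + b 2 s \<omega> * y)
     + (f 3 s \<omega> + b 3 s \<omega> * y) * y * (\<sigma> 1 s \<omega> + \<sigma> 2 s \<omega> * y) / (1 - \<sigma> 3 s \<omega> * y)"

definition char_G ::
  "(nat \<Rightarrow> real \<Rightarrow> 'a \<Rightarrow> real) \<Rightarrow> (nat \<Rightarrow> real \<Rightarrow> 'a \<Rightarrow> real) \<Rightarrow>
   (nat \<Rightarrow> real \<Rightarrow> 'a \<Rightarrow> real) \<Rightarrow> real \<Rightarrow> 'a \<Rightarrow> real \<Rightarrow> real" where
  "char_G b \<sigma> f s \<omega> y =
     ((\<sigma> 1 s \<omega> + f 3 s \<omega>) + (\<sigma> 2 s \<omega> + b 3 s \<omega>) * y) / (1 - \<sigma> 3 s \<omega> * y)"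

definition char_Lambda ::
  "(nat \<Rightarrow> real \<Rightarrow> 'a \<Rightarrow> real) \<Rightarrow> real \<Rightarrow> 'a \<Rightarrow> real \<Rightarrow> real" where
  "char_Lambda \<sigma> s \<omega> y = \<sigma> 3 s \<omega> / (1 - \<sigma> 3 s \<omega> * y)"

definition char_driver ::
  "(nat \<Rightarrow> real \<Rightarrow> 'a \<Rightarrow> real) \<Rightarrow> (nat \<Rightarrow> real \<Rightarrow> 'a \<Rightarrow> real) \<Rightarrow>
   (nat \<Rightarrow> real \<Rightarrow> 'a \<Rightarrow> real) \<Rightarrow> real \<Rightarrow> 'a \<Rightarrow> real \<Rightarrow> real \<Rightarrow> real" where
  "char_driver b \<sigma> f s \<omega> y z =
     char_F b \<sigma> f s \<omega> y + char_G b \<sigma> f s \<omega> y * z + char_Lambda \<sigma> s \<omega> y * \<bar>z\<bar>\<^sup>2"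

definition solves_char_bsde ::
  "'a measure \<Rightarrow> (real \<Rightarrow> 'a measure) \<Rightarrow> (real \<Rightarrow> 'a \<Rightarrow> real) \<Rightarrow> real \<Rightarrow>
   (nat \<Rightarrow> real \<Rightarrow> 'a \<Rightarrow> real) \<Rightarrow> (nat \<Rightarrow> real \<Rightarrow> 'a \<Rightarrow> real) \<Rightarrow>
   (nat \<Rightarrow> real \<Rightarrow> 'a \<Rightarrow> real) \<Rightarrow> ('a \<Rightarrow> real) \<Rightarrow>
   (real \<Rightarrow> 'a \<Rightarrow> real) \<Rightarrow> (real \<Rightarrow> 'a \<Rightarrow> real) \<Rightarrow> bool" where
  "solves_char_bsde M \<F> B T b \<sigma> f h Y Z \<longleftrightarrow>
     progressive \<F> T Y \<and> progressive \<F> T Z \<and>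
     (AE \<omega> in M. set_integrable lborel {0..T} (\<lambda>s. char_driver b \<sigma> f s \<omega> (Y s \<omega>) (Z s \<omega>))) \<and>
     (\<exists>J. has_ito_integral M \<F> B T Z J \<and>
        (AE \<omega> in M. \<forall>t\<in>{0..T}.
           Y t \<omega> = h \<omega> + (LBINT s:{t..T}. char_driver b \<sigma> f s \<omega> (Y s \<omega>) (Z s \<omega>))
             - (J T \<omega> - J t \<omega>)))"

end

theory Submission
 imports Defs
begin

text \<open>
 Part (i). Put \<open>\<gamma> = (Zh + Yh (\<sigma>\<^sub>1 + \<sigma>\<^sub>2 Yh)) / (1 - \<sigma>\<^sub>3 Yh)\<close>, let \<open>\<alpha>\<close> and \<open>\<beta>\<close> be the diffusion and drift coefficients of
 the forward equation at \<open>(1, Yh, \<gamma>)\<close>, and \<open>L = \<integral> (\<beta> - \<alpha>\<^sup>2 / 2) ds + \<integral> \<alpha> dB\<close>. By Ito's formula \<open>X = e\<^sup>L\<close>, \<open>Y = Yh X\<close>,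
 \<open>Z = \<gamma> X\<close> solve the linear system. The integrability with an exponent \<open>q = 1 + \<epsilon>\<close> comes from
 the supermartingale \<open>W = K e\<^bsup>q L\<^esup> - e\<^bsup>q L + c Yh\<^esup>\<close> (up to a discount): it is comparable to
 \<open>X\<^sup>q\<close> and, for \<open>c\<close> and \<open>K\<close> large, has drift at most \<open>C W - \<eta> e\<^bsup>q L\<^esup> Zh\<^sup>2\<close>, so a weak maximal inequality for \<open>X\<^sup>q\<close> and an energy bound for \<open>Z\<close> follow.

 Part (ii). The same \<open>W\<close> with \<open>q = - \<epsilon>\<close>, with \<open>L\<close> a smooth extension of \<open>ln X\<close> below a level \<open>\<delta>\<close> and with
 \<open>U = Y e\<^bsup>- L\<^esup>\<close> in place of \<open>Yh\<close>, discounted by its drift on \<open>{X < \<delta>}\<close>, yields \<open>P (inf X < \<delta>) \<le> C \<delta>\<^bsup>\<epsilon>\<^esup>\<close>. Hence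
 \<open>X > 0\<close>, and Ito's formula for \<open>Y / X\<close> is the characteristic equation.

 The Ito integral is the limit of simple integrals, uniformly in time and in probability; it is built from
 Kolmogorov's inequality, and Ito's formula from a Taylor expansion along refining grids.
\<close>

text \<open>The coefficients of \<open>L\<close> grow linearly in \<open>Zh\<close>, and of
  \<open>Zh\<close> only square integrable paths are given, so powers of \<open>exp L\<close> cannot
  be estimated through known exponential moments. The sign in \<open>W\<close> resolves this: for
  \<open>- exp (q * L + c * Yh)\<close> Ito's formula yields the negative term
  \<open>- c^2 * Zh^2 / 2\<close>, which absorbs the quadratic driver and the cross variation of
  \<open>L\<close> and \<open>Yh\<close>. The price of the positive summand is a term with the
  factor \<open>q^2 - q\<close>. Hence \<open>q\<close> must be close to a root of
  \<open>q^2 - q\<close>: slightly above 1 where integrability beyond the first power is wanted,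
  slightly below 0 where a negative power must be controlled. One estimate covers both.

  Localisation works with adapted factors instead of stopped integrals: coefficients of simple
  integrands are switched off cell by cell, martingale parts are tamed by a decreasing exponential
  of their own energy, unbounded functions are composed with \<open>m * sin (x / m)\<close>, and the
  unknown behaviour of \<open>X\<close> below \<open>\<delta>\<close> is discounted away by a factor
  that equals 1 until \<open>\<delta>\<close> is reached.\<close>

abbreviation tends_to :: "(nat => 'a::topological_space) => 'a => bool" (infix "~>" 60) where
 "X ~> L \<equiv> X \<longlonglongrightarrow> L"

section \<open>Progressive processes\<close>

lemma progressive_measurable:
 "progressive F T X ==> t \<in> {0..T} ==>
  (%p. X (fst p) (snd p)) \<in> borel_measurable (restrict_space borel {0..t} \<Otimes>\<^sub>M F t)"
 by (auto simp: progressive_def split_beta')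

lemma progressiveI:
 "(\<And>t. t \<in> {0..T} ==>
  (%p. X (fst p) (snd p)) \<in> borel_measurable (restrict_space borel {0..t} \<Otimes>\<^sub>M F t)) ==>
  progressive F T X"
 by (auto simp: progressive_def split_beta')

lemma progressive_compose:
 assumes "progressive F T X" "g \<in> borel_measurable borel"
 shows "progressive F T (%s w. g (X s w))"
 by (rule progressiveI, rule measurable_compose[OF progressive_measurable[OF assms(1)] assms(2)])

lemma progressive_const: "progressive F T (%s w. c)"
 by (rule progressiveI) simp

lemma progressive_add:
 "progressive F T X ==> progressive F T Y ==> progressive F T (%s w. X s w + Y s w)"
 by (intro progressiveI borel_measurable_add) (auto dest: progressive_measurable)

lemma progressive_diff:
 "progressive F T X ==> progressive F T Y ==> progressive F T (%s w. X s w - Y s w)"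
 by (intro progressiveI borel_measurable_diff) (auto dest: progressive_measurable)

lemma progressive_uminus:
 "progressive F T X ==> progressive F T (%s w. - X s w)"
 by (intro progressiveI borel_measurable_uminus) (auto dest: progressive_measurable)

lemma progressive_mult:
 "progressive F T X ==> progressive F T Y ==> progressive F T (%s w. X s w * Y s w)"
 by (intro progressiveI borel_measurable_times) (auto dest: progressive_measurable)

lemma progressive_divide:
 "progressive F T X ==> progressive F T Y ==> progressive F T (%s w. X s w / Y s w)"
 by (intro progressiveI borel_measurable_divide) (auto dest: progressive_measurable)

lemma progressive_power:
 "progressive F T X ==> progressive F T (%s w. (X s w) ^ n)"
 by (intro progressiveI borel_measurable_power) (auto dest: progressive_measurable)

lemma progressive_exp:
 "progressive F T X ==> progressive F T (%s w. exp (X s w))"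
 by (rule progressive_compose[where g = exp]) auto

lemma progressive_sum:
 "(\<And>i. i \<in> A ==> progressive F T (X i)) ==> progressive F T (%s w. \<Sum>i\<in>A. X i s w)"
 by (rule progressiveI, rule borel_measurable_sum) (auto intro!: progressive_measurable)

lemmas progressive_intros =
 progressive_const progressive_add progressive_diff progressive_uminus progressive_mult
 progressive_divide progressive_power progressive_exp progressive_sum

text \<open>The facts on which the stochastic calculus rests. Independence is stated for every
  random variable known at \<open>s\<close>, the form in which the isometry uses it. Having the null
  sets in every \<open>F t\<close> allows a process to be altered on a null set without losing
  adaptedness.\<close>

locale brownian_filtration = prob_space M
 for M :: "'a measure" +
 fixes T :: real and F :: "real => 'a measure" and B :: "real => 'a => real"
 assumes T_pos: "0 < T"
  and space_F [simp]: "space (F t) = space M"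
  and sets_F_M: "t \<in> {0..T} ==> sets (F t) \<subseteq> sets M"
  and sets_F_mono: "0 \<le> s ==> s \<le> t ==> t \<le> T ==> sets (F s) \<subseteq> sets (F t)"
  and null_sets_F: "0 \<le> t ==> null_sets M \<subseteq> sets (F t)"
  and B_adapted: "t \<in> {0..T} ==> B t \<in> borel_measurable (F t)"
  and B_cont: "AE w in M. continuous_on {0..T} (%t. B t w)"
  and B_indep: "0 \<le> s ==> s \<le> t ==> t \<le> T ==> \<xi> \<in> borel_measurable (F s) ==>
   indep_var borel \<xi> borel (%w. B t w - B s w)"
  and B_normal: "0 \<le> s ==> s < t ==> t \<le> T ==>
   distributed M lborel (%w. B t w - B s w) (normal_density 0 (sqrt (t - s)))"
begin

lemma measurable_F_M: "t \<in> {0..T} ==> \<xi> \<in> borel_measurable (F t) ==> \<xi> \<in> borel_measurable M"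
 using measurable_mono[of borel borel "F t" M] sets_F_M[of t] by auto

lemma measurable_F_mono:
 "0 \<le> s ==> s \<le> t ==> t \<le> T ==> \<xi> \<in> borel_measurable (F s) ==> \<xi> \<in> borel_measurable (F t)"
 using measurable_mono[of borel borel "F s" "F t"] sets_F_mono[of s t] by auto

lemma B_measurable [measurable]: "t \<in> {0..T} ==> B t \<in> borel_measurable M"
 using B_adapted measurable_F_M by blast

lemma progressive_section:
 assumes "progressive F T X" "t \<in> {0..T}"
 shows "X t \<in> borel_measurable (F t)"
proof -
 have "Pair t \<in> F t \<rightarrow>\<^sub>M restrict_space borel {0..t} \<Otimes>\<^sub>M F t"
  using assms(2) by (auto intro!: measurable_Pair measurable_restrict_space2)
 from measurable_compose[OF this progressive_measurable[OF assms]] show ?thesis by simp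
qed

lemma progressive_section_M:
 "progressive F T X ==> t \<in> {0..T} ==> X t \<in> borel_measurable M"
 using progressive_section measurable_F_M by blast

text \<open>Clamping the time argument to \<open>{0..t}\<close> trades the restricted time space for
  all of \<open>borel\<close>, the form needed for parametrised integrals over
  \<open>lborel\<close>.\<close>

lemma progressive_joint:
 assumes "progressive F T X" "t \<in> {0..T}"
 shows "(%p. indicator {0..t} (fst p) * X (fst p) (snd p)) \<in> borel_measurable (borel \<Otimes>\<^sub>M F t)"
proof -
 have "(%p. (max 0 (min t (fst p)), snd p)) \<in> borel \<Otimes>\<^sub>M F t \<rightarrow>\<^sub>M restrict_space borel {0..t} \<Otimes>\<^sub>M F t"
  using assms(2) by (intro measurable_Pair measurable_restrict_space2) auto
 from measurable_compose[OF this progressive_measurable[OF assms]]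
 have "(%p. indicator {0..t} (fst p) * X (max 0 (min t (fst p))) (snd p)) \<in> borel_measurable (borel \<Otimes>\<^sub>M F t)"
  by (intro borel_measurable_times) auto
 also have "(%p. indicator {0..t} (fst p) * X (max 0 (min t (fst p))) (snd p)) =
   (%p. indicator {0..t} (fst p) * X (fst p) (snd p))"
  by (auto simp: fun_eq_iff indicator_def)
 finally show ?thesis .
qed

lemma progressive_joint_M:
 assumes "progressive F T X"
 shows "(%p. indicator {0..T} (fst p) * X (fst p) (snd p)) \<in> borel_measurable (borel \<Otimes>\<^sub>M M)"
proof -
 have T: "T \<in> {0..T}" using T_pos by simp
 have "{a \<times> b |a b. a \<in> sets borel \<and> b \<in> sets (F T)} \<subseteq>
   {a \<times> b |a b. a \<in> sets (borel :: real measure) \<and> b \<in> sets M}"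
  using sets_F_M[OF T] by blast
 hence "sets (borel \<Otimes>\<^sub>M F T) \<subseteq> sets ((borel :: real measure) \<Otimes>\<^sub>M M)"
  unfolding sets_pair_measure space_F by (rule sigma_sets_mono')
 from measurable_mono[OF subset_refl refl this, of borel] progressive_joint[OF assms T]
 show ?thesis by (auto simp: space_pair_measure)
qed

lemma progressive_path:
 assumes "progressive F T X" "w \<in> space M"
 shows "(%s. indicator {0..T} s * X s w) \<in> borel_measurable borel"
 using measurable_compose[OF measurable_Pair2' progressive_joint_M[OF assms(1)], of w] assms(2) by simp

text \<open>The upper limit is moved into the integrand as the indicator of the region between 0 and
  the time variable, so that measurability of parametrised integrals applies.\<close>

lemma progressive_integral:
 assumes "progressive F T a"
 shows "progressive F T (%t w. LBINT s:{0..t}. a s w)"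
proof (rule progressiveI)
 fix t assume t: "t \<in> {0..T}"
 let ?N = "restrict_space borel {0..t} \<Otimes>\<^sub>M F t"
 have 1: "(%q. indicator {0..t} (snd q) * a (snd q) (snd (fst q))) \<in> borel_measurable (?N \<Otimes>\<^sub>M lborel)"
 proof -
  have "(%q. (snd q, snd (fst q))) \<in> ?N \<Otimes>\<^sub>M lborel \<rightarrow>\<^sub>M borel \<Otimes>\<^sub>M F t"
   by (intro measurable_Pair measurable_compose[OF measurable_fst measurable_snd])
    (simp add: measurable_snd[of _ borel, simplified measurable_lborel1])
  from measurable_compose[OF this progressive_joint[OF assms t]] show ?thesis by simp
 qed
 have f: "(%q. fst (fst q)) \<in> borel_measurable (?N \<Otimes>\<^sub>M lborel)"
  by (rule measurable_compose[OF measurable_fst measurable_compose[OF measurable_fst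
    measurable_restrict_space1]]) simp
 have 2: "(%q. indicator {q. 0 \<le> snd q \<and> snd q \<le> fst (fst q)} q :: real) \<in> borel_measurable (?N \<Otimes>\<^sub>M lborel)"
 proof (rule borel_measurable_indicator')
  show "{x \<in> space (?N \<Otimes>\<^sub>M lborel). x \<in> {q. 0 \<le> snd q \<and> snd q \<le> fst (fst q)}} \<in> sets (?N \<Otimes>\<^sub>M lborel)"
  proof -
   have "{x \<in> space (?N \<Otimes>\<^sub>M lborel). x \<in> {q. 0 \<le> snd q \<and> snd q \<le> fst (fst q)}} =
    {x \<in> space (?N \<Otimes>\<^sub>M lborel). 0 \<le> snd x} \<inter> {x \<in> space (?N \<Otimes>\<^sub>M lborel). snd x \<le> fst (fst x)}"
    by auto
   also have "\<dots> \<in> sets (?N \<Otimes>\<^sub>M lborel)" by (rule sets.Int; intro borel_measurable_le f) auto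
   finally show ?thesis .
  qed
 qed
 have 3: "(%(p, s). indicator {0..fst p} s * (indicator {0..t} s * a s (snd p))) =
   (%q. indicator {q. 0 \<le> snd q \<and> snd q \<le> fst (fst q)} q *
    (indicator {0..t} (snd q) * a (snd q) (snd (fst q))))"
  by (auto simp: fun_eq_iff indicator_def)
 have A: "(%p. \<integral>s. indicator {0..fst p} s * (indicator {0..t} s * a s (snd p)) \<partial>lborel) \<in> borel_measurable ?N"
  by (rule lborel.borel_measurable_lebesgue_integral)
   (use borel_measurable_times[OF 2 1] in \<open>simp only: 3\<close>)
 have "(\<integral>s. indicator {0..fst p} s * (indicator {0..t} s * a s (snd p)) \<partial>lborel) =
   (LBINT s:{0..fst p}. a s (snd p))" if "p \<in> space ?N" for p
 proof -
  have "fst p \<le> t" using that by (auto simp: space_pair_measure space_restrict_space)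
  hence "indicator {0..fst p} s * (indicator {0..t} s * a s (snd p)) =
    indicator {0..fst p} s *\<^sub>R a s (snd p)" for s
   by (simp add: indicator_def)
  thus ?thesis unfolding set_lebesgue_integral_def by presburger
 qed
 thus "(%p. LBINT s:{0..fst p}. a s (snd p)) \<in> borel_measurable ?N" by (rule measurable_cong[THEN iffD1, rotated, OF A])
qed

text \<open>Rounding the time up to the grid of mesh \<open>1 / Suc n\<close> leaves countably many
  values, so the rounded process is jointly measurable; cutting at \<open>t\<close> keeps it within
  the information at \<open>t\<close>. Continuity of the paths recovers the process.\<close>

lemma adapted_continuous_progressive:
 assumes X: "\<And>t. t \<in> {0..T} ==> X t \<in> borel_measurable (F t)"
  and cont: "\<And>w. w \<in> space M ==> continuous_on {0..T} (%t. X t w)"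
 shows "progressive F T X"
proof (rule progressiveI)
 fix t assume t: "t \<in> {0..T}"
 let ?N = "restrict_space borel {0..t} \<Otimes>\<^sub>M F t"
 define d where "d n s = max 0 (min t (real_of_int \<lceil>real (Suc n) * s\<rceil> / real (Suc n)))" for n :: nat and s :: real
 have d_lim: "(%n. d n s) ~> s" if "s \<in> {0..t}" for s
 proof -
  have "\<bar>d n s - s\<bar> \<le> 1 / real (Suc n)" for n
  proof -
   have "real_of_int \<lceil>real (Suc n) * s\<rceil> \<ge> real (Suc n) * s" "real_of_int \<lceil>real (Suc n) * s\<rceil> < real (Suc n) * s + 1"
    by linarith+
   hence "real_of_int \<lceil>real (Suc n) * s\<rceil> / real (Suc n) \<ge> s"
    "real_of_int \<lceil>real (Suc n) * s\<rceil> / real (Suc n) < s + 1 / real (Suc n)"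
    by (simp_all add: pos_le_divide_eq pos_divide_less_eq distrib_right mult.commute[of s]
      del: of_nat_Suc)
   thus ?thesis using that unfolding d_def by auto
  qed
  hence "(%n. d n s - s) ~> 0"
   by (intro Lim_null_comparison[OF _ LIMSEQ_Suc[OF lim_1_over_n]]) (auto simp: divide_inverse)
  thus ?thesis by (simp add: LIM_zero_iff)
 qed
 show "(%p. X (fst p) (snd p)) \<in> borel_measurable ?N"
 proof (rule borel_measurable_LIMSEQ_real)
  fix p assume "p \<in> space ?N"
  hence p: "fst p \<in> {0..t}" "snd p \<in> space M" by (auto simp: space_pair_measure space_restrict_space)
  show "(%n. X (d n (fst p)) (snd p)) ~> X (fst p) (snd p)"
   by (rule continuous_on_tendsto_compose[OF cont[OF p(2)] d_lim[OF p(1)]])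
    (use p t in \<open>auto simp: d_def min.coboundedI1\<close>)
 next
  fix n
  have "(%p. X (max 0 (min t (real_of_int (\<lceil>real (Suc n) * fst p\<rceil>) / real (Suc n)))) (snd p)) \<in> borel_measurable ?N"
  proof (rule measurable_compose_countable[where f = "%i p. X (max 0 (min t (real_of_int i / real (Suc n)))) (snd p)"])
   fix i :: int
   have "X (max 0 (min t (real_of_int i / real (Suc n)))) \<in> borel_measurable (F t)" by (rule measurable_F_mono[OF _ _ _ X]) (use t in auto)
   thus "(%p. X (max 0 (min t (real_of_int i / real (Suc n)))) (snd p)) \<in> borel_measurable ?N"
    by (rule measurable_compose[OF measurable_snd])
  next
   have "fst \<in> borel_measurable ?N" by (rule measurable_compose[OF measurable_fst measurable_restrict_space1]) simp
   hence "(%p. real (Suc n) * fst p) \<in> borel_measurable ?N" by (intro borel_measurable_times) auto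
   from measurable_compose[OF this measurable_real_ceiling] show "(%p. \<lceil>real (Suc n) * fst p\<rceil>) \<in> ?N \<rightarrow>\<^sub>M count_space UNIV" .
  qed
  thus "(%p. X (d n (fst p)) (snd p)) \<in> borel_measurable ?N" by (simp add: d_def)
 qed
qed

end

section \<open>The augmented Brownian filtration\<close>

lemma space_augmented_filtration [simp]: "space (augmented_filtration M B t) = space M"
 by (simp add: augmented_filtration_def space_measure_of_conv)

context brownian_motion
begin

definition past_events :: "real => 'a set set" where
 "past_events t = {B s -` A \<inter> space M | s A. s \<in> {0..t} \<and> A \<in> sets borel} \<union> null_sets M"

lemma sets_augmented_filtration:
 "sets (augmented_filtration M B t) = sigma_sets (space M) (past_events t)"
 unfolding augmented_filtration_def past_events_def by (rule sets_measure_of) (auto dest: null_setsD2 sets.sets_into_space)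

lemma past_events_M: "t \<le> T ==> past_events t \<subseteq> events"
 using measurable_sets[OF B_measurable] by (fastforce simp: past_events_def)

text \<open>Cylinder events, up to null sets. They form a \<open>\<pi>\<close>-system that generates the augmented
 filtration.\<close>

definition cylinders :: "real => 'a set set" where
 "cylinders s = {A \<in> events. \<exists>J E. finite J \<and> J \<subseteq> {0..s} \<and> (\<forall>j. E j \<in> sets borel) \<and>
   (AE w in M. w \<in> A \<longleftrightarrow> (\<forall>j\<in>J. B j w \<in> E j))}"

lemma Int_stable_cylinders: "Int_stable (cylinders s)"
proof (rule Int_stableI)
 fix A A' assume "A \<in> cylinders s" "A' \<in> cylinders s"
 then obtain J E J' E' where *: "A \<in> events" "A' \<in> events" "finite J" "finite J'"
  "J \<subseteq> {0..s}" "J' \<subseteq> {0..s}" "\<And>j. E j \<in> sets borel" "\<And>j. E' j \<in> sets borel"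
  "AE w in M. w \<in> A \<longleftrightarrow> (\<forall>j\<in>J. B j w \<in> E j)" "AE w in M. w \<in> A' \<longleftrightarrow> (\<forall>j\<in>J'. B j w \<in> E' j)"
  unfolding cylinders_def by blast
 let ?E = "%j. (if j \<in> J then E j else UNIV) \<inter> (if j \<in> J' then E' j else UNIV)"
 have "AE w in M. w \<in> A \<inter> A' \<longleftrightarrow> (\<forall>j\<in>J \<union> J'. B j w \<in> ?E j)"
  using *(9,10) by eventually_elim auto
 thus "A \<inter> A' \<in> cylinders s"
  unfolding cylinders_def using *(1-8) by (auto intro!: exI[of _ "J \<union> J'"] exI[of _ ?E])
qed

lemma past_events_cylinders:
 assumes "0 \<le> s" "s \<le> T"
 shows "past_events s \<subseteq> cylinders s"
proof
 fix X assume X: "X \<in> past_events s"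
 hence "X \<in> events" using past_events_M[OF assms(2)] by auto
 show "X \<in> cylinders s"
 proof (cases "X \<in> null_sets M")
  case True
  \<comment> \<open>A null event is almost surely the cylinder with empty base at time 0; with no
    time at all the condition would hold vacuously.\<close>
  have "AE w in M. w \<in> X \<longleftrightarrow> (\<forall>j\<in>{0}. B j w \<in> {})"
   using AE_not_in[OF True] by eventually_elim auto
  thus ?thesis unfolding cylinders_def using \<open>X \<in> events\<close> assms by (auto intro!: exI[of _ "{0}"] exI[of _ "%_. {}"])
 next
  case False
  with X obtain r A where "X = B r -` A \<inter> space M" "r \<in> {0..s}" "A \<in> sets borel"
   unfolding past_events_def by blast
  thus ?thesis unfolding cylinders_def using \<open>X \<in> events\<close> by (auto intro!: exI[of _ "{r}"] exI[of _ "%_. A"])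
 qed
qed

text \<open>Since \<open>B 0 = 0\<close> almost surely, the values of \<open>B\<close> at finitely
  many times up to \<open>s\<close> are partial sums of increments over ordered times. As
  \<open>B t - B s\<close> is one further increment, grouping the independent increments gives the
  claim.\<close>

lemma cylinder_indep:
 assumes st: "0 \<le> s" "s < t" "t \<le> T" and A: "A \<in> cylinders s" and C: "C \<in> sets borel"
 shows "prob (A \<inter> ((%w. B t w - B s w) -` C \<inter> space M)) =
  prob A * prob ((%w. B t w - B s w) -` C \<inter> space M)"
proof -
 have [measurable]: "C \<in> sets borel" by fact
 from A obtain J E where J: "A \<in> events" "finite J" "J \<subseteq> {0..s}" and E [measurable]: "\<And>j. E j \<in> sets borel"
  and AE_A: "AE w in M. w \<in> A \<longleftrightarrow> (\<forall>j\<in>J. B j w \<in> E j)"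
  unfolding cylinders_def by blast
 have [measurable]: "A \<in> events" by fact
 \<comment> \<open>Starting at 0 anchors the partial sums at \<open>B 0\<close>; ending at
   \<open>s\<close> makes the final increment, to \<open>t\<close>, exactly
   \<open>B t - B s\<close>.\<close>
 define xs where "xs = sorted_list_of_set (insert 0 (insert s J))"
 define m where "m = length xs - 1"
 have xs: "sorted xs" "distinct xs" "set xs = insert 0 (insert s J)" using J unfolding xs_def by (simp_all del: sorted_list_of_set_insert_remove)
 hence len: "length xs = Suc m"
  unfolding m_def by (metis Suc_pred' insert_not_empty length_greater_0_conv set_empty)
 define \<tau> where "\<tau> i = (if i \<le> m then xs ! i else t)" for i
 have mem: "xs ! i \<in> {0..s}" if "i \<le> m" for i
 proof -
  have "xs ! i \<in> set xs" using that len by auto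
  thus ?thesis using xs(3) J(3) st by auto
 qed
 have t0: "\<tau> 0 = 0"
 proof -
  obtain i where "i \<le> m" "xs ! i = 0"
   using xs(3) len by (metis in_set_conv_nth insertI1 less_Suc_eq_le)
  hence "xs ! 0 \<le> 0" using sorted_nth_mono[OF xs(1), of 0 i] len by auto
  with mem[of 0] show ?thesis by (auto simp: \<tau>_def)
 qed
 have tm: "\<tau> m = s"
 proof -
  obtain i where "i \<le> m" "xs ! i = s"
   using xs(3) len by (metis in_set_conv_nth insertI1 insertI2 less_Suc_eq_le)
  hence "s \<le> xs ! m" using sorted_nth_mono[OF xs(1), of i m] len by auto
  with mem[of m] show ?thesis by (auto simp: \<tau>_def)
 qed
 have tS: "\<tau> (Suc m) = t" by (simp add: \<tau>_def)
 have incr: "\<tau> i < \<tau> (Suc i)" if "i < Suc m" for i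
 proof (cases "i = m")
  case True thus ?thesis using tm tS st by simp
 next
  case False
  hence i: "Suc i < length xs" using that len by simp
  hence "xs ! i \<le> xs ! Suc i" "xs ! i \<noteq> xs ! Suc i"
   using sorted_nth_mono[OF xs(1), of i "Suc i"] nth_eq_iff_index_eq[OF xs(2), of i "Suc i"] by auto
  thus ?thesis using i len unfolding \<tau>_def by auto
 qed
 let ?inc = "%i w. B (\<tau> (Suc i)) w - B (\<tau> i) w"
 have "indep_vars (%_. borel) ?inc {..<Suc m}" by (rule B_indep) (use t0 tS incr st in auto)
 hence iv: "indep_var (PiM {..<m} (%_. borel)) (%w. restrict (%i. ?inc i w) {..<m})
   (PiM {m} (%_. borel)) (%w. restrict (%i. ?inc i w) {m})"
  by (rule indep_var_restrict) auto
 \<comment> \<open>\<open>P\<close> is the event \<open>A\<close> read off the first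
   \<open>m\<close> increments.\<close>
 define P where "P v \<longleftrightarrow> (\<forall>k\<in>{..m}. \<tau> k \<in> J \<longrightarrow> (\<Sum>i<k. v i) \<in> E (\<tau> k))" for v :: "nat => real"
 have P_meas: "P \<in> PiM {..<m} (%_. borel) \<rightarrow>\<^sub>M count_space UNIV" unfolding P_def
 proof (rule pred_intros_finite(3), goal_cases)
  case (2 k)
  have "(%v. \<Sum>i<k. v i) \<in> borel_measurable (PiM {..<m} (%_. borel :: real measure))"
   using 2 by (intro borel_measurable_sum measurable_component_singleton) auto
  hence "Measurable.pred (PiM {..<m} (%_. borel)) (%v. (\<Sum>i<k. v i) \<in> E (\<tau> k))" by (rule pred_sets2[OF E])
  thus ?case by (cases "\<tau> k \<in> J") auto
 qed simp
 have "indep_var (count_space UNIV) (P \<circ> (%w. restrict (%i. ?inc i w) {..<m}))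
   (count_space UNIV) ((%v. v m \<in> C) \<circ> (%w. restrict (%i. ?inc i w) {m}))"
  by (rule indep_var_compose[OF iv P_meas]) (auto intro!: pred_sets2[OF C] measurable_component_singleton)
 from indep_varD[OF this, of "{True}" "{True}"]
 have eq: "prob {w \<in> space M. P (restrict (%i. ?inc i w) {..<m}) \<and> ?inc m w \<in> C} =
   prob {w \<in> space M. P (restrict (%i. ?inc i w) {..<m})} * prob {w \<in> space M. ?inc m w \<in> C}"
  by (simp add: vimage_def Int_def conj_commute)
 have sum: "(\<Sum>i<k. restrict (%i. ?inc i w) {..<m} i) = B (\<tau> k) w - B 0 w" if "k \<le> m" for k w
 proof -
  have "(\<Sum>i<k. restrict (%i. ?inc i w) {..<m} i) = (\<Sum>i<k. ?inc i w)"
   using that by (intro sum.cong) auto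
  also have "\<dots> = B (\<tau> k) w - B (\<tau> 0) w" by (rule sum_lessThan_telescope)
  finally show ?thesis by (simp add: t0)
 qed
 have J_range: "\<exists>k\<le>m. \<tau> k = j" if "j \<in> J" for j
  using that xs(3) len unfolding \<tau>_def by (metis in_set_conv_nth insertI2 less_Suc_eq_le)
 have AE_P: "AE w in M. P (restrict (%i. ?inc i w) {..<m}) \<longleftrightarrow> w \<in> A"
  using AE_A B_zero
 proof eventually_elim
  case (elim w)
  have "P (restrict (%i. ?inc i w) {..<m}) \<longleftrightarrow> (\<forall>k\<le>m. \<tau> k \<in> J \<longrightarrow> B (\<tau> k) w \<in> E (\<tau> k))"
   unfolding P_def using sum elim by auto
  also have "\<dots> \<longleftrightarrow> (\<forall>j\<in>J. B j w \<in> E j)" using J_range by metis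
  finally show ?case using elim by simp
 qed
 have P_pred [measurable]: "Measurable.pred M (%w. P (restrict (%i. ?inc i w) {..<m}))"
  using measurable_compose[OF indep_var_rv1[OF iv] P_meas] by simp
 have D_meas [measurable]: "random_variable borel (?inc m)"
  using tm tS st B_measurable by (intro borel_measurable_diff) auto
 have "prob (A \<inter> (?inc m -` C \<inter> space M)) =
   prob {w \<in> space M. P (restrict (%i. ?inc i w) {..<m}) \<and> ?inc m w \<in> C}"
  by (rule measure_eq_AE) (use AE_P in \<open>auto elim!: eventually_mono\<close>)
 moreover have "prob A = prob {w \<in> space M. P (restrict (%i. ?inc i w) {..<m})}"
  by (rule measure_eq_AE) (use AE_P in \<open>auto elim!: eventually_mono\<close>)
 ultimately show ?thesis using eq by (simp add: tm tS vimage_def Int_def conj_commute)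
qed

text \<open>Independence passes from cylinders and increment events to the sigma-algebras they
  generate because both families are closed under intersection.\<close>

lemma augmented_filtration_indep:
 assumes st: "0 \<le> s" "s \<le> t" "t \<le> T" and \<xi>: "\<xi> \<in> borel_measurable (augmented_filtration M B s)"
 shows "indep_var borel \<xi> borel (%w. B t w - B s w)"
proof -
 let ?D = "%w. B t w - B s w" and ?F = "augmented_filtration M B s"
 let ?\<D> = "{?D -` C \<inter> space M | C. C \<in> sets borel}"
 have D [measurable]: "random_variable borel ?D" using st B_measurable by (intro borel_measurable_diff) auto
 have F_M: "sets ?F \<subseteq> events" unfolding sets_augmented_filtration using past_events_M[of s] st by (intro sets.sigma_sets_subset) auto
 have stable_D: "Int_stable ?\<D>"
 proof (rule Int_stableI)
  fix a b assume "a \<in> ?\<D>" "b \<in> ?\<D>"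
  then obtain C C' where "a = ?D -` C \<inter> space M" "C \<in> sets borel" "b = ?D -` C' \<inter> space M" "C' \<in> sets borel" by blast
  hence "a \<inter> b = ?D -` (C \<inter> C') \<inter> space M" "C \<inter> C' \<in> sets borel" by auto
  thus "a \<inter> b \<in> ?\<D>" by blast
 qed
 have sub: "sigma_sets (space M) (past_events s) \<subseteq> sigma_sets (space M) (cylinders s)"
  using past_events_cylinders[of s] st by (intro sigma_sets_mono') auto
 have "indep_set (sigma_sets (space M) (cylinders s)) (sigma_sets (space M) ?\<D>)"
 proof (rule indep_set_sigma_sets[OF _ Int_stable_cylinders stable_D])
  show "indep_set (cylinders s) ?\<D>" unfolding indep_sets2_eq
  proof (intro conjI ballI)
   fix a b assume a: "a \<in> cylinders s" and "b \<in> ?\<D>"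
   then obtain C where b: "b = ?D -` C \<inter> space M" "C \<in> sets borel" by blast
   show "prob (a \<inter> b) = prob a * prob b"
   proof (cases "s = t")
    case True
    \<comment> \<open>The increment over an empty interval is 0, so the event is trivial and
      independence is immediate.\<close>
    hence "b = (if 0 \<in> C then space M else {})" using b by auto
    moreover have "a \<subseteq> space M" using a sets.sets_into_space unfolding cylinders_def by blast
    ultimately show ?thesis using prob_space by (simp add: Int_absorb2)
   next
    case False
    thus ?thesis using cylinder_indep[OF _ _ _ a b(2), of t] st b by simp
   qed
  qed (use D in \<open>auto simp: cylinders_def measurable_sets\<close>)
 qed
 moreover have "sigma_sets (space M) {\<xi> -` A \<inter> space M |A. A \<in> sets borel} \<subseteq> sets ?F"
 proof -
  have "{\<xi> -` A \<inter> space M |A. A \<in> sets borel} \<subseteq> sets ?F"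
   using measurable_sets[OF \<xi>] by auto
  from sets.sigma_sets_subset[OF this] show ?thesis by simp
 qed
 hence "sigma_sets (space M) {\<xi> -` A \<inter> space M |A. A \<in> sets borel} \<subseteq> sigma_sets (space M) (cylinders s)"
  "sigma_sets (space M) {\<xi> -` A \<inter> space M |A. A \<in> sets borel} \<subseteq> events"
  using sub F_M sets_augmented_filtration[of s] by auto
 ultimately have "indep_set (sigma_sets (space M) {\<xi> -` A \<inter> space M |A. A \<in> sets borel}) (sigma_sets (space M) ?\<D>)"
  unfolding indep_sets2_eq by (meson subsetD)
 moreover have "random_variable borel \<xi>" using measurable_mono[of borel borel ?F M] F_M \<xi> by auto
 ultimately show ?thesis unfolding indep_var_eq using D by blast
qed

lemma brownian_filtration_augmented:
 assumes "0 < T"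
 shows "brownian_filtration M T (augmented_filtration M B) B"
proof (unfold_locales)
 show "0 < T" by fact
 show "space (augmented_filtration M B t) = space M" for t by simp
 show "sets (augmented_filtration M B t) \<subseteq> events" if "t \<in> {0..T}" for t
  unfolding sets_augmented_filtration using past_events_M[of t] that by (intro sets.sigma_sets_subset) auto
 show "sets (augmented_filtration M B s) \<subseteq> sets (augmented_filtration M B t)"
  if "0 \<le> s" "s \<le> t" "t \<le> T" for s t
  unfolding sets_augmented_filtration using that
  by (intro sigma_sets_mono') (use that(2) in \<open>auto simp: past_events_def intro: order_trans\<close>)
 show "null_sets M \<subseteq> sets (augmented_filtration M B t)" if "0 \<le> t" for t
  unfolding sets_augmented_filtration by (auto simp: past_events_def)
 show "B t \<in> borel_measurable (augmented_filtration M B t)" if "t \<in> {0..T}" for t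
  by (rule measurableI) (use that in \<open>auto simp: sets_augmented_filtration past_events_def\<close>)
qed (use B_continuous B_increment augmented_filtration_indep in auto)

end

section \<open>Simple integrals\<close>

context prob_space
begin

lemma null_in_prob_AE:
 assumes "\<And>n. D n \<in> borel_measurable M" and "AE w in M. (%n. D n w) ~> 0"
 shows "null_in_prob M D"
 unfolding null_in_prob_def
proof (intro conjI allI impI assms(1))
 fix \<epsilon> :: real assume "\<epsilon> > 0"
 note [measurable] = assms(1)
 have "(%n. \<integral>w. indicator {w \<in> space M. ennreal \<epsilon> < D n w} w \<partial>M) ~> (\<integral>w. (0::real) \<partial>M)"
 proof (rule integral_dominated_convergence[where w = "%_. 1"])
  show "AE w in M. (%n. indicat_real {w \<in> space M. ennreal \<epsilon> < D n w} w) ~> 0"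
   using assms(2)
  proof eventually_elim
   case (elim w)
   hence "\<forall>\<^sub>F n in sequentially. D n w < ennreal \<epsilon>"
    using \<open>\<epsilon> > 0\<close> by (intro order_tendstoD) auto
   hence "\<forall>\<^sub>F n in sequentially. indicat_real {w \<in> space M. ennreal \<epsilon> < D n w} w = 0"
    by eventually_elim (auto simp: indicator_def)
   thus ?case by (rule tendsto_eventually)
  qed
 qed (auto simp: indicator_def)
 thus "(%n. prob {w \<in> space M. ennreal \<epsilon> < D n w}) ~> 0"
  by (simp add: Int_absorb2 Collect_conj_eq[symmetric])
qed

text \<open>Freely prescribed tolerances make the exceptional probabilities summable, as the
  Borel-Cantelli lemma requires.\<close>

lemma null_in_prob_fast:
 assumes "null_in_prob M D" and "\<And>k. \<epsilon> k > (0::real)" "\<And>k. \<delta> k > (0::real)"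
 shows "\<exists>r::nat => nat. strict_mono r \<and>
  (\<forall>k. prob {w \<in> space M. ennreal (\<epsilon> k) < D (r k) w} \<le> \<delta> k)"
proof -
 have "\<exists>n>m. prob {w \<in> space M. ennreal (\<epsilon> k) < D n w} \<le> \<delta> k" for m k
 proof -
  have "\<forall>\<^sub>F n in sequentially. prob {w \<in> space M. ennreal (\<epsilon> k) < D n w} < \<delta> k"
   using assms by (intro order_tendstoD) (auto simp: null_in_prob_def)
  hence "\<forall>\<^sub>F n in sequentially. m < n \<and> prob {w \<in> space M. ennreal (\<epsilon> k) < D n w} < \<delta> k"
   using eventually_gt_at_top[of m] by eventually_elim auto
  thus ?thesis by (auto simp: eventually_sequentially intro: less_imp_le)
 qed
 then obtain g where g: "\<And>m k. m < g m k \<and> prob {w \<in> space M. ennreal (\<epsilon> k) < D (g m k) w} \<le> \<delta> k" by metis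
 define r where "r = rec_nat (g 0 0) (%k m. g m (Suc k))"
 have "strict_mono r" unfolding strict_mono_Suc_iff using g by (simp add: r_def)
 moreover have "prob {w \<in> space M. ennreal (\<epsilon> k) < D (r k) w} \<le> \<delta> k" for k
  using g by (cases k) (simp_all add: r_def)
 ultimately show ?thesis by blast
qed

lemma AE_eventually_le:
 assumes [measurable]: "\<And>k. D k \<in> borel_measurable M"
  and "summable (%k. prob {w \<in> space M. ennreal (\<epsilon> k) < D k w})"
 shows "AE w in M. \<forall>\<^sub>F k in sequentially. D k w \<le> ennreal (\<epsilon> k)"
proof -
 have "AE w in M. \<forall>\<^sub>F k in sequentially. w \<in> space M - {w \<in> space M. ennreal (\<epsilon> k) < D k w}"
  using assms(2) by (intro borel_cantelli_AE1) (auto simp: emeasure_eq_measure)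
 thus ?thesis by eventually_elim (auto elim!: eventually_mono simp: not_less)
qed

lemma summable_half: "summable (%k. c * (1 / 2 :: real) ^ k)"
 by (intro summable_mult summable_geometric) simp

lemma AE_null_of_fast:
 assumes "\<And>k. D k \<in> borel_measurable M"
  and "\<And>k. prob {w \<in> space M. ennreal ((1/2) ^ k) < D k w} \<le> c * (1/2) ^ k"
 shows "AE w in M. (%k. D k w) ~> 0"
proof -
 have "summable (%k. prob {w \<in> space M. ennreal ((1/2) ^ k) < D k w})"
  by (rule summable_comparison_test'[OF summable_half[of c]]) (use assms(2) in auto)
 from AE_eventually_le[OF assms(1) this] show ?thesis
 proof eventually_elim
  case (elim w)
  have "(%k. ennreal ((1/2) ^ k)) ~> ennreal 0" by (intro tendsto_ennrealI LIMSEQ_power_zero) simp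
  thus ?case by (intro tendsto_sandwich[OF _ elim tendsto_const]) auto
 qed
qed

lemma null_in_prob_subseq:
 assumes "null_in_prob M D"
 shows "\<exists>r::nat => nat. strict_mono r \<and> (AE w in M. (%k. D (r k) w) ~> 0)"
proof -
 obtain r where "strict_mono r" "\<forall>k. prob {w \<in> space M. ennreal ((1/2) ^ k) < D (r k) w} \<le> (1/2) ^ k"
  using null_in_prob_fast[OF assms, of "%k. (1/2) ^ k" "%k. (1/2) ^ k"] by auto
 moreover have "D (r k) \<in> borel_measurable M" for k using assms by (simp add: null_in_prob_def)
 ultimately show ?thesis using AE_null_of_fast[of "%k. D (r k)" 1] by auto
qed

lemma null_in_prob_compose_subseq:
 assumes "null_in_prob M D" "strict_mono r"
 shows "null_in_prob M (%n. D (r n))"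
 using assms LIMSEQ_subseq_LIMSEQ[OF _ assms(2)] unfolding null_in_prob_def o_def by blast

text \<open>One index per row is enough: row \<open>m\<close> exceeds \<open>(1/2) ^ m\<close> with
  probability at most \<open>(1/2) ^ m\<close>, which is summable.\<close>

lemma null_in_prob_diagonal:
 assumes "\<And>m. null_in_prob M (D m)"
 shows "\<exists>r. AE w in M. (%m. D m (r m) w) ~> 0"
proof -
 have "\<exists>n. prob {w \<in> space M. ennreal ((1/2) ^ m) < D m n w} \<le> (1/2) ^ m" for m
  using null_in_prob_fast[OF assms, of "%_. (1/2) ^ m" "%_. (1/2) ^ m" m] by auto
 then obtain r where "\<And>m. prob {w \<in> space M. ennreal ((1/2) ^ m) < D m (r m) w} \<le> (1/2) ^ m" by metis
 moreover have "D m n \<in> borel_measurable M" for m n using assms by (simp add: null_in_prob_def)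
 ultimately show ?thesis using AE_null_of_fast[of "%m. D m (r m)" 1] by auto
qed

end

section \<open>Algebra of simple integrands and time grids\<close>

lemma simple_process_append:
 "simple_process (S @ S') s w = simple_process S s w + simple_process S' s w"
 by (simp add: simple_process_def)

lemma simple_integral_append:
 "simple_integral B (S @ S') t w = simple_integral B S t w + simple_integral B S' t w"
 by (simp add: simple_integral_def)

definition simple_scale :: "real => 'a simple_integrand => 'a simple_integrand" where
 "simple_scale c S = map (%(u, v, \<xi>). (u, v, %w. c * \<xi> w)) S"

lemma simple_process_scale: "simple_process (simple_scale c S) s w = c * simple_process S s w"
 by (induction S) (auto simp: simple_process_def simple_scale_def algebra_simps)

lemma simple_integral_scale: "simple_integral B (simple_scale c S) t w = c * simple_integral B S t w"
 by (induction S) (auto simp: simple_integral_def simple_scale_def algebra_simps)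

lemma simple_integrand_append:
 "simple_integrand F T S ==> simple_integrand F T S' ==> simple_integrand F T (S @ S')"
 by (auto simp: simple_integrand_def)

lemma simple_integrand_scale:
 assumes "simple_integrand F T S"
 shows "simple_integrand F T (simple_scale c S)"
proof -
 have "\<exists>K. \<forall>w\<in>A. \<bar>c * \<xi> w\<bar> \<le> K" if "\<exists>K. \<forall>w\<in>A. \<bar>\<xi> w\<bar> \<le> K" for A and \<xi> :: "'a => real"
 proof -
  from that obtain K where "\<And>w. w \<in> A ==> \<bar>\<xi> w\<bar> \<le> K" by auto
  thus ?thesis by (intro exI[of _ "\<bar>c\<bar> * K"]) (auto simp: abs_mult mult_left_mono)
 qed
 thus ?thesis using assms by (fastforce simp: simple_integrand_def simple_scale_def)
qed

text \<open>Simple integrands on consecutive cells. On an increasing grid the cells are disjoint, so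
  squares and stopping can be treated cell by cell.\<close>

definition step_list :: "nat => (nat => real) => (nat => 'a => real) => 'a simple_integrand" where
 "step_list N t c = map (%i. (t i, t (Suc i), c i)) [0..<N]"

lemma simple_process_step_list:
 "simple_process (step_list N t c) s w = (\<Sum>i<N. c i w * indicator {t i<..t (Suc i)} s)"
 by (simp add: simple_process_def step_list_def o_def interv_sum_list_conv_sum_set_nat atLeast0LessThan)

lemma simple_integral_step_list:
 "simple_integral B (step_list N t c) s w =
  (\<Sum>i<N. c i w * (B (min (t (Suc i)) s) w - B (min (t i) s) w))"
 by (simp add: simple_integral_def step_list_def o_def interv_sum_list_conv_sum_set_nat atLeast0LessThan)

definition grid :: "real => nat => (nat => real) => bool" where
 "grid T N t \<longleftrightarrow> t 0 = 0 \<and> t N = T \<and> (\<forall>i<N. t i < t (Suc i))"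

lemma grid_less: "grid T N t ==> i < j ==> j \<le> N ==> t i < t j"
proof (induction j)
 case (Suc j)
 hence "t j < t (Suc j)" by (simp add: grid_def)
 thus ?case using Suc by (cases "i = j") auto
qed simp

lemma grid_le: "grid T N t ==> i \<le> j ==> j \<le> N ==> t i \<le> t j"
 using grid_less[of T N t i j] by (cases "i = j") auto

lemma grid_le_iff: "grid T N t ==> i \<le> N ==> j \<le> N ==> t i \<le> t j \<longleftrightarrow> i \<le> j"
 using grid_le[of T N t i j] grid_less[of T N t j i] by force

lemma grid_range: "grid T N t ==> i \<le> N ==> t i \<in> {0..T}"
 using grid_le[of T N t 0 i] grid_le[of T N t i N] by (auto simp: grid_def)

lemma grid_exists:
 assumes "0 < T" "finite P" "P \<subseteq> {0..T}" "0 < \<delta>"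
 shows "\<exists>N t. grid T N t \<and> P \<subseteq> t ` {..N} \<and> (\<forall>i<N. t (Suc i) - t i \<le> \<delta>)"
proof -
 obtain k :: nat where k: "k > 0" "T / real k < \<delta>"
 proof -
  obtain k :: nat where "T / \<delta> < real k" using reals_Archimedean2 by blast
  moreover from this have "0 < real k" using assms by (meson divide_pos_pos less_trans)
  ultimately show ?thesis using assms that[of k] by (simp add: field_simps)
 qed
 define Q where "Q = insert 0 (insert T (P \<union> (%j. T * real j / real k) ` {..k}))"
 have Q: "finite Q" "Q \<subseteq> {0..T}" using assms k by (auto simp: Q_def divide_simps)
 define xs where "xs = sorted_list_of_set Q"
 have xs: "sorted xs" "distinct xs" "set xs = Q" using Q by (simp_all add: xs_def)
 define N where "N = length xs - 1"
 have len: "length xs = Suc N"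
  using xs(3) unfolding N_def Q_def by (metis Suc_pred' insert_not_empty length_greater_0_conv set_empty)
 define t where "t i = xs ! i" for i
 have ex: "\<exists>i\<le>N. t i = q" if "q \<in> Q" for q
  using that xs(3) len unfolding t_def by (metis in_set_conv_nth less_Suc_eq_le)
 have mem: "t i \<in> Q" if "i \<le> N" for i using that xs(3) len unfolding t_def by auto
 have mono: "t i \<le> t j" if "i \<le> j" "j \<le> N" for i j
  unfolding t_def using sorted_nth_mono[OF xs(1)] that len by auto
 have strict: "t i < t (Suc i)" if "i < N" for i
  using mono[of i "Suc i"] that nth_eq_iff_index_eq[OF xs(2), of i "Suc i"] len by (auto simp: t_def less_le)
 have "t 0 = 0"
 proof -
  obtain i where "i \<le> N" "t i = 0" using ex[of 0] by (auto simp: Q_def)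
  thus ?thesis using mono[of 0 i] mem[of 0] Q by force
 qed
 moreover have "t N = T"
 proof -
  obtain i where "i \<le> N" "t i = T" using ex[of T] by (auto simp: Q_def)
  thus ?thesis using mono[of i N] mem[of N] Q by force
 qed
 ultimately have g: "grid T N t" using strict by (simp add: grid_def)
 have "t (Suc i) - t i \<le> \<delta>" if i: "i < N" for i
 proof (rule ccontr)
  \<comment> \<open>A gap larger than \<open>\<delta>\<close> would contain the equidistant point
    \<open>T * Suc j / k\<close> that follows \<open>t i\<close>, although \<open>t i\<close> and
    \<open>t (Suc i)\<close> are neighbours.\<close>
  assume *: "\<not> ?thesis"
  define j where "j = nat \<lfloor>t i * k / T\<rfloor>"
  have ti: "0 \<le> t i" "t i < T" "t (Suc i) \<le> T"
   using grid_range[OF g, of i] grid_range[OF g, of "Suc i"] strict[OF i] i by auto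
  have "0 \<le> t i * k / T" using ti assms by simp
  hence j: "real j \<le> t i * k / T" "t i * k / T < real j + 1" unfolding j_def by linarith+
  have tik: "t i * k / T < k" using ti assms k by (simp add: divide_simps)
  have q: "T * real (Suc j) / k \<in> Q"
  proof -
   have "Suc j \<le> k" using j(1) tik by linarith
   thus ?thesis unfolding Q_def by (intro insertI2 UnI2 imageI) simp
  qed
  then obtain l where l: "l \<le> N" "t l = T * real (Suc j) / k" using ex by blast
  have "t i < t l" using j(2) assms k unfolding l(2) by (simp add: divide_simps mult.commute add.commute)
  moreover have "t l < t (Suc i)"
  proof -
   have "T * real j / k \<le> t i" using j(1) assms k by (simp add: divide_simps mult.commute)
   hence "t l \<le> t i + T / k" unfolding l(2) by (simp add: divide_simps distrib_left)
   thus ?thesis using * k by simp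
  qed
  ultimately show False using grid_le_iff[OF g, of l i] grid_le_iff[OF g, of "Suc i" l] l i by linarith
 qed
 moreover have "P \<subseteq> t ` {..N}"
  using ex unfolding Q_def by (metis UnCI atMost_iff image_eqI insertCI subsetI)
 ultimately show ?thesis using g by blast
qed

lemma grid_telescope:
 fixes g :: "real => real"
 assumes g: "grid T N t" and uv: "u \<in> t ` {..N}" "v \<in> t ` {..N}" "u \<le> v"
 shows "(\<Sum>i<N. if u \<le> t i \<and> t (Suc i) \<le> v then g (t (Suc i)) - g (t i) else 0) = g v - g u"
proof -
 obtain a b where ab: "a \<le> N" "u = t a" "b \<le> N" "v = t b" using uv by auto
 hence "a \<le> b" using grid_le_iff[OF g] uv(3) by simp
 have "(\<Sum>i<N. if u \<le> t i \<and> t (Suc i) \<le> v then g (t (Suc i)) - g (t i) else 0) =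
   (\<Sum>i<N. if a \<le> i \<and> i < b then g (t (Suc i)) - g (t i) else 0)"
  using ab grid_le_iff[OF g] by (intro sum.cong) (auto simp: Suc_le_eq)
 also have "\<dots> = (\<Sum>i\<in>{a..<b}. g (t (Suc i)) - g (t i))"
  using ab by (intro sum.mono_neutral_cong_right) auto
 also have "\<dots> = g (t b) - g (t a)" using \<open>a \<le> b\<close> by (rule sum_Suc_diff')
 finally show ?thesis using ab by simp
qed

abbreviation "L1 N f \<equiv> \<integral>\<^sup>+s. ennreal \<bar>f s\<bar> \<partial>N"
abbreviation "L2 N f \<equiv> \<integral>\<^sup>+s. ennreal ((f s)^2) \<partial>N"

lemma grid_indicator_sum:
 assumes g: "grid T N t" and "k < N" "s \<in> {t k<..t (Suc k)}"
 shows "(\<Sum>i<N. c i * indicator {t i<..t (Suc i)} s) = (c k :: real)"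
proof -
 have "(\<Sum>i<N. c i * indicator {t i<..t (Suc i)} s) = (\<Sum>i<N. if i = k then c k else 0)"
 proof (rule sum.cong[OF refl])
  fix i assume i: "i \<in> {..<N}"
  consider "i = k" | "Suc i \<le> k" | "Suc k \<le> i" by linarith
  thus "c i * indicator {t i<..t (Suc i)} s = (if i = k then c k else 0)"
  proof cases
   case 2
   thus ?thesis using assms grid_le[OF g, of "Suc i" k] by (simp add: indicator_def)
  next
   case 3
   thus ?thesis using assms i grid_le[OF g, of "Suc k" i] by (simp add: indicator_def)
  qed (use assms in simp)
 qed
 thus ?thesis using assms by simp
qed

context brownian_filtration
begin

abbreviation "prog \<equiv> progressive F T"
abbreviation "simple \<equiv> simple_integrand F T"
abbreviation "energy \<equiv> int_square T"
abbreviation "SP \<equiv> simple_process"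
abbreviation "SI \<equiv> simple_integral B"
abbreviation "ito_integral \<equiv> has_ito_integral M F B T"
abbreviation "gap S H \<equiv> energy (%s w. SP S s w - H s w)"
abbreviation "approx S H I w \<equiv> (%n. gap (S n) H w) ~> 0 \<and>
 uniform_limit {0..T} (%n t. SI (S n) t w) (%t. I t w) sequentially"

definition adapted_coeffs :: "nat => (nat => real) => (nat => 'a => real) => bool" where
 "adapted_coeffs N t c \<longleftrightarrow>
  (\<forall>i<N. c i \<in> borel_measurable (F (t i)) \<and> (\<exists>K. \<forall>w\<in>space M. \<bar>c i w\<bar> \<le> K))"

lemma simple_integrand_step_list:
 assumes g: "grid T N t" and c: "adapted_coeffs N t c"
 shows "simple (step_list N t c)"
proof -
 have "0 \<le> t i \<and> t i \<le> t (Suc i) \<and> t (Suc i) \<le> T" if "i < N" for i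
  using that grid_range[OF g, of i] grid_range[OF g, of "Suc i"] grid_le[OF g, of i "Suc i"] by auto
 thus ?thesis using c by (auto simp: simple_integrand_def step_list_def adapted_coeffs_def)
qed

text \<open>Overlaps are resolved on a common refinement: the coefficient of a cell sums the
  \<open>\<xi>\<close> of all intervals that contain the cell. The extra points \<open>R\<close>
  allow times of evaluation to be grid points, and the mesh bound serves the Taylor
  expansion.\<close>

lemma simple_integrand_grid:
 assumes S: "simple S" and R: "finite R" "R \<subseteq> {0..T}" and "0 < \<delta>"
 shows "\<exists>N t c. grid T N t \<and> R \<subseteq> t ` {..N} \<and> (\<forall>i<N. t (Suc i) - t i \<le> \<delta>) \<and> adapted_coeffs N t c \<and>
  (\<forall>s w. SP S s w = SP (step_list N t c) s w) \<and>
  (\<forall>s w. SI S s w = SI (step_list N t c) s w)"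
proof -
 define P where "P = R \<union> (fst ` set S \<union> (fst \<circ> snd) ` set S)"
 have "P \<subseteq> {0..T}" using S R by (auto simp: P_def simple_integrand_def)
 then obtain N t where g: "grid T N t" and P: "P \<subseteq> t ` {..N}" and \<delta>: "\<forall>i<N. t (Suc i) - t i \<le> \<delta>"
  using grid_exists[OF T_pos _ _ \<open>0 < \<delta>\<close>, of P] R by (auto simp: P_def)
 define c where "c i w = (\<Sum>(u, v, \<xi>)\<leftarrow>S. if u \<le> t i \<and> t (Suc i) \<le> v then \<xi> w else 0)" for i w
 have "adapted_coeffs N t c" unfolding adapted_coeffs_def
 proof (intro allI impI)
  fix i assume i: "i < N"
  have ti: "t i \<in> {0..T}" using grid_range[OF g] i by auto
  have "c i \<in> borel_measurable (F (t i)) \<and> (\<exists>K. \<forall>w\<in>space M. \<bar>c i w\<bar> \<le> K)"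
   using S unfolding c_def
  proof (induction S)
   case Nil
   thus ?case by auto
  next
   case (Cons p S)
   obtain u v \<xi> where p: "p = (u, v, \<xi>)" by (cases p)
   from Cons have S: "simple S" and uv: "0 \<le> u" "u \<le> v" "v \<le> T"
    and \<xi>: "\<xi> \<in> borel_measurable (F u)" and K: "\<exists>K. \<forall>w\<in>space M. \<bar>\<xi> w\<bar> \<le> K"
    by (auto simp: simple_integrand_def p)
   obtain K where K: "\<And>w. w \<in> space M ==> \<bar>\<xi> w\<bar> \<le> K" using K by auto
   let ?c = "%w. \<Sum>(u, v, \<xi>)\<leftarrow>S. if u \<le> t i \<and> t (Suc i) \<le> v then \<xi> w else 0"
   obtain K' where K': "\<And>w. w \<in> space M ==> \<bar>?c w\<bar> \<le> K'" using Cons.IH[OF S] by auto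
   have 1: "(%w. if u \<le> t i \<and> t (Suc i) \<le> v then \<xi> w else 0) \<in> borel_measurable (F (t i))"
    using measurable_F_mono[OF uv(1) _ _ \<xi>, of "t i"] ti by (cases "u \<le> t i \<and> t (Suc i) \<le> v") auto
   have 2: "?c \<in> borel_measurable (F (t i))" using Cons.IH[OF S] by auto
   have "\<bar>(if u \<le> t i \<and> t (Suc i) \<le> v then \<xi> w else 0) + ?c w\<bar> \<le> \<bar>K\<bar> + K'" if "w \<in> space M" for w
    using K[OF that] K'[OF that] by (auto split: if_splits)
   hence "\<exists>K. \<forall>w\<in>space M. \<bar>(if u \<le> t i \<and> t (Suc i) \<le> v then \<xi> w else 0) + ?c w\<bar> \<le> K" by blast
   thus ?case using borel_measurable_add[OF 1 2] by (simp add: p)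
  qed
  thus "c i \<in> borel_measurable (F (t i)) \<and> (\<exists>K. \<forall>w\<in>space M. \<bar>c i w\<bar> \<le> K)" .
 qed
 have pts: "u \<in> t ` {..N} \<and> v \<in> t ` {..N} \<and> u \<le> v" if "(u, v, \<xi>) \<in> set S" for u v \<xi>
 proof -
  have "u \<in> fst ` set S" "v \<in> (fst \<circ> snd) ` set S"
   using imageI[OF that, of fst] imageI[OF that, of "fst \<circ> snd"] by simp_all
  moreover have "u \<le> v" using that S by (auto simp: simple_integrand_def)
  ultimately show ?thesis using P unfolding P_def by blast
 qed
 \<comment> \<open>Both identities are instances of this one: the process at \<open>s\<close> takes
   \<open>g x\<close> to be 1 for \<open>s \<le> x\<close> and 0 otherwise, the integral takes
   \<open>g x = B (min x s)\<close>.\<close>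
 have exch: "(\<Sum>i<N. c i w * (g (t (Suc i)) - g (t i))) = (\<Sum>(u, v, \<xi>)\<leftarrow>S. \<xi> w * (g v - g u))" for g :: "real => real" and w
  using pts unfolding c_def
 proof (induction S)
  case (Cons p S)
  obtain u v \<xi> where p: "p = (u, v, \<xi>)" by (cases p)
  have "(\<Sum>i<N. (if u \<le> t i \<and> t (Suc i) \<le> v then \<xi> w else 0) * (g (t (Suc i)) - g (t i))) =
    \<xi> w * (\<Sum>i<N. if u \<le> t i \<and> t (Suc i) \<le> v then g (t (Suc i)) - g (t i) else 0)"
   unfolding sum_distrib_left by (intro sum.cong) auto
  also have "\<dots> = \<xi> w * (g v - g u)"
   using Cons.prems[of u v \<xi>] p by (subst grid_telescope[OF \<open>grid T N t\<close>]) auto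
  finally have "(\<Sum>i<N. (if u \<le> t i \<and> t (Suc i) \<le> v then \<xi> w else 0) * (g (t (Suc i)) - g (t i))) = \<xi> w * (g v - g u)" .
  moreover have "(\<Sum>i<N. (\<Sum>(u, v, \<xi>)\<leftarrow>S. if u \<le> t i \<and> t (Suc i) \<le> v then \<xi> w else 0) * (g (t (Suc i)) - g (t i))) =
    (\<Sum>(u, v, \<xi>)\<leftarrow>S. \<xi> w * (g v - g u))"
   by (rule Cons.IH) (rule Cons.prems, rule list.set_intros(2))
  ultimately show ?case by (simp only: p list.map sum_list.Cons prod.case distrib_right sum.distrib)
 qed simp
 have "SP S s w = SP (step_list N t c) s w" for s w
 proof -
  let ?g = "%x. if s \<le> x then 1 else 0 :: real"
  have "SP (step_list N t c) s w = (\<Sum>i<N. c i w * (?g (t (Suc i)) - ?g (t i)))"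
   unfolding simple_process_step_list
  proof (rule sum.cong[OF refl])
   fix i assume "i \<in> {..<N}"
   hence "t i < t (Suc i)" using g by (simp add: grid_def)
   hence "indicator {t i<..t (Suc i)} s = ?g (t (Suc i)) - ?g (t i)" by (simp add: indicator_def)
   thus "c i w * indicator {t i<..t (Suc i)} s = c i w * (?g (t (Suc i)) - ?g (t i))" by (simp only:)
  qed
  also have "\<dots> = (\<Sum>(u, v, \<xi>)\<leftarrow>S. \<xi> w * (?g v - ?g u))" by (rule exch)
  also have "\<dots> = SP S s w"
  proof -
   have "?g v - ?g u = indicator {u<..v} s" if "(u, v, \<xi>) \<in> set S" for u v \<xi>
    using pts[OF that] by (simp add: indicator_def)
   thus ?thesis
    unfolding simple_process_def by (intro arg_cong[where f = sum_list] map_cong[OF refl]) auto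
  qed
  finally show ?thesis by simp
 qed
 moreover have "SI S s w = SI (step_list N t c) s w" for s w
  unfolding simple_integral_step_list unfolding simple_integral_def by (rule exch[of w "%x. B (min x s) w", symmetric])
 ultimately show ?thesis using g P \<delta> \<open>adapted_coeffs N t c\<close> unfolding P_def
  by (intro exI[of _ N] exI[of _ t] exI[of _ c] conjI allI) auto
qed

lemma simple_integral_clipped:
 assumes g: "grid T N t" and "m \<le> N"
 shows "SI (step_list N t c) (min (t m) r) w =
  (\<Sum>i<m. c i w * (B (min (t (Suc i)) r) w - B (min (t i) r) w))"
proof -
 have "(\<Sum>i<N. c i w * (B (min (t (Suc i)) (min (t m) r)) w - B (min (t i) (min (t m) r)) w)) =
   (\<Sum>i<N. if i < m then c i w * (B (min (t (Suc i)) r) w - B (min (t i) r) w) else 0)"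
 proof (rule sum.cong[OF refl])
  fix i assume i: "i \<in> {..<N}"
  show "c i w * (B (min (t (Suc i)) (min (t m) r)) w - B (min (t i) (min (t m) r)) w) =
    (if i < m then c i w * (B (min (t (Suc i)) r) w - B (min (t i) r) w) else 0)"
  proof (cases "i < m")
   case True
   hence "t i \<le> t m" "t (Suc i) \<le> t m"
    using assms grid_le[OF g, of "Suc i" m] grid_le[OF g, of i m] by auto
   hence "min (t (Suc i)) (min (t m) r) = min (t (Suc i)) r" "min (t i) (min (t m) r) = min (t i) r" by (auto simp: min_def)
   thus ?thesis using True by simp
  next
   case False
   hence "t m \<le> t i" "t m \<le> t (Suc i)"
    using i grid_le[OF g, of m i] grid_le[OF g, of m "Suc i"] by auto
   hence "min (t (Suc i)) (min (t m) r) = min (t m) r" "min (t i) (min (t m) r) = min (t m) r" by (auto simp: min_def)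
   thus ?thesis using False by simp
  qed
 qed
 also have "\<dots> = (\<Sum>i<m. c i w * (B (min (t (Suc i)) r) w - B (min (t i) r) w))"
  using assms by (intro sum.mono_neutral_cong_right) auto
 finally show ?thesis by (simp add: simple_integral_step_list)
qed

lemma simple_integral_grid_point:
 assumes g: "grid T N t" and "k \<le> N"
 shows "SI (step_list N t c) (t k) w = (\<Sum>i<k. c i w * (B (t (Suc i)) w - B (t i) w))"
proof -
 have "t i \<le> T" if "i \<le> N" for i using grid_range[OF g that] by simp
 thus ?thesis using simple_integral_clipped[OF assms, of c T w] assms(2) by (simp add: min_absorb1 cong: sum.cong_simp)
qed

lemma int_square_step_list:
 assumes g: "grid T N t"
 shows "energy (SP (step_list N t c)) w = ennreal (\<Sum>i<N. (c i w)^2 * (t (Suc i) - t i))"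
proof -
 have sq: "(\<Sum>i<N. c i w * indicator {t i<..t (Suc i)} s)^2 = (\<Sum>i<N. (c i w)^2 * indicator {t i<..t (Suc i)} s)" for s
 proof (cases "\<exists>j<N. s \<in> {t j<..t (Suc j)}")
  case True
  then obtain j where j: "j < N" "s \<in> {t j<..t (Suc j)}" by blast
  show ?thesis using grid_indicator_sum[OF g j, of "%i. c i w"] grid_indicator_sum[OF g j, of "%i. (c i w)^2"] by simp
 next
  case False
  hence "indicator {t i<..t (Suc i)} s = (0 :: real)" if "i < N" for i
   using that by (auto simp: indicator_def)
  hence "(\<Sum>i<N. c i w * indicator {t i<..t (Suc i)} s) = 0"
   "(\<Sum>i<N. (c i w)^2 * indicator {t i<..t (Suc i)} s) = 0"
   by (auto intro!: sum.neutral)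
  thus ?thesis by simp
 qed
 have "energy (SP (step_list N t c)) w =
   (\<integral>\<^sup>+s. (\<Sum>i<N. ennreal ((c i w)^2) * indicator {t i<..t (Suc i)} s) \<partial>lborel)"
  unfolding int_square_def simple_process_step_list sq
 proof (intro nn_integral_cong)
  fix s
  have "ennreal (\<Sum>i<N. (c i w)^2 * indicator {t i<..t (Suc i)} s) * indicator {0..T} s =
    (\<Sum>i<N. ennreal ((c i w)^2 * indicator {t i<..t (Suc i)} s)) * indicator {0..T} s"
   by (subst sum_ennreal) auto
  also have "\<dots> = (\<Sum>i<N. ennreal ((c i w)^2) * indicator {t i<..t (Suc i)} s)"
   unfolding sum_distrib_right
  proof (rule sum.cong[OF refl])
   fix i assume "i \<in> {..<N}"
   thus "ennreal ((c i w)^2 * indicator {t i<..t (Suc i)} s) * indicator {0..T} s =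
     ennreal ((c i w)^2) * indicator {t i<..t (Suc i)} s"
    using grid_range[OF g, of i] grid_range[OF g, of "Suc i"] by (auto simp: indicator_def)
  qed
  finally show "ennreal (\<Sum>i<N. (c i w)^2 * indicator {t i<..t (Suc i)} s) * indicator {0..T} s =
   (\<Sum>i<N. ennreal ((c i w)^2) * indicator {t i<..t (Suc i)} s)" .
 qed
 also have "\<dots> = (\<Sum>i<N. ennreal ((c i w)^2) * emeasure lborel {t i<..t (Suc i)})"
  by (subst nn_integral_sum) (auto simp: nn_integral_cmult_indicator)
 also have "\<dots> = (\<Sum>i<N. ennreal ((c i w)^2 * (t (Suc i) - t i)))"
 proof (rule sum.cong[OF refl])
  fix i assume "i \<in> {..<N}"
  hence "t i \<le> t (Suc i)" using grid_le[OF g, of i "Suc i"] by auto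
  thus "ennreal ((c i w)^2) * emeasure lborel {t i<..t (Suc i)} = ennreal ((c i w)^2 * (t (Suc i) - t i))"
   by (simp add: ennreal_mult')
 qed
 also have "\<dots> = ennreal (\<Sum>i<N. (c i w)^2 * (t (Suc i) - t i))"
  using grid_le[OF g] by (intro sum_ennreal) (auto simp: Suc_leI)
 finally show ?thesis .
qed

section \<open>Moments of Brownian increments, the isometry and its inequalities\<close>

lemma B_increment_integrable:
 assumes "0 \<le> s" "s \<le> t" "t \<le> T"
 shows "integrable M (%w. (B t w - B s w) ^ k)"
proof (cases "s = t")
 case True thus ?thesis by simp
next
 case False
 with assms show ?thesis
  using distributed_integrable[OF B_normal[of s t], of "%x. x ^ k"] integrable_normal_moment[of "sqrt (t - s)" 0 k] by simp
qed

lemma B_increment_moments: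
 assumes "0 \<le> s" "s \<le> t" "t \<le> T"
 shows "expectation (%w. B t w - B s w) = 0"
  "expectation (%w. (B t w - B s w)^2) = t - s"
  "expectation (%w. (B t w - B s w) ^ 4) = 3 * (t - s)^2"
proof -
 have "expectation (%w. B t w - B s w) = 0 \<and> expectation (%w. (B t w - B s w)^2) = t - s \<and>
  expectation (%w. (B t w - B s w) ^ 4) = 3 * (t - s)^2"
 proof (cases "s = t")
  case False
  with assms have st: "s < t" by simp
  have E: "expectation (%w. (B t w - B s w) ^ k) = (LBINT x. normal_density 0 (sqrt (t - s)) x * x ^ k)" for k
   using distributed_integral[OF B_normal[of s t], of "%x. x ^ k"] assms st by simp
  show ?thesis using E[of 1] E[of 2] E[of 4] integral_normal_moment_odd[of "sqrt (t - s)" 0 0]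
    integral_normal_moment_even[of "sqrt (t - s)" 0 1] integral_normal_moment_even[of "sqrt (t - s)" 0 2] st
   by (simp add: fact_numeral field_simps power2_eq_square)
 qed simp
 thus "expectation (%w. B t w - B s w) = 0"
  "expectation (%w. (B t w - B s w)^2) = t - s"
  "expectation (%w. (B t w - B s w) ^ 4) = 3 * (t - s)^2" by auto
qed

lemma increment_indep_integral:
 fixes g :: "real => real"
 assumes st: "0 \<le> s" "s \<le> t" "t \<le> T" and \<xi>: "\<xi> \<in> borel_measurable (F s)" "integrable M \<xi>"
  and g: "g \<in> borel_measurable borel" "integrable M (%w. g (B t w - B s w))"
 shows "integrable M (%w. \<xi> w * g (B t w - B s w))"
  and "expectation (%w. \<xi> w * g (B t w - B s w)) = expectation \<xi> * expectation (%w. g (B t w - B s w))"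
proof -
 have "indep_var borel (id \<circ> \<xi>) borel (g \<circ> (%w. B t w - B s w))"
  by (rule indep_var_compose[OF B_indep[OF st \<xi>(1)]]) (use g in auto)
 hence "indep_var borel \<xi> borel (%w. g (B t w - B s w))" by (simp add: o_def)
 thus "integrable M (%w. \<xi> w * g (B t w - B s w))"
  "expectation (%w. \<xi> w * g (B t w - B s w)) = expectation \<xi> * expectation (%w. g (B t w - B s w))"
  using \<xi>(2) g(2) indep_var_integrable indep_var_lebesgue_integral by blast+
qed

lemma integrable_bounded_F:
 fixes K :: real
 assumes "t \<in> {0..T}" "\<xi> \<in> borel_measurable (F t)" "\<And>w. w \<in> space M ==> \<bar>\<xi> w\<bar> \<le> K"
 shows "integrable M \<xi>"
 by (rule integrable_const_bound[where B = K]) (use assms measurable_F_M in auto)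

lemma step_sum_measurable:
 assumes g: "grid T N t" and c: "adapted_coeffs N t c" and "k \<le> N"
 shows "(%w. \<Sum>i<k. c i w * (B (t (Suc i)) w - B (t i) w)) \<in> borel_measurable (F (t k))"
proof (intro borel_measurable_sum borel_measurable_times borel_measurable_diff)
 fix i assume i: "i \<in> {..<k}"
 note r = grid_range[OF g, of i] grid_range[OF g, of "Suc i"] grid_range[OF g, of k]
  grid_le[OF g, of i k] grid_le[OF g, of "Suc i" k]
 show "c i \<in> borel_measurable (F (t k))" by (rule measurable_F_mono[of "t i"]) (use r i assms in \<open>auto simp: adapted_coeffs_def\<close>)
 show "B (t (Suc i)) \<in> borel_measurable (F (t k))"
  by (rule measurable_F_mono[of "t (Suc i)"]) (use r i assms in \<open>auto intro!: B_adapted\<close>)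
 show "B (t i) \<in> borel_measurable (F (t k))" by (rule measurable_F_mono[of "t i"]) (use r i assms in \<open>auto intro!: B_adapted\<close>)
qed

lemma integrable_mult_bounded:
 fixes X \<xi> :: "'a => real" and K :: real
 assumes "integrable M X" "\<xi> \<in> borel_measurable M" "\<And>w. w \<in> space M ==> \<bar>\<xi> w\<bar> \<le> K"
 shows "integrable M (%w. X w * \<xi> w)"
proof (rule Bochner_Integration.integrable_bound[where f = "%w. K * \<bar>X w\<bar>"])
 show "AE w in M. norm (X w * \<xi> w) \<le> norm (K * \<bar>X w\<bar>)"
 proof (rule AE_I2)
  fix w assume "w \<in> space M"
  from assms(3)[OF this] show "norm (X w * \<xi> w) \<le> norm (K * \<bar>X w\<bar>)"
   using mult_right_mono[of "\<bar>\<xi> w\<bar>" K "\<bar>X w\<bar>"] by (simp add: abs_mult mult.commute)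
 qed
qed (use assms in auto)

text \<open>Induction over the cells: the sum so far times the new coefficient is known at
  \<open>t k\<close>, so its product with the centred independent increment has mean zero and only
  squares remain. Integrability is carried along because each product needs it.\<close>

lemma step_isometry:
 assumes g: "grid T N t" and c: "adapted_coeffs N t c" and k: "k \<le> N"
 shows "integrable M (%w. (\<Sum>i<k. c i w * (B (t (Suc i)) w - B (t i) w))^2) \<and>
  integrable M (%w. \<Sum>i<k. (c i w)^2 * (t (Suc i) - t i)) \<and>
  expectation (%w. (\<Sum>i<k. c i w * (B (t (Suc i)) w - B (t i) w))^2) =
  expectation (%w. \<Sum>i<k. (c i w)^2 * (t (Suc i) - t i))"
 using k
proof (induction k)
 case (Suc k)
 hence k: "k < N" by simp
 let ?G = "%w. \<Sum>i<k. c i w * (B (t (Suc i)) w - B (t i) w)"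
 let ?D = "%w. B (t (Suc k)) w - B (t k) w"
 have r: "0 \<le> t k" "t k \<le> t (Suc k)" "t (Suc k) \<le> T" "t k \<in> {0..T}"
  using grid_range[OF g, of k] grid_range[OF g, of "Suc k"] grid_le[OF g, of k "Suc k"] k by auto
 from c k obtain K where cm: "c k \<in> borel_measurable (F (t k))" and K: "\<And>w. w \<in> space M ==> \<bar>c k w\<bar> \<le> K"
  unfolding adapted_coeffs_def by blast
 have IH: "integrable M (%w. (?G w)^2)" "integrable M (%w. \<Sum>i<k. (c i w)^2 * (t (Suc i) - t i))"
  "expectation (%w. (?G w)^2) = expectation (%w. \<Sum>i<k. (c i w)^2 * (t (Suc i) - t i))"
  using Suc by auto
 have Gm: "?G \<in> borel_measurable (F (t k))" by (rule step_sum_measurable[OF g c]) (use k in simp)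
 hence GM: "?G \<in> borel_measurable M" using measurable_F_M r by blast
 have iG: "integrable M ?G" by (rule square_integrable_imp_integrable[OF GM IH(1)])
 have icG: "integrable M (%w. ?G w * c k w)" by (rule integrable_mult_bounded[OF iG measurable_F_M[OF r(4) cm] K])
 have cGm: "(%w. ?G w * c k w) \<in> borel_measurable (F (t k))"
  using Gm cm by (rule borel_measurable_times)
 have iD: "integrable M ?D" "integrable M (%w. (?D w)^2)"
  using B_increment_integrable[OF r(1-3), of 1] B_increment_integrable[OF r(1-3), of 2] by auto
 note cross = increment_indep_integral[OF r(1-3) cGm icG, of "%x. x"]
 have c2m: "(%w. (c k w)^2) \<in> borel_measurable (F (t k))" using cm by (rule borel_measurable_power)
 have "\<bar>(c k w)^2\<bar> \<le> K^2" if "w \<in> space M" for w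
  using power_mono[OF K[OF that], of 2] by simp
 hence ic2: "integrable M (%w. (c k w)^2)" by (rule integrable_bounded_F[OF r(4) c2m])
 note sq = increment_indep_integral[OF r(1-3) c2m ic2, of "%x. x^2"]
 have exp: "(?G w + c k w * ?D w)^2 = (?G w)^2 + (2 * (?G w * c k w * ?D w) + (c k w)^2 * (?D w)^2)" for w
  by (simp add: power2_sum power_mult_distrib)
 have i1: "integrable M (%w. ?G w * c k w * ?D w)" "expectation (%w. ?G w * c k w * ?D w) = 0"
  using cross iD B_increment_moments[OF r(1-3)] by auto
 have i2: "integrable M (%w. (c k w)^2 * (?D w)^2)"
  "expectation (%w. (c k w)^2 * (?D w)^2) = expectation (%w. (c k w)^2) * (t (Suc k) - t k)"
  using sq iD B_increment_moments[OF r(1-3)] by auto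
 show ?case unfolding sum.lessThan_Suc exp using IH i1 i2 ic2 by simp
qed simp

text \<open>Switching off coefficient \<open>i\<close> on an event known at \<open>t i\<close> takes
  the place of stopping: the integrand stays simple and adapted.\<close>

lemma step_coeffs_indicator:
 assumes "adapted_coeffs N t c" "\<And>i. i < N ==> E i \<inter> space M \<in> sets (F (t i))"
 shows "adapted_coeffs N t (%i w. c i w * indicator (E i) w)"
 unfolding adapted_coeffs_def
proof (intro allI impI conjI)
 fix i assume i: "i < N"
 have "c i \<in> borel_measurable (F (t i))" using assms i by (simp add: adapted_coeffs_def)
 moreover have "indicat_real (E i) \<in> borel_measurable (F (t i))"
  by (rule borel_measurable_indicator') (use assms(2)[OF i] in \<open>simp add: Int_def conj_commute\<close>)
 ultimately show "(%w. c i w * indicator (E i) w) \<in> borel_measurable (F (t i))" by (rule borel_measurable_times)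
 obtain K where "\<And>w. w \<in> space M ==> \<bar>c i w\<bar> \<le> K" using assms i unfolding adapted_coeffs_def by blast
 thus "\<exists>K. \<forall>w\<in>space M. \<bar>c i w * indicator (E i) w\<bar> \<le> K"
  by (intro exI[of _ "\<bar>K\<bar>"]) (auto simp: indicator_def intro: order_trans[OF _ abs_ge_self])
qed

lemma simple_integral_adapted:
 assumes "simple S" "t \<in> {0..T}"
 shows "SI S t \<in> borel_measurable (F t)"
proof -
 obtain N \<tau> c where g: "grid T N \<tau>" and R: "{t} \<subseteq> \<tau> ` {..N}" and c: "adapted_coeffs N \<tau> c"
  and eq: "\<forall>s w. SI S s w = SI (step_list N \<tau> c) s w"
  using simple_integrand_grid[OF assms(1), of "{t}" 1] assms(2) by auto
 obtain k where k: "k \<le> N" "t = \<tau> k" using R by auto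
 have "SI S t = (%w. \<Sum>i<k. c i w * (B (\<tau> (Suc i)) w - B (\<tau> i) w))"
  using eq simple_integral_grid_point[OF g k(1)] k(2) by auto
 thus ?thesis using step_sum_measurable[OF g c k(1)] k(2) by simp
qed

lemma simple_integral_measurable:
 "simple S ==> t \<in> {0..T} ==> SI S t \<in> borel_measurable M"
 using simple_integral_adapted measurable_F_M by blast

lemma int_square_simple_measurable:
 assumes "simple S"
 shows "energy (SP S) \<in> borel_measurable M"
proof -
 obtain N t c where g: "grid T N t" and c: "adapted_coeffs N t c"
  and eq: "\<forall>s w. SP S s w = SP (step_list N t c) s w"
  using simple_integrand_grid[OF assms(1), of "{}" 1] by auto
 have "SP S = SP (step_list N t c)" using eq by blast
 hence "energy (SP S) = energy (SP (step_list N t c))" by (rule arg_cong)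
 also have "\<dots> = (%w. ennreal (\<Sum>i<N. (c i w)^2 * (t (Suc i) - t i)))" by (rule ext) (rule int_square_step_list[OF g])
 finally have "energy (SP S) = (%w. ennreal (\<Sum>i<N. (c i w)^2 * (t (Suc i) - t i)))" .
 moreover have "c i \<in> borel_measurable M" if "i < N" for i
  using c that grid_range[OF g, of i] by (intro measurable_F_M[of "t i"]) (auto simp: adapted_coeffs_def)
 ultimately show ?thesis by (simp only:) (intro measurable_compose[OF _ measurable_ennreal] borel_measurable_sum
   borel_measurable_times borel_measurable_power borel_measurable_const, simp)
qed

lemma simple_isometry:
 assumes S: "simple S" and t: "t \<in> {0..T}"
  and \<delta>: "0 \<le> \<delta>" "\<And>w. w \<in> space M ==> energy (SP S) w \<le> ennreal \<delta>"
 shows "integrable M (%w. (SI S t w)^2)"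
  and "expectation (%w. (SI S t w)^2) \<le> \<delta>"
proof -
 obtain N \<tau> c where g: "grid T N \<tau>" and R: "{t} \<subseteq> \<tau> ` {..N}" and c: "adapted_coeffs N \<tau> c"
  and eq: "\<forall>s w. SP S s w = SP (step_list N \<tau> c) s w"
   "\<forall>s w. SI S s w = SI (step_list N \<tau> c) s w"
  using simple_integrand_grid[OF S, of "{t}" 1] t by auto
 have eqp: "SP S = SP (step_list N \<tau> c)" using eq by blast
 obtain k where k: "k \<le> N" "t = \<tau> k" using R by auto
 have N: "SI S t w = (\<Sum>i<k. c i w * (B (\<tau> (Suc i)) w - B (\<tau> i) w))" for w
  using eq simple_integral_grid_point[OF g k(1)] k(2) by auto
 note iso = step_isometry[OF g c k(1)]
 show "integrable M (%w. (SI S t w)^2)" unfolding N using iso by blast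
 have le: "(\<Sum>i<k. (c i w)^2 * (\<tau> (Suc i) - \<tau> i)) \<le> \<delta>" if w: "w \<in> space M" for w
 proof -
  have nn: "0 \<le> (c i w)^2 * (\<tau> (Suc i) - \<tau> i)" if "i < N" for i
   using grid_le[OF g, of i "Suc i"] that by auto
  have "(\<Sum>i<k. (c i w)^2 * (\<tau> (Suc i) - \<tau> i)) \<le> (\<Sum>i<N. (c i w)^2 * (\<tau> (Suc i) - \<tau> i))"
   using k nn by (intro sum_mono2) auto
  also have "\<dots> \<le> \<delta>"
   using \<delta>(2)[OF w] \<delta>(1) unfolding eqp int_square_step_list[OF g] by (simp add: ennreal_le_iff)
  finally show ?thesis .
 qed
 have "expectation (%w. \<Sum>i<k. (c i w)^2 * (\<tau> (Suc i) - \<tau> i)) \<le> expectation (%w. \<delta>)"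
  using iso le by (intro integral_mono) auto
 thus "expectation (%w. (SI S t w)^2) \<le> \<delta>"
  unfolding N using iso by (simp add: prob_space)
qed

text \<open>Kolmogorov's inequality: the integral is stopped at the first grid point at which it
 exceeds \<open>\<epsilon>\<close>.\<close>

lemma simple_kolmogorov:
 assumes S: "simple S" and R: "finite R" "R \<subseteq> {0..T}" and "0 < \<epsilon>"
  and \<delta>: "0 \<le> \<delta>" "\<And>w. w \<in> space M ==> energy (SP S) w \<le> ennreal \<delta>"
 shows "prob {w \<in> space M. \<exists>t\<in>R. \<epsilon> < \<bar>SI S t w\<bar>} \<le> \<delta> / \<epsilon>^2"
proof -
 obtain N \<tau> c where g: "grid T N \<tau>" and sub: "R \<subseteq> \<tau> ` {..N}" and c: "adapted_coeffs N \<tau> c"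
  and eq: "\<forall>s w. SP S s w = SP (step_list N \<tau> c) s w"
   "\<forall>s w. SI S s w = SI (step_list N \<tau> c) s w"
  using simple_integrand_grid[OF S R, of 1] by auto
 have eqp: "SP S = SP (step_list N \<tau> c)" using eq by blast
 define G where "G k w = (\<Sum>i<k. c i w * (B (\<tau> (Suc i)) w - B (\<tau> i) w))" for k w
 \<comment> \<open>\<open>E i\<close> says that no partial sum up to index \<open>i\<close> has
   exceeded \<open>\<epsilon>\<close>. It is decided at \<open>\<tau> i\<close>, and with these
   indicators the sum freezes at its first excess.\<close>
 define E where "E i = {w. \<forall>j\<in>{..i}. \<bar>G j w\<bar> \<le> \<epsilon>}" for i
 define c' where "c' i w = c i w * indicator (E i) w" for i w
 let ?S = "step_list N \<tau> c'"
 have G_meas: "G j \<in> borel_measurable (F (\<tau> i))" if "j \<le> i" "i \<le> N" for i j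
  unfolding G_def using step_sum_measurable[OF g c, of j] that grid_range[OF g] grid_le[OF g, of j i]
  by (intro measurable_F_mono[of "\<tau> j" "\<tau> i"]) auto
 have "E i \<inter> space M \<in> sets (F (\<tau> i))" if "i < N" for i
 proof -
  have "{w \<in> space (F (\<tau> i)). \<forall>j\<in>{..i}. \<bar>G j w\<bar> \<le> \<epsilon>} \<in> sets (F (\<tau> i))"
   using that G_meas by (intro sets.sets_Collect_finite_All borel_measurable_le borel_measurable_abs) auto
  thus ?thesis by (simp add: E_def Int_def conj_commute)
 qed
 hence c': "adapted_coeffs N \<tau> c'" unfolding c'_def by (rule step_coeffs_indicator[OF c])
 have S': "simple ?S" by (rule simple_integrand_step_list[OF g c'])
 have \<delta>': "energy (SP ?S) w \<le> ennreal \<delta>" if "w \<in> space M" for w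
 proof -
  have "(\<Sum>i<N. (c' i w)^2 * (\<tau> (Suc i) - \<tau> i)) \<le> (\<Sum>i<N. (c i w)^2 * (\<tau> (Suc i) - \<tau> i))"
   using grid_le[OF g] by (intro sum_mono mult_right_mono) (auto simp: c'_def indicator_def Suc_leI)
  thus ?thesis
   using \<delta>(2)[OF that] unfolding eqp int_square_step_list[OF g] by (meson ennreal_leI order_trans)
 qed
 have T: "T \<in> {0..T}" using T_pos by simp
 note iso = simple_isometry[OF S' T \<delta>(1) \<delta>']
 have exceeds: "\<epsilon>^2 \<le> (SI ?S T w)^2" if t: "t \<in> R" "\<epsilon> < \<bar>SI S t w\<bar>" for t w
 proof -
  obtain k0 where k0: "k0 \<le> N" "t = \<tau> k0" using sub t by auto
  hence "\<epsilon> < \<bar>G k0 w\<bar>"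
   using t eq(2) simple_integral_grid_point[OF g k0(1), of c w] by (simp add: G_def)
  define k where "k = (LEAST k. \<epsilon> < \<bar>G k w\<bar>)"
  have k: "\<epsilon> < \<bar>G k w\<bar>" "k \<le> k0"
   unfolding k_def using \<open>\<epsilon> < \<bar>G k0 w\<bar>\<close> by (auto intro: LeastI Least_le)
  have before: "\<bar>G j w\<bar> \<le> \<epsilon>" if "j < k" for j
   using not_less_Least[of j "%k. \<epsilon> < \<bar>G k w\<bar>"] that unfolding k_def by (simp add: not_less)
  have "SI ?S T w = (\<Sum>i<N. c' i w * (B (\<tau> (Suc i)) w - B (\<tau> i) w))"
   using simple_integral_grid_point[OF g order_refl, of c'] g by (simp add: grid_def)
  also have "\<dots> = (\<Sum>i<N. if i < k then c i w * (B (\<tau> (Suc i)) w - B (\<tau> i) w) else 0)"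
  proof (rule sum.cong[OF refl])
   fix i
   have "w \<in> E i \<longleftrightarrow> i < k"
    using k(1) before unfolding E_def by (auto simp: not_less[symmetric])
   thus "c' i w * (B (\<tau> (Suc i)) w - B (\<tau> i) w) =
     (if i < k then c i w * (B (\<tau> (Suc i)) w - B (\<tau> i) w) else 0)"
    by (simp add: c'_def)
  qed
  also have "\<dots> = G k w" unfolding G_def using k k0 by (intro sum.mono_neutral_cong_right) auto
  finally show ?thesis using k(1) \<open>0 < \<epsilon>\<close> by (intro abs_le_square_iff[THEN iffD1]) simp
 qed
 have [measurable]: "SI ?S T \<in> borel_measurable M" by (rule simple_integral_measurable[OF S' T])
 have "prob {w \<in> space M. \<exists>t\<in>R. \<epsilon> < \<bar>SI S t w\<bar>} \<le>
   prob {w \<in> space M. \<epsilon>^2 \<le> (SI ?S T w)^2}"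
  using exceeds by (intro finite_measure_mono) auto
 also have "\<dots> \<le> expectation (%w. (SI ?S T w)^2) / \<epsilon>^2"
  using iso(1) \<open>0 < \<epsilon>\<close> by (intro integral_Markov_inequality_measure[where A = "{}"]) auto
 also have "\<dots> \<le> \<delta> / \<epsilon>^2" using iso(2) by (intro divide_right_mono) auto
 finally show ?thesis .
qed

text \<open>Cell \<open>i\<close> is kept only if the energy including that cell stays within
  \<open>\<delta>\<close>. This energy involves \<open>c 0\<close> to \<open>c i\<close> alone and
  so is already known at \<open>t i\<close>: the bound is never overshot, and paths of small total
  energy are left unchanged.\<close>

lemma simple_truncation:
 assumes S: "simple S" and "0 \<le> \<delta>"
 shows "\<exists>S'. simple S' \<and>
  (\<forall>w\<in>space M. energy (SP S') w \<le> ennreal \<delta>) \<and>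
  (\<forall>w. energy (SP S) w \<le> ennreal \<delta> \<longrightarrow>
   (\<forall>s. SP S' s w = SP S s w \<and> SI S' s w = SI S s w))"
proof -
 obtain N t c where g: "grid T N t" and c: "adapted_coeffs N t c"
  and eq: "\<forall>s w. SP S s w = SP (step_list N t c) s w"
   "\<forall>s w. SI S s w = SI (step_list N t c) s w"
  using simple_integrand_grid[OF S, of "{}" 1] by auto
 have eqp: "SP S = SP (step_list N t c)" using eq by blast
 define V where "V n w = (\<Sum>j<n. (c j w)^2 * (t (Suc j) - t j))" for n w
 define c' where "c' i w = c i w * indicator {w. V (Suc i) w \<le> \<delta>} w" for i w
 have nn: "0 \<le> (c i w)^2 * (t (Suc i) - t i)" if "i < N" for i w
  using grid_le[OF g, of i "Suc i"] that by auto
 have V_mono: "V i w \<le> V j w" if "i \<le> j" "j \<le> N" for i j w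
  unfolding V_def using that nn by (intro sum_mono2) auto
 have c': "adapted_coeffs N t c'" unfolding c'_def
 proof (rule step_coeffs_indicator[OF c])
  fix i assume i: "i < N"
  have "V (Suc i) \<in> borel_measurable (F (t i))" unfolding V_def
  proof (intro borel_measurable_sum borel_measurable_times borel_measurable_power borel_measurable_const)
   fix j assume "j \<in> {..<Suc i}"
   thus "c j \<in> borel_measurable (F (t i))"
    using c[unfolded adapted_coeffs_def, rule_format, of j] i grid_range[OF g, of j]
     grid_range[OF g, of i] grid_le[OF g, of j i]
    by (intro measurable_F_mono[of "t j" "t i" "c j"]) simp_all
  qed
  hence "{w \<in> space (F (t i)). V (Suc i) w \<le> \<delta>} \<in> sets (F (t i))" by (intro borel_measurable_le borel_measurable_const)
  thus "{w. V (Suc i) w \<le> \<delta>} \<inter> space M \<in> sets (F (t i))" by (simp add: Int_def conj_commute)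
 qed
 have bound: "(\<Sum>i<n. (c' i w)^2 * (t (Suc i) - t i)) \<le> \<delta>" if "n \<le> N" for n w
  using that
 proof (induction n)
  case (Suc n)
  show ?case
  proof (cases "V (Suc n) w \<le> \<delta>")
   case True
   have "(\<Sum>i<Suc n. (c' i w)^2 * (t (Suc i) - t i)) \<le> V (Suc n) w" unfolding V_def
   proof (rule sum_mono)
    fix i assume "i \<in> {..<Suc n}"
    thus "(c' i w)^2 * (t (Suc i) - t i) \<le> (c i w)^2 * (t (Suc i) - t i)"
     using grid_le[OF g, of i "Suc i"] Suc.prems by (intro mult_right_mono) (simp_all add: c'_def indicator_def)
   qed
   with True show ?thesis by simp
  next
   case False
   thus ?thesis using Suc by (simp add: c'_def)
  qed
 qed (use \<open>0 \<le> \<delta>\<close> in simp)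
 have same: "c' i w = c i w" if "energy (SP S) w \<le> ennreal \<delta>" "i < N" for i w
 proof -
  have "V N w \<le> \<delta>"
   using that(1) \<open>0 \<le> \<delta>\<close> unfolding eqp int_square_step_list[OF g] V_def by (simp add: ennreal_le_iff)
  thus ?thesis using V_mono[of "Suc i" N w] that(2) by (simp add: c'_def)
 qed
 have same_sum: "(\<Sum>i<N. c' i w * x i) = (\<Sum>i<N. c i w * x i)"
  if "energy (SP S) w \<le> ennreal \<delta>" for x w
  by (rule sum.cong[OF refl]) (simp add: same[OF that])
 show ?thesis
 proof (intro exI[of _ "step_list N t c'"] conjI ballI allI impI)
  show "simple (step_list N t c')" by (rule simple_integrand_step_list[OF g c'])
  show "energy (SP (step_list N t c')) w \<le> ennreal \<delta>" for w
   unfolding int_square_step_list[OF g] by (rule ennreal_leI[OF bound[OF order_refl]])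
  fix w s assume "energy (SP S) w \<le> ennreal \<delta>"
  note sum = same_sum[OF this]
  show "SP (step_list N t c') s w = SP S s w"
   unfolding eq(1)[rule_format] simple_process_step_list by (rule sum)
  show "SI (step_list N t c') s w = SI S s w"
   unfolding eq(2)[rule_format] simple_integral_step_list by (rule sum)
 qed
qed

lemma countable_union_prob_le:
 assumes R: "countable R" and P: "\<And>t. t \<in> R ==> {w \<in> space M. P t w} \<in> events"
  and le: "\<And>R'. finite R' ==> R' \<subseteq> R ==> prob {w \<in> space M. \<exists>t\<in>R'. P t w} \<le> c"
 shows "prob {w \<in> space M. \<exists>t\<in>R. P t w} \<le> c"
proof (cases "R = {}")
 case False
 define A where "A n = {w \<in> space M. \<exists>t\<in>from_nat_into R ` {..n}. P t w}" for n :: nat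
 have sub: "from_nat_into R ` {..n} \<subseteq> R" for n using from_nat_into[OF False] by auto
 have A: "A n \<in> events" for n unfolding A_def using P sub by (intro sets.sets_Collect_finite_Ex) auto
 have "(%n. prob (A n)) ~> prob (\<Union>n. A n)"
  using A by (intro finite_Lim_measure_incseq) (auto simp: incseq_def A_def)
 moreover have "(\<Union>n. A n) = {w \<in> space M. \<exists>t\<in>R. P t w}"
 proof -
  have "R = (\<Union>n. from_nat_into R ` {..n})"
  proof (intro equalityI subsetI)
   fix x assume "x \<in> R"
   from from_nat_into_surj[OF R this] obtain n where "from_nat_into R n = x" by blast
   thus "x \<in> (\<Union>n. from_nat_into R ` {..n})" by blast
  qed (use sub in blast)
  thus ?thesis unfolding A_def by blast
 qed
 ultimately have "(%n. prob (A n)) ~> prob {w \<in> space M. \<exists>t\<in>R. P t w}" by simp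
 moreover have "prob (A n) \<le> c" for n unfolding A_def by (rule le) (use sub in auto)
 ultimately show ?thesis by (intro LIMSEQ_le_const2) auto
qed (use le[of "{}"] in simp)

text \<open>Lenglart's inequality: truncate the energy at \<open>\<delta>\<close>, apply
  Kolmogorov's inequality to the truncated integrand, and charge the paths on which the truncation
  acts to the first term. Small energy in probability then gives small integrals in probability,
  uniformly in time.\<close>

lemma simple_lenglart:
 assumes S: "simple S" and R: "countable R" "R \<subseteq> {0..T}" and \<epsilon>: "0 < \<epsilon>" and \<delta>: "0 \<le> \<delta>"
 shows "prob {w \<in> space M. \<exists>t\<in>R. \<epsilon> < \<bar>SI S t w\<bar>} \<le>
  prob {w \<in> space M. ennreal \<delta> < energy (SP S) w} + \<delta> / \<epsilon>^2"
proof (rule countable_union_prob_le[OF R(1)])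
 note [measurable] = int_square_simple_measurable[OF S]
 have meas: "{w \<in> space M. \<epsilon> < \<bar>SI S t w\<bar>} \<in> events"
  if "simple S" "t \<in> {0..T}" for S t
  using simple_integral_measurable[OF that] by (intro borel_measurable_less borel_measurable_abs) auto
 show "{w \<in> space M. \<epsilon> < \<bar>SI S t w\<bar>} \<in> events" if "t \<in> R" for t
  using meas[OF S] that R by auto
 fix R' assume R': "finite R'" "R' \<subseteq> R"
 obtain S' where S': "simple S'"
  "\<And>w. w \<in> space M ==> energy (SP S') w \<le> ennreal \<delta>"
  "\<And>w s. energy (SP S) w \<le> ennreal \<delta> ==> SI S' s w = SI S s w"
  using simple_truncation[OF S \<delta>] by blast
 let ?A = "%S. {w \<in> space M. \<exists>t\<in>R'. \<epsilon> < \<bar>SI S t w\<bar>}"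
 let ?D = "{w \<in> space M. ennreal \<delta> < energy (SP S) w}"
 have D: "?D \<in> events" by measurable
 have A': "?A S' \<in> events" using R R' by (intro sets.sets_Collect_finite_Ex meas[OF S'(1)]) auto
 have "?A S \<subseteq> ?D \<union> ?A S'" using S'(3) by (auto simp: not_less)
 hence "prob (?A S) \<le> prob (?D \<union> ?A S')" using D A' by (intro finite_measure_mono) auto
 also have "\<dots> \<le> prob ?D + prob (?A S')" by (rule measure_Un_le[OF D A'])
 also have "prob (?A S') \<le> \<delta> / \<epsilon>^2"
  by (rule simple_kolmogorov[OF S'(1) R'(1) _ \<epsilon> \<delta> S'(2)]) (use R R' in auto)
 finally show "prob (?A S) \<le> prob ?D + \<delta> / \<epsilon>^2" by simp
qed

lemma simple_martingale:
 assumes S: "simple S" and st: "0 \<le> s" "s \<le> t" "t \<le> T" and A: "A \<in> sets (F s)"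
 shows "expectation (%w. indicator A w * (SI S t w - SI S s w)) = 0"
proof -
 obtain N \<tau> c where g: "grid T N \<tau>" and R: "{s, t} \<subseteq> \<tau> ` {..N}" and c: "adapted_coeffs N \<tau> c"
  and eq: "\<forall>s w. SI S s w = SI (step_list N \<tau> c) s w"
  using simple_integrand_grid[OF S, of "{s, t}" 1] st by auto
 obtain a b where ab: "a \<le> N" "s = \<tau> a" "b \<le> N" "t = \<tau> b" using R by auto
 hence "a \<le> b" using grid_le_iff[OF g] st by simp
 let ?x = "%i w. c i w * (B (\<tau> (Suc i)) w - B (\<tau> i) w)"
 have N: "SI S t w - SI S s w = (\<Sum>i\<in>{a..<b}. ?x i w)" for w
 proof -
  have "SI S t w - SI S s w = (\<Sum>i<b. ?x i w) - (\<Sum>i<a. ?x i w)"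
   using eq ab simple_integral_grid_point[OF g] by simp
  also have "\<dots> = (\<Sum>i\<in>{a..<b}. ?x i w)"
   using sum.atLeastLessThan_concat[of 0 a b "%i. ?x i w"] \<open>a \<le> b\<close> by (simp add: atLeast0LessThan)
  finally show ?thesis .
 qed
 have i: "integrable M (%w. indicator A w * ?x i w) \<and> expectation (%w. indicator A w * ?x i w) = 0"
  if "i \<in> {a..<b}" for i
 proof -
  have r: "0 \<le> \<tau> i" "\<tau> i \<le> \<tau> (Suc i)" "\<tau> (Suc i) \<le> T" "\<tau> i \<in> {0..T}" "s \<le> \<tau> i"
   using grid_range[OF g, of i] grid_range[OF g, of "Suc i"] grid_le[OF g, of i "Suc i"] grid_le[OF g, of a i] that ab by auto
  obtain K where cm: "c i \<in> borel_measurable (F (\<tau> i))" and K: "\<And>w. w \<in> space M ==> \<bar>c i w\<bar> \<le> K"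
  proof -
   have "i < N" using \<open>i \<in> {a..<b}\<close> ab by simp
   thus ?thesis using c that unfolding adapted_coeffs_def by blast
  qed
  have "A \<in> sets (F (\<tau> i))" using A sets_F_mono[of s "\<tau> i"] r st by auto
  hence m: "(%w. indicator A w * c i w) \<in> borel_measurable (F (\<tau> i))"
   by (intro borel_measurable_times cm borel_measurable_indicator)
  have int: "integrable M (%w. indicator A w * c i w)" by (rule integrable_bounded_F[OF r(4) m, of "\<bar>K\<bar>"])
    (use K in \<open>auto simp: indicator_def intro: order_trans[OF _ abs_ge_self]\<close>)
  have "integrable M (%w. B (\<tau> (Suc i)) w - B (\<tau> i) w)"
   using B_increment_integrable[OF r(1-3), of 1] by simp
  with increment_indep_integral[OF r(1-3) m int, of "%x. x"] B_increment_moments(1)[OF r(1-3)]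
  show ?thesis by (simp add: mult.assoc)
 qed
 have "expectation (%w. indicator A w * (\<Sum>i\<in>{a..<b}. ?x i w)) = (\<Sum>i\<in>{a..<b}. expectation (%w. indicator A w * ?x i w))"
  unfolding sum_distrib_left using i by (intro Bochner_Integration.integral_sum) blast
 also have "\<dots> = 0" using i by (intro sum.neutral) blast
 finally show ?thesis unfolding N .
qed

end

lemma nn_integral_square_add_le:
 fixes x y :: "'b => real"
 assumes [measurable]: "x \<in> borel_measurable N" "y \<in> borel_measurable N"
 shows "(\<integral>\<^sup>+s. ennreal ((x s + y s)^2) \<partial>N) \<le>
  2 * (\<integral>\<^sup>+s. ennreal ((x s)^2) \<partial>N) + 2 * (\<integral>\<^sup>+s. ennreal ((y s)^2) \<partial>N)"
proof -
 have "(\<integral>\<^sup>+s. ennreal ((x s + y s)^2) \<partial>N) \<le> (\<integral>\<^sup>+s. 2 * ennreal ((x s)^2) + 2 * ennreal ((y s)^2) \<partial>N)"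
 proof (rule nn_integral_mono)
  fix s
  have "(x s + y s)^2 \<le> 2 * (x s)^2 + 2 * (y s)^2"
   using zero_le_power2[of "x s - y s"] by (simp add: power2_sum power2_diff)
  hence "ennreal ((x s + y s)^2) \<le> ennreal (2 * (x s)^2 + 2 * (y s)^2)" by (rule ennreal_leI)
  thus "ennreal ((x s + y s)^2) \<le> 2 * ennreal ((x s)^2) + 2 * ennreal ((y s)^2)" by (simp add: ennreal_plus ennreal_mult)
 qed
 also have "\<dots> = 2 * (\<integral>\<^sup>+s. ennreal ((x s)^2) \<partial>N) + 2 * (\<integral>\<^sup>+s. ennreal ((y s)^2) \<partial>N)"
  by (simp add: nn_integral_add nn_integral_cmult)
 finally show ?thesis .
qed

abbreviation leb :: "real => real measure" where
 "leb T \<equiv> restrict_space lborel {0..T}"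

lemma AE_timeI: "(\<And>s. s \<in> {0..T} ==> P s) ==> AE s in leb T. P s"
 by (rule AE_I2) (simp add: space_restrict_space)

lemma int_square_eq: "int_square T Z w = (\<integral>\<^sup>+s. ennreal ((Z s w)^2) \<partial>leb T)"
 unfolding int_square_def by (subst nn_integral_restrict_space) auto

lemma set_integrable_leb:
 "set_integrable lborel {0..T} f \<longleftrightarrow> integrable (leb T) (f :: real => real)"
 unfolding set_integrable_def by (subst integrable_restrict_space) auto

lemma set_lebesgue_integral_leb:
 assumes "t \<le> T"
 shows "(LBINT s:{0..t}. f s) = (\<integral>s. indicator {0..t} s * (f s :: real) \<partial>leb T)"
proof -
 have eq: "(%s. indicator {0..t} s *\<^sub>R f s) = (%s. indicator {0..T} s *\<^sub>R (indicator {0..t} s * f s :: real))"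
  using assms by (auto simp: indicator_def)
 show ?thesis unfolding set_lebesgue_integral_def eq by (subst integral_restrict_space) simp_all
qed

lemma simple_process_path: "(%s. simple_process S s w) \<in> borel_measurable borel"
proof (induction S)
 case (Cons p S)
 obtain u v \<xi> where "p = (u, v, \<xi>)" by (cases p)
 moreover have "(%s. \<xi> w * indicator {u<..v} s) \<in> borel_measurable borel"
  by (intro borel_measurable_times borel_measurable_indicator) auto
 ultimately show ?case using borel_measurable_add[OF _ Cons] by (simp add: simple_process_def)
qed (simp add: simple_process_def)

lemma simple_process_path_time [measurable]:
 "(%s. simple_process S s w) \<in> borel_measurable (leb T)"
 using simple_process_path by (intro measurable_restrict_space1) simp

lemma simple_integral_continuous:
 assumes "continuous_on {0..T} (%t. B t w)" "simple_integrand F T S"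
 shows "continuous_on {0..T} (%t. simple_integral B S t w)"
 using assms(2)
proof (induction S)
 case (Cons p S)
 obtain u v \<xi> where p: "p = (u, v, \<xi>)" by (cases p)
 with Cons have uv: "0 \<le> u" "u \<le> v" "v \<le> T" and S: "simple_integrand F T S" by (auto simp: simple_integrand_def)
 have "continuous_on {0..T} (%t. B (min v t) w)" "continuous_on {0..T} (%t. B (min u t) w)"
  by (rule continuous_on_compose2[OF assms(1)]; use uv in \<open>auto intro!: continuous_intros\<close>)+
 hence "continuous_on {0..T} (%t. \<xi> w * (B (min v t) w - B (min u t) w) + simple_integral B S t w)"
  using Cons.IH[OF S] by (intro continuous_intros)
 thus ?case by (simp add: simple_integral_def p)
qed (simp add: simple_integral_def)

section \<open>Dense times and almost sure uniform convergence of simple integrals\<close>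

context brownian_filtration
begin

text \<open>Continuous paths are determined by their values at these countably many times, so bounds
  over all of \<open>{0..T}\<close> can be expressed by measurable events.\<close>

definition dense_times :: "real set" where
 "dense_times = {0..T} \<inter> range (%q. T * of_rat q)"

lemma countable_times: "countable dense_times"
 unfolding dense_times_def by auto

lemma dense_times_subset: "dense_times \<subseteq> {0..T}"
 by (simp add: dense_times_def)

lemma times_dense:
 assumes t: "t \<in> {0..T}"
 shows "\<exists>u. (\<forall>n. u n \<in> dense_times) \<and> u ~> t"
proof -
 define m where "m n = real_of_int \<lfloor>real (Suc n) * (t / T)\<rfloor>" for n
 define u where "u n = T * (m n / real (Suc n))" for n
 have m: "m n \<le> real (Suc n) * (t / T)" "real (Suc n) * (t / T) < m n + 1" "0 \<le> m n" for n
  unfolding m_def using t T_pos by (linarith, linarith, simp)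
 have close: "t - T / real (Suc n) \<le> u n \<and> u n \<le> t" for n
 proof -
  have "m n / real (Suc n) \<le> t / T" "t / T \<le> m n / real (Suc n) + 1 / real (Suc n)"
  proof -
   show "m n / real (Suc n) \<le> t / T"
    using m(1)[of n] by (subst pos_divide_le_eq) (simp_all add: mult.commute del: of_nat_Suc)
   have "t / T \<le> (m n + 1) / real (Suc n)"
    using m(2)[of n] by (subst pos_le_divide_eq) (simp_all add: mult.commute less_imp_le del: of_nat_Suc)
   thus "t / T \<le> m n / real (Suc n) + 1 / real (Suc n)" by (simp only: add_divide_distrib)
  qed
  from this[THEN mult_left_mono, of T] show ?thesis using T_pos by (simp add: u_def distrib_left)
 qed
 have "u n \<in> dense_times" for n
 proof -
  have "u n = T * of_rat (of_int \<lfloor>real (Suc n) * (t / T)\<rfloor> / of_nat (Suc n))" by (simp add: u_def m_def of_rat_divide del: of_nat_Suc)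
  moreover have "0 \<le> u n" using m(3)[of n] T_pos by (simp add: u_def)
  ultimately show ?thesis
   using close[of n] t unfolding dense_times_def by (intro IntI) (auto simp del: of_nat_Suc)
 qed
 moreover have "u ~> t"
 proof (rule tendsto_sandwich)
  have "(%n. t - T * inverse (real (Suc n))) ~> t - T * 0" by (intro tendsto_intros LIMSEQ_inverse_real_of_nat)
  thus "(%n. t - T / real (Suc n)) ~> t" by (simp add: divide_inverse)
 qed (use close in auto)
 ultimately show ?thesis by blast
qed

lemma continuous_le_times:
 fixes g :: "real => real"
 assumes "continuous_on {0..T} g" "\<And>t. t \<in> dense_times ==> g t \<le> c" "t \<in> {0..T}"
 shows "g t \<le> c"
proof -
 obtain u where u: "\<And>n. u n \<in> dense_times" "u ~> t" using times_dense[OF assms(3)] by blast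
 have "(%n. g (u n)) ~> g t" by (rule continuous_on_tendsto_compose[OF assms(1) u(2) assms(3)])
   (rule always_eventually, rule allI, rule subsetD[OF dense_times_subset], rule u(1))
 thus ?thesis by (rule LIMSEQ_le_const2) (use assms(2) u in auto)
qed

lemma continuous_eq_times:
 fixes g g' :: "real => real"
 assumes "continuous_on {0..T} g" "continuous_on {0..T} g'" "\<And>t. t \<in> dense_times ==> g t = g' t" "t \<in> {0..T}"
 shows "g t = g' t"
proof -
 have "\<bar>g t - g' t\<bar> \<le> 0"
  by (rule continuous_le_times[of "%t. \<bar>g t - g' t\<bar>"]) (use assms in \<open>auto intro!: continuous_intros\<close>)
 thus ?thesis by simp
qed

lemma progressive_path_time:
 assumes "prog X" "w \<in> space M"
 shows "(%s. X s w) \<in> borel_measurable (leb T)"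
 using progressive_path[OF assms] by (subst borel_measurable_restrict_space_iff) auto

lemma int_square_measurable:
 assumes "prog H"
 shows "energy H \<in> borel_measurable M"
proof -
 have "(%q. indicator {0..T} (snd q) * H (snd q) (fst q)) \<in> borel_measurable (M \<Otimes>\<^sub>M lborel)"
 proof -
  have "(%q. (snd q, fst q)) \<in> M \<Otimes>\<^sub>M lborel \<rightarrow>\<^sub>M borel \<Otimes>\<^sub>M M"
   by (intro measurable_Pair) (simp_all add: measurable_snd[of _ borel, simplified measurable_lborel1])
  from measurable_compose[OF this progressive_joint_M[OF assms]] show ?thesis by simp
 qed
 hence "(%w. \<integral>\<^sup>+s. ennreal ((indicator {0..T} s * H s w)^2) \<partial>lborel) \<in> borel_measurable M"
  by (intro lborel.borel_measurable_nn_integral)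
   (auto simp: split_beta' intro!: measurable_compose[OF _ measurable_ennreal] borel_measurable_power)
 also have "(%w. \<integral>\<^sup>+s. ennreal ((indicator {0..T} s * H s w)^2) \<partial>lborel) = energy H"
  unfolding int_square_def by (intro ext nn_integral_cong) (auto simp: indicator_def)
 finally show ?thesis .
qed

lemma simple_process_progressive:
 assumes "simple S"
 shows "prog (SP S)"
 using assms
proof (induction S)
 case Nil
 thus ?case by (simp add: simple_process_def progressive_const)
next
 case (Cons p S)
 obtain u v \<xi> where p: "p = (u, v, \<xi>)" by (cases p)
 with Cons have uv: "0 \<le> u" "u \<le> v" "v \<le> T" and \<xi>: "\<xi> \<in> borel_measurable (F u)" and S: "simple S"
  by (auto simp: simple_integrand_def)
 have "prog (%s w. \<xi> w * indicator {u<..v} s)"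
 proof (rule progressiveI)
  fix t assume t: "t \<in> {0..T}"
  let ?N = "restrict_space borel {0..t} \<Otimes>\<^sub>M F t"
  show "(%p. \<xi> (snd p) * indicator {u<..v} (fst p)) \<in> borel_measurable ?N"
  proof (cases "u \<le> t")
   case True
   hence "\<xi> \<in> borel_measurable (F t)" using measurable_F_mono[of u t \<xi>] uv t \<xi> by auto
   moreover have "indicat_real {u<..v} \<in> borel_measurable (restrict_space borel {0..t})"
    by (intro measurable_restrict_space1 borel_measurable_indicator) auto
   ultimately show ?thesis by (intro borel_measurable_times measurable_compose[OF measurable_snd, of \<xi>]
      measurable_compose[OF measurable_fst, of "indicat_real {u<..v}"])
  next
   case False
   hence "\<xi> (snd p) * indicator {u<..v} (fst p) = 0" if "p \<in> space ?N" for p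
    using that by (auto simp: space_pair_measure space_restrict_space indicator_def)
   thus ?thesis using measurable_cong[of ?N "%p. \<xi> (snd p) * indicator {u<..v} (fst p)" "%_. 0"] by simp
  qed
 qed
 from progressive_add[OF this Cons.IH[OF S]] show ?case by (simp add: simple_process_def p)
qed

lemma int_square_diff_measurable:
 assumes "simple S" "prog H"
 shows "gap S H \<in> borel_measurable M"
 by (intro int_square_measurable progressive_diff simple_process_progressive assms)

lemma int_square_add_le:
 assumes "prog X" "prog Y" "w \<in> space M"
 shows "energy (%s w. X s w + Y s w) w \<le> 2 * energy X w + 2 * energy Y w"
 unfolding int_square_eq using assms by (intro nn_integral_square_add_le progressive_path_time)

lemma int_square_uminus: "energy (%s w. - X s w) w = energy X w"
 by (simp add: int_square_def)

lemma uniformly_Cauchy_of_geometric: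
 fixes g :: "nat => real => real"
 assumes "\<forall>\<^sub>F k in sequentially. \<forall>t\<in>A. \<bar>g (Suc k) t - g k t\<bar> \<le> (1 / 2) ^ k"
 shows "uniformly_Cauchy_on A g"
proof -
 obtain K where K: "\<And>k t. k \<ge> K ==> t \<in> A ==> \<bar>g (Suc k) t - g k t\<bar> \<le> (1 / 2) ^ k"
  using assms unfolding eventually_sequentially by blast
 \<comment> \<open>The factor \<open>1 - (1/2) ^ j\<close> records the partial geometric sum; it is
   what makes the induction close.\<close>
 have tail: "\<bar>g (k + j) t - g k t\<bar> \<le> 2 * (1/2) ^ k * (1 - (1/2) ^ j)" if "k \<ge> K" "t \<in> A" for k j t
 proof (induction j)
  case (Suc j)
  have "\<bar>g (k + Suc j) t - g k t\<bar> \<le> \<bar>g (Suc (k + j)) t - g (k + j) t\<bar> + \<bar>g (k + j) t - g k t\<bar>" by simp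
  also have "\<dots> \<le> (1/2) ^ (k + j) + 2 * (1/2) ^ k * (1 - (1/2) ^ j)"
   using K[of "k + j" t] that Suc by (intro add_mono) auto
  also have "\<dots> = 2 * (1/2) ^ k * (1 - (1/2) ^ Suc j)" by (simp add: power_add algebra_simps)
  finally show ?case .
 qed simp
 have tail': "\<bar>g m t - g k t\<bar> \<le> 2 * (1/2) ^ k" if "k \<ge> K" "k \<le> m" "t \<in> A" for k m t
 proof -
  have "\<bar>g m t - g k t\<bar> \<le> 2 * (1/2) ^ k * (1 - (1/2) ^ (m - k))"
   using tail[of k t "m - k"] that by simp
  also have "\<dots> \<le> 2 * (1/2) ^ k * 1" by (intro mult_left_mono) auto
  finally show ?thesis by simp
 qed
 show ?thesis unfolding uniformly_Cauchy_on_def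
 proof (intro allI impI)
  fix e :: real assume "0 < e"
  obtain L where L: "(1/2 :: real) ^ L < e / 4"
   using real_arch_pow_inv[of "e / 4" "1/2"] \<open>0 < e\<close> by auto
  have "dist (g m t) (g n t) < e" if "t \<in> A" "m \<ge> max K L" "n \<ge> max K L" for m n t
  proof -
   have "(1/2 :: real) ^ max K L \<le> (1/2) ^ L" by (intro power_decreasing) auto
   moreover have "\<bar>g m t - g (max K L) t\<bar> \<le> 2 * (1/2) ^ max K L" "\<bar>g n t - g (max K L) t\<bar> \<le> 2 * (1/2) ^ max K L"
    using tail'[of "max K L"] that by auto
   ultimately show ?thesis using L unfolding dist_real_def by linarith
  qed
  thus "\<exists>L. \<forall>x\<in>A. \<forall>m\<ge>L. \<forall>n\<ge>L. dist (g m x) (g n x) < e" by blast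
 qed
qed

text \<open>Along a subsequence, consecutive integrands differ in energy by more than
  \<open>(1/8) ^ k\<close> with probability at most \<open>2 * (1/2) ^ k\<close>. Lenglart's
  inequality at level \<open>(1/2) ^ k\<close> adds
  \<open>(1/8) ^ k / (1/4) ^ k = (1/2) ^ k\<close>, so by the Borel-Cantelli lemma successive
  integrals eventually differ, uniformly in time, by at most \<open>(1/2) ^ k\<close>.\<close>

lemma simple_subseq:
 assumes S: "\<And>n. simple (S n)" and H: "prog H"
  and null: "null_in_prob M (%n. gap (S n) H)"
 shows "\<exists>r. strict_mono (r :: nat => nat) \<and> (AE w in M.
  (%n. gap (S (r n)) H w) ~> 0 \<and>
  uniformly_Cauchy_on {0..T} (%n t. SI (S (r n)) t w))"
proof -
 \<comment> \<open>The factor 1/4 leaves room for the 2 in the energy of a difference: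
   \<open>2/4 * (1/8) ^ Suc k + 2/4 * (1/8) ^ k \<le> (1/8) ^ k\<close>.\<close>
 obtain r :: "nat => nat" where r: "strict_mono r" and
  fast: "\<And>k. prob {w \<in> space M. ennreal ((1/8) ^ k / 4) <
   gap (S (r k)) H w} \<le> (1/2) ^ k"
  using null_in_prob_fast[OF null, of "%k. (1/8) ^ k / 4" "%k. (1/2) ^ k"] by auto
 define D where "D k = gap (S (r k)) H" for k
 have D [measurable]: "D k \<in> borel_measurable M" for k
  unfolding D_def by (rule int_square_diff_measurable[OF S H])
 have fastD: "prob {w \<in> space M. ennreal ((1/8) ^ k / 4) < D k w} \<le> (1/2) ^ k" for k
  using fast by (simp add: D_def)
 have "AE w in M. (%k. D k w) ~> 0"
 proof (rule AE_null_of_fast[where c = 1])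
  fix k
  have "(1/8) ^ k / 4 \<le> (1/2 :: real) ^ k"
  proof -
   have "(1/8 :: real) ^ k \<le> (1/2) ^ k" by (rule power_mono) auto
   moreover have "(0 :: real) \<le> (1/8) ^ k" by simp
   ultimately show ?thesis by linarith
  qed
  hence "ennreal ((1/8) ^ k / 4) \<le> ennreal ((1/2) ^ k)" by (rule ennreal_leI)
  hence "prob {w \<in> space M. ennreal ((1/2) ^ k) < D k w} \<le> prob {w \<in> space M. ennreal ((1/8) ^ k / 4) < D k w}"
   by (intro finite_measure_mono Collect_mono conj_mono imp_refl impI) (erule (1) le_less_trans, measurable)
  thus "prob {w \<in> space M. ennreal ((1/2) ^ k) < D k w} \<le> 1 * (1/2) ^ k"
   using fastD[of k] by simp
 qed (rule D)
 define S' where "S' k = S (r (Suc k)) @ simple_scale (-1) (S (r k))" for k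
 have S': "simple (S' k)" for k unfolding S'_def by (intro simple_integrand_append simple_integrand_scale S)
 have N': "SI (S' k) t w = SI (S (r (Suc k))) t w - SI (S (r k)) t w" for k t w by (simp add: S'_def simple_integral_append simple_integral_scale)
 have E': "energy (SP (S' k)) w \<le> 2 * D (Suc k) w + 2 * D k w" if "w \<in> space M" for k w
 proof -
  have "energy (SP (S' k)) w = energy (%s w.
    (SP (S (r (Suc k))) s w - H s w) + - (SP (S (r k)) s w - H s w)) w"
   unfolding int_square_def S'_def by (simp add: simple_process_append simple_process_scale)
  also have "\<dots> \<le> 2 * D (Suc k) w + 2 * energy (%s w. - (SP (S (r k)) s w - H s w)) w"
   unfolding D_def by (intro int_square_add_le that progressive_diff progressive_uminus simple_process_progressive S H)
  finally show ?thesis unfolding int_square_uminus D_def .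
 qed
 have probE: "prob {w \<in> space M. ennreal ((1/8) ^ k) < energy (SP (S' k)) w} \<le> 2 * (1/2) ^ k" for k
 proof -
  let ?A = "%k. {w \<in> space M. ennreal ((1/8) ^ k / 4) < D k w}"
  have "{w \<in> space M. ennreal ((1/8) ^ k) < energy (SP (S' k)) w} \<subseteq> ?A (Suc k) \<union> ?A k"
  proof (rule ccontr)
   assume "\<not> ?thesis"
   then obtain w where w: "w \<in> space M" "ennreal ((1/8) ^ k) < energy (SP (S' k)) w"
    "D (Suc k) w \<le> ennreal ((1/8) ^ Suc k / 4)" "D k w \<le> ennreal ((1/8) ^ k / 4)"
    by (simp only: subset_iff mem_Collect_eq Un_iff not_less de_Morgan_disj) (metis leI)
   have "energy (SP (S' k)) w \<le> 2 * ennreal ((1/8) ^ Suc k / 4) + 2 * ennreal ((1/8) ^ k / 4)"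
    using E'[OF w(1), of k] w(3,4) by (meson add_mono mult_left_mono order_trans zero_le)
   also have "\<dots> = ennreal (2 * ((1/8) ^ Suc k / 4) + 2 * ((1/8) ^ k / 4))"
    by (subst ennreal_plus) (simp_all only: ennreal_mult' ennreal_numeral mult_nonneg_nonneg
     zero_le_numeral divide_nonneg_nonneg zero_le_power zero_le_one)
   also have "\<dots> \<le> ennreal ((1/8) ^ k)" by (intro ennreal_leI) (simp add: field_simps)
   finally show False using w(2) by simp
  qed
  hence "prob {w \<in> space M. ennreal ((1/8) ^ k) < energy (SP (S' k)) w} \<le> prob (?A (Suc k) \<union> ?A k)"
   by (intro finite_measure_mono) auto
  also have "\<dots> \<le> prob (?A (Suc k)) + prob (?A k)" by (intro measure_Un_le) auto
  also have "\<dots> \<le> (1/2) ^ Suc k + (1/2) ^ k" by (intro add_mono fastD)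
  also have "\<dots> \<le> 2 * (1/2) ^ k" by simp
  finally show ?thesis .
 qed
 let ?U = "%k. {w \<in> space M. \<exists>t\<in>dense_times. (1/2) ^ k < \<bar>SI (S' k) t w\<bar>}"
 have U: "?U k \<in> events" for k using simple_integral_measurable[OF S'] dense_times_subset
  by (intro sets.sets_Collect_countable_Ex' countable_times borel_measurable_less borel_measurable_abs) auto
 have "prob (?U k) \<le> 3 * (1/2) ^ k" for k
 proof -
  have "prob (?U k) \<le> 2 * (1/2) ^ k + (1/8) ^ k / ((1/2) ^ k)^2"
   using simple_lenglart[OF S'[of k] countable_times dense_times_subset, of "(1/2) ^ k" "(1/8) ^ k"] probE[of k] by simp
  also have "(1/8) ^ k / ((1/2) ^ k)^2 = (1/2 :: real) ^ k"
   by (simp add: power_divide power2_eq_square power_mult_distrib[symmetric] field_simps)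
  finally show ?thesis by simp
 qed
 hence "summable (%k. prob (?U k))" by (intro summable_comparison_test'[OF summable_half[of 3]]) auto
 from borel_cantelli_AE1[OF U _ this]
 have "AE w in M. \<forall>\<^sub>F k in sequentially. w \<in> space M - ?U k" by (simp add: emeasure_eq_measure)
 with \<open>AE w in M. (%k. D k w) ~> 0\<close> B_cont have "AE w in M. (%k. D k w) ~> 0 \<and>
   uniformly_Cauchy_on {0..T} (%n t. SI (S (r n)) t w)"
 proof eventually_elim
  case (elim w)
  hence cont: "continuous_on {0..T} (%t. B t w)" by simp
  have "\<forall>\<^sub>F k in sequentially. \<forall>t\<in>{0..T}. \<bar>SI (S (r (Suc k))) t w - SI (S (r k)) t w\<bar> \<le> (1/2) ^ k"
   using elim(3)
  proof eventually_elim
   case (elim k)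
   have "continuous_on {0..T} (%t. \<bar>SI (S' k) t w\<bar>)"
    using simple_integral_continuous[of T B w F "S' k"] cont S' by (intro continuous_on_rabs) blast
   from continuous_le_times[OF this, of "(1/2) ^ k"] elim show ?case unfolding N' by (auto simp: not_less)
  qed
  from uniformly_Cauchy_of_geometric[OF this] show ?case using elim by blast
 qed
 thus ?thesis using r unfolding D_def by blast
qed

lemma simple_integral_zero:
 assumes "simple S"
 shows "SI S 0 w = 0"
proof -
 have "(\<Sum>(u, v, \<xi>)\<leftarrow>R. \<xi> w * (B (min v 0) w - B (min u 0) w)) = 0" if "\<forall>(u, v, \<xi>)\<in>set R. 0 \<le> u \<and> 0 \<le> v"
  for R :: "'a simple_integrand"
  using that by (induction R) auto
 moreover have "\<forall>(u, v, \<xi>)\<in>set S. 0 \<le> u \<and> 0 \<le> v" using assms by (auto simp: simple_integrand_def)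
 ultimately show ?thesis unfolding simple_integral_def by blast
qed

text \<open>The definition only gives convergence in probability at each time. A fast subsequence
  converges uniformly on almost every path; at every dense time its limit agrees with
  \<open>I\<close> along a further subsequence, hence everywhere by continuity.\<close>

lemma has_ito_integral_AE:
 assumes "ito_integral H I"
 shows "\<exists>S. (\<forall>n. simple (S n)) \<and> (AE w in M. approx S H I w)"
proof -
 from assms obtain S where H: "prog H" and I: "prog I"
  and I_cont: "AE w in M. continuous_on {0..T} (%t. I t w)" and S: "\<And>n. simple (S n)"
  and null: "null_in_prob M (%n. gap (S n) H)"
  and conv: "\<And>t. t \<in> {0..T} ==> null_in_prob M (%n w. ennreal \<bar>SI (S n) t w - I t w\<bar>)"
  unfolding has_ito_integral_def by blast
 obtain r :: "nat => nat" where r: "strict_mono r" and AE_r: "AE w in M.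
  (%n. gap (S (r n)) H w) ~> 0 \<and>
  uniformly_Cauchy_on {0..T} (%n t. SI (S (r n)) t w)"
  using simple_subseq[OF S H null] by blast
 have "AE w in M. \<forall>t\<in>dense_times. \<exists>q :: nat => nat. strict_mono q \<and>
   (%n. SI (S (r (q n))) t w) ~> I t w"
 proof (rule AE_ball_countable'[OF _ countable_times])
  fix t assume "t \<in> dense_times"
  hence t: "t \<in> {0..T}" using dense_times_subset by auto
  obtain q where q: "strict_mono (q :: nat => nat)"
   "AE w in M. (%n. ennreal \<bar>SI (S (r (q n))) t w - I t w\<bar>) ~> 0"
   using null_in_prob_subseq[OF null_in_prob_compose_subseq[OF conv[OF t] r]] by blast
  from q(2) show "AE w in M. \<exists>q :: nat => nat. strict_mono q \<and> (%n. SI (S (r (q n))) t w) ~> I t w"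
  proof eventually_elim
   case (elim w)
   hence "(%n. \<bar>SI (S (r (q n))) t w - I t w\<bar>) ~> 0" by (intro tendsto_ennrealD[of _ 0, simplified]) auto
   hence "(%n. SI (S (r (q n))) t w) ~> I t w" by (simp add: LIM_zero_iff tendsto_rabs_zero_iff)
   thus ?case using q(1) by blast
  qed
 qed
 with AE_r I_cont B_cont have "AE w in M. approx (%n. S (r n)) H I w"
 proof eventually_elim
  case (elim w)
  then obtain g where g: "uniform_limit {0..T} (%n t. SI (S (r n)) t w) g sequentially"
   using uniformly_convergent_eq_Cauchy[of "{0..T}" "%n t. SI (S (r n)) t w"]
   unfolding uniformly_convergent_on_def by blast
  have g_cont: "continuous_on {0..T} g" by (rule uniform_limit_theorem[OF _ g]) (use simple_integral_continuous[of T B w F] elim(3) S in auto)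
  have "g t = I t w" if "t \<in> dense_times" for t
  proof -
   obtain q :: "nat => nat" where q: "strict_mono q" "(%n. SI (S (r (q n))) t w) ~> I t w"
    using elim(4) \<open>t \<in> dense_times\<close> by blast
   have "(%n. SI (S (r n)) t w) ~> g t"
    using tendsto_uniform_limitI[OF g] that dense_times_subset by blast
   from LIMSEQ_subseq_LIMSEQ[OF this q(1)] q(2) show ?thesis unfolding o_def by (rule LIMSEQ_unique)
  qed
  hence "\<And>t. t \<in> {0..T} ==> g t = I t w"
   using continuous_eq_times[OF g_cont elim(2)] by blast
  with g have "uniform_limit {0..T} (%n t. SI (S (r n)) t w) (%t. I t w) sequentially" by (simp add: uniform_limit_iff)
  thus ?case using elim(1) by blast
 qed
 thus ?thesis using S by (intro exI[of _ "%n. S (r n)"]) auto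
qed

lemma has_ito_integralI:
 assumes H: "prog H" "AE w in M. energy H w < \<infinity>"
  and I: "prog I" "AE w in M. continuous_on {0..T} (%t. I t w)"
  and S: "\<And>n. simple (S n)"
  and null: "null_in_prob M (%n. gap (S n) H)"
  and conv: "\<And>t. t \<in> {0..T} ==> AE w in M. (%n. SI (S n) t w) ~> I t w"
 shows "ito_integral H I"
 unfolding has_ito_integral_def
proof (intro conjI exI[of _ S] allI ballI)
 fix t assume t: "t \<in> {0..T}"
 show "null_in_prob M (%n w. ennreal \<bar>SI (S n) t w - I t w\<bar>)"
 proof (rule null_in_prob_AE)
  show "(%w. ennreal \<bar>SI (S n) t w - I t w\<bar>) \<in> borel_measurable M" for n
   using simple_integral_measurable[OF S t] progressive_section_M[OF I(1) t]
   by (intro measurable_compose[OF _ measurable_ennreal] borel_measurable_abs borel_measurable_diff)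
  show "AE w in M. (%n. ennreal \<bar>SI (S n) t w - I t w\<bar>) ~> 0"
   using conv[OF t]
  proof eventually_elim
   case (elim w)
   hence "(%n. ennreal \<bar>SI (S n) t w - I t w\<bar>) ~> ennreal 0"
    by (intro tendsto_ennrealI tendsto_rabs_zero LIM_zero)
   thus ?case by simp
  qed
 qed
qed (use assms in auto)

text \<open>Convergence of the integrands alone produces the integral. On the exceptional null set,
  which belongs to every \<open>F t\<close>, the approximants are replaced by 0; the limit is then
  adapted and continuous on every path, and therefore progressive.\<close>

lemma has_ito_integral_simple_limit:
 assumes S: "\<And>n. simple (S n)" and H: "prog H" "AE w in M. energy H w < \<infinity>"
  and null: "null_in_prob M (%n. gap (S n) H)"
 shows "\<exists>r I. ito_integral H I \<and> (AE w in M. \<forall>t\<in>{0..T}. (%n. SI (S (r n)) t w) ~> I t w)"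
proof -
 obtain r :: "nat => nat" where r: "strict_mono r" and AE_r: "AE w in M.
  (%n. gap (S (r n)) H w) ~> 0 \<and>
  uniformly_Cauchy_on {0..T} (%n t. SI (S (r n)) t w)"
  using simple_subseq[OF S H(1) null] by blast
 let ?good = "%w. continuous_on {0..T} (%t. B t w) \<and> uniformly_Cauchy_on {0..T} (%n t. SI (S (r n)) t w)"
 have "AE w in M. ?good w" using AE_r B_cont by eventually_elim auto
 then obtain Z where Z: "Z \<in> null_sets M" "\<And>w. w \<in> space M - Z ==> ?good w" by (elim AE_E3) blast
 define N where "N n t w = indicator (- Z) w * SI (S (r n)) t w" for n t w
 define I where "I t w = lim (%n. N n t w)" for t w
 have unif: "uniform_limit {0..T} (%n t. N n t w) (%t. I t w) sequentially" if "w \<in> space M" for w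
 proof (cases "w \<in> Z")
  case True
  thus ?thesis by (simp add: N_def I_def uniform_limit_const)
 next
  case False
  hence "uniformly_convergent_on {0..T} (%n t. N n t w)"
   using Z(2)[of w] that uniformly_convergent_eq_Cauchy by (simp add: N_def) blast
  thus ?thesis unfolding I_def by (rule uniformly_convergent_uniform_limit_iff[THEN iffD1])
 qed
 have I_adapted: "I t \<in> borel_measurable (F t)" if t: "t \<in> {0..T}" for t
 proof (rule borel_measurable_LIMSEQ_real)
  show "(%n. N n t w) ~> I t w" if "w \<in> space (F t)" for w
   using tendsto_uniform_limitI[OF unif t] that by simp
  have "Z \<in> sets (F t)" using Z null_sets_F[of t] t by auto
  hence "indicat_real (- Z) \<in> borel_measurable (F t)"
   using sets.compl_sets[of Z "F t"] by (intro borel_measurable_indicator') (auto simp: set_diff_eq)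
  thus "(%w. N n t w) \<in> borel_measurable (F t)" for n
   unfolding N_def by (intro borel_measurable_times simple_integral_adapted[OF S t])
 qed
 have I_cont: "continuous_on {0..T} (%t. I t w)" if "w \<in> space M" for w
 proof (rule uniform_limit_theorem[OF _ unif[OF that]])
  have "continuous_on {0..T} (%t. N n t w)" for n
  proof (cases "w \<in> Z")
   case False
   thus ?thesis using Z(2)[of w] that simple_integral_continuous[OF _ S] by (simp add: N_def)
  qed (simp add: N_def)
  thus "\<forall>\<^sub>F n in sequentially. continuous_on {0..T} (%t. N n t w)" by simp
 qed simp
 have lim: "AE w in M. \<forall>t\<in>{0..T}. (%n. SI (S (r n)) t w) ~> I t w"
  using AE_not_in[OF Z(1)]
 proof (rule AE_mp, intro AE_I2 impI ballI)
  fix w t assume "w \<in> space M" "w \<notin> Z" "t \<in> {0..T}"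
  thus "(%n. SI (S (r n)) t w) ~> I t w"
   using tendsto_uniform_limitI[OF unif, of w t] by (simp add: N_def)
 qed
 have "ito_integral H I"
 proof (rule has_ito_integralI[OF H])
  show "prog I" by (rule adapted_continuous_progressive[OF I_adapted I_cont])
  show "AE w in M. continuous_on {0..T} (%t. I t w)" using I_cont by auto
  show "simple (S (r n))" for n by (rule S)
  show "null_in_prob M (%n. gap (S (r n)) H)" by (rule null_in_prob_compose_subseq[OF null r])
  show "AE w in M. (%n. SI (S (r n)) t w) ~> I t w" if t: "t \<in> {0..T}" for t
   using lim by eventually_elim (use t in blast)
 qed
 with lim show ?thesis by blast
qed

end

section \<open>Density of simple integrands\<close>

definition clip :: "real => real => real" where
 "clip K x = max (- K) (min K x)"

lemma clip_bound: "0 \<le> K ==> \<bar>clip K x\<bar> \<le> K"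
 by (auto simp: clip_def)

lemma clip_eq: "\<bar>x\<bar> \<le> K ==> clip K x = x"
 by (auto simp: clip_def)

lemma clip_measurable [measurable]: "clip K \<in> borel_measurable borel"
 unfolding clip_def by measurable

lemma clip_tendsto: "(%n. clip (real n) x) ~> x"
proof (rule tendsto_eventually)
 obtain N :: nat where "\<bar>x\<bar> \<le> real N" using real_arch_simple by blast
 thus "\<forall>\<^sub>F n in sequentially. clip (real n) x = x" by (intro eventually_mono[OF eventually_ge_at_top[of N]] clip_eq) simp
qed

definition mesh_point :: "real => nat => nat => real" where
 "mesh_point T n i = real i * (T / real (Suc n))"

text \<open>The value on each interval of the uniform grid is the average over the preceding interval,
 which makes the step process adapted.\<close>

definition avg_coeff :: "real => nat => (real => real) => nat => real" where
 "avg_coeff T n f i = (if i = 0 then 0 else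
  (real (Suc n) / T) * (\<integral>s. indicator {mesh_point T n (i - 1)<..mesh_point T n i} s * f s \<partial>leb T))"

definition avg_step :: "real => nat => (real => real) => real => real" where
 "avg_step T n f s = (\<Sum>i<Suc n. avg_coeff T n f i * indicator {mesh_point T n i<..mesh_point T n (Suc i)} s)"

lemma grid_mesh_point: "0 < T ==> grid T (Suc n) (mesh_point T n)"
 by (simp add: grid_def mesh_point_def divide_strict_right_mono del: of_nat_Suc)

lemma mesh_point_Suc: "mesh_point T n (Suc i) = mesh_point T n i + T / real (Suc n)"
 by (simp add: mesh_point_def distrib_right add_divide_distrib)

lemma grid_cell:
 assumes g: "grid T N t" and s: "0 < s" "s \<le> T"
 shows "\<exists>k<N. s \<in> {t k<..t (Suc k)}"
proof -
 define k where "k = (LEAST k. s \<le> t k)"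
 have "s \<le> t N" using g s by (simp add: grid_def)
 hence k: "s \<le> t k" "k \<le> N" unfolding k_def by (auto intro: LeastI Least_le)
 have "k \<noteq> 0"
 proof
  assume "k = 0"
  thus False using k(1) s g by (simp add: grid_def)
 qed
 then obtain j where j: "k = Suc j" using not0_implies_Suc by blast
 have "t j < s" using not_less_Least[of j "%k. s \<le> t k"] j unfolding k_def by (simp add: not_le)
 thus ?thesis using k j by (intro exI[of _ j]) auto
qed

lemma avg_step_cell:
 assumes "0 < T" "k < Suc n" "s \<in> {mesh_point T n k<..mesh_point T n (Suc k)}"
 shows "avg_step T n f s = avg_coeff T n f k"
 unfolding avg_step_def by (rule grid_indicator_sum[OF grid_mesh_point]) (use assms in auto)

lemma finite_leb: "finite_measure (leb T)"
 by (rule finite_measureI) (auto simp: emeasure_restrict_space space_restrict_space emeasure_lborel_Icc_eq)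

lemma sets_leb: "A \<in> sets borel ==> A \<subseteq> {0..T} ==> A \<in> sets (leb T)"
 by (auto simp: sets_restrict_space intro!: image_eqI[of _ _ A])

lemma measure_time_cell:
 assumes "0 \<le> u" "u \<le> v" "v \<le> T"
 shows "(\<integral>s. indicator {u<..v} s \<partial>leb T) = v - u"
proof -
 have "{u<..v} \<subseteq> {0..T}" using assms by auto
 hence "(\<integral>s. indicator {u<..v} s \<partial>leb T) = measure (leb T) {u<..v}"
  using assms by (subst Bochner_Integration.integral_indicator) (auto intro!: sets_leb arg_cong[where f = "measure (leb T)"] simp: space_restrict_space)
 also have "\<dots> = v - u"
  using assms \<open>{u<..v} \<subseteq> {0..T}\<close> by (subst measure_restrict_space) auto
 finally show ?thesis .
qed

lemma integrable_indicator_mult_time: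
 fixes f :: "real => real"
 assumes "integrable (leb T) f" "A \<in> sets borel"
 shows "integrable (leb T) (%s. indicator A s * f s)"
proof (rule Bochner_Integration.integrable_bound[OF assms(1)])
 show "(%s. indicator A s * f s) \<in> borel_measurable (leb T)"
  by (intro borel_measurable_times measurable_restrict_space1 borel_measurable_integrable[OF assms(1)])
   (use assms(2) in simp)
qed (auto simp: indicator_def)

lemma integrable_bounded_time:
 fixes f :: "real => real"
 assumes "f \<in> borel_measurable (leb T)" "\<And>s. s \<in> {0..T} ==> \<bar>f s\<bar> \<le> K"
 shows "integrable (leb T) f"
 by (rule finite_measure.integrable_const_bound[OF finite_leb AE_timeI assms(1), where B = K]) (use assms(2) in simp)

lemma avg_coeff_near:
 assumes T: "0 < T" and i: "0 < i" "i \<le> Suc n" and f: "integrable (leb T) f"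
  and near: "\<And>r. r \<in> {mesh_point T n (i - 1)<..mesh_point T n i} ==> \<bar>f r - c\<bar> \<le> \<epsilon>"
 shows "\<bar>avg_coeff T n f i - c\<bar> \<le> \<epsilon>"
proof -
 let ?I = "{mesh_point T n (i - 1)<..mesh_point T n i}" and ?h = "T / real (Suc n)"
 have r: "0 \<le> mesh_point T n (i - 1)" "mesh_point T n i = mesh_point T n (i - 1) + ?h" "mesh_point T n i \<le> T"
  using grid_range[OF grid_mesh_point[OF T], of "i - 1" n] grid_range[OF grid_mesh_point[OF T], of i n] i
   mesh_point_Suc[of T n "i - 1"] by auto
 have h: "0 < ?h" using T by simp
 have I: "(\<integral>s. indicator ?I s \<partial>leb T) = ?h"
  using measure_time_cell[of "mesh_point T n (i - 1)" "mesh_point T n i" T] r h by simp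
 have iI: "integrable (leb T) (%s. x * indicator ?I s)" for x :: real
  by (rule integrable_bounded_time[where K = "\<bar>x\<bar>"]) (auto intro!: borel_measurable_times measurable_restrict_space1 simp: indicator_def)
 note if' = integrable_indicator_mult_time[OF f, of ?I]
 have "\<bar>\<integral>s. indicator ?I s * f s - c * indicator ?I s \<partial>leb T\<bar> \<le> (\<integral>s. \<epsilon> * indicator ?I s \<partial>leb T)"
  by (rule integral_abs_bound_integral[OF Bochner_Integration.integrable_diff[OF if' iI] iI]) (use near in \<open>auto simp: indicator_def\<close>)
 hence "\<bar>(\<integral>s. indicator ?I s * f s \<partial>leb T) - c * ?h\<bar> \<le> \<epsilon> * ?h"
  using if' iI I by (simp del: Bochner_Integration.integral_indicator)
 hence "(real (Suc n) / T) * \<bar>(\<integral>s. indicator ?I s * f s \<partial>leb T) - c * ?h\<bar> \<le> (real (Suc n) / T) * (\<epsilon> * ?h)"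
  using T by (intro mult_left_mono) auto
 moreover have "avg_coeff T n f i - c = (real (Suc n) / T) * ((\<integral>s. indicator ?I s * f s \<partial>leb T) - c * ?h)"
  using i T by (simp add: avg_coeff_def right_diff_distrib)
 ultimately show ?thesis using T by (simp add: abs_mult)
qed

lemma avg_step_measurable [measurable]: "avg_step T n f \<in> borel_measurable borel"
 unfolding avg_step_def by (intro borel_measurable_sum borel_measurable_times borel_measurable_indicator) auto

lemma avg_step_bounded: "\<exists>K. \<forall>s. \<bar>avg_step T n f s\<bar> \<le> K"
proof (intro exI allI)
 fix s
 show "\<bar>avg_step T n f s\<bar> \<le> (\<Sum>i<Suc n. \<bar>avg_coeff T n f i\<bar>)"
  unfolding avg_step_def by (rule order_trans[OF sum_abs]) (auto intro!: sum_mono simp: indicator_def simp del: sum.lessThan_Suc)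
qed

lemma integrable_avg_step: "integrable (leb T) (avg_step T n f)"
proof -
 obtain K where "\<forall>s. \<bar>avg_step T n f s\<bar> \<le> K" using avg_step_bounded by blast
 thus ?thesis by (intro integrable_bounded_time[where K = K] measurable_restrict_space1) simp_all
qed

lemma avg_coeff_add:
 assumes "integrable (leb T) f" "integrable (leb T) g"
 shows "avg_coeff T n (%s. f s + g s) i = avg_coeff T n f i + avg_coeff T n g i"
 using integrable_indicator_mult_time[OF assms(1)] integrable_indicator_mult_time[OF assms(2)] by (simp add: avg_coeff_def distrib_left)

lemma avg_step_add:
 assumes "integrable (leb T) f" "integrable (leb T) g"
 shows "avg_step T n (%s. f s + g s) s = avg_step T n f s + avg_step T n g s"
 unfolding avg_step_def avg_coeff_add[OF assms] by (simp add: distrib_right sum.distrib)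

text \<open>Averaging only moves the integral of \<open>f\<close> over a cell to the next cell, so
  the triangle inequality on each cell gives the contraction; the first cell receives 0.\<close>

lemma avg_step_contraction:
 assumes T: "0 < T" and f: "integrable (leb T) f"
 shows "(\<integral>s. \<bar>avg_step T n f s\<bar> \<partial>leb T) \<le> (\<integral>s. \<bar>f s\<bar> \<partial>leb T)"
proof -
 let ?\<Lambda> = "leb T" and ?t = "mesh_point T n" and ?h = "T / real (Suc n)"
 let ?I = "%i. {?t i<..?t (Suc i)}"
 note g = grid_mesh_point[OF T, of n]
 have r: "0 \<le> ?t i" "?t i \<le> ?t (Suc i)" "?t (Suc i) \<le> T" if "i < Suc n" for i
  using grid_range[OF g, of i] grid_range[OF g, of "Suc i"] grid_le[OF g, of i "Suc i"] that by auto
 have intI: "integrable ?\<Lambda> (indicat_real A)" if "A \<in> sets borel" for A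
  using that by (intro integrable_bounded_time[where K = 1] measurable_restrict_space1) (auto simp: indicator_def)
 have fa: "integrable ?\<Lambda> (%s. \<bar>f s\<bar>)" using f by (rule integrable_abs)
 have "(\<integral>s. \<bar>avg_step T n f s\<bar> \<partial>?\<Lambda>) \<le> (\<integral>s. (\<Sum>i<Suc n. \<bar>avg_coeff T n f i\<bar> * indicator (?I i) s) \<partial>?\<Lambda>)"
 proof (rule integral_mono)
  show "integrable ?\<Lambda> (%s. \<bar>avg_step T n f s\<bar>)" by (intro integrable_abs integrable_avg_step)
  show "integrable ?\<Lambda> (%s. \<Sum>i<Suc n. \<bar>avg_coeff T n f i\<bar> * indicator (?I i) s)"
   by (intro Bochner_Integration.integrable_sum integrable_mult_right intI) auto
  show "\<bar>avg_step T n f s\<bar> \<le> (\<Sum>i<Suc n. \<bar>avg_coeff T n f i\<bar> * indicator (?I i) s)" for s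
   unfolding avg_step_def by (rule order_trans[OF sum_abs]) (simp add: abs_mult del: sum.lessThan_Suc)
 qed
 also have "\<dots> = (\<Sum>i<Suc n. \<bar>avg_coeff T n f i\<bar> * ?h)"
 proof (subst Bochner_Integration.integral_sum)
  show "integrable ?\<Lambda> (%s. \<bar>avg_coeff T n f i\<bar> * indicator (?I i) s)" for i by (intro integrable_mult_right intI) auto
  show "(\<Sum>i<Suc n. \<integral>s. \<bar>avg_coeff T n f i\<bar> * indicator (?I i) s \<partial>?\<Lambda>) = (\<Sum>i<Suc n. \<bar>avg_coeff T n f i\<bar> * ?h)"
  proof (rule sum.cong[OF refl])
   fix i assume "i \<in> {..<Suc n}"
   hence "(\<integral>s. indicator (?I i) s \<partial>?\<Lambda>) = ?h"
    using r[of i] by (subst measure_time_cell) (auto simp: mesh_point_Suc)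
   thus "(\<integral>s. \<bar>avg_coeff T n f i\<bar> * indicator (?I i) s \<partial>?\<Lambda>) = \<bar>avg_coeff T n f i\<bar> * ?h"
    by (subst integral_mult_right_zero) (simp only:)
  qed
 qed
 also have "\<dots> = (\<Sum>i<n. \<bar>avg_coeff T n f (Suc i)\<bar> * ?h)" by (subst sum.lessThan_Suc_shift) (simp add: avg_coeff_def)
 also have "\<dots> \<le> (\<Sum>i<n. \<integral>s. indicator (?I i) s * \<bar>f s\<bar> \<partial>?\<Lambda>)"
 proof (rule sum_mono)
  fix i
  have "\<bar>avg_coeff T n f (Suc i)\<bar> * ?h = \<bar>\<integral>s. indicator (?I i) s * f s \<partial>?\<Lambda>\<bar>"
   using T by (simp add: avg_coeff_def abs_mult)
  also have "\<dots> \<le> (\<integral>s. indicator (?I i) s * \<bar>f s\<bar> \<partial>?\<Lambda>)"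
   using integrable_indicator_mult_time[OF f] integrable_indicator_mult_time[OF fa] by (intro integral_abs_bound_integral) (auto simp: abs_mult)
  finally show "\<bar>avg_coeff T n f (Suc i)\<bar> * ?h \<le> (\<integral>s. indicator (?I i) s * \<bar>f s\<bar> \<partial>?\<Lambda>)" .
 qed
 also have "\<dots> = (\<integral>s. (\<Sum>i<n. indicator (?I i) s * \<bar>f s\<bar>) \<partial>?\<Lambda>)"
  using integrable_indicator_mult_time[OF fa] by (subst Bochner_Integration.integral_sum) auto
 also have "\<dots> \<le> (\<integral>s. \<bar>f s\<bar> \<partial>?\<Lambda>)"
 proof (rule integral_mono[OF _ fa])
  show "integrable ?\<Lambda> (%s. \<Sum>i<n. indicator (?I i) s * \<bar>f s\<bar>)"
   using integrable_indicator_mult_time[OF fa] by (intro Bochner_Integration.integrable_sum) auto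
  fix s
  have "(\<Sum>i<n. indicator (?I i) s) \<le> (\<Sum>i<Suc n. 1 * indicator (?I i) s :: real)" by simp
  also have "\<dots> \<le> 1"
  proof (cases "\<exists>k<Suc n. s \<in> ?I k")
   case True
   then obtain k where "k < Suc n" "s \<in> ?I k" by blast
   from grid_indicator_sum[OF g this, of "%_. 1"] show ?thesis by simp
  next
   case False
   hence "(\<Sum>i<Suc n. 1 * indicator (?I i) s :: real) = 0" by (intro sum.neutral) auto
   thus ?thesis by simp
  qed
  finally have "(\<Sum>i<n. indicator (?I i) s) * \<bar>f s\<bar> \<le> 1 * \<bar>f s\<bar>" by (intro mult_right_mono) auto
  thus "(\<Sum>i<n. indicator (?I i) s * \<bar>f s\<bar>) \<le> \<bar>f s\<bar>" by (simp add: sum_distrib_right)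
 qed
 finally show ?thesis .
qed

lemma avg_coeff_bound:
 assumes T: "0 < T" and i: "i \<le> Suc n" and f: "\<And>s. s \<in> {0..T} ==> \<bar>f s\<bar> \<le> K" "f \<in> borel_measurable (leb T)"
 shows "\<bar>avg_coeff T n f i\<bar> \<le> K"
proof (cases "i = 0")
 case True
 thus ?thesis using f(1)[of 0] T by (simp add: avg_coeff_def)
next
 case False
 have "\<bar>avg_coeff T n f i - 0\<bar> \<le> K"
  using False grid_range[OF grid_mesh_point[OF T] order_trans[OF diff_le_self i], of 1] grid_range[OF grid_mesh_point[OF T] i]
  by (intro avg_coeff_near[OF T _ i integrable_bounded_time[OF f(2,1)]]) (auto intro!: f(1))
 thus ?thesis by simp
qed

lemma avg_step_bound:
 assumes T: "0 < T" and s: "s \<in> {0..T}" and f: "\<And>s. s \<in> {0..T} ==> \<bar>f s\<bar> \<le> K" "f \<in> borel_measurable (leb T)"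
 shows "\<bar>avg_step T n f s\<bar> \<le> K"
proof (cases "s = 0")
 case True
 have "avg_step T n f 0 = 0"
  unfolding avg_step_def using T by (intro sum.neutral) (simp add: indicator_def mesh_point_def not_less)
 thus ?thesis using True order_trans[OF abs_ge_zero f(1)[of 0]] T by simp
next
 case False
 hence "0 < s" "s \<le> T" using s by auto
 then obtain k where k: "k < Suc n" "s \<in> {mesh_point T n k<..mesh_point T n (Suc k)}"
  using grid_cell[OF grid_mesh_point[OF T]] by blast
 show ?thesis unfolding avg_step_cell[OF T k] using k by (intro avg_coeff_bound[OF T _ f]) auto
qed

lemma avg_step_continuous:
 assumes T: "0 < T" and g: "continuous_on UNIV g" "integrable (leb T) g" and s: "0 < s" "s \<le> T"
 shows "(%n. avg_step T n g s) ~> g s"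
proof (rule LIMSEQ_I)
 fix e :: real assume "0 < e"
 hence e: "0 < e / 2" by simp
 obtain \<delta> where \<delta>: "0 < \<delta>" "\<And>r. \<bar>r - s\<bar> < \<delta> ==> \<bar>g r - g s\<bar> < e / 2"
  using g(1) e unfolding continuous_on_iff dist_real_def by (metis UNIV_I)
 have "(%n. 2 * T * inverse (real (Suc n))) ~> 2 * T * 0" by (intro tendsto_intros LIMSEQ_inverse_real_of_nat)
 hence "\<forall>\<^sub>F n in sequentially. 2 * T * inverse (real (Suc n)) < min \<delta> s" using \<delta> s by (intro order_tendstoD(2)) auto
 then obtain N where N: "\<And>n. n \<ge> N ==> 2 * T * inverse (real (Suc n)) < min \<delta> s" unfolding eventually_sequentially by blast
 have "norm (avg_step T n g s - g s) < e" if "n \<ge> N" for n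
 proof -
  define h where "h = T / real (Suc n)"
  have h: "2 * h < \<delta>" "2 * h < s" "0 < h" using N[OF that] T by (simp_all add: h_def divide_inverse)
  have tS: "mesh_point T n (Suc i) = mesh_point T n i + h" for i unfolding h_def by (rule mesh_point_Suc)
  obtain k where k: "k < Suc n" "s \<in> {mesh_point T n k<..mesh_point T n (Suc k)}"
   using grid_cell[OF grid_mesh_point[OF T], of s n] s by auto
  have "mesh_point T n (Suc 0) = h" using tS[of 0] by (simp add: mesh_point_def[of T n 0])
  \<comment> \<open>Cell 0 carries the default value 0 instead of an average; it is excluded because
    \<open>s\<close> exceeds the mesh.\<close>
  hence "k \<noteq> 0" using k h by (intro notI) simp
  hence k1: "0 < k" "mesh_point T n k = mesh_point T n (k - 1) + h" using tS[of "k - 1"] by auto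
  have "\<bar>avg_coeff T n g k - g s\<bar> \<le> e / 2"
  proof (rule avg_coeff_near[OF T k1(1) _ g(2)])
   fix r assume "r \<in> {mesh_point T n (k - 1)<..mesh_point T n k}"
   hence "\<bar>r - s\<bar> < \<delta>" using k k1(2) tS[of k] h by auto
   thus "\<bar>g r - g s\<bar> \<le> e / 2" using \<delta>(2)[of r] by simp
  qed (use k in simp)
  thus ?thesis unfolding avg_step_cell[OF T k] using \<open>0 < e\<close> by simp
 qed
 thus "\<exists>N. \<forall>n\<ge>N. norm (avg_step T n g s - g s) < e" by blast
qed

lemma bounded_convergence_time:
 assumes T: "0 < T" and u: "\<And>n. u n \<in> borel_measurable (leb T)" "\<And>n s. s \<in> {0..T} ==> \<bar>u n s\<bar> \<le> (C :: real)"
  and lim: "AE s in lborel. s \<in> {0..T} \<longrightarrow> (%n. u n s) ~> 0"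
 shows "(%n. \<integral>s. \<bar>u n s\<bar> \<partial>leb T) ~> 0"
proof -
 have "(%n. \<integral>s. \<bar>u n s\<bar> \<partial>leb T) ~> (\<integral>s. 0 \<partial>leb T)"
 proof (rule integral_dominated_convergence[where w = "%_. C"])
  show "integrable (leb T) (%_. C)" by (rule integrable_bounded_time[where K = "\<bar>C\<bar>"]) auto
  have "AE s in leb T. (%n. u n s) ~> 0" using lim by (subst AE_restrict_space_iff) auto
  thus "AE s in leb T. (%n. \<bar>u n s\<bar>) ~> 0" by eventually_elim (rule tendsto_rabs_zero)
  show "AE s in leb T. norm \<bar>u n s\<bar> \<le> C" for n using u(2) by (intro AE_timeI) simp
 qed (simp_all add: borel_measurable_abs[OF u(1)])
 thus ?thesis by simp
qed

text \<open>A three-term argument: \<open>f\<close> is approximated in the mean by a continuous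
  function, for which the averages converge pointwise, and the contraction carries the approximation
  error through the averaging uniformly in \<open>n\<close>.\<close>

lemma avg_step_L1:
 assumes T: "0 < T" and f: "\<And>s. s \<in> {0..T} ==> \<bar>f s\<bar> \<le> K" "f \<in> borel_measurable (leb T)"
 shows "(%n. \<integral>s. \<bar>avg_step T n f s - f s\<bar> \<partial>leb T) ~> 0"
proof (rule LIMSEQ_I)
 fix e :: real assume e: "0 < e"
 have K: "0 \<le> K" using order_trans[OF abs_ge_zero f(1)[of 0]] T by simp
 have "(%s. indicator {0..T} s * f s) \<in> borel_measurable lborel"
  using f(2) by (subst (asm) borel_measurable_restrict_space_iff) auto
 \<comment> \<open>\<open>measurable_on\<close> supplies continuous functions that converge to
   \<open>f\<close> off a negligible set; clipping them at \<open>K\<close> keeps them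
   dominated.\<close>
 hence "(%s. indicator {0..T} s * f s) measurable_on UNIV"
  by (intro lebesgue_measurable_imp_measurable_on_real measurable_completion) auto
 then obtain N g where N: "negligible N" and *: "\<forall>k. continuous_on UNIV (g k :: real => real)"
  "\<forall>s. s \<notin> N \<longrightarrow> (%k. g k s) ~> (if s \<in> UNIV then indicator {0..T} s * f s else 0)"
  unfolding measurable_on_def by blast
 have g: "continuous_on UNIV (g k)" for k using *(1) by blast
 have lim: "(%k. g k s) ~> indicator {0..T} s * f s" if "s \<notin> N" for s using spec[OF *(2), of s] that by simp
 define G where "G k s = clip K (g k s)" for k s
 have G: "continuous_on UNIV (G k)" "\<bar>G k s\<bar> \<le> K" for k s
  unfolding G_def using K g[of k] by (auto simp: clip_def[abs_def] intro!: continuous_intros clip_bound)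
 have Gm: "G k \<in> borel_measurable (leb T)" for k
  using borel_measurable_continuous_onI[OF G(1)] by (intro measurable_restrict_space1) simp
 have iG: "integrable (leb T) (G k)" for k by (rule integrable_bounded_time[OF Gm G(2)])
 have fi: "integrable (leb T) f" by (rule integrable_bounded_time[OF f(2,1)])
 have sm: "avg_step T n u \<in> borel_measurable (leb T)" for n u
  using avg_step_measurable by (intro measurable_restrict_space1) simp
 have "(%k. \<integral>s. \<bar>G k s - f s\<bar> \<partial>leb T) ~> 0"
 proof (rule bounded_convergence_time[OF T, where C = "2 * K"])
  have "AE s in lebesgue. s \<notin> N" using N by (intro AE_not_in) (simp add: negligible_iff_null_sets)
  hence "AE s in lborel. s \<notin> N" by (simp only: AE_completion_iff)
  thus "AE s in lborel. s \<in> {0..T} \<longrightarrow> (%k. G k s - f s) ~> 0"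
  proof (eventually_elim, intro impI)
   fix s assume s: "s \<notin> N" "s \<in> {0..T}"
   have "continuous_on UNIV (clip K)" unfolding clip_def[abs_def] by (intro continuous_intros)
   from continuous_on_tendsto_compose[OF this lim[OF s(1)]] have "(%k. G k s) ~> clip K (f s)" using s(2) by (simp add: G_def)
   thus "(%k. G k s - f s) ~> 0" using clip_eq[OF f(1)[OF s(2)]] by (simp add: LIM_zero)
  qed
  show "\<bar>G k s - f s\<bar> \<le> 2 * K" if "s \<in> {0..T}" for k s using G(2)[of k s] f(1)[OF that] by linarith
 qed (intro borel_measurable_diff Gm f(2))
 from order_tendstoD(2)[OF this, of "e / 3"] e obtain k where k: "(\<integral>s. \<bar>G k s - f s\<bar> \<partial>leb T) < e / 3"
  unfolding eventually_sequentially by auto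
 have "(%n. \<integral>s. \<bar>avg_step T n (G k) s - G k s\<bar> \<partial>leb T) ~> 0"
 proof (rule bounded_convergence_time[OF T, where C = "2 * K"])
  show "AE s in lborel. s \<in> {0..T} \<longrightarrow> (%n. avg_step T n (G k) s - G k s) ~> 0"
   using AE_lborel_singleton[of 0]
  proof (eventually_elim, intro impI)
   fix s :: real assume "s \<noteq> 0" "s \<in> {0..T}"
   thus "(%n. avg_step T n (G k) s - G k s) ~> 0"
    by (intro LIM_zero avg_step_continuous[OF T G(1) iG]) auto
  qed
  show "\<bar>avg_step T n (G k) s - G k s\<bar> \<le> 2 * K" if "s \<in> {0..T}" for n s
   using avg_step_bound[OF T that G(2) Gm, of n k] G(2)[of k s] by linarith
 qed (intro borel_measurable_diff Gm sm)
 from order_tendstoD(2)[OF this, of "e / 3"] e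
 obtain n0 where n0: "\<And>n. n \<ge> n0 ==> (\<integral>s. \<bar>avg_step T n (G k) s - G k s\<bar> \<partial>leb T) < e / 3"
  unfolding eventually_sequentially by auto
 have "(\<integral>s. \<bar>avg_step T n f s - f s\<bar> \<partial>leb T) < e" if "n \<ge> n0" for n
 proof -
  let ?d = "%s. f s + (-1) * G k s"
  have d: "integrable (leb T) ?d" using fi iG by (intro Bochner_Integration.integrable_add integrable_mult_right)
  have "avg_step T n f s = avg_step T n ?d s + avg_step T n (G k) s" for s
   using avg_step_add[OF d iG, of n k s] by simp
  hence le: "\<bar>avg_step T n f s - f s\<bar> \<le> \<bar>avg_step T n (G k) s - G k s\<bar> + (\<bar>avg_step T n ?d s\<bar> + \<bar>G k s - f s\<bar>)" for s
   by simp
  have i: "integrable (leb T) (%s. \<bar>avg_step T n (G k) s - G k s\<bar>)"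
   "integrable (leb T) (%s. \<bar>avg_step T n ?d s\<bar>)" "integrable (leb T) (%s. \<bar>G k s - f s\<bar>)"
   by (intro integrable_abs Bochner_Integration.integrable_diff integrable_avg_step fi iG)+
  have "(\<integral>s. \<bar>avg_step T n f s - f s\<bar> \<partial>leb T) \<le>
    (\<integral>s. \<bar>avg_step T n (G k) s - G k s\<bar> + (\<bar>avg_step T n ?d s\<bar> + \<bar>G k s - f s\<bar>) \<partial>leb T)"
   by (intro integral_mono integrable_abs Bochner_Integration.integrable_diff
     Bochner_Integration.integrable_add integrable_avg_step fi iG le)
  also have "\<dots> = (\<integral>s. \<bar>avg_step T n (G k) s - G k s\<bar> \<partial>leb T) +
    ((\<integral>s. \<bar>avg_step T n ?d s\<bar> \<partial>leb T) + (\<integral>s. \<bar>G k s - f s\<bar> \<partial>leb T))" using i by simp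
  also have "(\<integral>s. \<bar>avg_step T n ?d s\<bar> \<partial>leb T) \<le> (\<integral>s. \<bar>G k s - f s\<bar> \<partial>leb T)"
   using avg_step_contraction[OF T d, of n] by (simp add: abs_minus_commute)
  finally show ?thesis using k n0[OF that] by simp
 qed
 moreover have "0 \<le> (\<integral>s. \<bar>avg_step T n f s - f s\<bar> \<partial>leb T)" for n by simp
 ultimately show "\<exists>N. \<forall>n\<ge>N. norm ((\<integral>s. \<bar>avg_step T n f s - f s\<bar> \<partial>leb T) - 0) < e"
  by (intro exI[of _ n0]) simp
qed

lemma progressive_clip: "progressive F T X ==> progressive F T (%s w. clip K (X s w))"
 by (rule progressive_compose) auto

lemma avg_step_L2:
 assumes T: "0 < T" and K: "0 \<le> K" and f: "\<And>s. s \<in> {0..T} ==> \<bar>f s\<bar> \<le> K" "f \<in> borel_measurable (leb T)"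
 shows "(%n. L2 (leb T) (%s. avg_step T n f s - f s)) ~> 0"
proof (rule tendsto_sandwich[OF _ _ tendsto_const])
 have int: "integrable (leb T) f" by (rule integrable_bounded_time[OF f(2,1)])
 have "(%n. ennreal (2 * K * (\<integral>s. \<bar>avg_step T n f s - f s\<bar> \<partial>leb T))) ~> ennreal (2 * K * 0)"
  by (intro avg_step_L1[OF T f] tendsto_ennrealI tendsto_mult tendsto_const)
 thus "(%n. ennreal (2 * K * (\<integral>s. \<bar>avg_step T n f s - f s\<bar> \<partial>leb T))) ~> 0" by simp
 have "L2 (leb T) (%s. avg_step T n f s - f s) \<le>
   ennreal (2 * K * (\<integral>s. \<bar>avg_step T n f s - f s\<bar> \<partial>leb T))" for n
 proof -
  have "L2 (leb T) (%s. avg_step T n f s - f s) \<le>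
    (\<integral>\<^sup>+s. ennreal (2 * K * \<bar>avg_step T n f s - f s\<bar>) \<partial>leb T)"
  proof (rule nn_integral_mono, rule ennreal_leI)
   fix s assume "s \<in> space (leb T)"
   hence s: "s \<in> {0..T}" by (simp add: space_restrict_space)
   have "\<bar>avg_step T n f s - f s\<bar> \<le> 2 * K"
    using avg_step_bound[OF T s f, of n] f(1)[OF s] by linarith
   hence "\<bar>avg_step T n f s - f s\<bar> * \<bar>avg_step T n f s - f s\<bar> \<le> 2 * K * \<bar>avg_step T n f s - f s\<bar>"
    by (rule mult_right_mono) simp
   thus "(avg_step T n f s - f s)^2 \<le> 2 * K * \<bar>avg_step T n f s - f s\<bar>" by (simp add: power2_eq_square)
  qed
  also have "\<dots> = ennreal (\<integral>s. 2 * K * \<bar>avg_step T n f s - f s\<bar> \<partial>leb T)"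
   using K int by (intro nn_integral_eq_integral integrable_mult_right integrable_abs
     Bochner_Integration.integrable_diff integrable_avg_step) auto
  finally show ?thesis by simp
 qed
 thus "\<forall>\<^sub>F n in sequentially. L2 (leb T) (%s. avg_step T n f s - f s) \<le>
   ennreal (2 * K * (\<integral>s. \<bar>avg_step T n f s - f s\<bar> \<partial>leb T))" by simp
qed simp

lemma nn_integral_square_dominated:
 fixes u :: "nat => 'b => real"
 assumes [measurable]: "\<And>n. u n \<in> borel_measurable N" "w \<in> borel_measurable N"
  and "\<And>n s. s \<in> space N ==> \<bar>u n s\<bar> \<le> \<bar>w s\<bar>" "L2 N w < \<infinity>"
  and "\<And>s. s \<in> space N ==> (%n. u n s) ~> 0"
 shows "(%n. L2 N (u n)) ~> 0"
proof -
 have "(%n. L2 N (u n)) ~> (\<integral>\<^sup>+s. 0 \<partial>N)"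
 proof (rule nn_integral_dominated_convergence[where w = "%s. ennreal ((w s)^2)"])
  show "AE s in N. ennreal ((u n s)^2) \<le> ennreal ((w s)^2)" for n
   using assms(3) by (intro AE_I2 ennreal_leI) (simp add: abs_le_square_iff)
  show "AE s in N. (%n. ennreal ((u n s)^2)) ~> 0"
  proof (rule AE_I2)
   fix s assume "s \<in> space N"
   from tendsto_power[OF assms(5)[OF this], of 2] have "(%n. ennreal ((u n s)^2)) ~> ennreal (0^2)"
    by (rule tendsto_ennrealI)
   thus "(%n. ennreal ((u n s)^2)) ~> 0" by simp
  qed
 qed (use assms in auto)
 thus ?thesis by simp
qed

section \<open>Existence and closedness of the Ito integral\<close>

context brownian_filtration
begin

lemma int_square_diff_triangle:
 assumes "prog X" "prog Y" "prog Z" "w \<in> space M"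
 shows "energy (%s w. X s w - Z s w) w \<le>
  2 * energy (%s w. X s w - Y s w) w + 2 * energy (%s w. Y s w - Z s w) w"
 using int_square_add_le[of "%s w. X s w - Y s w" "%s w. Y s w - Z s w" w] assms by (simp add: progressive_diff)

lemma tendsto_twice_sum_zero:
 fixes f g :: "nat => ennreal"
 assumes "f ~> 0" "g ~> 0" "\<And>n. h n \<le> 2 * f n + 2 * g n"
 shows "h ~> 0"
proof (rule tendsto_sandwich[OF _ _ tendsto_const])
 have "(%n. 2 * f n + 2 * g n) ~> 2 * 0 + 2 * 0"
  using assms(1,2) by (intro tendsto_add ennreal_tendsto_cmult) auto
 thus "(%n. 2 * f n + 2 * g n) ~> 0" by simp
qed (use assms in auto)

lemma simple_integrand_dense_bounded:
 assumes H: "prog H" "\<And>s w. \<bar>H s w\<bar> \<le> K"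
 shows "\<exists>S. (\<forall>n. simple (S n)) \<and>
  null_in_prob M (%n. gap (S n) H)"
proof -
 have K: "0 \<le> K" using H(2)[of 0 undefined] abs_ge_zero order_trans by blast
 define c where "c n i w = avg_coeff T n (%s. H s w) i" for n i w
 define S where "S n = step_list (Suc n) (mesh_point T n) (c n)" for n
 have g: "grid T (Suc n) (mesh_point T n)" for n by (rule grid_mesh_point[OF T_pos])
 have c: "adapted_coeffs (Suc n) (mesh_point T n) (c n)" for n unfolding adapted_coeffs_def
 proof (intro allI impI conjI)
  fix i assume i: "i < Suc n"
  show "\<exists>K. \<forall>w\<in>space M. \<bar>c n i w\<bar> \<le> K" unfolding c_def using i H
   by (intro exI[of _ K] ballI avg_coeff_bound[OF T_pos] progressive_path_time) auto
  have c_eq: "c n i = (%w. avg_coeff T n (%s. H s w) i)" by (rule ext) (simp add: c_def)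
  show "c n i \<in> borel_measurable (F (mesh_point T n i))"
  proof (cases "i = 0")
   case True
   thus ?thesis unfolding c_eq avg_coeff_def by simp
  next
   case False
   let ?t = "mesh_point T n i" and ?I = "{mesh_point T n (i - 1)<..mesh_point T n i}"
   have r: "?t \<in> {0..T}" "0 \<le> mesh_point T n (i - 1)"
    using grid_range[OF g, of i n] grid_range[OF g, of "i - 1" n] i by auto
   have "(%q. indicator {0..?t} (snd q) * H (snd q) (fst q)) \<in> borel_measurable (F ?t \<Otimes>\<^sub>M lborel)"
   proof -
    have "(%q. (snd q, fst q)) \<in> F ?t \<Otimes>\<^sub>M lborel \<rightarrow>\<^sub>M borel \<Otimes>\<^sub>M F ?t"
     by (intro measurable_Pair) (simp_all add: measurable_snd[of _ borel, simplified measurable_lborel1])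
    from measurable_compose[OF this progressive_joint[OF H(1) r(1)]] show ?thesis by simp
   qed
   note Hm = this
   have "(%q. indicat_real ?I (snd q)) \<in> borel_measurable (F ?t \<Otimes>\<^sub>M lborel)"
    by (rule measurable_compose[OF measurable_snd]) simp
   from borel_measurable_times[OF this Hm] have "(%q. indicat_real ?I (snd q) * (indicator {0..?t} (snd q) * H (snd q) (fst q))) \<in> borel_measurable (F ?t \<Otimes>\<^sub>M lborel)"
    .
   hence "(%w. \<integral>s. indicat_real ?I s * (indicator {0..?t} s * H s w) \<partial>lborel) \<in> borel_measurable (F ?t)"
    by (intro lborel.borel_measurable_lebesgue_integral) (simp add: split_beta')
   also have "(%w. \<integral>s. indicat_real ?I s * (indicator {0..?t} s * H s w) \<partial>lborel) =
     (%w. \<integral>s. indicator ?I s * H s w \<partial>leb T)"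
   proof
    fix w
    have "(%s. indicat_real ?I s * (indicator {0..?t} s * H s w)) = (%s. indicator {0..T} s *\<^sub>R (indicator ?I s * H s w))"
     using r by (auto simp: indicator_def)
    thus "(\<integral>s. indicat_real ?I s * (indicator {0..?t} s * H s w) \<partial>lborel) = (\<integral>s. indicator ?I s * H s w \<partial>leb T)"
     by (subst integral_restrict_space) simp_all
   qed
   finally show ?thesis using False unfolding c_eq avg_coeff_def by simp
  qed
 qed
 have S: "simple (S n)" for n unfolding S_def by (rule simple_integrand_step_list[OF g c])
 have "SP (S n) s w = avg_step T n (%s. H s w) s" for n s w
  unfolding S_def simple_process_step_list avg_step_def c_def ..
 hence "(%n. gap (S n) H w) ~> 0" if "w \<in> space M" for w
  unfolding int_square_eq
  using avg_step_L2[OF T_pos K, of "%s. H s w"] H progressive_path_time[OF H(1) that] by simp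
 hence "null_in_prob M (%n. gap (S n) H)" by (intro null_in_prob_AE AE_I2 int_square_diff_measurable S H)
 with S show ?thesis by blast
qed

text \<open>Clip \<open>H\<close> at level \<open>m\<close>, approximate each clipped process, and
  take one index per level along the diagonal; the clipping error vanishes in energy by dominated
  convergence.\<close>

lemma simple_integrand_dense:
 assumes H: "prog H" "AE w in M. energy H w < \<infinity>"
 shows "\<exists>S. (\<forall>n. simple (S n)) \<and>
  null_in_prob M (%n. gap (S n) H)"
proof -
 define Hm where "Hm m s w = clip (real m) (H s w)" for m :: nat and s w
 have Hm: "prog (Hm m)" for m unfolding Hm_def by (rule progressive_clip[OF H(1)])
 have "\<bar>Hm m s w\<bar> \<le> real m" for m s w unfolding Hm_def by (rule clip_bound) simp
 note dense = simple_integrand_dense_bounded[OF Hm this]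
 define P where "P m S \<longleftrightarrow> (\<forall>n. simple (S n)) \<and>
  null_in_prob M (%n. gap (S n) (Hm m))" for m S
 have "\<exists>S. P m S" for m unfolding P_def by (rule dense)
 then obtain S where P: "\<And>m. P m (S m)" by metis
 have S: "\<And>m n. simple (S m n)" and
  null: "\<And>m. null_in_prob M (%n. gap (S m n) (Hm m))"
  using P by (simp_all add: P_def)
 obtain r where r: "AE w in M. (%m. gap (S m (r m)) (Hm m) w) ~> 0"
  using null_in_prob_diagonal[of "%m n. gap (S m n) (Hm m)"] null by blast
 have clip_conv: "AE w in M. (%m. energy (%s w. Hm m s w - H s w) w) ~> 0"
  using H(2)
 proof (rule AE_mp, intro AE_I2 impI)
  fix w assume w: "w \<in> space M" "energy H w < \<infinity>"
  show "(%m. energy (%s w. Hm m s w - H s w) w) ~> 0"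
   unfolding int_square_eq
  proof (rule nn_integral_square_dominated[where w = "%s. H s w"])
   show "(%s. Hm m s w - H s w) \<in> borel_measurable (leb T)" for m by (intro progressive_path_time[OF progressive_diff[OF Hm H(1)]] w)
   show "(%s. H s w) \<in> borel_measurable (leb T)" by (intro progressive_path_time[OF H(1)] w)
   show "\<bar>Hm m s w - H s w\<bar> \<le> \<bar>H s w\<bar>" for m s by (auto simp: Hm_def clip_def)
   show "(%m. Hm m s w - H s w) ~> 0" for s
    unfolding Hm_def by (intro LIM_zero clip_tendsto)
  qed (use w in \<open>simp add: int_square_eq\<close>)
 qed
 have "AE w in M. (%m. gap (S m (r m)) H w) ~> 0"
  using r clip_conv AE_space
 proof eventually_elim
  case (elim w)
  show ?case by (rule tendsto_twice_sum_zero[OF elim(1,2)])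
    (intro int_square_diff_triangle simple_process_progressive S Hm H elim)
 qed
 hence "null_in_prob M (%m. gap (S m (r m)) H)" by (intro null_in_prob_AE int_square_diff_measurable S H)
 thus ?thesis using S by (intro exI[of _ "%m. S m (r m)"]) auto
qed

theorem has_ito_integral_exists:
 assumes "prog H" "AE w in M. energy H w < \<infinity>"
 shows "\<exists>I. ito_integral H I"
proof -
 obtain S where "\<And>n. simple (S n)"
  "null_in_prob M (%n. gap (S n) H)"
  using simple_integrand_dense[OF assms] by blast
 from has_ito_integral_simple_limit[OF this(1) assms this(2)] show ?thesis by blast
qed

lemma has_ito_integralD:
 assumes "ito_integral H I"
 shows "prog H" "AE w in M. energy H w < \<infinity>" "prog I"
  "AE w in M. continuous_on {0..T} (%t. I t w)"
 using assms by (auto simp: has_ito_integral_def)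

text \<open>The graph of the Ito integral is closed, and later limits pass through this fact. For
  each \<open>m\<close> a simple integrand is chosen that is close to \<open>H m\<close> in energy
  and whose integral is close to \<open>I m\<close> uniformly in time.\<close>

theorem has_ito_integral_closed:
 assumes HI: "\<And>m. ito_integral (H m) (I m)"
  and H: "prog H'" "AE w in M. energy H' w < \<infinity>"
  and I: "prog I'" "AE w in M. continuous_on {0..T} (%t. I' t w)"
  and lim_H: "AE w in M. (%m. energy (%s w. H m s w - H' s w) w) ~> 0"
  and lim_I: "\<And>t. t \<in> {0..T} ==> AE w in M. (%m. I m t w) ~> I' t w"
 shows "ito_integral H' I'"
proof -
 note D = has_ito_integralD[OF HI]
 define P where "P m S \<longleftrightarrow> (\<forall>n. simple (S n)) \<and> (AE w in M. approx S (H m) (I m) w)" for m S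
 have "\<exists>S. P m S" for m unfolding P_def by (rule has_ito_integral_AE[OF HI])
 then obtain S where P: "\<And>m. P m (S m)" by metis
 have S: "\<And>m n. simple (S m n)" and lim_S: "\<And>m. AE w in M. approx (S m) (H m) (I m) w"
  using P by (simp_all add: P_def)
 define E where "E m n w = (SUP t\<in>dense_times. ennreal \<bar>SI (S m n) t w - I m t w\<bar>)" for m n w
 \<comment> \<open>Adding the two errors lets one diagonal index control both; the supremum in
   \<open>E\<close> runs over dense times to be measurable.\<close>
 define G where "G m n w = gap (S m n) (H m) w + E m n w" for m n w
 have E_meas: "E m n \<in> borel_measurable M" for m n unfolding E_def
 proof (rule borel_measurable_SUP[OF countable_times])
  fix t assume "t \<in> dense_times"
  hence "t \<in> {0..T}" using dense_times_subset by auto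
  thus "(%w. ennreal \<bar>SI (S m n) t w - I m t w\<bar>) \<in> borel_measurable M"
   using simple_integral_measurable[OF S] progressive_section_M[OF D(3)]
   by (intro measurable_compose[OF _ measurable_ennreal] borel_measurable_abs borel_measurable_diff) auto
 qed
 have "null_in_prob M (G m)" for m
 proof (rule null_in_prob_AE)
  show "G m n \<in> borel_measurable M" for n
   unfolding G_def by (intro borel_measurable_add int_square_diff_measurable S D E_meas)
  show "AE w in M. (%n. G m n w) ~> 0" using lim_S[of m]
  proof eventually_elim
   case (elim w)
   have "(%n. E m n w) ~> 0"
   proof (rule order_tendstoI)
    fix e :: ennreal assume "0 < e"
    then obtain e' where e': "0 < e'" "ennreal e' < e"
    proof (cases e)
     case (real x)
     thus ?thesis using \<open>0 < e\<close> that[of "x / 2"] by (simp add: ennreal_lessI)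
    next
     case top
     thus ?thesis using that[of 1] by simp
    qed
    have "\<forall>\<^sub>F n in sequentially. \<forall>t\<in>{0..T}. dist (SI (S m n) t w) (I m t w) < e'"
     using elim e'(1) by (auto simp: uniform_limit_iff)
    thus "\<forall>\<^sub>F n in sequentially. E m n w < e"
    proof eventually_elim
     case (elim n)
     have "E m n w \<le> ennreal e'" unfolding E_def
     proof (rule SUP_least)
      fix t assume "t \<in> dense_times"
      hence "dist (SI (S m n) t w) (I m t w) < e'" using elim dense_times_subset by blast
      thus "ennreal \<bar>SI (S m n) t w - I m t w\<bar> \<le> ennreal e'" by (intro ennreal_leI) (simp add: dist_real_def)
     qed
     thus ?case using e'(2) by (rule le_less_trans)
    qed
   qed auto
   from tendsto_add[OF conjunct1[OF elim] this] show ?case unfolding G_def by simp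
  qed
 qed
 then obtain r where r: "AE w in M. (%m. G m (r m) w) ~> 0"
  using null_in_prob_diagonal[of G] by blast
 have parts: "AE w in M. (%m. gap (S m (r m)) (H m) w) ~> 0 \<and>
   (%m. E m (r m) w) ~> 0"
  using r
 proof eventually_elim
  case (elim w)
  have "(%m. f m) ~> 0" if "\<And>m. f m \<le> G m (r m) w" for f :: "nat => ennreal"
   by (rule tendsto_sandwich[OF _ _ tendsto_const elim]) (simp_all add: that)
  thus ?case by (simp add: G_def)
 qed
 show ?thesis
 proof (rule has_ito_integralI[OF H I])
  show "simple (S m (r m))" for m by (rule S)
  have "AE w in M. (%m. gap (S m (r m)) H' w) ~> 0"
   using parts lim_H AE_space
  proof eventually_elim
   case (elim w)
   show ?case by (rule tendsto_twice_sum_zero[OF conjunct1[OF elim(1)] elim(2)])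
     (intro int_square_diff_triangle simple_process_progressive S D H elim)
  qed
  thus "null_in_prob M (%m. gap (S m (r m)) H')"
   by (intro null_in_prob_AE int_square_diff_measurable S H)
  fix t assume t: "t \<in> {0..T}"
  have "AE w in M. \<forall>m. continuous_on {0..T} (%t. I m t w)"
   unfolding AE_all_countable using D(4) by blast
  from parts lim_I[OF t] this B_cont show "AE w in M. (%m. SI (S m (r m)) t w) ~> I' t w"
  proof eventually_elim
   case (elim w)
   note cont = elim(4)
   have le: "ennreal \<bar>SI (S m (r m)) t w - I m t w\<bar> \<le> E m (r m) w" for m
   proof (cases "E m (r m) w")
    case (real x)
    have "\<bar>SI (S m (r m)) t w - I m t w\<bar> \<le> x"
    proof (rule continuous_le_times[OF _ _ t])
     show "continuous_on {0..T} (%t. \<bar>SI (S m (r m)) t w - I m t w\<bar>)"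
      using elim(3)[rule_format, of m] simple_integral_continuous[of T B w F "S m (r m)", OF _ S]
       cont by (intro continuous_on_rabs continuous_on_diff) blast+
     fix u assume "u \<in> dense_times"
     hence "ennreal \<bar>SI (S m (r m)) u w - I m u w\<bar> \<le> ennreal x"
      unfolding real(2)[symmetric] E_def by (rule SUP_upper)
     thus "\<bar>SI (S m (r m)) u w - I m u w\<bar> \<le> x" using real(1) by (simp add: ennreal_le_iff)
    qed
    thus ?thesis using real by (simp add: ennreal_leI)
   qed simp
   have "(%m. ennreal \<bar>SI (S m (r m)) t w - I m t w\<bar>) ~> ennreal 0"
    unfolding ennreal_0 by (rule tendsto_sandwich[OF _ _ tendsto_const conjunct2[OF elim(1)]]) (simp_all add: le)
   hence "(%m. SI (S m (r m)) t w - I m t w) ~> 0" by (intro tendsto_rabs_zero_cancel[OF tendsto_ennrealD]) auto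
   from tendsto_add[OF this elim(2)] show ?case by simp
  qed
 qed
qed

text \<open>The constant sequence in \<open>has_ito_integral_closed\<close>.\<close>

lemma has_ito_integral_cong:
 assumes "ito_integral H I" "prog H'" "prog I'"
  and "AE w in M. AE s in leb T. H s w = H' s w" "AE w in M. \<forall>t\<in>{0..T}. I t w = I' t w"
 shows "ito_integral H' I'"
proof -
 note D = has_ito_integralD[OF assms(1)]
 have eq: "AE w in M. energy H' w = energy H w \<and> energy (%s w. H s w - H' s w) w = 0"
  using assms(4)
 proof eventually_elim
  case (elim w)
  have "energy H' w = energy H w"
   unfolding int_square_eq by (rule nn_integral_cong_AE) (use elim in \<open>auto elim!: eventually_mono\<close>)
  moreover have "energy (%s w. H s w - H' s w) w = (\<integral>\<^sup>+s. 0 \<partial>leb T)"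
   unfolding int_square_eq by (rule nn_integral_cong_AE) (use elim in \<open>auto elim!: eventually_mono\<close>)
  ultimately show ?case by simp
 qed
 show ?thesis
 proof (rule has_ito_integral_closed[OF assms(1,2) _ assms(3)])
  show "AE w in M. energy H' w < \<infinity>" using eq D(2) by eventually_elim auto
  show "AE w in M. continuous_on {0..T} (%t. I' t w)" using D(4) assms(5)
  proof eventually_elim
   case (elim w)
   thus ?case using continuous_on_cong[of "{0..T}" "{0..T}" "%t. I t w" "%t. I' t w"] by blast
  qed
  show "AE w in M. (%m. energy (%s w. H s w - H' s w) w) ~> 0"
   using eq by eventually_elim auto
  show "AE w in M. (%m. I t w) ~> I' t w" if "t \<in> {0..T}" for t
   using assms(5) by eventually_elim (use that in auto)
 qed
qed

text \<open>Concatenating the lists adds both the simple processes and their integrals, since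
  intervals are allowed to overlap.\<close>

lemma has_ito_integral_add:
 assumes 1: "ito_integral H I" and 2: "ito_integral H' I'"
 shows "ito_integral (%s w. H s w + H' s w) (%s w. I s w + I' s w)"
proof -
 note D = has_ito_integralD[OF 1] and D' = has_ito_integralD[OF 2]
 obtain S where S: "\<And>n. simple (S n)" and lim_S: "AE w in M. approx S H I w"
  using has_ito_integral_AE[OF 1] by blast
 obtain S' where S': "\<And>n. simple (S' n)" and lim_S': "AE w in M. approx S' H' I' w"
  using has_ito_integral_AE[OF 2] by blast
 have SS: "simple (S n @ S' n)" for n by (rule simple_integrand_append[OF S S'])
 show ?thesis
 proof (rule has_ito_integralI[OF progressive_add[OF D(1) D'(1)] _ progressive_add[OF D(3) D'(3)] _ SS])
  show "AE w in M. energy (%s w. H s w + H' s w) w < \<infinity>" using D(2) D'(2) AE_space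
  proof eventually_elim
   case (elim w)
   have "2 * energy H w + 2 * energy H' w < \<infinity>" using elim by (simp add: ennreal_mult_less_top)
   with int_square_add_le[OF D(1) D'(1) elim(3)] show ?case by (rule le_less_trans)
  qed
  show "AE w in M. continuous_on {0..T} (%s. I s w + I' s w)"
   using D(4) D'(4) by eventually_elim (rule continuous_on_add)
  have "AE w in M. (%n. energy (%s w. SP (S n @ S' n) s w - (H s w + H' s w)) w) ~> 0"
   using lim_S lim_S' AE_space
  proof eventually_elim
   case (elim w)
   show ?case
   proof (rule tendsto_twice_sum_zero[OF conjunct1[OF elim(1)] conjunct1[OF elim(2)]])
    fix n
    have "energy (%s w. SP (S n @ S' n) s w - (H s w + H' s w)) w =
      energy (%s w. (SP (S n) s w - H s w) + (SP (S' n) s w - H' s w)) w"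
     by (simp add: int_square_def simple_process_append algebra_simps)
    also have "\<dots> \<le> 2 * gap (S n) H w +
      2 * gap (S' n) H' w"
     by (intro int_square_add_le progressive_diff simple_process_progressive S S' D(1) D'(1) elim)
    finally show "energy (%s w. SP (S n @ S' n) s w - (H s w + H' s w)) w \<le> \<dots>" .
   qed
  qed
  thus "null_in_prob M (%n. energy (%s w. SP (S n @ S' n) s w - (H s w + H' s w)))"
   by (intro null_in_prob_AE int_square_diff_measurable SS progressive_add D(1) D'(1))
  show "AE w in M. (%n. SI (S n @ S' n) t w) ~> I t w + I' t w" if t: "t \<in> {0..T}" for t
   using lim_S lim_S'
  proof eventually_elim
   case (elim w)
   thus ?case
    unfolding simple_integral_append using t by (intro tendsto_add) (auto dest: tendsto_uniform_limitI)
  qed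
 qed
qed

end

section \<open>Ito processes\<close>

lemma nn_integral_abs_add_le:
 fixes x y :: "'b => real"
 assumes [measurable]: "x \<in> borel_measurable N" "y \<in> borel_measurable N"
 shows "L1 N (%s. x s + y s) \<le> (L1 N x) + L1 N y"
proof -
 have "L1 N (%s. x s + y s) \<le> (\<integral>\<^sup>+s. ennreal \<bar>x s\<bar> + ennreal \<bar>y s\<bar> \<partial>N)"
  by (intro nn_integral_mono) (simp add: ennreal_plus[symmetric] ennreal_leI del: ennreal_plus)
 thus ?thesis by (simp add: nn_integral_add)
qed

lemma nn_integral_abs_dominated:
 fixes u :: "nat => 'b => real"
 assumes [measurable]: "\<And>n. u n \<in> borel_measurable N" "w \<in> borel_measurable N"
  and "\<And>n s. s \<in> space N ==> \<bar>u n s\<bar> \<le> \<bar>w s\<bar>" "L1 N w < \<infinity>"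
  and "\<And>s. s \<in> space N ==> (%n. u n s) ~> 0"
 shows "(%n. L1 N (u n)) ~> 0"
proof -
 have "(%n. L1 N (u n)) ~> (\<integral>\<^sup>+s. 0 \<partial>N)"
 proof (rule nn_integral_dominated_convergence[where w = "%s. ennreal \<bar>w s\<bar>"])
  show "AE s in N. ennreal \<bar>u n s\<bar> \<le> ennreal \<bar>w s\<bar>" for n
   using assms(3) by (intro AE_I2 ennreal_leI)
  show "AE s in N. (%n. ennreal \<bar>u n s\<bar>) ~> 0"
  proof (rule AE_I2)
   fix s assume "s \<in> space N"
   from tendsto_rabs[OF assms(5)[OF this]] have "(%n. ennreal \<bar>u n s\<bar>) ~> ennreal \<bar>0\<bar>"
    by (rule tendsto_ennrealI)
   thus "(%n. ennreal \<bar>u n s\<bar>) ~> 0" by simp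
  qed
 qed (use assms in auto)
 thus ?thesis by simp
qed

lemma integrable_square_iff:
 fixes h :: "'b => real"
 assumes "h \<in> borel_measurable N"
 shows "integrable N (%s. (h s)^2) \<longleftrightarrow> (L2 N h) < \<infinity>"
 using assms by (subst integrable_iff_bounded) auto

lemma nn_integral_square_mult_le:
 fixes u h :: "'b => real"
 assumes [measurable]: "h \<in> borel_measurable N" and "\<And>s. s \<in> space N ==> \<bar>u s\<bar> \<le> C"
 shows "L2 N (%s. u s * h s) \<le> ennreal (C^2) * L2 N h"
proof -
 have "L2 N (%s. u s * h s) \<le> (\<integral>\<^sup>+s. ennreal (C^2) * ennreal ((h s)^2) \<partial>N)"
 proof (rule nn_integral_mono)
  fix s assume "s \<in> space N"
  from assms(2)[OF this] have "(u s)^2 \<le> C^2" by (metis abs_ge_zero power2_abs power_mono)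
  hence "(u s * h s)^2 \<le> C^2 * (h s)^2" unfolding power_mult_distrib by (rule mult_right_mono) simp
  thus "ennreal ((u s * h s)^2) \<le> ennreal (C^2) * ennreal ((h s)^2)" by (simp add: ennreal_mult[symmetric] ennreal_leI)
 qed
 thus ?thesis by (simp add: nn_integral_cmult)
qed

text \<open>With \<open>d = k n - h\<close>, Young's inequality bounds the difference of the squares
  by \<open>(1 + 1 / \<epsilon>) * d^2 + \<epsilon> * h^2\<close>: for fixed
  \<open>\<epsilon>\<close> the first term vanishes in the limit, and the second is small by the
  choice of \<open>\<epsilon>\<close>.\<close>

lemma nn_integral_square_diff_tendsto:
 fixes h :: "'b => real"
 assumes [measurable]: "\<And>n. k n \<in> borel_measurable N" "h \<in> borel_measurable N"
  and h: "L2 N h < \<infinity>"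
  and lim: "(%n. L2 N (%s. k n s - h s)) ~> 0"
 shows "(%n. L1 N (%s. (k n s)^2 - (h s)^2)) ~> 0"
proof (rule order_tendstoI)
 fix e :: ennreal assume "0 < e"
 then obtain e' where e': "0 < e'" "ennreal e' < e"
 proof (cases e)
  case (real x)
  thus ?thesis using \<open>0 < e\<close> that[of "x / 2"] by (simp add: ennreal_lessI)
 next
  case top
  thus ?thesis using that[of 1] by simp
 qed
 obtain A where A: "0 \<le> A" "L2 N h = ennreal A"
  using h by (cases "L2 N h") auto
 define \<epsilon> where "\<epsilon> = e' / (2 * (A + 1))"
 have \<epsilon>: "0 < \<epsilon>" "\<epsilon> * A \<le> e' / 2" using A e' by (auto simp: \<epsilon>_def field_simps)
 define c where "c = 1 + 1 / \<epsilon>"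
 have c: "0 < c" using \<epsilon> by (simp add: c_def add_pos_pos)
 have le: "L1 N (%s. (k n s)^2 - (h s)^2) \<le>
   ennreal c * L2 N (%s. k n s - h s) + ennreal (\<epsilon> * A)" for n
 proof -
  have "L1 N (%s. (k n s)^2 - (h s)^2) \<le>
    (\<integral>\<^sup>+s. ennreal c * ennreal ((k n s - h s)^2) + ennreal \<epsilon> * ennreal ((h s)^2) \<partial>N)"
  proof (rule nn_integral_mono)
   fix s
   define d where "d = k n s - h s"
   have "0 \<le> (\<epsilon> * \<bar>h s\<bar> - \<bar>d\<bar>)^2 / \<epsilon>" using \<epsilon> by simp
   also have "\<dots> = \<epsilon> * (h s)^2 - 2 * \<bar>h s * d\<bar> + d^2 / \<epsilon>"
    using \<epsilon> by (simp add: power2_diff power_mult_distrib abs_mult field_simps power2_eq_square)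
   finally have "2 * \<bar>h s * d\<bar> \<le> \<epsilon> * (h s)^2 + d^2 / \<epsilon>" by simp
   moreover have "(k n s)^2 - (h s)^2 = d^2 + 2 * (h s * d)" by (simp add: d_def power2_eq_square algebra_simps)
   hence "\<bar>(k n s)^2 - (h s)^2\<bar> \<le> d^2 + 2 * \<bar>h s * d\<bar>"
    using abs_triangle_ineq[of "d^2" "2 * (h s * d)"] by simp
   ultimately have "\<bar>(k n s)^2 - (h s)^2\<bar> \<le> c * d^2 + \<epsilon> * (h s)^2" by (simp add: c_def distrib_right)
   hence "ennreal \<bar>(k n s)^2 - (h s)^2\<bar> \<le> ennreal (c * d^2 + \<epsilon> * (h s)^2)" by (rule ennreal_leI)
   also have "\<dots> = ennreal c * ennreal (d^2) + ennreal \<epsilon> * ennreal ((h s)^2)"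
    using c \<epsilon> by (simp add: ennreal_plus ennreal_mult)
   finally show "ennreal \<bar>(k n s)^2 - (h s)^2\<bar> \<le> ennreal c * ennreal ((k n s - h s)^2) + ennreal \<epsilon> * ennreal ((h s)^2)"
    unfolding d_def .
  qed
  also have "\<dots> = ennreal c * L2 N (%s. k n s - h s) + ennreal \<epsilon> * ennreal A"
   by (simp add: nn_integral_add nn_integral_cmult A(2))
  finally show ?thesis using \<epsilon> A by (simp add: ennreal_mult)
 qed
 have "(%n. ennreal c * L2 N (%s. k n s - h s)) ~> ennreal c * 0"
  by (intro ennreal_tendsto_cmult lim) auto
 hence "\<forall>\<^sub>F n in sequentially. ennreal c * L2 N (%s. k n s - h s) < ennreal (e' / 2)"
  using e' by (intro order_tendstoD) auto
 thus "\<forall>\<^sub>F n in sequentially. L1 N (%s. (k n s)^2 - (h s)^2) < e"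
 proof eventually_elim
  case (elim n)
  have "L1 N (%s. (k n s)^2 - (h s)^2) \<le> ennreal (e' / 2) + ennreal (e' / 2)"
   using le[of n] elim \<epsilon>(2) by (meson add_mono ennreal_leI less_imp_le order_trans)
  also have "\<dots> = ennreal e'" using e' by (simp add: ennreal_plus[symmetric] del: ennreal_plus)
  finally show ?case using e'(2) by (rule le_less_trans)
 qed
qed auto

context
 fixes N :: "'b measure" and u v :: "'b => real" and un vn :: "nat => 'b => real" and C :: real
  and a h :: "'b => real" and an hn :: "nat => 'b => real"
 assumes meas [measurable]: "u \<in> borel_measurable N" "v \<in> borel_measurable N" "\<And>n. un n \<in> borel_measurable N"
   "\<And>n. vn n \<in> borel_measurable N" "h \<in> borel_measurable N" "a \<in> borel_measurable N"
   "\<And>n. hn n \<in> borel_measurable N" "\<And>n. an n \<in> borel_measurable N"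
  and bound: "\<And>n s. s \<in> space N ==> \<bar>un n s\<bar> \<le> C" "\<And>n s. s \<in> space N ==> \<bar>vn n s\<bar> \<le> C"
  and lim: "\<And>s. s \<in> space N ==> (%n. un n s) ~> u s" "\<And>s. s \<in> space N ==> (%n. vn n s) ~> v s"
  and h: "L2 N h < \<infinity>" and hn: "(%n. L2 N (%s. hn n s - h s)) ~> 0"
begin

lemma limit_bounds:
 assumes s: "s \<in> space N"
 shows "\<bar>u s\<bar> \<le> C" "\<bar>v s\<bar> \<le> C"
proof -
 show "\<bar>u s\<bar> \<le> C" by (rule LIMSEQ_le_const2[OF tendsto_rabs[OF lim(1)[OF s]]]) (simp add: bound(1)[OF s])
 show "\<bar>v s\<bar> \<le> C" by (rule LIMSEQ_le_const2[OF tendsto_rabs[OF lim(2)[OF s]]]) (simp add: bound(2)[OF s])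
qed

lemma product_square_finite: "L2 N (%s. u s * h s) < \<infinity>"
 by (rule le_less_trans[OF nn_integral_square_mult_le[OF _ limit_bounds(1)]])
  (use h in \<open>auto simp: ennreal_mult_less_top\<close>)

text \<open>Split into \<open>un * (hn - h)\<close>, controlled by the bound \<open>C\<close> and
  the error of \<open>hn\<close>, and \<open>(un - u) * h\<close>, which tends to 0 by dominated
  convergence.\<close>

lemma product_square_tendsto: "(%n. L2 N (%s. un n s * hn n s - u s * h s)) ~> 0"
proof (rule tendsto_sandwich[OF _ _ tendsto_const])
 have 1: "(%n. L2 N (%s. (un n s - u s) * h s)) ~> 0"
 proof (rule nn_integral_square_dominated[where w = "%s. (2 * C) * h s"])
  show "\<bar>(un n s - u s) * h s\<bar> \<le> \<bar>2 * C * h s\<bar>" if "s \<in> space N" for n s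
  proof -
   have "\<bar>un n s - u s\<bar> \<le> \<bar>2 * C\<bar>" using bound(1)[OF that, of n] limit_bounds(1)[OF that] by linarith
   thus ?thesis unfolding abs_mult by (intro mult_right_mono) (simp_all add: abs_mult)
  qed
  show "L2 N (%s. 2 * C * h s) < \<infinity>"
   by (rule le_less_trans[OF nn_integral_square_mult_le[where C = "\<bar>2 * C\<bar>"]])
    (use h in \<open>auto simp: ennreal_mult_less_top\<close>)
  show "(%n. (un n s - u s) * h s) ~> 0" if "s \<in> space N" for s
   using LIM_zero[OF lim(1)[OF that]] by (rule tendsto_mult_left_zero)
 qed auto
 have "(%n. 2 * (ennreal (C^2) * L2 N (%s. hn n s - h s)) + 2 * L2 N (%s. (un n s - u s) * h s)) ~>
   2 * (ennreal (C^2) * 0) + 2 * 0"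
  by (intro tendsto_add ennreal_tendsto_cmult hn 1) auto
 thus "(%n. 2 * (ennreal (C^2) * L2 N (%s. hn n s - h s)) + 2 * L2 N (%s. (un n s - u s) * h s)) ~> 0"
  by simp
 have "L2 N (%s. un n s * hn n s - u s * h s) \<le>
  2 * (ennreal (C^2) * L2 N (%s. hn n s - h s)) + 2 * L2 N (%s. (un n s - u s) * h s)" for n
 proof -
  have "L2 N (%s. un n s * hn n s - u s * h s) =
    L2 N (%s. un n s * (hn n s - h s) + (un n s - u s) * h s)"
   by (simp add: algebra_simps)
  also have "\<dots> \<le> 2 * L2 N (%s. un n s * (hn n s - h s)) + 2 * L2 N (%s. (un n s - u s) * h s)"
   by (rule nn_integral_square_add_le) auto
  also have "L2 N (%s. un n s * (hn n s - h s)) \<le> ennreal (C^2) * L2 N (%s. hn n s - h s)"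
   by (rule nn_integral_square_mult_le) (auto simp: bound)
  finally show ?thesis by (simp add: add_right_mono mult_left_mono)
 qed
 thus "\<forall>\<^sub>F n in sequentially. L2 N (%s. un n s * hn n s - u s * h s) \<le>
  2 * (ennreal (C^2) * L2 N (%s. hn n s - h s)) + 2 * L2 N (%s. (un n s - u s) * h s)" by simp
qed auto

lemma nn_integral_abs_mult_le:
 fixes w x :: "'b => real"
 assumes [measurable]: "x \<in> borel_measurable N" and "\<And>s. s \<in> space N ==> \<bar>w s\<bar> \<le> C"
 shows "L1 N (%s. w s * x s) \<le> ennreal C * L1 N x"
proof -
 have "L1 N (%s. w s * x s) \<le> (\<integral>\<^sup>+s. ennreal C * ennreal \<bar>x s\<bar> \<partial>N)"
 proof (rule nn_integral_mono)
  fix s assume "s \<in> space N"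
  from assms(2)[OF this] have "\<bar>w s * x s\<bar> \<le> C * \<bar>x s\<bar>" unfolding abs_mult by (rule mult_right_mono) simp
  moreover have "0 \<le> C" using assms(2)[OF \<open>s \<in> space N\<close>] by linarith
  ultimately show "ennreal \<bar>w s * x s\<bar> \<le> ennreal C * ennreal \<bar>x s\<bar>" by (simp add: ennreal_mult[symmetric] ennreal_leI)
 qed
 thus ?thesis by (simp add: nn_integral_cmult)
qed

text \<open>Serves twice in \<open>drift_tendsto\<close>: for \<open>un * an\<close> and for
  \<open>vn * hn^2\<close>.\<close>

lemma product_abs_tendsto:
 assumes [measurable]: "\<And>n. xn n \<in> borel_measurable N" "x \<in> borel_measurable N"
  "\<And>n. wn n \<in> borel_measurable N" "w \<in> borel_measurable N"
  and w: "\<And>n s. s \<in> space N ==> \<bar>wn n s\<bar> \<le> C" "\<And>s. s \<in> space N ==> (%n. wn n s) ~> w s"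
  and x: "L1 N x < \<infinity>" "(%n. L1 N (%s. xn n s - x s)) ~> 0"
 shows "(%n. L1 N (%s. wn n s * xn n s - w s * x s)) ~> 0"
proof (rule tendsto_sandwich[OF _ _ tendsto_const])
 have wb: "\<bar>w s\<bar> \<le> C" if "s \<in> space N" for s by (rule LIMSEQ_le_const2[OF tendsto_rabs[OF w(2)[OF that]]]) (use w(1) that in auto)
 have 1: "(%n. L1 N (%s. (wn n s - w s) * x s)) ~> 0"
 proof (rule nn_integral_abs_dominated[where w = "%s. (2 * C) * x s"])
  show "\<bar>(wn n s - w s) * x s\<bar> \<le> \<bar>2 * C * x s\<bar>" if "s \<in> space N" for n s
  proof -
   have "\<bar>wn n s - w s\<bar> \<le> \<bar>2 * C\<bar>" using w(1)[OF that, of n] wb[OF that] by linarith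
   thus ?thesis unfolding abs_mult by (intro mult_right_mono) (simp_all add: abs_mult)
  qed
  have "L1 N (%s. 2 * C * x s) = (\<integral>\<^sup>+s. ennreal \<bar>2 * C\<bar> * ennreal \<bar>x s\<bar> \<partial>N)"
   by (intro nn_integral_cong) (simp only: abs_mult ennreal_mult[symmetric] abs_ge_zero mult_nonneg_nonneg)
  also have "\<dots> < \<infinity>" using x(1) by (simp add: nn_integral_cmult ennreal_mult_less_top)
  finally show "L1 N (%s. 2 * C * x s) < \<infinity>" .
  show "(%n. (wn n s - w s) * x s) ~> 0" if "s \<in> space N" for s
   using LIM_zero[OF w(2)[OF that]] by (rule tendsto_mult_left_zero)
 qed auto
 have "(%n. ennreal C * L1 N (%s. xn n s - x s) + L1 N (%s. (wn n s - w s) * x s)) ~> ennreal C * 0 + 0"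
  by (intro tendsto_add ennreal_tendsto_cmult x 1) auto
 thus "(%n. ennreal C * L1 N (%s. xn n s - x s) + L1 N (%s. (wn n s - w s) * x s)) ~> 0" by simp
 have "L1 N (%s. wn n s * xn n s - w s * x s) \<le>
  ennreal C * L1 N (%s. xn n s - x s) + L1 N (%s. (wn n s - w s) * x s)" for n
 proof -
  have "L1 N (%s. wn n s * xn n s - w s * x s) =
    L1 N (%s. wn n s * (xn n s - x s) + (wn n s - w s) * x s)"
   by (simp add: algebra_simps)
  also have "\<dots> \<le> (L1 N (%s. wn n s * (xn n s - x s))) + L1 N (%s. (wn n s - w s) * x s)"
   by (rule nn_integral_abs_add_le) auto
  also have "L1 N (%s. wn n s * (xn n s - x s)) \<le> ennreal C * L1 N (%s. xn n s - x s)"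
   by (rule nn_integral_abs_mult_le) (auto simp: w)
  finally show ?thesis by (simp add: add_right_mono)
 qed
 thus "\<forall>\<^sub>F n in sequentially. L1 N (%s. wn n s * xn n s - w s * x s) \<le>
  ennreal C * L1 N (%s. xn n s - x s) + L1 N (%s. (wn n s - w s) * x s)" by simp
qed auto

lemma drift_integrable:
 assumes "integrable N a"
 shows "integrable N (%s. u s * a s + v s * (h s)^2 / 2)"
proof -
 have "integrable N (%s. u s * a s)"
 proof (rule Bochner_Integration.integrable_bound[where f = "%s. C * a s"])
  show "AE s in N. norm (u s * a s) \<le> norm (C * a s)"
  proof (rule AE_I2)
   fix s assume "s \<in> space N"
   hence "\<bar>u s\<bar> \<le> \<bar>C\<bar>" using limit_bounds(1)[of s] by simp
   thus "norm (u s * a s) \<le> norm (C * a s)" by (simp add: abs_mult mult_right_mono)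
  qed
 qed (use assms in auto)
 moreover have "integrable N (%s. v s * (h s)^2)"
 proof (rule Bochner_Integration.integrable_bound[where f = "%s. C * (h s)^2"])
  show "integrable N (%s. C * (h s)^2)"
   using integrable_square_iff[of h N] h by (intro integrable_mult_right) simp
  show "AE s in N. norm (v s * (h s)^2) \<le> norm (C * (h s)^2)"
  proof (rule AE_I2)
   fix s assume "s \<in> space N"
   hence "\<bar>v s\<bar> \<le> \<bar>C\<bar>" using limit_bounds(2)[of s] by simp
   thus "norm (v s * (h s)^2) \<le> norm (C * (h s)^2)" by (simp add: abs_mult mult_right_mono)
  qed
 qed auto
 ultimately show ?thesis by (intro Bochner_Integration.integrable_add integrable_divide_zero) auto
qed

lemma drift_tendsto:
 assumes a: "integrable N a" "(%n. L1 N (%s. an n s - a s)) ~> 0"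
 shows "(%n. L1 N (%s. (un n s * an n s + vn n s * (hn n s)^2 / 2) - (u s * a s + v s * (h s)^2 / 2))) ~> 0"
proof (rule tendsto_sandwich[OF _ _ tendsto_const])
 have fin: "L1 N a < \<infinity>" using a(1) by (simp add: integrable_iff_bounded)
 have 1: "(%n. L1 N (%s. un n s * an n s - u s * a s)) ~> 0"
  by (rule product_abs_tendsto[OF _ _ _ _ bound(1) lim(1) fin a(2)]) auto
 have 2: "(%n. L1 N (%s. vn n s * (hn n s)^2 - v s * (h s)^2)) ~> 0"
  by (rule product_abs_tendsto[OF _ _ _ _ bound(2) lim(2) _ nn_integral_square_diff_tendsto[OF _ _ h hn]]) (use h in auto)
 show "(%n. L1 N (%s. un n s * an n s - u s * a s) + L1 N (%s. vn n s * (hn n s)^2 - v s * (h s)^2)) ~> 0"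
  using tendsto_add[OF 1 2] by simp
 have "L1 N (%s. (un n s * an n s + vn n s * (hn n s)^2 / 2) - (u s * a s + v s * (h s)^2 / 2)) \<le>
  L1 N (%s. un n s * an n s - u s * a s) + L1 N (%s. vn n s * (hn n s)^2 - v s * (h s)^2)" for n
 proof -
  have "L1 N (%s. (un n s * an n s + vn n s * (hn n s)^2 / 2) - (u s * a s + v s * (h s)^2 / 2)) =
    L1 N (%s. (un n s * an n s - u s * a s) + (vn n s * (hn n s)^2 - v s * (h s)^2) / 2)"
   by (intro nn_integral_cong arg_cong[where f = ennreal] arg_cong[where f = abs]) (simp add: field_simps)
  also have "\<dots> \<le> (L1 N (%s. un n s * an n s - u s * a s)) + L1 N (%s. (vn n s * (hn n s)^2 - v s * (h s)^2) / 2)"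
   by (rule nn_integral_abs_add_le) auto
  also have "L1 N (%s. (vn n s * (hn n s)^2 - v s * (h s)^2) / 2) \<le> (L1 N (%s. vn n s * (hn n s)^2 - v s * (h s)^2))"
   by (intro nn_integral_mono ennreal_leI) simp
  finally show ?thesis by (simp add: add_left_mono)
 qed
 thus "\<forall>\<^sub>F n in sequentially. L1 N (%s. (un n s * an n s + vn n s * (hn n s)^2 / 2) - (u s * a s + v s * (h s)^2 / 2)) \<le>
  L1 N (%s. un n s * an n s - u s * a s) + L1 N (%s. vn n s * (hn n s)^2 - v s * (h s)^2)" by simp
qed auto

end

lemma integral_tendsto_of_nn:
 fixes a :: "'b => real"
 assumes int: "\<And>n. integrable N (an n)" "integrable N a"
  and lim: "(%n. L1 N (%s. an n s - a s)) ~> 0" and e: "\<And>s. \<bar>e s\<bar> \<le> 1" "e \<in> borel_measurable N"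
 shows "(%n. \<integral>s. e s * an n s \<partial>N) ~> (\<integral>s. e s * a s \<partial>N)"
proof -
 have ie: "integrable N (%s. e s * x s)" if "integrable N x" for x :: "'b => real"
 proof (rule Bochner_Integration.integrable_bound[OF that])
  show "AE s in N. norm (e s * x s) \<le> norm (x s)"
   using e(1) mult_right_mono[OF e(1)] by (intro AE_I2) (simp add: abs_mult)
 qed (use e that in auto)
 have eq: "L1 N (%s. an n s - a s) = ennreal (\<integral>s. \<bar>an n s - a s\<bar> \<partial>N)" for n
  using int by (intro nn_integral_eq_integral integrable_abs) auto
 have lim': "(%n. \<integral>s. \<bar>an n s - a s\<bar> \<partial>N) ~> 0"
  using lim unfolding eq by (intro tendsto_ennrealD) auto
 have "(%n. (\<integral>s. e s * an n s \<partial>N) - (\<integral>s. e s * a s \<partial>N)) ~> 0"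
 proof (rule Lim_null_comparison[OF _ lim'], intro always_eventually allI)
  fix n
  have "(\<integral>s. e s * an n s \<partial>N) - (\<integral>s. e s * a s \<partial>N) = (\<integral>s. e s * (an n s - a s) \<partial>N)"
   using ie[OF int(1)] ie[OF int(2)] by (simp add: right_diff_distrib)
  also have "\<bar>\<dots>\<bar> \<le> (\<integral>s. \<bar>e s * (an n s - a s)\<bar> \<partial>N)" by (rule integral_abs_bound)
  also have "\<dots> \<le> (\<integral>s. \<bar>an n s - a s\<bar> \<partial>N)"
  proof (rule integral_mono)
   show "integrable N (%s. \<bar>e s * (an n s - a s)\<bar>)" "integrable N (%s. \<bar>an n s - a s\<bar>)"
    by (intro integrable_abs ie Bochner_Integration.integrable_diff int)+
   show "\<bar>e s * (an n s - a s)\<bar> \<le> \<bar>an n s - a s\<bar>" for s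
    using mult_right_mono[OF e(1)[of s], of "\<bar>an n s - a s\<bar>"] by (simp add: abs_mult)
  qed
  finally show "norm ((\<integral>s. e s * an n s \<partial>N) - (\<integral>s. e s * a s \<partial>N)) \<le> (\<integral>s. \<bar>an n s - a s\<bar> \<partial>N)" by simp
 qed
 thus ?thesis by (simp add: LIM_zero_iff)
qed

lemma indefinite_integral_continuous_time:
 assumes a: "integrable (leb T) (a :: real => real)"
 shows "continuous_on {0..T} (%t. LBINT s:{0..t}. a s)"
proof -
 have "continuous_on {0..T} (%t. \<integral>s. indicator {0..t} s * a s \<partial>leb T)"
  unfolding continuous_on_sequentially o_def
 proof (intro allI ballI impI, elim conjE)
  fix x :: "nat => real" and t assume t: "t \<in> {0..T}" and x: "\<forall>n. x n \<in> {0..T}" "x ~> t"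
  show "(%n. \<integral>s. indicator {0..x n} s * a s \<partial>leb T) ~> (\<integral>s. indicator {0..t} s * a s \<partial>leb T)"
  proof (rule integral_dominated_convergence[where w = "%s. \<bar>a s\<bar>"])
   show "(%s. indicator {0..r} s * a s) \<in> borel_measurable (leb T)" for r
    by (intro borel_measurable_times borel_measurable_integrable[OF a])
     (simp add: measurable_restrict_space1)
   thus "(%s. indicator {0..x n} s * a s) \<in> borel_measurable (leb T)" for n .
   show "integrable (leb T) (%s. \<bar>a s\<bar>)" using a by simp
   have "AE s in lborel. s \<in> {0..T} \<longrightarrow> (%n. indicator {0..x n} s * a s) ~> indicator {0..t} s * a s"
    using AE_lborel_singleton[of t]
   proof eventually_elim
    case (elim s)
    have "\<forall>\<^sub>F n in sequentially. indicator {0..x n} s = (indicator {0..t} s :: real)" if "0 \<le> s"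
    proof (cases "s < t")
     case True
     from order_tendstoD(1)[OF x(2) this] show ?thesis by eventually_elim (use True that in \<open>auto simp: indicator_def\<close>)
    next
     case False
     with elim have "t < s" by simp
     from order_tendstoD(2)[OF x(2) this] show ?thesis by eventually_elim (use \<open>t < s\<close> in \<open>auto simp: indicator_def\<close>)
    qed
    thus ?case by (intro impI tendsto_mult tendsto_const tendsto_eventually) auto
   qed
   thus "AE s in leb T. (%n. indicator {0..x n} s * a s) ~> indicator {0..t} s * a s"
    by (subst AE_restrict_space_iff) auto
   show "AE s in leb T. norm (indicator {0..x n} s * a s) \<le> \<bar>a s\<bar>" for n by (rule AE_I2) (auto simp: indicator_def)
  qed
 qed
 thus ?thesis by (rule continuous_on_cong[THEN iffD1, rotated 2]) (auto simp: set_lebesgue_integral_leb)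
qed

section \<open>Ito processes and their stability under limits\<close>

context brownian_filtration
begin

text \<open>\<open>a\<close> is the drift and \<open>H\<close> the diffusion coefficient. The
  stochastic integral is existentially quantified; by \<open>ito_process_integral\<close> it can
  always be taken to be \<open>X\<close> minus its initial value and its drift integral.\<close>

definition ito_process :: "(real => 'a => real) => (real => 'a => real) => (real => 'a => real) => bool" where
 "ito_process X a H \<longleftrightarrow> prog X \<and> prog a \<and>
  (AE w in M. integrable (leb T) (%s. a s w)) \<and>
  (\<exists>I. ito_integral H I \<and>
   (AE w in M. \<forall>t\<in>{0..T}. X t w = X 0 w + (LBINT s:{0..t}. a s w) + I t w))"

lemma ito_processD:
 assumes "ito_process X a H"
 shows "prog X" "prog a" "prog H"
  "AE w in M. integrable (leb T) (%s. a s w)" "AE w in M. energy H w < \<infinity>"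
 using assms has_ito_integralD unfolding ito_process_def by blast+

lemma progressive_initial:
 assumes "\<xi> \<in> borel_measurable (F 0)"
 shows "prog (%t w. \<xi> w)"
 by (rule adapted_continuous_progressive) (use measurable_F_mono[OF _ _ _ assms] in auto)

lemma initial_measurable: "prog X ==> X 0 \<in> borel_measurable (F 0)"
 using progressive_section[of X 0] T_pos by auto

lemma ito_process_continuous:
 assumes "ito_process X a H"
 shows "AE w in M. continuous_on {0..T} (%t. X t w)"
proof -
 obtain I where I: "ito_integral H I"
  "AE w in M. \<forall>t\<in>{0..T}. X t w = X 0 w + (LBINT s:{0..t}. a s w) + I t w"
  using assms unfolding ito_process_def by blast
 from I(2) has_ito_integralD(4)[OF I(1)] ito_processD(4)[OF assms] show ?thesis
 proof eventually_elim
  case (elim w)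
  have "continuous_on {0..T} (%t. X 0 w + (LBINT s:{0..t}. a s w) + I t w)"
   by (intro continuous_on_add continuous_on_const indefinite_integral_continuous_time elim)
  thus ?case using elim(1) continuous_on_cong[of "{0..T}" "{0..T}" "%t. X t w"
    "%t. X 0 w + (LBINT s:{0..t}. a s w) + I t w"] by blast
 qed
qed

lemma ito_processI:
 assumes "prog X" "prog a" "AE w in M. integrable (leb T) (%s. a s w)"
  and I: "ito_integral H (%t w. X t w - X 0 w - (LBINT s:{0..t}. a s w))"
 shows "ito_process X a H"
 unfolding ito_process_def using assms by (intro conjI exI[of _ "%t w. X t w - X 0 w - (LBINT s:{0..t}. a s w)"]) auto

lemma progressive_remainder:
 assumes "prog X" "prog a"
 shows "prog (%t w. X t w - X 0 w - (LBINT s:{0..t}. a s w))"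
 by (intro progressive_diff progressive_integral assms progressive_initial initial_measurable)

lemma ito_process_integral:
 assumes "ito_process X a H"
 shows "ito_integral H (%t w. X t w - X 0 w - (LBINT s:{0..t}. a s w))"
proof -
 note D = ito_processD[OF assms]
 obtain I where I: "ito_integral H I"
  "AE w in M. \<forall>t\<in>{0..T}. X t w = X 0 w + (LBINT s:{0..t}. a s w) + I t w"
  using assms unfolding ito_process_def by blast
 show ?thesis by (rule has_ito_integral_cong[OF I(1) D(3) progressive_remainder[OF D(1,2)]])
   (use I(2) in \<open>auto elim!: eventually_mono\<close>)
qed

text \<open>The stability used in the approximations below: paths converge pointwise, drifts in the
  mean and diffusion coefficients in energy. It reduces to closedness of the integral, applied to
  the remainders after subtracting initial value and drift.\<close>

lemma ito_process_limit:
 assumes ito: "\<And>n. ito_process (X n) (a n) (H n)"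
  and prog: "prog X'" "prog a'" "prog H'"
  and cont: "AE w in M. continuous_on {0..T} (%t. X' t w)"
  and X: "AE w in M. \<forall>t\<in>{0..T}. (%n. X n t w) ~> X' t w"
  and a': "AE w in M. integrable (leb T) (%s. a' s w)"
  and a: "AE w in M. (%n. L1 (leb T) (%s. a n s w - a' s w)) ~> 0"
  and H': "AE w in M. energy H' w < \<infinity>"
  and H: "AE w in M. (%n. energy (%s w. H n s w - H' s w) w) ~> 0"
 shows "ito_process X' a' H'"
proof (rule ito_processI[OF prog(1,2) a'])
 show "ito_integral H' (%t w. X' t w - X' 0 w - (LBINT s:{0..t}. a' s w))"
 proof (rule has_ito_integral_closed[OF ito_process_integral[OF ito] prog(3) H' progressive_remainder[OF prog(1,2)] _ H])
  show "AE w in M. continuous_on {0..T} (%t. X' t w - X' 0 w - (LBINT s:{0..t}. a' s w))"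
   using cont a' by eventually_elim (intro continuous_on_diff continuous_on_const indefinite_integral_continuous_time)
  fix t assume t: "t \<in> {0..T}"
  have "AE w in M. \<forall>n. integrable (leb T) (%s. a n s w)"
   unfolding AE_all_countable using ito_processD(4)[OF ito] by blast
  with X a' a show "AE w in M. (%n. X n t w - X n 0 w - (LBINT s:{0..t}. a n s w)) ~>
    X' t w - X' 0 w - (LBINT s:{0..t}. a' s w)"
  proof eventually_elim
   case (elim w)
   have "(%n. \<integral>s. indicator {0..t} s * a n s w \<partial>leb T) ~> (\<integral>s. indicator {0..t} s * a' s w \<partial>leb T)"
   proof (rule integral_tendsto_of_nn[OF _ elim(2,3)])
    show "integrable (leb T) (%s. a n s w)" for n using elim(4) by blast
    show "indicat_real {0..t} \<in> borel_measurable (leb T)" by (rule measurable_restrict_space1) simp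
   qed (simp add: indicator_def)
   hence "(%n. LBINT s:{0..t}. a n s w) ~> (LBINT s:{0..t}. a' s w)"
    using t set_lebesgue_integral_leb[of t T] by simp
   with elim(1) t T_pos show ?case by (intro tendsto_diff) auto
  qed
 qed
qed

end

section \<open>Ito's formula\<close>

text \<open>The Lagrange remainder evaluates \<open>f2\<close> at an intermediate point; its
  Lipschitz condition turns this into a cubic error.\<close>

lemma taylor2_bound:
 fixes f f1 f2 :: "real => real"
 assumes f: "\<And>x. (f has_real_derivative f1 x) (at x)" "\<And>x. (f1 has_real_derivative f2 x) (at x)"
  and lip: "\<And>x y. \<bar>f2 x - f2 y\<bar> \<le> K * \<bar>x - y\<bar>" and K: "0 \<le> K"
 shows "\<bar>f (x + h) - f x - f1 x * h - f2 x * h^2 / 2\<bar> \<le> K * \<bar>h\<bar> ^ 3"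
proof (cases "h = 0")
 case False
 define diff where "diff m = (if m = 0 then f else if m = 1 then f1 else f2)" for m :: nat
 have "\<exists>t. (if x + h < x then x + h < t \<and> t < x else x < t \<and> t < x + h) \<and>
   f (x + h) = (\<Sum>m<2. diff m x / fact m * ((x + h) - x) ^ m) + diff 2 t / fact 2 * ((x + h) - x)^2"
 proof (rule Taylor[where a = "min x (x + h)" and b = "max x (x + h)"])
  show "\<forall>m t. m < 2 \<and> min x (x + h) \<le> t \<and> t \<le> max x (x + h) \<longrightarrow> (diff m has_real_derivative diff (Suc m) t) (at t)"
   using f by (auto simp: diff_def less_Suc_eq numeral_2_eq_2)
 qed (use False in \<open>auto simp: diff_def\<close>)
 then obtain t where t: "if x + h < x then x + h < t \<and> t < x else x < t \<and> t < x + h"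
  "f (x + h) = (\<Sum>m<2. diff m x / fact m * h ^ m) + diff 2 t / fact 2 * h^2" by auto
 hence eq: "f (x + h) - f x - f1 x * h - f2 x * h^2 / 2 = (f2 t - f2 x) * h^2 / 2" by (simp add: diff_def numeral_2_eq_2 field_simps)
 have "\<bar>t - x\<bar> \<le> \<bar>h\<bar>" using t(1) by (auto split: if_splits)
 hence "\<bar>f2 t - f2 x\<bar> \<le> K * \<bar>h\<bar>"
  using lip[of t x] K by (meson mult_left_mono order_trans)
 hence "\<bar>f2 t - f2 x\<bar> * h^2 \<le> K * \<bar>h\<bar> * h^2" by (intro mult_right_mono) auto
 also have "K * \<bar>h\<bar> * h^2 = K * \<bar>h\<bar> ^ 3"
  unfolding power2_abs[of h, symmetric] by (simp add: power3_eq_cube power2_eq_square del: abs_mult_self_eq)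
 finally have "\<bar>f2 t - f2 x\<bar> * h^2 \<le> K * \<bar>h\<bar> ^ 3" .
 moreover have "\<bar>(f2 t - f2 x) * h^2 / 2\<bar> = \<bar>f2 t - f2 x\<bar> * h^2 / 2" by (simp add: abs_mult)
 moreover have "0 \<le> K * \<bar>h\<bar> ^ 3" using K by simp
 ultimately show ?thesis unfolding eq by simp
qed simp

text \<open>Young's inequality in two forms: odd absolute powers of a Brownian increment are traded
  for even powers, whose expectations are explicit.\<close>

lemma abs_cube_le:
 fixes D \<theta> :: real
 assumes "0 < \<theta>"
 shows "2 * \<bar>D\<bar> ^ 3 \<le> \<theta> * D^2 + D ^ 4 / \<theta>" and "2 * \<bar>D\<bar> \<le> \<theta> + D^2 / \<theta>"
proof -
 have 1: "2 * \<bar>D\<bar> \<le> \<theta> + D^2 / \<theta>"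
 proof -
  have "0 \<le> (\<theta> - \<bar>D\<bar>)^2 / \<theta>" using assms by simp
  also have "\<dots> = \<theta> - 2 * \<bar>D\<bar> + D^2 / \<theta>" using assms by (simp add: power2_diff field_simps power2_eq_square)
  finally show ?thesis by simp
 qed
 thus "2 * \<bar>D\<bar> \<le> \<theta> + D^2 / \<theta>" .
 have "2 * \<bar>D\<bar> * D^2 \<le> (\<theta> + D^2 / \<theta>) * D^2" using 1 by (rule mult_right_mono) simp
 moreover have "2 * \<bar>D\<bar> * D^2 = 2 * \<bar>D\<bar> ^ 3"
  unfolding power2_abs[of D, symmetric] by (simp add: power3_eq_cube power2_eq_square del: abs_mult_self_eq)
 moreover have "(\<theta> + D^2 / \<theta>) * D^2 = \<theta> * D^2 + D ^ 4 / \<theta>"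
  by (simp add: distrib_right power4_eq_xxxx power2_eq_square)
 ultimately show "2 * \<bar>D\<bar> ^ 3 \<le> \<theta> * D^2 + D ^ 4 / \<theta>" by simp
qed

text \<open>Bounds the terms \<open>4 * d^3 + 4 * \<bar>D\<bar>^3 + d^2 + d * \<bar>D\<bar>\<close>
  of a cell of length \<open>d\<close> with Brownian increment \<open>D\<close>, the odd powers of
  \<open>D\<close> having been removed by Young's inequality with parameter
  \<open>\<theta>\<close>.\<close>

definition ito_error :: "real => real => real => real" where
 "ito_error \<theta> d D = 4 * d ^ 3 + 2 * (\<theta> * D^2 + D ^ 4 / \<theta>) + d^2 + d * (\<theta> + D^2 / \<theta>)"

text \<open>\<open>A\<close> is the drift and \<open>c * D\<close> the noise on a cell. The
  fluctuation \<open>D^2 - d\<close> is subtracted too, because it becomes negligible only after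
  summation, by orthogonality. What remains are the Taylor remainder and the terms in
  \<open>A^2\<close> and \<open>A * c * D\<close>.\<close>

lemma ito_remainder_bound:
 fixes f f1 f2 :: "real => real"
 assumes f: "\<And>x. (f has_real_derivative f1 x) (at x)" "\<And>x. (f1 has_real_derivative f2 x) (at x)"
  and lip: "\<And>x y. \<bar>f2 x - f2 y\<bar> \<le> K * \<bar>x - y\<bar>" and K: "0 \<le> K" "\<And>x. \<bar>f2 x\<bar> \<le> K"
  and L: "1 \<le> L" "\<bar>A\<bar> \<le> L * d" "\<bar>c\<bar> \<le> L" and d: "0 \<le> d" "0 < \<theta>"
 shows "\<bar>f (x + A + c * D) - f x - (f1 x * A + f2 x * c^2 * d / 2) - f1 x * c * D - f2 x * c^2 / 2 * (D^2 - d)\<bar> \<le>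
  K * L ^ 3 * ito_error \<theta> d D"
proof -
 define h where "h = A + c * D"
 have hL: "\<bar>h\<bar> \<le> L * (d + \<bar>D\<bar>)"
 proof -
  have "\<bar>c * D\<bar> \<le> L * \<bar>D\<bar>" unfolding abs_mult using L by (intro mult_right_mono) auto
  thus ?thesis using L(2) abs_triangle_ineq[of A "c * D"] by (simp add: h_def distrib_left)
 qed
 have cube: "(d + \<bar>D\<bar>) ^ 3 \<le> 4 * d ^ 3 + 4 * \<bar>D\<bar> ^ 3"
 proof -
  have "0 \<le> 3 * ((d + \<bar>D\<bar>) * (d - \<bar>D\<bar>)^2)" using d by simp
  also have "\<dots> = 4 * d ^ 3 + 4 * \<bar>D\<bar> ^ 3 - (d + \<bar>D\<bar>) ^ 3" by (simp add: power3_eq_cube power2_eq_square algebra_simps)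
  finally show ?thesis by simp
 qed
 have "\<bar>h\<bar> ^ 3 \<le> (L * (d + \<bar>D\<bar>)) ^ 3" using hL by (rule power_mono) simp
 also have "\<dots> = L ^ 3 * (d + \<bar>D\<bar>) ^ 3" by (simp add: power_mult_distrib)
 also have "\<dots> \<le> L ^ 3 * (4 * d ^ 3 + 4 * \<bar>D\<bar> ^ 3)" using cube L by (intro mult_left_mono) auto
 finally have h3: "\<bar>h\<bar> ^ 3 \<le> L ^ 3 * (4 * d ^ 3 + 4 * \<bar>D\<bar> ^ 3)" .
 have t: "\<bar>f (x + h) - f x - f1 x * h - f2 x * h^2 / 2\<bar> \<le> K * (L ^ 3 * (4 * d ^ 3 + 4 * \<bar>D\<bar> ^ 3))"
  using taylor2_bound[OF f lip K(1), of x h] mult_left_mono[OF h3 K(1)] by linarith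
 have L23: "L^2 \<le> L ^ 3" using L(1) by (intro power_increasing) auto
 have second: "\<bar>f2 x / 2 * (A^2 + 2 * A * (c * D))\<bar> \<le> K * (L ^ 3 * (d^2 + d * \<bar>D\<bar>))"
 proof -
  have "A^2 \<le> (L * d)^2" using L(2) by (metis abs_ge_zero power2_abs power_mono)
  moreover have "\<bar>A * (c * D)\<bar> \<le> (L * d) * (L * \<bar>D\<bar>)"
   unfolding abs_mult using L d by (intro mult_mono mult_right_mono) auto
  ultimately have "\<bar>A^2 + 2 * A * (c * D)\<bar> \<le> (L * d)^2 + 2 * ((L * d) * (L * \<bar>D\<bar>))"
   using abs_triangle_ineq[of "A^2" "2 * A * (c * D)"] by (simp add: abs_mult mult.assoc)
  also have "\<dots> \<le> 2 * (L^2 * (d^2 + d * \<bar>D\<bar>))"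
  proof -
   have "2 * (L^2 * (d^2 + d * \<bar>D\<bar>)) - ((L * d)^2 + 2 * ((L * d) * (L * \<bar>D\<bar>))) = (L * d)^2"
    by (simp add: power_mult_distrib power2_eq_square[of L] algebra_simps)
   thus ?thesis using zero_le_power2[of "L * d"] by linarith
  qed
  also have "\<dots> \<le> 2 * (L ^ 3 * (d^2 + d * \<bar>D\<bar>))" using L23 d by (intro mult_left_mono mult_right_mono) auto
  finally have "\<bar>f2 x / 2\<bar> * \<bar>A^2 + 2 * A * (c * D)\<bar> \<le> (K / 2) * (2 * (L ^ 3 * (d^2 + d * \<bar>D\<bar>)))"
   using K(2)[of x] K(1) by (intro mult_mono) auto
  thus ?thesis by (simp add: abs_mult)
 qed
 have "f (x + A + c * D) - f x - (f1 x * A + f2 x * c^2 * d / 2) - f1 x * c * D - f2 x * c^2 / 2 * (D^2 - d) =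
   (f (x + h) - f x - f1 x * h - f2 x * h^2 / 2) + f2 x / 2 * (A^2 + 2 * A * (c * D))"
 proof -
  have "h^2 = A^2 + 2 * A * (c * D) + c^2 * D^2" by (simp add: h_def power2_sum power_mult_distrib algebra_simps)
  moreover have "f (x + A + c * D) = f (x + h)" by (simp add: h_def add.assoc)
  moreover have "f1 x * h = f1 x * A + f1 x * c * D" by (simp add: h_def distrib_left)
  ultimately show ?thesis by (simp only:) (simp add: field_simps)
 qed
 hence "\<bar>f (x + A + c * D) - f x - (f1 x * A + f2 x * c^2 * d / 2) - f1 x * c * D - f2 x * c^2 / 2 * (D^2 - d)\<bar> \<le>
   K * (L ^ 3 * (4 * d ^ 3 + 4 * \<bar>D\<bar> ^ 3)) + K * (L ^ 3 * (d^2 + d * \<bar>D\<bar>))"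
  using t second by linarith
 also have "\<dots> = K * L ^ 3 * (4 * d ^ 3 + 4 * \<bar>D\<bar> ^ 3 + d^2 + d * \<bar>D\<bar>)" by (simp add: algebra_simps)
 also have "\<dots> \<le> K * L ^ 3 * ito_error \<theta> d D"
 proof (rule mult_left_mono)
  have "d * \<bar>D\<bar> \<le> d * (2 * \<bar>D\<bar>)" using d by (intro mult_left_mono) auto
  also have "\<dots> \<le> d * (\<theta> + D^2 / \<theta>)" using abs_cube_le(2)[OF d(2)] d(1) by (rule mult_left_mono)
  finally have "d * \<bar>D\<bar> \<le> d * (\<theta> + D^2 / \<theta>)" .
  moreover have "4 * \<bar>D\<bar> ^ 3 \<le> 2 * (\<theta> * D^2 + D ^ 4 / \<theta>)"
   using mult_left_mono[OF abs_cube_le(1)[OF d(2), of D], of 2] by simp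
  ultimately show "4 * d ^ 3 + 4 * \<bar>D\<bar> ^ 3 + d^2 + d * \<bar>D\<bar> \<le> ito_error \<theta> d D"
   unfolding ito_error_def by (intro add_mono order_refl)
 qed (use K L in auto)
 finally show ?thesis .
qed

context brownian_filtration
begin

lemma simple_process_bounded:
 assumes "simple S"
 shows "\<exists>L. \<forall>s. \<forall>w\<in>space M. \<bar>SP S s w\<bar> \<le> L"
 using assms
proof (induction S)
 case (Cons p S)
 obtain u v \<xi> where p: "p = (u, v, \<xi>)" by (cases p)
 with Cons.prems obtain K where K: "\<And>w. w \<in> space M ==> \<bar>\<xi> w\<bar> \<le> K" and S: "simple S"
  by (auto simp: simple_integrand_def)
 obtain L where L: "\<And>s w. w \<in> space M ==> \<bar>SP S s w\<bar> \<le> L" using Cons.IH[OF S] by blast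
 have "\<bar>SP (p # S) s w\<bar> \<le> K + L" if "w \<in> space M" for s w
 proof -
  have "\<bar>\<xi> w * indicator {u<..v} s\<bar> \<le> K" using K[OF that] by (auto simp: indicator_def)
  thus ?thesis using L[OF that, of s] by (simp add: simple_process_def p)
 qed
 thus ?case by blast
qed (auto simp: simple_process_def)

lemma int_square_simple_finite:
 assumes "simple S"
 shows "energy (SP S) w < \<infinity>"
proof -
 obtain N t c where g: "grid T N t" and eq: "\<forall>s w. SP S s w = SP (step_list N t c) s w"
  using simple_integrand_grid[OF assms(1), of "{}" 1] by auto
 have "SP S = SP (step_list N t c)" using eq by blast
 thus ?thesis using int_square_step_list[OF g, of c w] by simp
qed

lemma has_ito_integral_simple:
 assumes S: "simple S"
 shows "\<exists>I. ito_integral (SP S) I \<and> (AE w in M. \<forall>t\<in>{0..T}. I t w = SI S t w)"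
proof -
 have "null_in_prob M (%n. gap S (SP S))"
  by (rule null_in_prob_AE[OF int_square_diff_measurable[OF S simple_process_progressive[OF S]]]) (auto simp: int_square_def)
 from has_ito_integral_simple_limit[OF S simple_process_progressive[OF S] _ this] int_square_simple_finite[OF S]
 obtain I where I: "ito_integral (SP S) I" "AE w in M. \<forall>t\<in>{0..T}. (%n::nat. SI S t w) ~> I t w" by auto
 from I(2) have "AE w in M. \<forall>t\<in>{0..T}. I t w = SI S t w" by eventually_elim (simp add: LIMSEQ_const_iff)
 with I(1) show ?thesis by blast
qed

text \<open>The weights \<open>g i\<close> are known before the cell, and the squared increment
  minus its length is centred, independent of the past and of variance twice the squared length. The
  summands are therefore orthogonal, and the second moment is of the order of the mesh.\<close>

lemma quadratic_variation_error:
 assumes s: "\<And>i. i \<le> N ==> s i \<in> {0..T}" "\<And>i. i < N ==> s i \<le> s (Suc i)"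
  and g: "\<And>i. i < N ==> g i \<in> borel_measurable (F (s i))" "\<And>i w. i < N ==> w \<in> space M ==> \<bar>g i w\<bar> \<le> G"
  and k: "k \<le> N"
 defines "Q \<equiv> %k w. \<Sum>i<k. g i w * ((B (s (Suc i)) w - B (s i) w)^2 - (s (Suc i) - s i))"
 shows "Q k \<in> borel_measurable (F (s k)) \<and> integrable M (%w. (Q k w)^2) \<and>
  expectation (%w. (Q k w)^2) \<le> (\<Sum>i<k. G^2 * (2 * (s (Suc i) - s i)^2))"
 using k
proof (induction k)
 case 0
 thus ?case by (simp add: Q_def)
next
 case (Suc k)
 let ?D = "%w. B (s (Suc k)) w - B (s k) w" and ?d = "s (Suc k) - s k"
 let ?\<phi> = "%x. x^2 - ?d"
 have r: "0 \<le> s k" "s k \<le> s (Suc k)" "s (Suc k) \<le> T" "s k \<in> {0..T}" "s (Suc k) \<in> {0..T}"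
  using s(1)[of k] s(1)[of "Suc k"] s(2)[of k] Suc.prems by auto
 have IH: "Q k \<in> borel_measurable (F (s k))" "integrable M (%w. (Q k w)^2)"
  "expectation (%w. (Q k w)^2) \<le> (\<Sum>i<k. G^2 * (2 * (s (Suc i) - s i)^2))" using Suc by auto
 have gm: "g k \<in> borel_measurable (F (s k))" and gb: "\<And>w. w \<in> space M ==> \<bar>g k w\<bar> \<le> G"
  using g Suc.prems by auto
 have QM: "Q k \<in> borel_measurable M" using measurable_F_M[OF r(4) IH(1)] .
 have iQ: "integrable M (Q k)" by (rule square_integrable_imp_integrable[OF QM IH(2)])
 have iQg: "integrable M (%w. Q k w * g k w)" by (rule integrable_mult_bounded[OF iQ measurable_F_M[OF r(4) gm] gb])
 have Qgm: "(%w. Q k w * g k w) \<in> borel_measurable (F (s k))" using IH(1) gm by (rule borel_measurable_times)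
 note iD = B_increment_integrable[OF r(1-3)] and E = B_increment_moments[OF r(1-3)]
 have i\<phi>: "integrable M (%w. ?\<phi> (?D w))" using iD[of 2] by simp
 have E\<phi>: "expectation (%w. ?\<phi> (?D w)) = 0" using iD[of 2] E(2) by (simp add: prob_space)
 have sq: "(?\<phi> x)^2 = x ^ 4 - 2 * ?d * x^2 + ?d^2" for x :: real
  by (simp add: power2_diff power4_eq_xxxx power2_eq_square algebra_simps)
 have i\<phi>2: "integrable M (%w. (?\<phi> (?D w))^2)" unfolding sq using iD[of 2] iD[of 4] by simp
 have E\<phi>2: "expectation (%w. (?\<phi> (?D w))^2) = 2 * ?d^2"
  unfolding sq using iD[of 2] iD[of 4] E by (simp add: prob_space power2_eq_square)
 have cross: "integrable M (%w. Q k w * g k w * ?\<phi> (?D w))" "expectation (%w. Q k w * g k w * ?\<phi> (?D w)) = 0"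
  using increment_indep_integral[OF r(1-3) Qgm iQg, of ?\<phi>] i\<phi> E\<phi> by auto
 have g2m: "(%w. (g k w)^2) \<in> borel_measurable (F (s k))" using gm by (rule borel_measurable_power)
 have g2b: "(g k w)^2 \<le> G^2" if "w \<in> space M" for w
  using power_mono[OF gb[OF that], of 2] by simp
 have ig2: "integrable M (%w. (g k w)^2)" by (rule integrable_bounded_F[OF r(4) g2m, of "G^2"]) (use g2b in simp)
 have sqg: "integrable M (%w. (g k w)^2 * (?\<phi> (?D w))^2)"
  "expectation (%w. (g k w)^2 * (?\<phi> (?D w))^2) = expectation (%w. (g k w)^2) * (2 * ?d^2)"
  using increment_indep_integral[OF r(1-3) g2m ig2, of "%x. (?\<phi> x)^2"] i\<phi>2 E\<phi>2 by auto
 have "expectation (%w. (g k w)^2) \<le> expectation (%w. G^2)"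
  using ig2 g2b by (intro integral_mono) auto
 hence Eg: "expectation (%w. (g k w)^2) * (2 * ?d^2) \<le> G^2 * (2 * ?d^2)"
  by (intro mult_right_mono) (auto simp: prob_space)
 have Q_Suc: "Q (Suc k) = (%w. Q k w + g k w * ?\<phi> (?D w))" by (simp add: Q_def)
 have exp: "(Q (Suc k) w)^2 = (Q k w)^2 + (2 * (Q k w * g k w * ?\<phi> (?D w)) + (g k w)^2 * (?\<phi> (?D w))^2)" for w
  unfolding Q_Suc by (simp add: power2_sum power_mult_distrib)
 have "Q k \<in> borel_measurable (F (s (Suc k)))" "g k \<in> borel_measurable (F (s (Suc k)))" "B (s k) \<in> borel_measurable (F (s (Suc k)))"
  using IH(1) gm B_adapted[OF r(4)] by (auto intro!: measurable_F_mono[OF r(1-3)])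
 hence "Q (Suc k) \<in> borel_measurable (F (s (Suc k)))" unfolding Q_Suc using B_adapted[OF r(5)]
  by (intro borel_measurable_add borel_measurable_times borel_measurable_diff borel_measurable_power borel_measurable_const)
 thus ?case unfolding exp using IH cross sqg Eg by simp
qed

lemma ito_error_integral:
 assumes "0 \<le> s" "s \<le> t" "t \<le> T" and \<theta>: "0 < \<theta>" "\<theta> \<le> 1" "t - s \<le> \<theta>^2"
 shows "integrable M (%w. ito_error \<theta> (t - s) (B t w - B s w))"
  and "expectation (%w. ito_error \<theta> (t - s) (B t w - B s w)) \<le> 15 * (\<theta> * (t - s))"
proof -
 define d where "d = t - s"
 note iD = B_increment_integrable[OF assms(1-3)] and E = B_increment_moments[OF assms(1-3), folded d_def]
 have d: "0 \<le> d" "d \<le> \<theta>^2" using assms by (auto simp: d_def)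
 have th: "\<theta>^2 \<le> \<theta>" using \<theta> by (simp add: power2_eq_square mult_left_le)
 show i: "integrable M (%w. ito_error \<theta> (t - s) (B t w - B s w))"
  unfolding ito_error_def using iD[of 2] iD[of 4] by simp
 have "expectation (%w. ito_error \<theta> d (B t w - B s w)) =
   4 * d ^ 3 + 2 * (\<theta> * d + 3 * d^2 / \<theta>) + d^2 + d * (\<theta> + d / \<theta>)"
  unfolding ito_error_def using iD[of 2] iD[of 4] E by (simp add: prob_space)
 \<comment> \<open>By \<open>d \<le> \<theta>^2\<close> every summand is at most a multiple of
   \<open>\<theta> * d\<close>; the four groups contribute 4, 8, 1 and 2.\<close>
 also have "\<dots> \<le> 15 * (\<theta> * d)"
 proof -
  have "d * d \<le> \<theta>^2 * d" using d by (intro mult_right_mono) auto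
  hence 1: "d^2 / \<theta> \<le> \<theta> * d" using \<theta> by (simp add: power2_eq_square divide_le_eq mult.commute mult.left_commute)
  have "d \<le> 1" using d th \<theta> by linarith
  have 2: "d^2 \<le> \<theta> * d" using d th by (simp add: power2_eq_square mult_right_mono)
  have 3: "d ^ 3 \<le> \<theta> * d"
  proof -
   have "d ^ 3 \<le> d^2" using d \<open>d \<le> 1\<close> by (intro power_decreasing) auto
   thus ?thesis using 2 by simp
  qed
  have "d * (\<theta> + d / \<theta>) = \<theta> * d + d^2 / \<theta>" by (simp add: power2_eq_square algebra_simps)
  moreover have "3 * d^2 / \<theta> = 3 * (d^2 / \<theta>)" by simp
  ultimately show ?thesis using 1 2 3 by (simp only: distrib_left)
 qed
 finally show "expectation (%w. ito_error \<theta> (t - s) (B t w - B s w)) \<le> 15 * (\<theta> * (t - s))"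
  unfolding d_def .
qed

end

text \<open>The left end point of the half-open cell containing \<open>s\<close>. At 0, which lies
  in no cell of a grid, the empty contribution is the correct value 0.\<close>

definition grid_floor :: "nat => (nat => real) => real => real" where
 "grid_floor N t s = (\<Sum>i<N. t i * indicator {t i<..t (Suc i)} s)"

lemma grid_floor_cell:
 "grid T N t ==> k < N ==> s \<in> {t k<..t (Suc k)} ==> grid_floor N t s = t k"
 unfolding grid_floor_def by (rule grid_indicator_sum)

lemma grid_floor_zero:
 assumes "grid T N t"
 shows "grid_floor N t 0 = 0"
 unfolding grid_floor_def using grid_range[OF assms] by (intro sum.neutral) (auto simp: indicator_def not_less)

lemma grid_floor_measurable [measurable]: "grid_floor N t \<in> borel_measurable borel"
 unfolding grid_floor_def by (intro borel_measurable_sum borel_measurable_times borel_measurable_indicator) auto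

lemma grid_floor_close:
 assumes g: "grid T N t" and mesh: "\<And>i. i < N ==> t (Suc i) - t i \<le> \<delta>" "0 \<le> \<delta>" and s: "s \<in> {0..T}"
 shows "grid_floor N t s \<in> {0..s}" "s - grid_floor N t s \<le> \<delta>"
proof -
 have "grid_floor N t s \<in> {0..s} \<and> s - grid_floor N t s \<le> \<delta>"
 proof (cases "s = 0")
  case True
  thus ?thesis using grid_floor_zero[OF g] mesh by simp
 next
  case False
  hence "0 < s" "s \<le> T" using s by auto
  then obtain k where k: "k < N" "s \<in> {t k<..t (Suc k)}" using grid_cell[OF g] by blast
  have "0 \<le> t k" using grid_range[OF g, of k] k by auto
  thus ?thesis using k mesh(1)[OF k(1)] grid_floor_cell[OF g k] by auto
 qed
 thus "grid_floor N t s \<in> {0..s}" "s - grid_floor N t s \<le> \<delta>" by auto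
qed

lemma continuous_path_measurable:
 assumes "continuous_on {0..T} (x :: real => real)"
 shows "x \<in> borel_measurable (leb T)"
proof -
 have "x \<in> borel_measurable (restrict_space borel {0..T})" by (rule borel_measurable_continuous_on_restrict[OF assms])
 moreover have "sets (restrict_space borel {0..T}) = sets (leb T)" by (simp add: sets_restrict_space)
 ultimately show ?thesis using measurable_cong_sets by blast
qed

section \<open>Ito's formula for bounded drift, simple diffusion and bounded derivatives\<close>

context brownian_filtration
begin

context
 fixes S :: "'a simple_integrand" and a X :: "real => 'a => real" and f f1 f2 :: "real => real" and K L :: real
 assumes S: "simple S" and a: "prog a" and X: "prog X"
  and aL: "\<And>s w. \<bar>a s w\<bar> \<le> L" and SL: "\<And>s w. w \<in> space M ==> \<bar>SP S s w\<bar> \<le> L" and L: "1 \<le> L"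
  and f: "\<And>x. (f has_real_derivative f1 x) (at x)" "\<And>x. (f1 has_real_derivative f2 x) (at x)"
  and f1K: "\<And>x. \<bar>f1 x\<bar> \<le> K" and f2K: "\<And>x. \<bar>f2 x\<bar> \<le> K" and f2lip: "\<And>x y. \<bar>f2 x - f2 y\<bar> \<le> K * \<bar>x - y\<bar>"
  and X_eq: "AE w in M. \<forall>t\<in>{0..T}. X t w = X 0 w + (LBINT s:{0..t}. a s w) + SI S t w"
begin

lemma K_nonneg: "0 \<le> K"
 using f1K[of 0] by linarith

lemma f_measurable: "f1 \<in> borel_measurable borel" "f2 \<in> borel_measurable borel"
proof -
 have "continuous_on UNIV f1" using f(2) by (meson DERIV_continuous continuous_at_imp_continuous_on)
 thus "f1 \<in> borel_measurable borel" by (rule borel_measurable_continuous_onI)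
 have "K-lipschitz_on UNIV f2" by (rule lipschitz_onI) (use f2lip K_nonneg in \<open>auto simp: dist_real_def\<close>)
 thus "f2 \<in> borel_measurable borel" by (intro borel_measurable_continuous_onI lipschitz_on_continuous_on)
qed

lemma f2_cont: "isCont f2 x"
proof -
 have "K-lipschitz_on UNIV f2" by (rule lipschitz_onI) (use f2lip K_nonneg in \<open>auto simp: dist_real_def\<close>)
 thus ?thesis using lipschitz_on_continuous_on continuous_on_eq_continuous_at[of UNIV f2] by auto
qed

lemma a_integrable: "w \<in> space M ==> integrable (leb T) (%s. a s w)"
 by (rule integrable_bounded_time[OF progressive_path_time[OF a]]) (use aL in auto)

lemma X_cont: "AE w in M. continuous_on {0..T} (%t. X t w)"
 using X_eq B_cont AE_space
proof eventually_elim
 case (elim w)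
 have "continuous_on {0..T} (%t. X 0 w + (LBINT s:{0..t}. a s w) + SI S t w)"
  by (intro continuous_on_add continuous_on_const indefinite_integral_continuous_time a_integrable[OF elim(3)]
    simple_integral_continuous[of T B w F S] elim(2) S)
 thus ?case using elim(1) continuous_on_cong[of "{0..T}" "{0..T}" "%t. X t w"
   "%t. X 0 w + (LBINT s:{0..t}. a s w) + SI S t w"] by blast
qed

context
 fixes N t c \<theta> r
 assumes g: "grid T N t" and mesh: "\<And>i. i < N ==> t (Suc i) - t i \<le> \<theta>^2" and \<theta>: "0 < \<theta>" "\<theta> \<le> 1"
  and c: "adapted_coeffs N t c" and r: "r \<in> {0..T}"
  and eq: "\<forall>s w. SP S s w = SP (step_list N t c) s w"
   "\<forall>s w. SI S s w = SI (step_list N t c) s w"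
begin

lemma coeff_eq: "i < N ==> s \<in> {t i<..t (Suc i)} ==> c i w = SP S s w"
 using eq(1) grid_indicator_sum[OF g, of i s "%i. c i w"] by (simp add: simple_process_step_list)

lemma coeff_bound: "i < N ==> w \<in> space M ==> \<bar>c i w\<bar> \<le> L"
 using coeff_eq[of i "t (Suc i)" w] SL g by (simp add: grid_def)

lemma frozen_simple:
 "simple (step_list N t (%i w. f1 (X (t i) w) * c i w))"
proof (rule simple_integrand_step_list[OF g], unfold adapted_coeffs_def, intro allI impI conjI)
 fix i assume i: "i < N"
 have ti: "t i \<in> {0..T}" using grid_range[OF g, of i] i by auto
 have "c i \<in> borel_measurable (F (t i))" using c i by (simp add: adapted_coeffs_def)
 thus "(%w. f1 (X (t i) w) * c i w) \<in> borel_measurable (F (t i))"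
  using measurable_compose[OF progressive_section[OF X ti] f_measurable(1)] by (rule borel_measurable_times[rotated])
 show "\<exists>K. \<forall>w\<in>space M. \<bar>f1 (X (t i) w) * c i w\<bar> \<le> K"
  using f1K coeff_bound[OF i] K_nonneg by (intro exI[of _ "K * L"] ballI) (simp add: abs_mult mult_mono)
qed

lemma frozen_process:
 assumes "s \<in> {0..T}"
 shows "SP (step_list N t (%i w. f1 (X (t i) w) * c i w)) s w =
  f1 (X (grid_floor N t s) w) * SP S s w"
proof (cases "s = 0")
 case True
 have "SP (step_list N t c') 0 w = 0" for c' unfolding simple_process_step_list using grid_range[OF g]
  by (intro sum.neutral) (auto simp: indicator_def not_less)
 thus ?thesis using True eq(1) by simp
next
 case False
 hence "0 < s" "s \<le> T" using assms by auto
 then obtain k where k: "k < N" "s \<in> {t k<..t (Suc k)}" using grid_cell[OF g] by blast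
 thus ?thesis
  using grid_indicator_sum[OF g k, of "%i. f1 (X (t i) w) * c i w"] coeff_eq[OF k] grid_floor_cell[OF g k]
  by (simp add: simple_process_step_list)
qed

text \<open>The grid frozen at \<open>r\<close>: cells beyond \<open>r\<close> become empty, so sums
  over all cells describe the process up to \<open>r\<close>, which need not be a grid
  point.\<close>

definition cut :: "nat => real" where
 "cut i = min (t i) r"

abbreviation "len i \<equiv> cut (Suc i) - cut i"

abbreviation "cell i \<equiv> {cut i<..cut (Suc i)}"

lemma clipped_range: "i \<le> N ==> cut i \<in> {0..T}"
 using grid_range[OF g, of i] r by (auto simp: cut_def)

lemma clipped_mono: "i < N ==> cut i \<le> cut (Suc i)"
 using grid_le[OF g, of i "Suc i"] by (auto simp: cut_def)

lemma clipped_mesh: "i < N ==> len i \<le> \<theta>^2"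
 using mesh[of i] grid_le[OF g, of i "Suc i"] by (auto simp: cut_def min_def)

lemma clipped_ends: "cut 0 = 0" "cut N = r"
 using g r by (auto simp: cut_def grid_def)

lemma clipped_total: "(\<Sum>i<N. len i) \<le> T"
 using sum_lessThan_telescope[of cut N] clipped_ends r by simp

lemma clipped_drift:
 assumes "i < N" "w \<in> space M"
 shows "(LBINT s:{0..cut (Suc i)}. a s w) - (LBINT s:{0..cut i}. a s w) =
   (\<integral>s. indicator (cell i) s * a s w \<partial>leb T)"
  and "\<bar>\<integral>s. indicator (cell i) s * a s w \<partial>leb T\<bar> \<le> L * len i"
proof -
 note r = clipped_range[of i] clipped_range[of "Suc i"] clipped_mono[OF assms(1)]
 note int = integrable_indicator_mult_time[OF a_integrable[OF assms(2)]]
 have "(\<integral>s. indicator {0..cut (Suc i)} s * a s w \<partial>leb T) - (\<integral>s. indicator {0..cut i} s * a s w \<partial>leb T) =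
   (\<integral>s. indicator {0..cut (Suc i)} s * a s w - indicator {0..cut i} s * a s w \<partial>leb T)"
  by (rule Bochner_Integration.integral_diff[symmetric]) (auto intro!: int)
 also have "\<dots> = (\<integral>s. indicator (cell i) s * a s w \<partial>leb T)"
  using r assms by (intro Bochner_Integration.integral_cong) (auto simp: indicator_def)
 finally show "(LBINT s:{0..cut (Suc i)}. a s w) - (LBINT s:{0..cut i}. a s w) =
   (\<integral>s. indicator (cell i) s * a s w \<partial>leb T)"
  using r assms by (simp add: set_lebesgue_integral_leb[of _ T])
 have "\<bar>\<integral>s. indicator (cell i) s * a s w \<partial>leb T\<bar> \<le>
   (\<integral>s. L * indicator (cell i) s \<partial>leb T)"
 proof (rule integral_abs_bound_integral)
  show "integrable (leb T) (%s. indicator (cell i) s * a s w)" by (rule int) simp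
  show "integrable (leb T) (%s. L * indicator (cell i) s)"
   using L by (intro integrable_bounded_time[where K = L] borel_measurable_times measurable_restrict_space1) (auto simp: indicator_def)
  show "\<bar>indicator (cell i) s * a s w\<bar> \<le> L * indicator (cell i) s" for s
   using aL[of s w] by (simp add: indicator_def)
 qed
 also have "\<dots> = L * len i"
  using r assms by (simp add: measure_time_cell del: Bochner_Integration.integral_indicator)
 finally show "\<bar>\<integral>s. indicator (cell i) s * a s w \<partial>leb T\<bar> \<le> L * len i" .
qed

abbreviation "frozen s w \<equiv> indicator {0..r} s * (f1 (X (grid_floor N t s) w) * a s w + f2 (X (grid_floor N t s) w) * (SP S s w)^2 / 2)"

abbreviation "drift_step i w \<equiv> \<integral>s. indicator (cell i) s * a s w \<partial>leb T"

abbreviation "noise_step i w \<equiv> B (cut (Suc i)) w - B (cut i) w"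

lemma frozen_drift:
 assumes w: "w \<in> space M" and cont: "continuous_on {0..T} (%t. X t w)"
 shows "(\<integral>s. frozen s w \<partial>leb T) =
  (\<Sum>i<N. f1 (X (cut i) w) * drift_step i w +
   f2 (X (cut i) w) * (c i w)^2 * len i / 2)"
proof -
 let ?x = "%i s. f1 (X (cut i) w) * (indicator (cell i) s * a s w) + f2 (X (cut i) w) * (c i w)^2 / 2 * indicator (cell i) s"
 have intI: "integrable (leb T) (indicat_real (cell i))" for i
  by (intro integrable_bounded_time[where K = 1] measurable_restrict_space1) (auto simp: indicator_def)
 note int = integrable_indicator_mult_time[OF a_integrable[OF w]]
 have pt: "frozen s w = (\<Sum>i<N. ?x i s)" if s: "0 < s" "s \<le> T" for s
 proof -
  obtain k where k: "k < N" "s \<in> {t k<..t (Suc k)}" using grid_cell[OF g s] by blast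
  have ind: "indicat_real (cell i) s = indicator {..r} s * indicator {t i<..t (Suc i)} s" for i
   by (auto simp: cut_def indicator_def)
  have "(\<Sum>i<N. ?x i s) = (f1 (X (cut k) w) * a s w + f2 (X (cut k) w) * (c k w)^2 / 2) * indicator {..r} s"
   unfolding grid_indicator_sum[OF g k, of "%i. (f1 (X (cut i) w) * a s w + f2 (X (cut i) w) * (c i w)^2 / 2) * indicator {..r} s", symmetric]
   by (rule sum.cong[OF refl]) (simp add: ind algebra_simps)
  also have "\<dots> = frozen s w"
  proof (cases "s \<le> r")
   case True
   hence "cut k = t k" using k by (auto simp: cut_def)
   thus ?thesis using True s grid_floor_cell[OF g k] coeff_eq[OF k, of w] by simp
  qed simp
  finally show ?thesis by simp
 qed
 have intx: "integrable (leb T) (?x i)" for i by (intro Bochner_Integration.integrable_add integrable_mult_right int intI) simp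
 have fl: "(%s. X (grid_floor N t s) w) \<in> borel_measurable (leb T)"
 proof (rule measurable_compose[OF _ continuous_path_measurable[OF cont]])
  have "grid_floor N t s \<in> {0..T}" if "s \<in> {0..T}" for s
   using grid_floor_close(1)[OF g mesh _ that] that by auto
  thus "grid_floor N t \<in> leb T \<rightarrow>\<^sub>M leb T" by (intro measurable_restrict_space3) (simp_all only: Pi_iff, simp_all)
 qed
 have "(\<integral>s. frozen s w \<partial>leb T) = (\<integral>s. (\<Sum>i<N. ?x i s) \<partial>leb T)"
 proof (rule integral_cong_AE)
  show "(%s. \<Sum>i<N. ?x i s) \<in> borel_measurable (leb T)" by (intro borel_measurable_integrable Bochner_Integration.integrable_sum intx)
  show "(%s. frozen s w) \<in> borel_measurable (leb T)"
   by (intro borel_measurable_times borel_measurable_add borel_measurable_divide borel_measurable_power borel_measurable_const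
     measurable_compose[OF fl f_measurable(1)] measurable_compose[OF fl f_measurable(2)] simple_process_path_time
     progressive_path_time[OF a w] measurable_restrict_space1[of "indicat_real {0..r}"]) simp
  have "AE s in lborel. s \<in> {0..T} \<longrightarrow> frozen s w = (\<Sum>i<N. ?x i s)"
   using AE_lborel_singleton[of 0] by eventually_elim (use pt in auto)
  thus "AE s in leb T. frozen s w = (\<Sum>i<N. ?x i s)"
   by (subst AE_restrict_space_iff) auto
 qed
 also have "\<dots> = (\<Sum>i<N. \<integral>s. ?x i s \<partial>leb T)" by (intro Bochner_Integration.integral_sum intx)
 also have "\<dots> = (\<Sum>i<N. f1 (X (cut i) w) * drift_step i w +
   f2 (X (cut i) w) * (c i w)^2 * len i / 2)"
 proof (rule sum.cong[OF refl])
  fix i assume i: "i \<in> {..<N}"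
  have "(\<integral>s. indicator (cell i) s \<partial>leb T) = len i"
   using i clipped_range[of i] clipped_range[of "Suc i"] clipped_mono[of i] by (intro measure_time_cell) auto
  moreover have "(\<integral>s. ?x i s \<partial>leb T) = f1 (X (cut i) w) * drift_step i w +
    f2 (X (cut i) w) * (c i w)^2 / 2 * (\<integral>s. indicator (cell i) s \<partial>leb T)"
   using int intI by (subst Bochner_Integration.integral_add) (auto intro!: integrable_mult_right simp del: Bochner_Integration.integral_indicator)
  ultimately show "(\<integral>s. ?x i s \<partial>leb T) = f1 (X (cut i) w) * drift_step i w +
   f2 (X (cut i) w) * (c i w)^2 * len i / 2" by simp
 qed
 finally show ?thesis .
qed

text \<open>The cellwise Taylor expansions are summed. Their remainders have total mean of order
  \<open>\<theta>\<close>; the quadratic fluctuation \<open>Q\<close> has second moment of order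
  \<open>\<theta>^2\<close>, and \<open>\<bar>Q\<bar> \<le> \<theta> + Q^2 / \<theta>\<close> turns
  this into a mean of order \<open>\<theta>\<close>.\<close>

lemma ito_step_error:
 "\<exists>R. integrable M R \<and> expectation R \<le> (15 * (K * L ^ 3) * T + 1 + 2 * (K * L^2)^2 * T) * \<theta> \<and>
  (AE w in M. \<bar>f (X r w) - f (X 0 w) -
   (\<integral>s. frozen s w \<partial>leb T) -
   SI (step_list N t (%i w. f1 (X (t i) w) * c i w)) r w\<bar> \<le> R w)"
proof -
 \<comment> \<open>On a cell starting after \<open>r\<close> the coefficient \<open>c i\<close> need
   not be known at \<open>cut i = r\<close>. As the increment there is 0, the coefficient can be
   replaced by 0.\<close>
 define e where "e i = (if t i \<le> r then c i else (%w. 0))" for i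
 have e_noise: "e i w * noise_step i w = c i w * noise_step i w" "(e i w)^2 * len i = (c i w)^2 * len i"
  if "i < N" for i w
  using that grid_le[OF g, of i "Suc i"] by (auto simp: e_def cut_def min_def)
 define G where "G i w = f2 (X (cut i) w) * (e i w)^2 / 2" for i w
 define Q where "Q w = (\<Sum>i<N. G i w * ((noise_step i w)^2 - len i))" for w
 have eL: "\<bar>e i w\<bar> \<le> L" if "i < N" "w \<in> space M" for i w
  using coeff_bound[OF that] L by (simp add: e_def)
 have G_meas: "G i \<in> borel_measurable (F (cut i))" if "i < N" for i
 proof -
  have "e i \<in> borel_measurable (F (cut i))"
   using c that by (auto simp: e_def adapted_coeffs_def cut_def)
  moreover have "X (cut i) \<in> borel_measurable (F (cut i))"
   using that by (intro progressive_section[OF X] clipped_range) simp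
  ultimately show ?thesis
   unfolding G_def by (intro borel_measurable_divide borel_measurable_times borel_measurable_power borel_measurable_const
     measurable_compose[OF _ f_measurable(2)])
 qed
 have G_bound: "\<bar>G i w\<bar> \<le> K * L^2" if "i < N" "w \<in> space M" for i w
 proof -
  have "(e i w)^2 \<le> L^2" using power_mono[OF eL[OF that], of 2] by simp
  hence "\<bar>f2 (X (cut i) w)\<bar> * (e i w)^2 \<le> K * L^2" using f2K K_nonneg by (intro mult_mono) auto
  moreover have "0 \<le> K * L^2" using K_nonneg by simp
  ultimately show ?thesis unfolding G_def by (simp add: abs_mult)
 qed
 have Q2: "integrable M (%w. (Q w)^2)" "expectation (%w. (Q w)^2) \<le> (\<Sum>i<N. (K * L^2)^2 * (2 * (len i)^2))"
  using quadratic_variation_error[of N cut G "K * L^2" N, OF clipped_range clipped_mono G_meas G_bound]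
  unfolding Q_def by auto
 have d: "0 \<le> len i" "len i \<le> \<theta>^2" if "i < N" for i
  using clipped_mono[OF that] clipped_mesh[OF that] by auto
 have EQ: "expectation (%w. (Q w)^2) \<le> (K * L^2)^2 * (2 * (\<theta>^2 * T))"
 proof -
  have "(\<Sum>i<N. (len i)^2) \<le> (\<Sum>i<N. \<theta>^2 * len i)"
   using d by (intro sum_mono) (simp add: power2_eq_square[of "cut _ - cut _"] mult_right_mono)
  also have "\<dots> \<le> \<theta>^2 * T"
   unfolding sum_distrib_left[symmetric] using clipped_total by (intro mult_left_mono) auto
  finally have "(K * L^2)^2 * (2 * (\<Sum>i<N. (len i)^2)) \<le> (K * L^2)^2 * (2 * (\<theta>^2 * T))"
   by (intro mult_left_mono) auto
  with Q2(2) show ?thesis by (simp add: sum_distrib_left)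
 qed
 define P where "P w = (\<Sum>i<N. K * L ^ 3 * ito_error \<theta> (len i) (noise_step i w))" for w
 have err_i: "integrable M (%w. ito_error \<theta> (len i) (noise_step i w))"
  "expectation (%w. ito_error \<theta> (len i) (noise_step i w)) \<le> 15 * (\<theta> * len i)" if "i < N" for i
 proof -
  have "0 \<le> cut i" "cut (Suc i) \<le> T" using clipped_range[of i] clipped_range[of "Suc i"] that by auto
  note ito_error_integral[OF this(1) clipped_mono[OF that] this(2) \<theta> d(2)[OF that]]
  thus "integrable M (%w. ito_error \<theta> (len i) (noise_step i w))"
   "expectation (%w. ito_error \<theta> (len i) (noise_step i w)) \<le> 15 * (\<theta> * len i)"
   by blast+
 qed
 have KL: "0 \<le> K * L ^ 3" using K_nonneg L by simp
 have P: "integrable M P" unfolding P_def using err_i(1) by (intro Bochner_Integration.integrable_sum integrable_mult_right) auto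
 have EP: "expectation P \<le> 15 * (K * L ^ 3) * T * \<theta>"
 proof -
  have "expectation P = (\<Sum>i<N. K * L ^ 3 * expectation (%w. ito_error \<theta> (len i) (noise_step i w)))"
   unfolding P_def using err_i(1) by (subst Bochner_Integration.integral_sum) (simp_all only: lessThan_iff integrable_mult_right integral_mult_right_zero)
  also have "\<dots> \<le> (\<Sum>i<N. K * L ^ 3 * (15 * (\<theta> * len i)))"
   using err_i(2) KL by (intro sum_mono mult_left_mono) auto
  also have "\<dots> = K * L ^ 3 * (15 * (\<theta> * (\<Sum>i<N. len i)))" by (simp only: sum_distrib_left)
  also have "\<dots> \<le> K * L ^ 3 * (15 * (\<theta> * T))"
   using KL \<theta> clipped_total by (intro mult_left_mono) auto
  also have "\<dots> = 15 * (K * L ^ 3) * T * \<theta>" by (simp only: mult_ac)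
  finally show ?thesis .
 qed
 define R where "R w = P w + (\<theta> + (Q w)^2 / \<theta>)" for w
 have "integrable M R" unfolding R_def using P Q2 by (intro Bochner_Integration.integrable_add integrable_divide_zero) auto
 moreover have "expectation R \<le> (15 * (K * L ^ 3) * T + 1 + 2 * (K * L^2)^2 * T) * \<theta>"
 proof -
  have "expectation R = expectation P + (\<theta> + expectation (%w. (Q w)^2) / \<theta>)"
   unfolding R_def using P Q2 by (simp add: prob_space)
  also have "expectation (%w. (Q w)^2) / \<theta> \<le> ((K * L^2)^2 * (2 * (\<theta>^2 * T))) / \<theta>"
   using EQ \<theta> by (intro divide_right_mono) auto
  also have "\<dots> = 2 * (K * L^2)^2 * T * \<theta>" using \<theta> by (simp add: power2_eq_square[of \<theta>])
  finally have "expectation R \<le> 15 * (K * L ^ 3) * T * \<theta> + (\<theta> + 2 * (K * L^2)^2 * T * \<theta>)"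
   using EP by simp
  thus ?thesis by (simp only: distrib_right mult_1_left add.assoc)
 qed
 moreover have "AE w in M. \<bar>f (X r w) - f (X 0 w) -
   (\<integral>s. frozen s w \<partial>leb T) -
   SI (step_list N t (%i w. f1 (X (t i) w) * c i w)) r w\<bar> \<le> R w"
  using X_eq B_cont AE_space X_cont
 proof eventually_elim
  case (elim w)
  note w = elim(3)
  note cont = elim(4)
  have step: "X (cut (Suc i)) w = X (cut i) w + drift_step i w + e i w * noise_step i w" if i: "i < N" for i
  proof -
   have "SI S (cut (Suc i)) w - SI S (cut i) w = c i w * noise_step i w"
    using eq(2) simple_integral_clipped[OF g, of "Suc i" c r w] simple_integral_clipped[OF g, of i c r w] i by (simp add: cut_def)
   moreover have "X (cut i) w = X 0 w + (LBINT s:{0..cut i}. a s w) + SI S (cut i) w"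
    "X (cut (Suc i)) w = X 0 w + (LBINT s:{0..cut (Suc i)}. a s w) + SI S (cut (Suc i)) w"
    by (rule elim(1)[rule_format], rule clipped_range, use i in simp)+
   ultimately show ?thesis using clipped_drift(1)[OF i w] e_noise(1)[OF i, of w] by linarith
  qed
  have tele: "f (X r w) - f (X 0 w) = (\<Sum>i<N. f (X (cut (Suc i)) w) - f (X (cut i) w))"
   using sum_lessThan_telescope[of "%i. f (X (cut i) w)" N] clipped_ends by simp
  have noise: "SI (step_list N t (%i w. f1 (X (t i) w) * c i w)) r w =
    (\<Sum>i<N. f1 (X (cut i) w) * e i w * noise_step i w)"
   unfolding simple_integral_step_list
  proof (rule sum.cong[OF refl])
   fix i assume i: "i \<in> {..<N}"
   show "f1 (X (t i) w) * c i w * (B (min (t (Suc i)) r) w - B (min (t i) r) w) =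
     f1 (X (cut i) w) * e i w * noise_step i w"
   proof (cases "t i \<le> r")
    case True
    thus ?thesis by (simp add: e_def cut_def)
   next
    case False
    thus ?thesis using grid_le[OF g, of i "Suc i"] i by (simp add: e_def cut_def min_def)
   qed
  qed
  define E where "E i = f (X (cut (Suc i)) w) - f (X (cut i) w) -
    (f1 (X (cut i) w) * drift_step i w + f2 (X (cut i) w) * (e i w)^2 * len i / 2) -
    f1 (X (cut i) w) * e i w * noise_step i w - G i w * ((noise_step i w)^2 - len i)" for i
  have drift: "(\<Sum>i<N. f1 (X (cut i) w) * drift_step i w + f2 (X (cut i) w) * (c i w)^2 * len i / 2) =
    (\<Sum>i<N. f1 (X (cut i) w) * drift_step i w + f2 (X (cut i) w) * (e i w)^2 * len i / 2)"
   by (rule sum.cong[OF refl]) (simp only: mult.assoc e_noise(2) lessThan_iff)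
  have "f (X r w) - f (X 0 w) -
   (\<integral>s. frozen s w \<partial>leb T) -
   SI (step_list N t (%i w. f1 (X (t i) w) * c i w)) r w = (\<Sum>i<N. E i) + Q w"
   unfolding frozen_drift[OF w cont] drift noise tele Q_def E_def by (simp add: sum_subtractf sum.distrib)
  moreover have "\<bar>\<Sum>i<N. E i\<bar> \<le> P w" unfolding P_def
  proof (rule order_trans[OF sum_abs sum_mono])
   fix i assume "i \<in> {..<N}"
   hence i: "i < N" by simp
   show "\<bar>E i\<bar> \<le> K * L ^ 3 * ito_error \<theta> (len i) (noise_step i w)"
    unfolding E_def G_def step[OF i]
    by (rule ito_remainder_bound[OF f f2lip K_nonneg f2K L clipped_drift(2)[OF i w] eL[OF i w] d(1)[OF i] \<theta>(1)])
  qed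
  moreover have "\<bar>Q w\<bar> \<le> \<theta> + (Q w)^2 / \<theta>"
   using abs_cube_le(2)[OF \<theta>(1), of "Q w"] by simp
  ultimately show ?case unfolding R_def by linarith
 qed
 ultimately show ?thesis by blast
qed

end

text \<open>With \<open>\<theta> = (1/4) ^ k\<close> the error has mean of order
  \<open>(1/4) ^ k\<close>, so by Markov's inequality it exceeds \<open>(1/2) ^ k\<close> with
  probability of order \<open>(1/2) ^ k\<close>, which is summable. The stochastic sums are
  integrals of simple integrands in which \<open>f1 (X)\<close> is frozen at grid points; these
  converge in energy to the integrand of the formula.\<close>

lemma ito_formula_simple:
 "ito_process (%t w. f (X t w)) (%s w. f1 (X s w) * a s w + f2 (X s w) * (SP S s w)^2 / 2)
  (%s w. f1 (X s w) * SP S s w)"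
proof -
 define P where "P k Z \<longleftrightarrow> (case Z of (N, t, c) => grid T N t \<and> (\<forall>i<N. t (Suc i) - t i \<le> ((1/4) ^ k)^2) \<and> adapted_coeffs N t c \<and>
  (\<forall>s w. SP S s w = SP (step_list N t c) s w) \<and>
  (\<forall>s w. SI S s w = SI (step_list N t c) s w))" for k :: nat and Z
 have "\<exists>Z. P k Z" for k
 proof -
  have "0 < ((1/4 :: real) ^ k)^2" by simp
  from simple_integrand_grid[OF S _ _ this, of "{}"] show ?thesis by (auto simp: P_def)
 qed
 then obtain Z where "\<And>k. P k (Z k)" by metis
 moreover define N t c where "N k = fst (Z k)" and "t k = fst (snd (Z k))" and "c k = snd (snd (Z k))" for k
 ultimately have g: "grid T (N k) (t k)" and mesh: "\<And>i. i < N k ==> t k (Suc i) - t k i \<le> ((1/4) ^ k)^2"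
  and c: "adapted_coeffs (N k) (t k) (c k)"
  and eq: "\<forall>s w. SP S s w = SP (step_list (N k) (t k) (c k)) s w"
   "\<forall>s w. SI S s w = SI (step_list (N k) (t k) (c k)) s w" for k
  by (simp_all add: P_def split_beta)
 have \<theta>: "0 < (1/4 :: real) ^ k" "(1/4 :: real) ^ k \<le> 1" for k by (simp_all add: power_le_one)
 define S' where "S' k = step_list (N k) (t k) (%i w. f1 (X (t k i) w) * c k i w)" for k
 define \<pi> where "\<pi> k = grid_floor (N k) (t k)" for k
 have S': "simple (S' k)" for k
  unfolding S'_def by (rule frozen_simple[where r = 0, OF g mesh \<theta> c _ eq]) (use T_pos in auto)
 have S'_path: "SP (S' k) s w = f1 (X (\<pi> k s) w) * SP S s w" if "s \<in> {0..T}" for k s w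
  unfolding S'_def \<pi>_def by (rule frozen_process[where r = 0, OF g mesh \<theta> c _ eq that]) (use T_pos in auto)
 have \<pi>: "\<pi> k s \<in> {0..T}" "s - \<pi> k s \<le> ((1/4) ^ k)^2" "\<pi> k s \<le> s" if "s \<in> {0..T}" for k s
  using grid_floor_close[OF g mesh _ that, of k] that by (auto simp: \<pi>_def)
 have \<pi>_lim: "(%k. \<pi> k s) ~> s" if "s \<in> {0..T}" for s
 proof -
  have "(%k. ((1/4 :: real) ^ k)^2) ~> 0^2" by (intro tendsto_power LIMSEQ_power_zero) simp
  hence lim: "(%k. s - ((1/4) ^ k)^2) ~> s - 0^2" by (intro tendsto_diff tendsto_const)
  show ?thesis
  proof (rule tendsto_sandwich[of "%k. s - ((1/4) ^ k)^2" _ _ "%_. s"])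
   show "\<forall>\<^sub>F k in sequentially. s - ((1/4) ^ k)^2 \<le> \<pi> k s"
    using \<pi>(2)[OF that] by (intro always_eventually allI) (simp add: diff_le_eq add.commute)
   show "\<forall>\<^sub>F k in sequentially. \<pi> k s \<le> s" using \<pi>(3)[OF that] by simp
  qed (use lim in auto)
 qed
 have f_cont: "continuous_on UNIV f" "continuous_on UNIV f1" "continuous_on UNIV f2"
  using f f2_cont DERIV_isCont by (blast intro: continuous_at_imp_continuous_on)+
 let ?D = "%s w. f1 (X s w) * a s w + f2 (X s w) * (SP S s w)^2 / 2"
 let ?J = "%k r w. \<integral>s. indicator {0..r} s * (f1 (X (\<pi> k s) w) * a s w + f2 (X (\<pi> k s) w) * (SP S s w)^2 / 2) \<partial>leb T"
 have path: "integrable (leb T) (%s. ?D s w) \<and> energy (%s w. f1 (X s w) * SP S s w) w < \<infinity> \<and>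
   (%k. energy (%s w. SP (S' k) s w - f1 (X s w) * SP S s w) w) ~> 0 \<and>
   (\<forall>r\<in>{0..T}. (%k. ?J k r w) ~> (LBINT s:{0..r}. ?D s w))"
  if w: "w \<in> space M" and cont: "continuous_on {0..T} (%t. X t w)" for w
 proof -
  let ?un = "%k s. f1 (X (\<pi> k s) w)" and ?vn = "%k s. f2 (X (\<pi> k s) w)" and ?h = "%s. SP S s w"
  have X_meas: "(%s. X s w) \<in> borel_measurable (leb T)" by (rule continuous_path_measurable[OF cont])
  have X\<pi>: "(%s. X (\<pi> k s) w) \<in> borel_measurable (leb T)" for k
  proof (rule measurable_compose[OF _ X_meas])
   show "\<pi> k \<in> leb T \<rightarrow>\<^sub>M leb T"
    using \<pi>(1) unfolding \<pi>_def by (intro measurable_restrict_space3) (simp_all only: Pi_iff, simp_all)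
  qed
  have Xlim: "(%k. X (\<pi> k s) w) ~> X s w" if "s \<in> {0..T}" for s
   by (rule continuous_on_tendsto_compose[OF cont \<pi>_lim[OF that] that]) (intro always_eventually allI \<pi>(1) that)
  note meas = measurable_compose[OF X_meas f_measurable(1)] measurable_compose[OF X_meas f_measurable(2)]
   measurable_compose[OF X\<pi> f_measurable(1)] measurable_compose[OF X\<pi> f_measurable(2)]
   simple_process_path_time[of S w T] progressive_path_time[OF a w] simple_process_path_time[of S w T] progressive_path_time[OF a w]
  have lim: "(%k. ?un k s) ~> f1 (X s w)" "(%k. ?vn k s) ~> f2 (X s w)" if "s \<in> space (leb T)" for s
   using continuous_on_tendsto_compose[OF f_cont(2) Xlim, of s] continuous_on_tendsto_compose[OF f_cont(3) Xlim, of s] that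
   by (simp_all add: space_restrict_space)
  have h: "L2 (leb T) (%s. ?h s) < \<infinity>"
   using int_square_simple_finite[OF S, of w] by (simp add: int_square_eq)
  have h0: "(%n. L2 (leb T) (%s. ?h s - ?h s)) ~> 0" by simp
  have a0: "(%n. L1 (leb T) (%s. a s w - a s w)) ~> 0" by simp
  have i: "integrable (leb T) (%s. ?D s w)" by (rule drift_integrable[OF meas _ _ lim h h0 a_integrable[OF w]]) (use f1K f2K in auto)
  have ik: "integrable (leb T) (%s. ?un k s * a s w + ?vn k s * (?h s)^2 / 2)" for k
   by (rule drift_integrable[OF meas(3)[of k] meas(4)[of k] meas(3)[of k] meas(4)[of k] meas(5-8) _ _ tendsto_const tendsto_const h h0 a_integrable[OF w]])
    (use f1K f2K in auto)
  have "(%k. ?J k r w) ~> (LBINT s:{0..r}. ?D s w)" if r: "r \<in> {0..T}" for r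
  proof -
   have "(%k. ?J k r w) ~> (\<integral>s. indicator {0..r} s * ?D s w \<partial>leb T)"
   proof (rule integral_tendsto_of_nn[OF ik i])
    show "(%k. L1 (leb T) (%s. (?un k s * a s w + ?vn k s * (?h s)^2 / 2) - ?D s w)) ~> 0"
     by (rule drift_tendsto[OF meas _ _ lim h h0 a_integrable[OF w] a0]) (use f1K f2K in auto)
    show "indicat_real {0..r} \<in> borel_measurable (leb T)" by (rule measurable_restrict_space1) simp
   qed (simp add: indicator_def)
   thus ?thesis using r set_lebesgue_integral_leb[of r T] by simp
  qed
  moreover have "energy (%s w. f1 (X s w) * SP S s w) w < \<infinity>"
   unfolding int_square_eq by (rule product_square_finite[OF meas _ _ lim h h0]) (use f1K f2K in auto)
  moreover have "(%k. energy (%s w. SP (S' k) s w - f1 (X s w) * SP S s w) w) ~> 0"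
  proof -
   have "(%k. L2 (leb T) (%s. ?un k s * ?h s - f1 (X s w) * ?h s)) ~> 0"
    by (rule product_square_tendsto[OF meas _ _ lim h h0]) (use f1K f2K in auto)
   moreover have "L2 (leb T) (%s. ?un k s * ?h s - f1 (X s w) * ?h s) =
     energy (%s w. SP (S' k) s w - f1 (X s w) * SP S s w) w" for k
    unfolding int_square_eq by (intro nn_integral_cong) (simp add: S'_path space_restrict_space)
   ultimately show ?thesis by (simp only:)
  qed
  ultimately show ?thesis using i by blast
 qed
 have prog: "prog (%t w. f (X t w))" "prog (%t w. f1 (X t w))" "prog (%t w. f2 (X t w))"
  using borel_measurable_continuous_onI[OF f_cont(1)] f_measurable by (auto intro: progressive_compose[OF X])
 have progD: "prog ?D" by (intro progressive_intros prog a simple_process_progressive S)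
 have progH: "prog (%s w. f1 (X s w) * SP S s w)" by (intro progressive_intros prog simple_process_progressive S)
 have AE_path: "AE w in M. integrable (leb T) (%s. ?D s w)"
  "AE w in M. energy (%s w. f1 (X s w) * SP S s w) w < \<infinity>"
  "AE w in M. (%k. energy (%s w. SP (S' k) s w - f1 (X s w) * SP S s w) w) ~> 0"
  "AE w in M. \<forall>r\<in>{0..T}. (%k. ?J k r w) ~> (LBINT s:{0..r}. ?D s w)"
  using X_cont AE_space by (eventually_elim, use path in blast)+
 show ?thesis
 proof (rule ito_processI[OF prog(1) progD AE_path(1)])
  show "ito_integral (%s w. f1 (X s w) * SP S s w) (%t w. f (X t w) - f (X 0 w) - (LBINT s:{0..t}. ?D s w))"
  proof (rule has_ito_integralI[OF progH AE_path(2) progressive_remainder[OF prog(1) progD] _ S'])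
   show "AE w in M. continuous_on {0..T} (%t. f (X t w) - f (X 0 w) - (LBINT s:{0..t}. ?D s w))"
    using X_cont AE_path(1) by eventually_elim (intro continuous_on_diff continuous_on_const indefinite_integral_continuous_time
     continuous_on_compose2[OF f_cont(1)], auto)
   show "null_in_prob M (%k. energy (%s w. SP (S' k) s w - f1 (X s w) * SP S s w))"
    by (intro null_in_prob_AE int_square_diff_measurable S' progH AE_path(3))
   fix r assume r: "r \<in> {0..T}"
   let ?C = "15 * (K * L ^ 3) * T + 1 + 2 * (K * L^2)^2 * T"
   define W where "W k R \<longleftrightarrow> integrable M R \<and> expectation R \<le> ?C * (1/4) ^ k \<and>
    (AE w in M. \<bar>f (X r w) - f (X 0 w) - ?J k r w - SI (S' k) r w\<bar> \<le> R w)" for k R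
   have "\<exists>R. W k R" for k
    unfolding W_def S'_def \<pi>_def using ito_step_error[OF g mesh \<theta> c r eq, of k] by blast
   then obtain R where R: "\<And>k. W k (R k)" by metis
   have Ri: "integrable M (R k)" "expectation (R k) \<le> ?C * (1/4) ^ k"
    and Rb: "AE w in M. \<bar>f (X r w) - f (X 0 w) - ?J k r w - SI (S' k) r w\<bar> \<le> R k w" for k
    using R[of k] by (simp_all add: W_def)
   have R0: "AE w in M. 0 \<le> R k w" for k using Rb[of k] by eventually_elim (meson abs_ge_zero order_trans)
   have "AE w in M. (%k. ennreal (R k w)) ~> 0"
   proof (rule AE_null_of_fast[where c = "?C"])
    show "(%w. ennreal (R k w)) \<in> borel_measurable M" for k
     using borel_measurable_integrable[OF Ri(1)] by (rule measurable_compose[OF _ measurable_ennreal])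
    fix k
    have [measurable]: "R k \<in> borel_measurable M" using Ri(1) by simp
    have "ennreal ((1/2) ^ k) < ennreal x ==> (1/2) ^ k \<le> x" for x :: real
     by (cases "0 \<le> x") (simp_all add: ennreal_less_iff ennreal_neg)
    hence "prob {w \<in> space M. ennreal ((1/2) ^ k) < ennreal (R k w)} \<le> prob {w \<in> space M. (1/2) ^ k \<le> R k w}"
     by (intro finite_measure_mono) auto
    also have "\<dots> \<le> expectation (R k) / (1/2) ^ k"
     using Ri R0 by (intro integral_Markov_inequality_measure[where A = "{}"]) auto
    also have "\<dots> \<le> (?C * (1/4) ^ k) / (1/2) ^ k" using Ri(2) by (intro divide_right_mono) auto
    also have "\<dots> = ?C * ((1/4) ^ k / (1/2) ^ k)" by (simp only: times_divide_eq_right)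
    also have "(1/4 :: real) ^ k / (1/2) ^ k = (1/2) ^ k" by (subst power_divide[symmetric]) simp
    finally show "prob {w \<in> space M. ennreal ((1/2) ^ k) < ennreal (R k w)} \<le> ?C * (1/2) ^ k" .
   qed
   moreover have "AE w in M. \<forall>k. \<bar>f (X r w) - f (X 0 w) - ?J k r w - SI (S' k) r w\<bar> \<le> R k w"
    unfolding AE_all_countable using Rb by blast
   ultimately show "AE w in M. (%k. SI (S' k) r w) ~> f (X r w) - f (X 0 w) - (LBINT s:{0..r}. ?D s w)"
    using AE_path(4)
   proof eventually_elim
    case (elim w)
    let ?E = "%k. f (X r w) - f (X 0 w) - ?J k r w - SI (S' k) r w"
    have "0 \<le> R k w" for k using elim(2) abs_ge_zero order_trans by blast
    hence "(%k. R k w) ~> 0" using elim(1) by (intro tendsto_ennrealD) auto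
    hence E: "?E ~> 0" by (rule Lim_null_comparison[rotated]) (use elim(2) in simp)
    have "(%k. ?J k r w) ~> (LBINT s:{0..r}. ?D s w)" using elim(3) r by blast
    hence "(%k. f (X r w) - f (X 0 w) - ?J k r w - ?E k) ~> f (X r w) - f (X 0 w) - (LBINT s:{0..r}. ?D s w) - 0"
     by (intro tendsto_diff tendsto_const E)
    thus ?case by simp
   qed
  qed
 qed
qed

end


text \<open>The common bound \<open>C\<close> on the coefficients may depend on the path; this
  admits derivatives that are bounded only along each continuous path.\<close>

lemma ito_process_function_limit:
 fixes Y :: "nat => real => 'a => real"
 assumes ito: "\<And>n. ito_process (Y n) (%s w. U n s w * a n s w + V n s w * (H n s w)^2 / 2) (%s w. U n s w * H n s w)"
  and prog: "\<And>n. prog (U n)" "\<And>n. prog (V n)" "\<And>n. prog (a n)" "\<And>n. prog (H n)"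
   "prog Y'" "prog U'" "prog V'" "prog a'" "prog H'"
  and cont: "AE w in M. continuous_on {0..T} (%t. Y' t w)"
  and Y: "AE w in M. \<forall>t\<in>{0..T}. (%n. Y n t w) ~> Y' t w"
  and UV: "AE w in M. \<forall>t\<in>{0..T}. (%n. U n t w) ~> U' t w \<and> (%n. V n t w) ~> V' t w"
  and bound: "AE w in M. \<exists>C. \<forall>n. \<forall>t\<in>{0..T}. \<bar>U n t w\<bar> \<le> C \<and> \<bar>V n t w\<bar> \<le> C"
  and a': "AE w in M. integrable (leb T) (%s. a' s w)"
  and a: "AE w in M. (%n. L1 (leb T) (%s. a n s w - a' s w)) ~> 0"
  and H': "AE w in M. energy H' w < \<infinity>"
  and H: "AE w in M. (%n. energy (%s w. H n s w - H' s w) w) ~> 0"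
 shows "ito_process Y' (%s w. U' s w * a' s w + V' s w * (H' s w)^2 / 2) (%s w. U' s w * H' s w)"
proof -
 let ?D = "%s w. U' s w * a' s w + V' s w * (H' s w)^2 / 2"
 let ?Dn = "%n s w. U n s w * a n s w + V n s w * (H n s w)^2 / 2"
 have path: "AE w in M. integrable (leb T) (%s. ?D s w) \<and>
   energy (%s w. U' s w * H' s w) w < \<infinity> \<and>
   (%n. L1 (leb T) (%s. ?Dn n s w - ?D s w)) ~> 0 \<and>
   (%n. energy (%s w. U n s w * H n s w - U' s w * H' s w) w) ~> 0"
  using UV bound a' a H' H AE_space
 proof eventually_elim
  case (elim w)
  then obtain C where C: "\<And>n t. t \<in> {0..T} ==> \<bar>U n t w\<bar> \<le> C" "\<And>n t. t \<in> {0..T} ==> \<bar>V n t w\<bar> \<le> C" by blast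
  note pm = progressive_path_time[OF _ elim(7)]
  note meas = pm[OF prog(6)] pm[OF prog(7)] pm[OF prog(1)] pm[OF prog(2)] pm[OF prog(9)] pm[OF prog(8)] pm[OF prog(4)] pm[OF prog(3)]
  note b = C[folded atLeastAtMost_iff]
  have sp: "s \<in> space (leb T) ==> s \<in> {0..T}" for s by (simp add: space_restrict_space)
  have lim: "(%n. U n s w) ~> U' s w" "(%n. V n s w) ~> V' s w" if "s \<in> space (leb T)" for s
   using elim(1) sp[OF that] by blast+
  note hyps = meas C(1)[OF sp] C(2)[OF sp] lim elim(5)[unfolded int_square_eq] elim(6)[unfolded int_square_eq]
  show ?case unfolding int_square_eq
   by (intro conjI) (rule drift_integrable[OF hyps elim(3)] product_square_finite[OF hyps] drift_tendsto[OF hyps elim(3,4)]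
    product_square_tendsto[OF hyps]; assumption)+
 qed
 show ?thesis by (rule ito_process_limit[OF ito prog(5) _ _ cont Y])
   (use path in \<open>auto elim!: eventually_mono intro!: progressive_intros prog\<close>)
qed

definition nice :: "real => (real => real) => (real => real) => (real => real) => bool" where
 "nice K f f1 f2 \<longleftrightarrow> (\<forall>x. (f has_real_derivative f1 x) (at x)) \<and> (\<forall>x. (f1 has_real_derivative f2 x) (at x)) \<and>
  (\<forall>x. \<bar>f1 x\<bar> \<le> K) \<and> (\<forall>x. \<bar>f2 x\<bar> \<le> K) \<and> (\<forall>x y. \<bar>f2 x - f2 y\<bar> \<le> K * \<bar>x - y\<bar>)"

text \<open>The drift is clipped and the diffusion coefficient replaced by simple processes. The
  resulting processes \<open>Z n\<close> converge to \<open>X\<close>, and since the derivatives are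
  bounded and continuous the formula passes to the limit.\<close>

lemma ito_formula_nice:
 assumes X: "ito_process X a H" and nice: "nice K f f1 f2"
 shows "ito_process (%t w. f (X t w)) (%s w. f1 (X s w) * a s w + f2 (X s w) * (H s w)^2 / 2) (%s w. f1 (X s w) * H s w)"
proof -
 have f: "\<And>x. (f has_real_derivative f1 x) (at x)" "\<And>x. (f1 has_real_derivative f2 x) (at x)"
  and bounds: "\<And>x. \<bar>f1 x\<bar> \<le> K" "\<And>x. \<bar>f2 x\<bar> \<le> K" and lip: "\<And>x y. \<bar>f2 x - f2 y\<bar> \<le> K * \<bar>x - y\<bar>"
  using nice by (simp_all add: nice_def)
 have K: "0 \<le> K" using bounds(1)[of 0] by linarith
 have f2_cont: "continuous_on UNIV f2"
  by (rule lipschitz_on_continuous_on[of K], rule lipschitz_onI) (use lip K in \<open>auto simp: dist_real_def\<close>)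
 have f_cont: "continuous_on UNIV f" "continuous_on UNIV f1"
  using f DERIV_isCont by (blast intro: continuous_at_imp_continuous_on)+
 note D = ito_processD[OF X]
 let ?I = "%t w. X t w - X 0 w - (LBINT s:{0..t}. a s w)"
 obtain S where S: "\<And>n. simple (S n)" and
  lim: "AE w in M. approx S H ?I w"
  using has_ito_integral_AE[OF ito_process_integral[OF X]] by blast
 define P where "P S I \<longleftrightarrow> ito_integral (SP S) I \<and> (AE w in M. \<forall>t\<in>{0..T}. I t w = SI S t w)" for S I
 have "\<forall>n. \<exists>I. P (S n) I" using has_ito_integral_simple[OF S] unfolding P_def by blast
 then obtain I where "\<And>n. P (S n) (I n)" by metis
 hence I: "ito_integral (SP (S n)) (I n)"
  and I_eq: "AE w in M. \<forall>t\<in>{0..T}. I n t w = SI (S n) t w" for n by (simp_all add: P_def)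
 define A where "A n s w = clip (real n) (a s w)" for n :: nat and s w
 have A: "prog (A n)" "\<bar>A n s w\<bar> \<le> real n" for n s w
  unfolding A_def by (auto intro!: progressive_clip D clip_bound)
 define Z where "Z n t w = X 0 w + (LBINT s:{0..t}. A n s w) + I n t w" for n t w
 have Z: "prog (Z n)" for n
  unfolding Z_def by (intro progressive_add progressive_integral progressive_initial initial_measurable D A has_ito_integralD(3)[OF I])
 have Z_eq: "AE w in M. \<forall>t\<in>{0..T}. Z n t w = Z n 0 w + (LBINT s:{0..t}. A n s w) + SI (S n) t w" for n
  using I_eq[of n]
 proof eventually_elim
  case (elim w)
  have "I n 0 w = 0" using elim T_pos by (simp add: simple_integral_zero[OF S])
  hence "Z n 0 w = X 0 w + (LBINT s:{0..0}. A n s w)" by (simp add: Z_def)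
  also have "(LBINT s:{0..0}. A n s w) = 0"
   unfolding set_lebesgue_integral_def using AE_lborel_singleton[of 0] by (intro integral_eq_zero_AE) (auto elim!: eventually_mono)
  finally have Z0: "Z n 0 w = X 0 w" by simp
  show ?case unfolding Z0 using elim by (simp add: Z_def)
 qed
 have "\<exists>L. 1 \<le> L \<and> real n \<le> L \<and> (\<forall>s. \<forall>w\<in>space M. \<bar>SP (S n) s w\<bar> \<le> L)" for n
 proof -
  obtain C where "\<forall>s. \<forall>w\<in>space M. \<bar>SP (S n) s w\<bar> \<le> C" using simple_process_bounded[OF S] by blast
  thus ?thesis by (intro exI[of _ "max 1 (max (real n) C)"]) (auto simp: le_max_iff_disj)
 qed
 then obtain L where L: "\<And>n. 1 \<le> L n" "\<And>n. real n \<le> L n" "\<And>n s w. w \<in> space M ==> \<bar>SP (S n) s w\<bar> \<le> L n"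
  by metis
 have ito: "ito_process (%t w. f (Z n t w)) (%s w. f1 (Z n s w) * A n s w + f2 (Z n s w) * (SP (S n) s w)^2 / 2)
   (%s w. f1 (Z n s w) * SP (S n) s w)" for n
  by (rule ito_formula_simple[OF S A(1) Z order_trans[OF A(2) L(2)] L(3,1) f bounds lip Z_eq])
 have A_lim: "AE w in M. (%n. L1 (leb T) (%s. A n s w - a s w)) ~> 0"
  using D(4) AE_space
 proof eventually_elim
  case (elim w)
  show ?case
  proof (rule nn_integral_abs_dominated[where w = "%s. a s w"])
   show "\<bar>A n s w - a s w\<bar> \<le> \<bar>a s w\<bar>" for n s by (auto simp: A_def clip_def)
   show "(%n. A n s w - a s w) ~> 0" for s
    unfolding A_def by (intro LIM_zero clip_tendsto)
   show "L1 (leb T) (%s. a s w) < \<infinity>" using elim(1) by (simp add: integrable_iff_bounded)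
  qed (intro borel_measurable_diff progressive_path_time[OF _ elim(2)] A D)+
 qed
 have Z_lim: "AE w in M. \<forall>t\<in>{0..T}. (%n. Z n t w) ~> X t w"
 proof -
  have "AE w in M. \<forall>n. \<forall>t\<in>{0..T}. I n t w = SI (S n) t w"
   unfolding AE_all_countable using I_eq by blast
  with lim A_lim D(4) AE_space show ?thesis
  proof eventually_elim
   case (elim w)
   show ?case
   proof
    fix t assume t: "t \<in> {0..T}"
    have "(%n. \<integral>s. indicator {0..t} s * A n s w \<partial>leb T) ~> (\<integral>s. indicator {0..t} s * a s w \<partial>leb T)"
    proof (rule integral_tendsto_of_nn[OF _ elim(3) elim(2)])
     show "integrable (leb T) (%s. A n s w)" for n
      by (rule integrable_bounded_time[OF progressive_path_time[OF A(1) elim(4)]]) (use A(2) in auto)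
     show "indicat_real {0..t} \<in> borel_measurable (leb T)" by (rule measurable_restrict_space1) simp
    qed (simp add: indicator_def)
    hence "(%n. LBINT s:{0..t}. A n s w) ~> (LBINT s:{0..t}. a s w)"
     using t set_lebesgue_integral_leb[of t T] by simp
    moreover have "(%n. I n t w) ~> ?I t w"
     using tendsto_uniform_limitI[OF conjunct2[OF elim(1)] t] elim(5) t by simp
    ultimately have "(%n. Z n t w) ~> X 0 w + (LBINT s:{0..t}. a s w) + ?I t w"
     unfolding Z_def by (intro tendsto_add tendsto_const)
    thus "(%n. Z n t w) ~> X t w" by simp
   qed
  qed
 qed
 have pc: "prog (%s w. g (W s w))" if "continuous_on UNIV g" "prog W" for g :: "real => real" and W
  by (rule progressive_compose[OF that(2) borel_measurable_continuous_onI[OF that(1)]])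
 show ?thesis
 proof (rule ito_process_function_limit[OF ito pc[OF f_cont(2) Z] pc[OF f2_cont Z] A(1) simple_process_progressive[OF S]
   pc[OF f_cont(1) D(1)] pc[OF f_cont(2) D(1)] pc[OF f2_cont D(1)] D(2,3) _ _ _ _ D(4) A_lim D(5)])
  show "AE w in M. continuous_on {0..T} (%t. f (X t w))"
   using ito_process_continuous[OF X] by eventually_elim (auto intro: continuous_on_compose2[OF f_cont(1)])
  have to: "(%n. g (z n)) ~> g x" if "continuous_on UNIV g" "z ~> x" for g :: "real => real" and z x
   using continuous_on_tendsto_compose[OF that] by simp
  show "AE w in M. \<forall>t\<in>{0..T}. (%n. f (Z n t w)) ~> f (X t w)"
   using Z_lim by eventually_elim (simp add: to[OF f_cont(1)])
  show "AE w in M. \<forall>t\<in>{0..T}. (%n. f1 (Z n t w)) ~> f1 (X t w) \<and> (%n. f2 (Z n t w)) ~> f2 (X t w)"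
   using Z_lim by eventually_elim (simp add: to[OF f_cont(2)] to[OF f2_cont])
  show "AE w in M. \<exists>C. \<forall>n. \<forall>t\<in>{0..T}. \<bar>f1 (Z n t w)\<bar> \<le> C \<and> \<bar>f2 (Z n t w)\<bar> \<le> C"
   using bounds by (intro AE_I2) blast
  show "AE w in M. (%n. gap (S n) H w) ~> 0"
   using lim by eventually_elim blast
 qed
qed


text \<open>Unbounded derivatives are reached by composition rather than stopping: \<open>f\<close>
  is applied to \<open>m * sin (x / m)\<close>. This map has bounded range and bounded derivatives,
  does not increase absolute values and tends to the identity. Hence all derivatives are bounded for
  fixed \<open>m\<close>, and along one path the first two are bounded uniformly in
  \<open>m\<close>.\<close>

theorem ito_formula:
 assumes X: "ito_process X a H"
  and f: "\<And>x. (f has_real_derivative f1 x) (at x)" "\<And>x. (f1 has_real_derivative f2 x) (at x)"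
   "\<And>x. (f2 has_real_derivative f3 x) (at x)" and f3: "continuous_on UNIV f3"
 shows "ito_process (%t w. f (X t w)) (%s w. f1 (X s w) * a s w + f2 (X s w) * (H s w)^2 / 2) (%s w. f1 (X s w) * H s w)"
proof -
 note D = ito_processD[OF X]
 have cont: "continuous_on UNIV f" "continuous_on UNIV f1" "continuous_on UNIV f2"
  using f DERIV_isCont by (blast intro: continuous_at_imp_continuous_on)+
 define m where "m n = real (Suc n)" for n
 have m: "1 \<le> m n" for n by (simp add: m_def)
 define g where "g n x = m n * sin (x / m n)" for n x
 define g1 where "g1 n x = f1 (g n x) * cos (x / m n)" for n x
 define g2 where "g2 n x = f2 (g n x) * (cos (x / m n))^2 - f1 (g n x) * (sin (x / m n) / m n)" for n x
 have g: "(g n has_real_derivative cos (x / m n)) (at x)" "\<bar>g n x\<bar> \<le> m n" "\<bar>g n x\<bar> \<le> \<bar>x\<bar>" for n x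
 proof -
  show "(g n has_real_derivative cos (x / m n)) (at x)"
   unfolding g_def using m[of n] by (auto intro!: derivative_eq_intros)
  show "\<bar>g n x\<bar> \<le> m n" unfolding g_def using m[of n] by (simp add: abs_mult mult_left_le)
  have "\<bar>g n x\<bar> = m n * \<bar>sin (x / m n)\<bar>" using m[of n] by (simp add: g_def abs_mult)
  also have "\<dots> \<le> m n * \<bar>x / m n\<bar>" using m[of n] by (intro mult_left_mono abs_sin_x_le_abs_x) simp
  also have "\<dots> = \<bar>x\<bar>" using m[of n] by simp
  finally show "\<bar>g n x\<bar> \<le> \<bar>x\<bar>" .
 qed
 have bnd: "\<exists>C\<ge>0. \<forall>x. \<bar>x\<bar> \<le> R \<longrightarrow> \<bar>f1 x\<bar> \<le> C \<and> \<bar>f2 x\<bar> \<le> C \<and> \<bar>f3 x\<bar> \<le> C" for R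
 proof -
  have "\<exists>C. \<forall>x. \<bar>x\<bar> \<le> R \<longrightarrow> \<bar>\<phi> x\<bar> \<le> C" if "continuous_on UNIV \<phi>" for \<phi> :: "real => real"
  proof -
   have "compact (\<phi> ` {-R..R})" using that by (intro compact_continuous_image continuous_on_subset[OF that]) auto
   then obtain C where "\<forall>y\<in>\<phi> ` {-R..R}. norm y \<le> C" using compact_imp_bounded bounded_iff by metis
   thus ?thesis by (intro exI[of _ C]) (auto simp: abs_le_iff)
  qed
  from this[OF cont(2)] this[OF cont(3)] this[OF f3] obtain C1 C2 C3 where
   "\<And>x. \<bar>x\<bar> \<le> R ==> \<bar>f1 x\<bar> \<le> C1" "\<And>x. \<bar>x\<bar> \<le> R ==> \<bar>f2 x\<bar> \<le> C2" "\<And>x. \<bar>x\<bar> \<le> R ==> \<bar>f3 x\<bar> \<le> C3" by metis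
  thus ?thesis by (intro exI[of _ "max 0 (max C1 (max C2 C3))"]) (simp add: le_max_iff_disj)
 qed
 have g1b: "\<bar>g1 n x\<bar> \<le> C" if "\<bar>f1 (g n x)\<bar> \<le> C" for n x C
  using mult_mono[OF that abs_cos_le_one[of "x / m n"]] that by (simp add: g1_def abs_mult)
 have sm: "\<bar>sin y / m n\<bar> \<le> 1" for n y
  using m[of n] order_trans[OF abs_sin_le_one[of y] m[of n]] by (simp add: abs_divide divide_le_eq)
 have mult1: "\<bar>p * q\<bar> \<le> C" if "\<bar>p\<bar> \<le> C" "\<bar>q\<bar> \<le> 1" for p q C :: real
  using mult_mono[OF that] that by (simp add: abs_mult)
 have g2b: "\<bar>g2 n x\<bar> \<le> 2 * C" if "\<bar>f1 (g n x)\<bar> \<le> C" "\<bar>f2 (g n x)\<bar> \<le> C" for n x C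
 proof -
  have "\<bar>f2 (g n x) * (cos (x / m n))^2\<bar> \<le> C" by (rule mult1[OF that(2)]) (simp add: abs_square_le_1)
  moreover have "\<bar>f1 (g n x) * (sin (x / m n) / m n)\<bar> \<le> C" by (rule mult1[OF that(1) sm])
  ultimately show ?thesis unfolding g2_def by linarith
 qed
 have "\<exists>K. nice K (%x. f (g n x)) (g1 n) (g2 n)" for n
 proof -
  obtain C where C: "0 \<le> C" "\<And>x. \<bar>x\<bar> \<le> m n ==> \<bar>f1 x\<bar> \<le> C \<and> \<bar>f2 x\<bar> \<le> C \<and> \<bar>f3 x\<bar> \<le> C"
   using bnd[of "m n"] by blast
  note C' = C(2)[OF g(2)]
  \<comment> \<open>The derivative of \<open>g2 n\<close>. Counted with multiplicity it has 1 + 3 +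
    1 terms, each at most \<open>C\<close>, which gives the Lipschitz constant
    \<open>5 * C\<close>.\<close>
  define g3 where "g3 x = f3 (g n x) * cos (x / m n) * (cos (x / m n))^2
   - 3 * (f2 (g n x) * cos (x / m n) * (sin (x / m n) / m n)) - f1 (g n x) * (cos (x / m n) / m n / m n)" for x
  note dg = DERIV_chain2[OF f(1) g(1)] DERIV_chain2[OF f(2) g(1)] DERIV_chain2[OF f(3) g(1)]
  have d1: "(g1 n has_real_derivative g2 n x) (at x)" for x unfolding g1_def g2_def using m[of n]
   by (auto intro!: derivative_eq_intros dg simp: power2_eq_square)
  have d2: "(g2 n has_real_derivative g3 x) (at x)" for x unfolding g2_def g3_def using m[of n]
   by (auto intro!: derivative_eq_intros dg simp: power2_eq_square field_simps)
  have g3b: "\<bar>g3 x\<bar> \<le> 5 * C" for x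
  proof -
   have cm: "\<bar>cos (x / m n) / m n / m n\<bar> \<le> 1"
    using m[of n] abs_cos_le_one[of "x / m n"] by (simp add: divide_le_eq mult_le_one order_trans[OF _ mult_mono[of 1 "m n" 1 "m n"]] abs_mult)
   have "\<bar>f3 (g n x) * cos (x / m n) * (cos (x / m n))^2\<bar> \<le> C"
    by (intro mult1) (use C'[of x] in \<open>simp_all add: abs_square_le_1\<close>)
   moreover have "\<bar>f2 (g n x) * cos (x / m n) * (sin (x / m n) / m n)\<bar> \<le> C" by (intro mult1 sm) (use C'[of x] in simp_all)
   moreover have "\<bar>f1 (g n x) * (cos (x / m n) / m n / m n)\<bar> \<le> C" by (intro mult1 cm) (use C'[of x] in simp_all)
   ultimately show ?thesis unfolding g3_def by linarith
  qed
  have "\<bar>g2 n x - g2 n y\<bar> \<le> 5 * C * \<bar>x - y\<bar>" for x y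
   using field_differentiable_bound[of UNIV "g2 n" g3 "5 * C" x y] d2 g3b by simp
  hence "nice (5 * C) (%x. f (g n x)) (g1 n) (g2 n)" unfolding nice_def
  proof (intro conjI allI)
   fix x
   show "((%x. f (g n x)) has_real_derivative g1 n x) (at x)" unfolding g1_def by (rule dg(1))
   show "\<bar>g1 n x\<bar> \<le> 5 * C" "\<bar>g2 n x\<bar> \<le> 5 * C"
    using g1b[of n x C] g2b[of n x C] C'[of x] C(1) by linarith+
  qed (use d1 in auto)
  thus ?thesis by blast
 qed
 then obtain K where nice: "\<And>n. nice (K n) (%x. f (g n x)) (g1 n) (g2 n)" by metis
 have m_lim: "(%n. y / m n) ~> 0" for y
  using LIMSEQ_Suc[OF lim_const_over_n[of y]] by (simp add: m_def)
 have g_lim: "(%n. g n x) ~> x" for x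
 proof (cases "x = 0")
  case False
  have "((%y::real. sin y / y) \<longlongrightarrow> 1) (at 0)" using DERIV_sin[of "0::real"] by (simp add: DERIV_def)
  moreover have "filterlim (%n. x / m n) (at 0) sequentially"
   unfolding filterlim_at using m_lim m False by (auto intro!: always_eventually) (metis not_one_le_zero)
  ultimately have "(%n. sin (x / m n) / (x / m n)) ~> 1" by (rule filterlim_compose)
  from tendsto_mult[OF this tendsto_const[of x]] show ?thesis using False m by (simp add: g_def field_simps)
 qed (simp add: g_def)
 have to: "(%n. h (z n)) ~> h x" if "continuous_on UNIV h" "z ~> x" for h :: "real => real" and z x
  using continuous_on_tendsto_compose[OF that] by simp
 have cos_lim: "(%n. cos (x / m n)) ~> 1" for x
  using tendsto_cos[OF m_lim[of x]] by simp
 have g1_lim: "(%n. g1 n x) ~> f1 x" for x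
  unfolding g1_def using tendsto_mult[OF to[OF cont(2) g_lim] cos_lim] by simp
 have g2_lim: "(%n. g2 n x) ~> f2 x" for x
 proof -
  have "(%n. sin (x / m n) * (1 / m n)) ~> sin 0 * 0" by (intro tendsto_mult tendsto_sin m_lim)
  from tendsto_mult[OF to[OF cont(2) g_lim] this] tendsto_mult[OF to[OF cont(3) g_lim] tendsto_power[OF cos_lim]]
  have "(%n. f2 (g n x) * (cos (x / m n))^2 - f1 (g n x) * (sin (x / m n) * (1 / m n))) ~> f2 x * 1^2 - f1 x * (sin 0 * 0)"
   by (intro tendsto_diff)
  thus ?thesis by (simp add: g2_def)
 qed
 have pc: "prog (%s w. \<phi> (X s w))" if "continuous_on UNIV \<phi>" for \<phi> :: "real => real"
  by (rule progressive_compose[OF D(1) borel_measurable_continuous_onI[OF that]])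
 have gc: "continuous_on UNIV (g1 n)" "continuous_on UNIV (g2 n)" for n
  using m[of n] unfolding g1_def g2_def g_def
  by (auto intro!: continuous_intros continuous_on_compose2[OF cont(2)] continuous_on_compose2[OF cont(3)])
 show ?thesis
 proof (rule ito_process_function_limit[OF ito_formula_nice[OF X nice] pc[OF gc(1)] pc[OF gc(2)] D(2,3)
   pc[OF cont(1)] pc[OF cont(2)] pc[OF cont(3)] D(2,3) _ _ _ _ D(4) _ D(5)])
  show "AE w in M. continuous_on {0..T} (%t. f (X t w))"
   using ito_process_continuous[OF X] by eventually_elim (auto intro: continuous_on_compose2[OF cont(1)])
  show "AE w in M. \<forall>t\<in>{0..T}. (%n. f (g n (X t w))) ~> f (X t w)" by (simp add: to[OF cont(1) g_lim])
  show "AE w in M. \<forall>t\<in>{0..T}. (%n. g1 n (X t w)) ~> f1 (X t w) \<and> (%n. g2 n (X t w)) ~> f2 (X t w)"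
   by (simp add: g1_lim g2_lim)
  show "AE w in M. \<exists>C. \<forall>n. \<forall>t\<in>{0..T}. \<bar>g1 n (X t w)\<bar> \<le> C \<and> \<bar>g2 n (X t w)\<bar> \<le> C"
   using ito_process_continuous[OF X]
  proof eventually_elim
   case (elim w)
   from compact_continuous_image[OF this] have "bounded ((%t. X t w) ` {0..T})" by (intro compact_imp_bounded) simp
   then obtain R where "\<forall>x\<in>(%t. X t w) ` {0..T}. norm x \<le> R" unfolding bounded_iff by blast
   hence R: "\<And>t. t \<in> {0..T} ==> \<bar>X t w\<bar> \<le> R" by simp
   obtain C where C: "0 \<le> C" "\<And>x. \<bar>x\<bar> \<le> R ==> \<bar>f1 x\<bar> \<le> C \<and> \<bar>f2 x\<bar> \<le> C \<and> \<bar>f3 x\<bar> \<le> C"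
    using bnd[of R] by blast
   have "\<bar>g1 n (X t w)\<bar> \<le> 2 * C \<and> \<bar>g2 n (X t w)\<bar> \<le> 2 * C" if "t \<in> {0..T}" for n t
    using C(2)[OF order_trans[OF g(3) R[OF that]]] g1b[of n "X t w" C] g2b[of n "X t w" C] C(1) by (metis add_increasing mult_2)
   thus ?case by blast
  qed
 qed (simp_all add: int_square_def)
qed

text \<open>Localisation by paths: approximants that coincide with the target from a path-dependent
  index on converge in every sense required by \<open>ito_process_limit\<close>.\<close>

lemma ito_process_eventually:
 assumes ito: "\<And>n. ito_process (X n) (a n) (H n)" and prog: "prog X'" "prog a'" "prog H'"
  and eq: "AE w in M. \<forall>\<^sub>F n in sequentially. (\<forall>t\<in>{0..T}. X n t w = X' t w) \<and> (AE s in leb T. a n s w = a' s w \<and> H n s w = H' s w)"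
 shows "ito_process X' a' H'"
proof -
 have D: "AE w in M. \<forall>n. continuous_on {0..T} (%t. X n t w)" "AE w in M. \<forall>n. integrable (leb T) (%s. a n s w)"
  "AE w in M. \<forall>n. energy (H n) w < \<infinity>"
  unfolding AE_all_countable by (intro allI ito_process_continuous[OF ito] ito_processD(4,5)[OF ito])+
 have all: "AE w in M. continuous_on {0..T} (%t. X' t w) \<and> (\<forall>t\<in>{0..T}. (%n. X n t w) ~> X' t w) \<and>
   integrable (leb T) (%s. a' s w) \<and> energy H' w < \<infinity> \<and>
   (%n. L1 (leb T) (%s. a n s w - a' s w)) ~> 0 \<and> (%n. energy (%s w. H n s w - H' s w) w) ~> 0"
  using eq D AE_space
 proof eventually_elim
  case (elim w)
  from elim(1) obtain N where *: "\<forall>n\<ge>N. (\<forall>t\<in>{0..T}. X n t w = X' t w) \<and> (AE s in leb T. a n s w = a' s w \<and> H n s w = H' s w)"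
   unfolding eventually_sequentially by (rule exE)
  have N: "t \<in> {0..T} ==> X n t w = X' t w" "AE s in leb T. a n s w = a' s w" "AE s in leb T. H n s w = H' s w" if "n \<ge> N" for n t
   using *[rule_format, OF that] unfolding eventually_conj_iff by (simp_all only:)
  have "continuous_on {0..T} (%t. X' t w)" by (rule continuous_on_eq[OF spec[OF elim(2)] N(1)[OF order_refl]])
  moreover have "integrable (leb T) (%s. a' s w)"
   by (rule integrable_cong_AE_imp[OF spec[OF elim(3)] progressive_path_time[OF prog(2) elim(5)] N(2)[OF order_refl]])
  moreover have "energy H' w < \<infinity>"
  proof -
   have "energy H' w = energy (H N) w"
    unfolding int_square_eq by (intro nn_integral_cong_AE eventually_mono[OF N(3)[OF order_refl]]) simp
   thus ?thesis using elim(4) by simp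
  qed
  moreover have "(%n. X n t w) ~> X' t w" if "t \<in> {0..T}" for t
   by (rule tendsto_eventually) (unfold eventually_sequentially, intro exI[of _ N] allI impI N(1) that)
  moreover have "(%n. L1 (leb T) (%s. a n s w - a' s w)) ~> 0"
  proof (rule tendsto_eventually, unfold eventually_sequentially, intro exI allI impI)
   fix n assume "N \<le> n"
   hence "L1 (leb T) (%s. a n s w - a' s w) = (\<integral>\<^sup>+s. 0 \<partial>leb T)"
    by (intro nn_integral_cong_AE eventually_mono[OF N(2)]) simp_all
   thus "L1 (leb T) (%s. a n s w - a' s w) = 0" by simp
  qed
  moreover have "(%n. energy (%s w. H n s w - H' s w) w) ~> 0"
  proof (rule tendsto_eventually, unfold eventually_sequentially, intro exI allI impI)
   fix n assume "N \<le> n"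
   hence "energy (%s w. H n s w - H' s w) w = (\<integral>\<^sup>+s. 0 \<partial>leb T)"
    unfolding int_square_eq by (intro nn_integral_cong_AE eventually_mono[OF N(3)]) simp_all
   thus "energy (%s w. H n s w - H' s w) w = 0" by simp
  qed
  ultimately show ?case by blast
 qed
 show ?thesis by (rule ito_process_limit[where X = X and a = a and H = H, OF ito prog]; rule eventually_mono[OF all], blast)
qed

lemma ito_process_cong:
 assumes X: "ito_process X a H" and prog: "prog X'" "prog a'" "prog H'"
  and eq: "AE w in M. \<forall>t\<in>{0..T}. X t w = X' t w" "AE w in M. AE s in leb T. a s w = a' s w"
   "AE w in M. AE s in leb T. H s w = H' s w"
 shows "ito_process X' a' H'"
proof (rule ito_process_eventually[OF X prog])
 show "AE w in M. \<forall>\<^sub>F n in sequentially. (\<forall>t\<in>{0..T}. X t w = X' t w) \<and> (AE s in leb T. a s w = a' s w \<and> H s w = H' s w)"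
  using eq by eventually_elim (simp add: eventually_conj_iff)
qed

section \<open>Calculus of Ito processes: sums, products, exponentials\<close>

lemma ito_process_add:
 assumes X: "ito_process X a H" and Y: "ito_process Y c G"
 shows "ito_process (%t w. X t w + Y t w) (%s w. a s w + c s w) (%s w. H s w + G s w)"
proof (rule ito_processI)
 note D = ito_processD[OF X] ito_processD[OF Y]
 show p: "prog (%t w. X t w + Y t w)" "prog (%s w. a s w + c s w)" by (intro progressive_add D)+
 show "AE w in M. integrable (leb T) (%s. a s w + c s w)"
  using D(4,9) by eventually_elim (rule Bochner_Integration.integrable_add)
 show "ito_integral (%s w. H s w + G s w)
  (%t w. X t w + Y t w - (X 0 w + Y 0 w) - (LBINT s:{0..t}. a s w + c s w))"
 proof (rule has_ito_integral_cong[OF has_ito_integral_add[OF ito_process_integral[OF X] ito_process_integral[OF Y]] _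
   progressive_remainder[OF p]])
  show "AE w in M. \<forall>t\<in>{0..T}. X t w - X 0 w - (LBINT s:{0..t}. a s w) + (Y t w - Y 0 w - (LBINT s:{0..t}. c s w)) =
    X t w + Y t w - (X 0 w + Y 0 w) - (LBINT s:{0..t}. a s w + c s w)"
   using D(4,9)
  proof eventually_elim
   case (elim w)
   have "(LBINT s:{0..t}. a s w + c s w) = (LBINT s:{0..t}. a s w) + (LBINT s:{0..t}. c s w)" if t: "t \<in> {0..T}" for t
    using t by (intro set_integral_add set_integrable_subset[OF elim(1)[folded set_integrable_leb]]
      set_integrable_subset[OF elim(2)[folded set_integrable_leb]]) auto
   thus ?case by simp
  qed
 qed (auto intro: progressive_add D)
qed

lemma ito_process_cmult:
 assumes X: "ito_process X a H"
 shows "ito_process (%t w. k * X t w) (%s w. k * a s w) (%s w. k * H s w)"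
 using ito_formula[OF X, of "%x. k * x" "%_. k" "%_. 0" "%_. 0"] by (auto intro!: derivative_eq_intros)

lemma ito_process_eq:
 assumes "ito_process X a H" "\<And>t w. X t w = X' t w" "\<And>t w. a t w = a' t w" "\<And>t w. H t w = H' t w"
 shows "ito_process X' a' H'"
proof -
 have "X = X'" "a = a'" "H = H'" using assms(2-4) by (auto intro!: ext)
 thus ?thesis using assms(1) by simp
qed

text \<open>Polarisation: \<open>x * y = ((x + y)^2 - (x - y)^2) / 4\<close> reduces the product
  rule to Ito's formula for the square.\<close>

lemma ito_process_mult:
 assumes X: "ito_process X a H" and Y: "ito_process Y c G"
 shows "ito_process (%t w. X t w * Y t w) (%s w. X s w * c s w + Y s w * a s w + H s w * G s w)
  (%s w. X s w * G s w + Y s w * H s w)"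
proof -
 have sq: "ito_process (%t w. (Z t w)^2) (%s w. 2 * Z s w * d s w + 2 * (K s w)^2 / 2) (%s w. 2 * Z s w * K s w)"
  if "ito_process Z d K" for Z d K
  by (rule ito_formula[OF that, of "%x. x^2" "%x. 2 * x" "%_. 2" "%_. 0"]) (auto intro!: derivative_eq_intros)
 have "ito_process (%t w. (1/4) * (X t w + Y t w)^2 + (-1/4) * (X t w + (-1) * Y t w)^2)
  (%s w. (1/4) * (2 * (X s w + Y s w) * (a s w + c s w) + 2 * (H s w + G s w)^2 / 2) +
   (-1/4) * (2 * (X s w + (-1) * Y s w) * (a s w + (-1) * c s w) + 2 * (H s w + (-1) * G s w)^2 / 2))
  (%s w. (1/4) * (2 * (X s w + Y s w) * (H s w + G s w)) +
   (-1/4) * (2 * (X s w + (-1) * Y s w) * (H s w + (-1) * G s w)))"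
  by (intro ito_process_add ito_process_cmult sq X Y)
 thus ?thesis by (rule ito_process_eq) (simp_all add: power2_eq_square field_simps)
qed

lemma ito_process_exp:
 assumes X: "ito_process X a H"
 shows "ito_process (%t w. exp (X t w)) (%s w. exp (X s w) * a s w + exp (X s w) * (H s w)^2 / 2) (%s w. exp (X s w) * H s w)"
 by (rule ito_formula[OF X, of exp exp exp exp]) (auto intro!: derivative_eq_intros continuous_intros)

lemma has_ito_integral_zero: "ito_integral (%_ _. 0) (%_ _. 0)"
proof -
 have S: "simple []" by (simp add: simple_integrand_def)
 from has_ito_integral_simple[OF S] obtain I where I: "ito_integral (SP []) I" "AE w in M. \<forall>t\<in>{0..T}. I t w = SI [] t w" by blast
 show ?thesis by (rule has_ito_integral_cong[OF I(1) progressive_const progressive_const])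
   (use I(2) in \<open>simp_all add: simple_process_def simple_integral_def\<close>)
qed

lemma ito_process_of_integral:
 assumes I: "ito_integral H I" "\<xi> \<in> borel_measurable (F 0)"
  and a: "prog a" "AE w in M. integrable (leb T) (%s. a s w)"
  and X: "prog X" "AE w in M. \<forall>t\<in>{0..T}. X t w = X 0 w + (LBINT s:{0..t}. a s w) + I t w"
 shows "ito_process X a H"
 unfolding ito_process_def using assms by blast

end

section \<open>Supermartingale bounds\<close>

lemma lbint_point: "(LBINT s:{a..a :: real}. f s) = (0 :: real)"
 unfolding set_lebesgue_integral_def using AE_lborel_singleton[of a] by (intro integral_eq_zero_AE) (auto elim!: eventually_mono)

text \<open>Bounded second moments pass to the limit by Fatou's lemma and make the sequence
  uniformly integrable, so almost sure convergence becomes convergence in the mean.\<close>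

lemma (in prob_space) square_bounded_limit:
 fixes f :: "nat => 'a => real"
 assumes f: "\<And>n. f n \<in> borel_measurable M" "\<And>n. integrable M (%w. (f n w)^2)" "\<And>n. expectation (%w. (f n w)^2) \<le> C"
  and g [measurable]: "g \<in> borel_measurable M" and lim: "AE w in M. (%n. f n w) ~> g w"
 shows "integrable M (%w. (g w)^2)" "expectation (%w. (g w)^2) \<le> C" "(%n. expectation (%w. \<bar>f n w - g w\<bar>)) ~> 0"
proof -
 note f(1)[measurable]
 have C: "0 \<le> C" using order_trans[OF integral_nonneg_AE f(3)[of 0]] by simp
 have "L2 M g = (\<integral>\<^sup>+w. liminf (%n. ennreal ((f n w)^2)) \<partial>M)"
  using lim
 proof (intro nn_integral_cong_AE, eventually_elim)
  case (elim w)
  hence "(%n. ennreal ((f n w)^2)) ~> ennreal ((g w)^2)" by (intro tendsto_ennrealI tendsto_power)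
  thus ?case using lim_imp_Liminf[of sequentially] by fastforce
 qed
 also have "\<dots> \<le> liminf (%n. L2 M (f n))" by (rule nn_integral_liminf) simp
 also have "\<dots> \<le> limsup (%n. ennreal C)"
 proof (rule order_trans[OF Liminf_le_Limsup Limsup_mono])
  show "\<forall>\<^sub>F n in sequentially. L2 M (f n) \<le> ennreal C"
   using f by (simp add: nn_integral_eq_integral ennreal_leI)
 qed simp
 also have "\<dots> = ennreal C" by (simp add: Limsup_const)
 finally have le: "L2 M g \<le> ennreal C" .
 thus gi: "integrable M (%w. (g w)^2)" by (intro integrableI_bounded) (auto simp: le_less_trans)
 show gC: "expectation (%w. (g w)^2) \<le> C"
  using le gi C by (simp add: nn_integral_eq_integral)
 let ?d = "%n w. \<bar>f n w - g w\<bar>"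
 have d2: "integrable M (%w. (?d n w)^2)" "expectation (%w. (?d n w)^2) \<le> 4 * C" for n
 proof -
  have bnd: "(?d n w)^2 \<le> 2 * (f n w)^2 + 2 * (g w)^2" for w
   using zero_le_power2[of "f n w + g w"] by (simp add: power2_sum power2_diff)
  have i: "integrable M (%w. 2 * (f n w)^2 + 2 * (g w)^2)" using f(2) gi by simp
  show "integrable M (%w. (?d n w)^2)"
   by (rule Bochner_Integration.integrable_bound[OF i]) (use bnd in \<open>auto simp: abs_of_nonneg\<close>)
  hence "expectation (%w. (?d n w)^2) \<le> expectation (%w. 2 * (f n w)^2 + 2 * (g w)^2)"
   using i bnd by (intro integral_mono) auto
  also have "\<dots> \<le> 4 * C" using f(2,3)[of n] gi gC by simp
  finally show "expectation (%w. (?d n w)^2) \<le> 4 * C" .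
 qed
 have di: "integrable M (?d n)" for n using square_integrable_imp_integrable[OF _ d2(1)[of n]] by simp
 show "(%n. expectation (?d n)) ~> 0"
 proof (rule LIMSEQ_I)
  fix e :: real assume e: "0 < e"
  \<comment> \<open>The difference is cut at \<open>K\<close>: the part below converges by dominated
    convergence, the part above is at most its square divided by \<open>K\<close>, with mean at most
    \<open>4 * C / K \<le> e / 2\<close>.\<close>
  define K where "K = 8 * C / e + 1"
  have K: "0 < K" "4 * C / K \<le> e / 2"
  proof -
   show "0 < K" using C e by (simp add: K_def add_nonneg_pos)
   thus "4 * C / K \<le> e / 2" using e by (simp add: K_def field_simps)
  qed
  have "(%n. expectation (%w. min (?d n w) K)) ~> expectation (%w. 0)"
  proof (rule integral_dominated_convergence[where w = "%_. K"])
   show "AE w in M. (%n. min (?d n w) K) ~> 0" using lim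
   proof eventually_elim
    case (elim w)
    from tendsto_min[OF tendsto_rabs[OF LIM_zero[OF elim]] tendsto_const[of K]] show ?case using K by (simp add: min_def)
   qed
   show "AE w in M. norm (min (?d n w) K) \<le> K" for n using K by (intro AE_I2) (auto simp: min_def)
  qed simp_all
  hence "\<forall>\<^sub>F n in sequentially. expectation (%w. min (?d n w) K) < e / 2"
   using e by (intro order_tendstoD(2)) auto
  then obtain N where N: "\<And>n. n \<ge> N ==> expectation (%w. min (?d n w) K) < e / 2"
   unfolding eventually_sequentially by blast
  have "norm (expectation (?d n) - 0) < e" if "n \<ge> N" for n
  proof -
   have mi: "integrable M (%w. min (?d n w) K)" by (intro integrable_min di) simp
   have "?d n w \<le> min (?d n w) K + (?d n w)^2 / K" for w
   proof (cases "?d n w \<le> K")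
    case False
    hence "?d n w * K \<le> ?d n w * ?d n w" using K by (intro mult_left_mono) auto
    hence "?d n w \<le> (?d n w)^2 / K" using K by (simp add: power2_eq_square field_simps)
    thus ?thesis using K False by simp
   qed (use K in simp)
   hence "expectation (?d n) \<le> expectation (%w. min (?d n w) K + (?d n w)^2 / K)"
    using di d2(1) mi by (intro integral_mono) auto
   also have "\<dots> = expectation (%w. min (?d n w) K) + expectation (%w. (?d n w)^2) / K"
    using mi d2(1) by simp
   also have "\<dots> < e / 2 + 4 * C / K"
    using N[OF that] d2(2)[of n] K by (intro add_less_le_mono divide_right_mono) auto
   finally have "expectation (?d n) < e" using K by linarith
   moreover have "0 \<le> expectation (?d n)" by (intro integral_nonneg_AE) simp
   ultimately show ?thesis by simp
  qed
  thus "\<exists>N. \<forall>n\<ge>N. norm (expectation (?d n) - 0) < e" by blast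
 qed
qed

section \<open>Integrals of integrands with bounded energy are martingales\<close>

context brownian_filtration
begin

text \<open>Truncating the approximants at energy \<open>2 * C + \<delta>\<close> gives a uniform
  bound. On almost every path the truncation eventually does nothing, since the energy of
  \<open>SP (S n)\<close> is at most twice the gap plus twice the energy of \<open>H\<close>, and
  the gap tends to 0.\<close>

lemma bounded_energy_approximation:
 assumes I: "ito_integral H I" and C: "0 \<le> C" "AE w in M. energy H w \<le> ennreal C" and \<delta>: "0 < \<delta>"
 shows "\<exists>S. (\<forall>n. simple (S n)) \<and> (\<forall>n. \<forall>w\<in>space M. energy (SP (S n)) w \<le> ennreal (2 * C + \<delta>)) \<and>
  (AE w in M. \<forall>t\<in>{0..T}. (%n. SI (S n) t w) ~> I t w)"
proof -
 note D = has_ito_integralD[OF I]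
 obtain S where S: "\<And>n. simple (S n)" and lim: "AE w in M.
   approx S H I w"
  using has_ito_integral_AE[OF I] by blast
 define P where "P S S' \<longleftrightarrow> simple S' \<and> (\<forall>w\<in>space M. energy (SP S') w \<le> ennreal (2 * C + \<delta>)) \<and>
  (\<forall>w. energy (SP S) w \<le> ennreal (2 * C + \<delta>) \<longrightarrow>
   (\<forall>s. SP S' s w = SP S s w \<and> SI S' s w = SI S s w))" for S S'
 have "\<exists>S'. P (S n) S'" for n using simple_truncation[OF S, of "2 * C + \<delta>"] C \<delta> unfolding P_def by simp
 then obtain S' where S': "\<And>n. P (S n) (S' n)" by metis
 have "AE w in M. \<forall>t\<in>{0..T}. (%n. SI (S' n) t w) ~> I t w"
  using lim C(2) AE_space
 proof eventually_elim
  case (elim w)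
  have "\<forall>\<^sub>F n in sequentially. gap (S n) H w < ennreal (\<delta> / 2)"
   using elim(1) \<delta> by (intro order_tendstoD(2)) auto
  hence "\<forall>\<^sub>F n in sequentially. energy (SP (S n)) w \<le> ennreal (2 * C + \<delta>)"
  proof eventually_elim
   case (elim n)
   have "energy (%s w. (SP (S n) s w - H s w) + H s w) w \<le>
     2 * gap (S n) H w + 2 * energy H w"
    by (intro int_square_add_le progressive_diff simple_process_progressive S D \<open>w \<in> space M\<close>)
   also have "\<dots> \<le> 2 * ennreal (\<delta> / 2) + 2 * ennreal C"
    by (intro add_mono mult_left_mono less_imp_le[OF elim] \<open>energy H w \<le> ennreal C\<close>) auto
   also have "\<dots> = ennreal (2 * C + \<delta>)"
    using C \<delta> by (simp add: ennreal_plus[symmetric] ennreal_numeral[symmetric] ennreal_mult'[symmetric] del: ennreal_plus ennreal_numeral)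
   finally show ?case by simp
  qed
  hence ev: "\<forall>\<^sub>F n in sequentially. \<forall>t. SI (S' n) t w = SI (S n) t w"
   by eventually_elim (use S' in \<open>auto simp: P_def\<close>)
  show ?case
  proof
   fix t assume "t \<in> {0..T}"
   have "(%n. SI (S n) t w) ~> I t w"
    by (rule tendsto_uniform_limitI[OF conjunct2[OF elim(1)] \<open>t \<in> {0..T}\<close>])
   thus "(%n. SI (S' n) t w) ~> I t w"
    by (rule Lim_transform_eventually) (use ev in \<open>auto elim!: eventually_mono\<close>)
  qed
 qed
 thus ?thesis using S' by (intro exI[of _ S']) (simp add: P_def)
qed

text \<open>The isometry bound and the martingale property of simple integrals survive convergence
  in the mean. The factor 2 comes from the truncation level \<open>2 * C + \<delta>\<close> with
  arbitrary \<open>\<delta>\<close>.\<close>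

lemma bounded_energy_martingale:
 assumes I: "ito_integral H I" and C: "0 \<le> C" "AE w in M. energy H w \<le> ennreal C"
 shows "t \<in> {0..T} ==> integrable M (%w. (I t w)^2)" "t \<in> {0..T} ==> expectation (%w. (I t w)^2) \<le> 2 * C"
  "0 \<le> s ==> s \<le> t ==> t \<le> T ==> A \<in> sets (F s) ==> expectation (%w. indicator A w * (I t w - I s w)) = 0"
proof -
 have Im: "t \<in> {0..T} ==> I t \<in> borel_measurable M" for t
  using has_ito_integralD(3)[OF I] progressive_section_M by blast
 have *: "integrable M (%w. (I t w)^2)" "expectation (%w. (I t w)^2) \<le> 2 * C + \<delta>" if \<delta>: "0 < \<delta>" and t: "t \<in> {0..T}" for \<delta> t
 proof -
  obtain S where S: "\<And>n. simple (S n)" "\<And>n w. w \<in> space M ==> energy (SP (S n)) w \<le> ennreal (2 * C + \<delta>)"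
   and lim: "AE w in M. \<forall>t\<in>{0..T}. (%n. SI (S n) t w) ~> I t w"
   using bounded_energy_approximation[OF I C \<delta>] by blast
  have lim_t: "AE w in M. (%n. SI (S n) t w) ~> I t w"
   using lim by eventually_elim (use t in blast)
  have C': "0 \<le> 2 * C + \<delta>" using C \<delta> by simp
  note sb = square_bounded_limit[where f = "%n. SI (S n) t" and g = "I t", OF simple_integral_measurable[OF S(1) t] simple_isometry[OF S(1) t C' S(2)] Im[OF t] lim_t]
  show "integrable M (%w. (I t w)^2)" "expectation (%w. (I t w)^2) \<le> 2 * C + \<delta>"
   using sb(1,2) by blast+
 qed
 show "t \<in> {0..T} ==> integrable M (%w. (I t w)^2)" using *(1)[of 1] by simp
 show "t \<in> {0..T} ==> expectation (%w. (I t w)^2) \<le> 2 * C" by (rule field_le_epsilon) (rule *(2))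
 show "expectation (%w. indicator A w * (I t w - I s w)) = 0" if st: "0 \<le> s" "s \<le> t" "t \<le> T" and A: "A \<in> sets (F s)"
 proof -
  obtain S where S: "\<And>n. simple (S n)" "\<And>n w. w \<in> space M ==> energy (SP (S n)) w \<le> ennreal (2 * C + 1)"
   and lim: "AE w in M. \<forall>t\<in>{0..T}. (%n. SI (S n) t w) ~> I t w"
   using bounded_energy_approximation[OF I C zero_less_one] by blast
  have C': "0 \<le> 2 * C + 1" using C by simp
  have AM: "A \<in> sets M" using subsetD[OF sets_F_M A] st by simp
  have indA: "(indicator A :: 'a => real) \<in> borel_measurable M" using AM by (rule borel_measurable_indicator)
  let ?N = "%n r w. SI (S n) r w"
  have conv: "(%n. expectation (%w. \<bar>?N n r w - I r w\<bar>)) ~> 0" if r: "r \<in> {0..T}" for r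
  proof -
   have "AE w in M. (%n. ?N n r w) ~> I r w" using lim by eventually_elim (use r in blast)
   from square_bounded_limit(3)[where f = "%n. SI (S n) r" and g = "I r", OF simple_integral_measurable[OF S(1) r] simple_isometry[OF S(1) r C' S(2)] Im[OF r] this]
   show ?thesis by blast
  qed
  have int: "integrable M (?N n r)" "integrable M (I r)" if r: "r \<in> {0..T}" for n r
   using square_integrable_imp_integrable[OF simple_integral_measurable[OF S(1) r] simple_isometry(1)[OF S(1) r C' S(2)]]
    square_integrable_imp_integrable[OF Im[OF r] *(1)[OF zero_less_one r]] by blast+
  have ts: "t \<in> {0..T}" "s \<in> {0..T}" using st by auto
  have lim0: "(%n. expectation (%w. \<bar>?N n t w - I t w\<bar>) + expectation (%w. \<bar>?N n s w - I s w\<bar>)) ~> 0 + 0"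
   by (intro tendsto_add conv ts)
  have le: "\<bar>expectation (%w. indicator A w * (I t w - I s w))\<bar> \<le>
   expectation (%w. \<bar>?N n t w - I t w\<bar>) + expectation (%w. \<bar>?N n s w - I s w\<bar>)" for n
  proof -
   have iA: "integrable M (%w. indicator A w * (f w :: real))" if "integrable M f" for f
    using integrable_mult_bounded[OF that indA, of 1] by (simp add: mult.commute indicator_def)
   let ?X = "%w. indicator A w * (I t w - I s w) - indicator A w * (?N n t w - ?N n s w)"
   have "expectation (%w. indicator A w * (I t w - I s w)) =
     expectation (%w. indicator A w * (I t w - I s w)) - expectation (%w. indicator A w * (?N n t w - ?N n s w))"
    by (simp only: simple_martingale[OF S(1) st A] diff_0_right)
   also have "\<dots> = expectation ?X" by (rule Bochner_Integration.integral_diff[symmetric]) (intro iA Bochner_Integration.integrable_diff int ts)+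
   finally have eq: "expectation (%w. indicator A w * (I t w - I s w)) = expectation ?X" .
   have "\<bar>expectation ?X\<bar> \<le> expectation (%w. \<bar>?X w\<bar>)" by (rule integral_abs_bound)
   also have "\<dots> \<le> expectation (%w. \<bar>?N n t w - I t w\<bar> + \<bar>?N n s w - I s w\<bar>)"
   proof (rule integral_mono)
    show "integrable M (%w. \<bar>indicator A w * (I t w - I s w) - indicator A w * (?N n t w - ?N n s w)\<bar>)"
     "integrable M (%w. \<bar>?N n t w - I t w\<bar> + \<bar>?N n s w - I s w\<bar>)"
     by (intro integrable_abs iA Bochner_Integration.integrable_diff Bochner_Integration.integrable_add int ts)+
    show "\<bar>indicator A w * (I t w - I s w) - indicator A w * (?N n t w - ?N n s w)\<bar> \<le> \<bar>?N n t w - I t w\<bar> + \<bar>?N n s w - I s w\<bar>" for w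
     by (cases "w \<in> A"; simp; linarith)
   qed
   also have "\<dots> = expectation (%w. \<bar>?N n t w - I t w\<bar>) + expectation (%w. \<bar>?N n s w - I s w\<bar>)"
    by (intro Bochner_Integration.integral_add integrable_abs Bochner_Integration.integrable_diff int ts)
   finally show ?thesis by (simp only: eq)
  qed
  have "\<bar>expectation (%w. indicator A w * (I t w - I s w))\<bar> \<le> 0 + 0" by (rule LIMSEQ_le_const[OF lim0]) (use le in blast)
  thus ?thesis by simp
 qed
qed

lemma ito_integral_zero:
 assumes I: "ito_integral H I" and H: "AE w in M. AE s in leb T. H s w = 0"
 shows "AE w in M. \<forall>t\<in>{0..T}. I t w = 0"
proof -
 have "AE w in M. energy H w \<le> ennreal 0" using H
 proof eventually_elim
  case (elim w)
  hence "energy H w = (\<integral>\<^sup>+s. 0 \<partial>leb T)"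
   unfolding int_square_eq by (intro nn_integral_cong_AE) (auto elim!: eventually_mono)
  thus ?case by simp
 qed
 note b = bounded_energy_martingale[OF I order_refl this]
 have "AE w in M. \<forall>t\<in>dense_times. I t w = 0"
 proof (rule AE_ball_countable'[OF _ countable_times])
  fix t assume "t \<in> dense_times"
  hence t: "t \<in> {0..T}" using dense_times_subset by auto
  have "expectation (%w. (I t w)^2) = 0"
   using b(2)[OF t] by (intro antisym integral_nonneg_AE) simp_all
  thus "AE w in M. I t w = 0" using integral_nonneg_eq_0_iff_AE[OF b(1)[OF t]] by simp
 qed
 thus ?thesis using has_ito_integralD(4)[OF I]
 proof eventually_elim
  case (elim w)
  show ?case by (rule ballI, rule continuous_eq_times[OF elim(2) continuous_on_const]) (use elim(1) in blast)
 qed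
qed

lemma ito_process_indefinite:
 assumes a: "prog a" "AE w in M. integrable (leb T) (%s. a s w)"
 shows "ito_process (%t w. LBINT s:{0..t}. a s w) a (%_ _. 0)"
proof (rule ito_process_of_integral[OF has_ito_integral_zero borel_measurable_const[of 0] a progressive_integral[OF a(1)]])
 show "AE w in M. \<forall>t\<in>{0..T}. (LBINT s:{0..t}. a s w) = (LBINT s:{0..0}. a s w) + (LBINT s:{0..t}. a s w) + 0"
  by (intro AE_I2 ballI) (simp only: lbint_point add_0_left add_0_right)
qed

end

lemma lbint_leb: "(LBINT s:{0..T}. f s) = integral\<^sup>L (leb T) (f :: real => real)"
 unfolding set_lebesgue_integral_leb[OF order_refl] by (rule Bochner_Integration.integral_cong) (auto simp: space_restrict_space indicator_def)

section \<open>Maximal and energy inequalities under a drift bound\<close>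

context brownian_filtration
begin

text \<open>Doob's inequality: the events \<open>A t\<close> of a first excess at \<open>t\<close>
  are disjoint and known at \<open>t\<close>, so on each of them \<open>Q t\<close> may be replaced
  by \<open>Q T\<close> under the expectation; nonnegativity of \<open>Q T\<close> bounds the
  sum.\<close>

lemma maximal_inequality:
 assumes Q: "\<And>t. t \<in> {0..T} ==> Q t \<in> borel_measurable (F t)" "\<And>t. t \<in> {0..T} ==> integrable M (Q t)"
  and pos: "AE w in M. 0 \<le> Q T w"
  and mart: "\<And>t A. t \<in> {0..T} ==> A \<in> sets (F t) ==> expectation (%w. indicator A w * (Q T w - Q t w)) = 0"
  and R: "finite R" "R \<subseteq> {0..T}" and r: "0 < r"
 shows "prob {w \<in> space M. \<exists>t\<in>R. r < Q t w} \<le> expectation (Q T) / r"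
proof -
 have T: "T \<in> {0..T}" using T_pos by simp
 define A where "A t = {w \<in> space M. r < Q t w \<and> (\<forall>s\<in>{s \<in> R. s < t}. Q s w \<le> r)}" for t
 have At: "A t \<in> sets (F t)" if "t \<in> R" for t
 proof -
  have "Q s \<in> borel_measurable (F t)" if "s \<in> R" "s \<le> t" for s
   by (rule measurable_F_mono[OF _ \<open>s \<le> t\<close> _ Q(1)]) (use that \<open>t \<in> R\<close> R in auto)
  hence "{w \<in> space (F t). r < Q t w \<and> (\<forall>s\<in>{s \<in> R. s < t}. Q s w \<le> r)} \<in> sets (F t)"
   using that R(1) by (intro sets.sets_Collect_conj sets.sets_Collect_finite_All borel_measurable_less borel_measurable_le) auto
  thus ?thesis using that R(2) by (simp add: A_def subset_iff)
 qed
 have AM: "A t \<in> events" if "t \<in> R" for t using subsetD[OF sets_F_M At[OF that]] R(2) that by blast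
 have un: "{w \<in> space M. \<exists>t\<in>R. r < Q t w} = (\<Union>t\<in>R. A t)"
 proof (intro equalityI subsetI)
  fix w assume "w \<in> {w \<in> space M. \<exists>t\<in>R. r < Q t w}"
  hence w: "w \<in> space M" "{t \<in> R. r < Q t w} \<noteq> {}" by auto
  let ?t = "Min {t \<in> R. r < Q t w}"
  have "?t \<in> {t \<in> R. r < Q t w}" using R(1) w(2) by (intro Min_in) auto
  moreover have "Q s w \<le> r" if "s \<in> R" "s < ?t" for s
  proof (rule ccontr)
   assume "\<not> Q s w \<le> r"
   hence "?t \<le> s" using that R(1) by (intro Min_le) auto
   thus False using that by simp
  qed
  ultimately show "w \<in> (\<Union>t\<in>R. A t)" using w(1) by (auto simp: A_def)
 qed (auto simp: A_def)
 have disj: "disjoint_family_on A R" unfolding disjoint_family_on_def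
 proof (intro ballI impI)
  fix s t assume st: "s \<in> R" "t \<in> R" "s \<noteq> t"
  have *: "A u \<inter> A v = {}" if "u \<in> R" "u < v" for u v
  proof (rule equals0I)
   fix w assume "w \<in> A u \<inter> A v"
   hence "r < Q u w" "Q u w \<le> r" using that by (auto simp: A_def)
   thus False by simp
  qed
  show "A s \<inter> A t = {}"
  proof (cases "s < t")
   case False
   thus ?thesis using *[of t s] st by (simp add: Int_commute)
  qed (rule *[OF st(1)])
 qed
 have iA: "integrable M (%w. indicator (A t) w * X w)" if "t \<in> R" "integrable M X" for t and X :: "'a => real"
  using integrable_mult_bounded[OF that(2) borel_measurable_indicator[OF AM[OF that(1)]], of 1] by (simp add: mult.commute indicator_def)
 have "r * prob (A t) \<le> expectation (%w. indicator (A t) w * Q T w)" if t: "t \<in> R" for t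
 proof -
  have tT: "t \<in> {0..T}" using t R(2) by auto
  have "r * prob (A t) = expectation (%w. indicator (A t) w * r)" using AM[OF t] by simp
  also have "\<dots> \<le> expectation (%w. indicator (A t) w * Q t w)" by (intro integral_mono iA t Q(2) tT) (auto simp: A_def indicator_def)
  also have "\<dots> = expectation (%w. indicator (A t) w * Q T w) - expectation (%w. indicator (A t) w * (Q T w - Q t w))"
   using iA[OF t Q(2)[OF tT]] iA[OF t Q(2)[OF T]] by (simp add: right_diff_distrib)
  finally show ?thesis using mart[OF tT At[OF t]] by simp
 qed
 hence "(\<Sum>t\<in>R. r * prob (A t)) \<le> (\<Sum>t\<in>R. expectation (%w. indicator (A t) w * Q T w))" by (rule sum_mono)
 also have "\<dots> = expectation (%w. \<Sum>t\<in>R. indicator (A t) w * Q T w)"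
  by (rule Bochner_Integration.integral_sum[symmetric]) (rule iA[OF _ Q(2)[OF T]])
 also have "\<dots> \<le> expectation (Q T)"
 proof (rule integral_mono_AE)
  show "integrable M (%w. \<Sum>t\<in>R. indicator (A t) w * Q T w)" by (rule Bochner_Integration.integrable_sum) (rule iA[OF _ Q(2)[OF T]])
  show "integrable M (Q T)" by (rule Q(2)[OF T])
  show "AE w in M. (\<Sum>t\<in>R. indicator (A t) w * Q T w) \<le> Q T w" using pos
  proof eventually_elim
   case (elim w)
   have "(\<Sum>t\<in>R. indicator (A t) w * Q T w) = indicator (\<Union>t\<in>R. A t) w * Q T w"
    by (simp add: sum_distrib_right[symmetric] indicator_UN_disjoint[OF R(1) disj])
   thus ?case using elim by (simp add: indicator_def)
  qed
 qed
 also have "(\<Sum>t\<in>R. r * prob (A t)) = r * prob (\<Union>t\<in>R. A t)"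
  using finite_measure_finite_Union[OF R(1) _ disj] AM by (simp add: sum_distrib_left image_subset_iff)
 finally show ?thesis unfolding un using r by (simp add: field_simps)
qed

context
 fixes W D H G c w\<^sub>0
 assumes W: "ito_process W D H" and G: "prog G" and c: "0 \<le> c" and w0: "0 \<le> w\<^sub>0"
  and W_pos: "AE w in M. \<forall>t\<in>{0..T}. 0 \<le> W t w" and W_init: "AE w in M. W 0 w \<le> w\<^sub>0"
  and drift: "AE w in M. AE s in leb T. D s w \<le> c * W s w - (G s w)^2"
begin

text \<open>The martingale part of \<open>W\<close> need not have bounded energy. \<open>W\<close>
  is therefore multiplied by \<open>E\<close>, the exponential of minus the integral of
  \<open>c + H^2 / m\<close>. As \<open>E^2\<close> decreases at least at rate
  \<open>2 / m * (E * H)^2\<close> and falls by at most 1 in all, the energy of \<open>E * H\<close>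
  is at most \<open>m / 2\<close>. The factor \<open>\<theta>\<close> is the final value of
  \<open>E\<close>, a lower bound at all times.\<close>

lemma supermartingale_bounds_discounted:
 fixes m :: nat
 assumes "0 < m"
 defines "\<theta> \<equiv> %w. exp (- c * T - enn2real (energy H w) / m)"
 shows "0 < r ==> prob {w \<in> space M. \<exists>t\<in>dense_times. r < \<theta> w * W t w} \<le> w\<^sub>0 / r"
  "(\<integral>\<^sup>+w. ennreal (\<theta> w) * energy G w \<partial>M) \<le> ennreal w\<^sub>0"
proof -
 note PW = ito_processD[OF W]
 have m: "0 < real m" using assms by simp
 have T: "T \<in> {0..T}" using T_pos by simp
 define a where "a s w = - c - (H s w)^2 / m" for s w
 have pa: "prog a" unfolding a_def by (intro progressive_intros PW)
 have H2: "AE w in M. integrable (leb T) (%s. (H s w)^2)" using PW(5) AE_space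
  by eventually_elim (simp add: int_square_eq integrable_square_iff[OF progressive_path_time[OF PW(3)]])
 have ia: "AE w in M. integrable (leb T) (%s. a s w)"
  using H2 unfolding a_def by eventually_elim (intro Bochner_Integration.integrable_diff integrable_divide_zero finite_measure.integrable_const finite_leb)
 define V where "V t w = (LBINT s:{0..t}. a s w)" for t w
 define E where "E t w = exp (V t w)" for t w
 have V: "ito_process V a (%_ _. 0)" unfolding V_def by (rule ito_process_indefinite[OF pa ia])
 have E0: "E 0 w = 1" for w by (simp only: E_def V_def lbint_point exp_zero)
 have E_pos: "0 < E t w" for t w by (simp add: E_def)
 have V_le: "AE w in M. \<forall>t\<in>{0..T}. - c * T - enn2real (energy H w) / m \<le> V t w \<and> V t w \<le> 0"
  using H2 ia
 proof eventually_elim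
  case (elim w)
  have i: "integrable (leb T) (%s. c + (H s w)^2 / m)"
   using integrable_minus[OF elim(2)] by (simp add: a_def add.commute)
  have e: "integral\<^sup>L (leb T) (%s. (H s w)^2) = enn2real (energy H w)"
   unfolding int_square_eq by (rule integral_eq_nn_integral) (use elim in auto)
  have mT: "measure (leb T) {0..T} = T" using T_pos by (simp add: measure_restrict_space)
  have tot: "integral\<^sup>L (leb T) (%s. c + (H s w)^2 / m) = c * T + enn2real (energy H w) / m"
   using elim(1) finite_measure.integrable_const[OF finite_leb[of T], of c] by (simp add: e mT space_restrict_space)
  show ?case
  proof
   fix t assume t: "t \<in> {0..T}"
   have "V t w = - (\<integral>s. indicator {0..t} s * (c + (H s w)^2 / m) \<partial>leb T)"
    using t unfolding V_def a_def by (simp only: atLeastAtMost_iff set_lebesgue_integral_leb[of t T] integral_minus[symmetric])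
     (simp add: algebra_simps)
   moreover have "0 \<le> (\<integral>s. indicator {0..t} s * (c + (H s w)^2 / m) \<partial>leb T)"
    using c by (intro integral_nonneg_AE AE_I2) simp
   moreover have "(\<integral>s. indicator {0..t} s * (c + (H s w)^2 / m) \<partial>leb T) \<le> integral\<^sup>L (leb T) (%s. c + (H s w)^2 / m)"
    using c by (intro integral_mono i integrable_indicator_mult_time) (auto simp: indicator_def)
   ultimately show "- c * T - enn2real (energy H w) / m \<le> V t w \<and> V t w \<le> 0" unfolding tot by simp
  qed
 qed
 have E: "ito_process E (%s w. E s w * a s w) (%_ _. 0)" by (rule ito_process_eq[OF ito_process_exp[OF V]]) (simp_all add: E_def)
 define d where "d s w = E s w * (D s w + W s w * a s w)" for s w
 have EW: "ito_process (%t w. E t w * W t w) d (%s w. E s w * H s w)"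
  by (rule ito_process_eq[OF ito_process_mult[OF E W]]) (simp_all add: d_def algebra_simps)
 let ?J = "%t w. E t w * W t w - E 0 w * W 0 w - (LBINT s:{0..t}. d s w)"
 note J = ito_process_integral[OF EW]
 have energy: "AE w in M. energy (%s w. E s w * H s w) w \<le> ennreal (m / 2)"
 proof -
  \<comment> \<open>The drift of \<open>E^2\<close>. This process has no martingale part, so the
    integral of \<open>- e\<close> is \<open>1 - (E T)^2\<close>, which is at most 1.\<close>
  define e where "e s w = 2 * (E s w)^2 * a s w" for s w
  have EE: "ito_process (%t w. E t w * E t w) e (%_ _. 0)"
   by (rule ito_process_eq[OF ito_process_mult[OF E E]]) (simp_all add: e_def power2_eq_square)
  have "AE w in M. \<forall>t\<in>{0..T}. E t w * E t w - E 0 w * E 0 w - (LBINT s:{0..t}. e s w) = 0"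
   by (rule ito_integral_zero[OF ito_process_integral[OF EE]]) simp
  with ito_processD(4)[OF EE] show ?thesis
  proof eventually_elim
   case (elim w)
   have "(LBINT s:{0..T}. e s w) = integral\<^sup>L (leb T) (%s. e s w)" by (rule lbint_leb)
   moreover have "E T w * E T w - E 0 w * E 0 w - (LBINT s:{0..T}. e s w) = 0" using elim(2) T by blast
   moreover have "0 \<le> E T w * E T w" by simp
   ultimately have int: "- integral\<^sup>L (leb T) (%s. e s w) \<le> 1" unfolding E0 by linarith
   have "energy (%s w. E s w * H s w) w \<le> (\<integral>\<^sup>+s. ennreal ((m / 2) * (- e s w)) \<partial>leb T)"
    unfolding int_square_eq
   proof (intro nn_integral_mono ennreal_leI)
    fix s
    have "(m / 2) * (- e s w) = (E s w)^2 * (m * c) + (E s w * H s w)^2"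
     using m by (simp add: e_def a_def power2_eq_square field_simps)
    moreover have "0 \<le> (E s w)^2 * (m * c)" using c by simp
    ultimately show "(E s w * H s w)^2 \<le> (m / 2) * (- e s w)" by linarith
   qed
   also have "\<dots> = ennreal (\<integral>s. (m / 2) * (- e s w) \<partial>leb T)"
   proof (rule nn_integral_eq_integral)
    show "integrable (leb T) (%s. (m / 2) * (- e s w))" by (intro integrable_mult_right integrable_minus elim(1))
    have "0 \<le> (m / 2) * (- e s w)" for s
    proof -
     have "- e s w = 2 * ((E s w)^2 * (c + (H s w)^2 / m))" by (simp add: e_def a_def algebra_simps)
     thus ?thesis using m c by simp
    qed
    thus "AE s in leb T. 0 \<le> (m / 2) * (- e s w)" by (intro AE_I2) blast
   qed
   also have "(\<integral>s. (m / 2) * (- e s w) \<partial>leb T) = (m / 2) * (- integral\<^sup>L (leb T) (%s. e s w))" by simp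
   also have "ennreal \<dots> \<le> ennreal (m / 2)"
    using mult_left_mono[OF int, of "m / 2"] by (intro ennreal_leI) simp
   finally show ?case .
  qed
 qed
 note mart = bounded_energy_martingale[OF J _ energy]
 define Q where "Q t w = W 0 w + ?J t w" for t w
 have W0m: "W 0 \<in> borel_measurable (F 0)" by (rule initial_measurable[OF PW(1)])
 have iW0: "integrable M (W 0)"
 proof (rule integrable_const_bound[where B = "w\<^sub>0"])
  show "AE w in M. norm (W 0 w) \<le> w\<^sub>0" using W_pos W_init by eventually_elim (use T_pos in auto)
  show "W 0 \<in> borel_measurable M" by (rule measurable_F_M[OF _ W0m]) (use T_pos in auto)
 qed
 have Jm: "?J t \<in> borel_measurable (F t)" if "t \<in> {0..T}" for t by (rule progressive_section[OF has_ito_integralD(3)[OF J] that])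
 have Jint: "integrable M (?J t)" if "t \<in> {0..T}" for t
  by (rule square_integrable_imp_integrable[OF measurable_F_M[OF that Jm[OF that]] mart(1)[OF _ that]]) simp
 have Qm: "Q t \<in> borel_measurable (F t)" if t: "t \<in> {0..T}" for t
  unfolding Q_def using Jm[OF t] measurable_F_mono[OF order_refl _ _ W0m, of t] t by (intro borel_measurable_add) auto
 have Qi: "integrable M (Q t)" if "t \<in> {0..T}" for t
  unfolding Q_def by (intro Bochner_Integration.integrable_add iW0 Jint that)
 have Qmart: "expectation (%w. indicator A w * (Q T w - Q t w)) = 0" if "t \<in> {0..T}" "A \<in> sets (F t)" for t A
  using mart(3)[OF _ _ _ order_refl that(2)] that(1) by (simp add: Q_def)
 have drift': "AE w in M. AE s in leb T. d s w \<le> - (E s w * (G s w)^2)" using drift W_pos AE_space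
 proof eventually_elim
  case (elim w)
  have "AE s in leb T. s \<in> space (leb T)" by (rule AE_space)
  with elim(1) show ?case
  proof eventually_elim
   case (elim s)
   have "0 \<le> W s w * ((H s w)^2 / m)"
    using \<open>\<forall>t\<in>{0..T}. 0 \<le> W t w\<close> elim(2) m by (simp add: space_restrict_space)
   with elim(1) have "D s w + W s w * a s w \<le> - ((G s w)^2)" by (simp add: a_def algebra_simps)
   from mult_left_mono[OF this, of "E s w"] show ?case using E_pos[of s w] by (simp add: d_def)
  qed
 qed
 have Q_ge: "AE w in M. (\<forall>t\<in>{0..T}. \<theta> w * W t w \<le> Q t w) \<and> ennreal (\<theta> w) * energy G w \<le> ennreal (Q T w)"
  using V_le W_pos drift' ito_processD(4)[OF EW] AE_space
 proof eventually_elim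
  case (elim w)
  note V_bounds = elim(1)
  have d0: "AE s in leb T. d s w \<le> 0"
   using elim(3) by eventually_elim (rule order_trans, assumption, simp add: E_def)
  have Qt: "E t w * W t w \<le> Q t w" if t: "t \<in> {0..T}" for t
  proof -
   have "(\<integral>s. indicator {0..t} s * d s w \<partial>leb T) \<le> (\<integral>s. 0 \<partial>leb T)"
   proof (rule integral_mono_AE)
    show "integrable (leb T) (%s. indicator {0..t} s * d s w)" by (rule integrable_indicator_mult_time[OF elim(4)]) simp
    show "AE s in leb T. indicator {0..t} s * d s w \<le> 0"
     using d0 by eventually_elim (simp add: indicator_def)
   qed simp
   hence "(LBINT s:{0..t}. d s w) \<le> 0" using t by (simp add: set_lebesgue_integral_leb[of t T])
   thus ?thesis unfolding Q_def E0 by simp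
  qed
  have "\<theta> w * W t w \<le> E t w * W t w" if t: "t \<in> {0..T}" for t
   unfolding \<theta>_def E_def using elim(1,2) t by (intro mult_right_mono) auto
  moreover have "ennreal (\<theta> w) * energy G w \<le> ennreal (Q T w)"
  proof -
   have "ennreal (\<theta> w) * energy G w = (\<integral>\<^sup>+s. ennreal (\<theta> w) * ennreal ((G s w)^2) \<partial>leb T)"
    unfolding int_square_eq using progressive_path_time[OF G elim(5)]
    by (intro nn_integral_cmult[symmetric]) (auto intro!: measurable_compose[OF _ measurable_ennreal] borel_measurable_power)
   also have "\<dots> \<le> (\<integral>\<^sup>+s. ennreal (- d s w) \<partial>leb T)"
   proof (rule nn_integral_mono_AE)
    have "AE s in leb T. s \<in> space (leb T)" by (rule AE_space)
    with elim(3) show "AE s in leb T. ennreal (\<theta> w) * ennreal ((G s w)^2) \<le> ennreal (- d s w)"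
    proof eventually_elim
     case (elim s)
     have "\<theta> w \<le> E s w"
      unfolding \<theta>_def E_def using bspec[OF V_bounds] elim(2) by (simp add: space_restrict_space)
     hence "\<theta> w * (G s w)^2 \<le> E s w * (G s w)^2" by (rule mult_right_mono) simp
     also have "\<dots> \<le> - d s w" using elim(1) by linarith
     finally show ?case by (simp add: ennreal_mult[symmetric] \<theta>_def ennreal_leI)
    qed
   qed
   also have "\<dots> = ennreal (\<integral>s. - d s w \<partial>leb T)"
    by (rule nn_integral_eq_integral) (use elim(4) d0 in \<open>auto elim!: eventually_mono\<close>)
   also have "(\<integral>s. - d s w \<partial>leb T) = - (LBINT s:{0..T}. d s w)" unfolding lbint_leb by simp
   also have "\<dots> \<le> Q T w"
   proof -
    have "0 \<le> E T w * W T w" using elim(2) T by (intro mult_nonneg_nonneg less_imp_le[OF E_pos]) auto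
    thus ?thesis unfolding Q_def E0 by simp
   qed
   finally show ?thesis by (simp add: ennreal_leI)
  qed
  ultimately show ?case using Qt by (meson order_trans)
 qed
 have Q_pos: "AE w in M. 0 \<le> Q T w" using Q_ge W_pos
 proof eventually_elim
  case (elim w)
  have "0 \<le> \<theta> w * W T w" using elim(2) T by (simp add: \<theta>_def)
  also have "\<dots> \<le> Q T w" using elim(1) T by blast
  finally show ?case .
 qed
 have EQ: "expectation (Q T) \<le> w\<^sub>0"
 proof -
  have "expectation (%w. indicator (space (F 0)) w * (?J T w - ?J 0 w)) = 0"
   by (rule mart(3)[OF _ order_refl _ order_refl sets.top]) (use T_pos m in auto)
  moreover have "expectation (%w. indicator (space (F 0)) w * (?J T w - ?J 0 w)) = expectation (?J T)"
   using T_pos by (intro Bochner_Integration.integral_cong refl) (simp add: lbint_point del: atLeastAtMost_singleton)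
  ultimately have "expectation (Q T) = expectation (W 0)" unfolding Q_def using iW0 Jint[OF T] by simp
  also have "\<dots> \<le> expectation (%_. w\<^sub>0)" by (rule integral_mono_AE[OF iW0 _ W_init]) simp
  finally show ?thesis by (simp add: prob_space)
 qed
 show "prob {w \<in> space M. \<exists>t\<in>dense_times. r < \<theta> w * W t w} \<le> w\<^sub>0 / r" if r: "0 < r"
 proof -
  have QM: "t \<in> dense_times ==> Q t \<in> borel_measurable M" for t
   using dense_times_subset measurable_F_M[OF _ Qm] by blast
  have "prob {w \<in> space M. \<exists>t\<in>dense_times. r < \<theta> w * W t w} \<le> prob {w \<in> space M. \<exists>t\<in>dense_times. r < Q t w}"
  proof (rule finite_measure_mono_AE)
   show "AE w in M. w \<in> {w \<in> space M. \<exists>t\<in>dense_times. r < \<theta> w * W t w} \<longrightarrow> w \<in> {w \<in> space M. \<exists>t\<in>dense_times. r < Q t w}"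
    using Q_ge by eventually_elim (use dense_times_subset in \<open>auto intro: less_le_trans\<close>)
   show "{w \<in> space M. \<exists>t\<in>dense_times. r < Q t w} \<in> events"
    using QM by (intro sets.sets_Collect_countable_Ex' countable_times borel_measurable_less) auto
  qed
  also have "\<dots> \<le> w\<^sub>0 / r"
  proof (rule countable_union_prob_le[OF countable_times])
   show "{w \<in> space M. r < Q t w} \<in> events" if "t \<in> dense_times" for t
    using QM[OF that] by (intro borel_measurable_less) auto
   fix R assume R: "finite R" "R \<subseteq> dense_times"
   have "prob {w \<in> space M. \<exists>t\<in>R. r < Q t w} \<le> expectation (Q T) / r"
    by (rule maximal_inequality[OF Qm Qi Q_pos Qmart R(1) _ r]) (use R(2) dense_times_subset in auto)
   also have "\<dots> \<le> w\<^sub>0 / r" using EQ r by (intro divide_right_mono) auto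
   finally show "prob {w \<in> space M. \<exists>t\<in>R. r < Q t w} \<le> w\<^sub>0 / r" .
  qed
  finally show ?thesis .
 qed
 have "(\<integral>\<^sup>+w. ennreal (\<theta> w) * energy G w \<partial>M) \<le> (\<integral>\<^sup>+w. ennreal (Q T w) \<partial>M)"
  using Q_ge by (intro nn_integral_mono_AE) (auto elim!: eventually_mono)
 also have "\<dots> = ennreal (expectation (Q T))" by (rule nn_integral_eq_integral[OF Qi[OF T] Q_pos])
 also have "\<dots> \<le> ennreal w\<^sub>0" using EQ by (rule ennreal_leI)
 finally show "(\<integral>\<^sup>+w. ennreal (\<theta> w) * energy G w \<partial>M) \<le> ennreal w\<^sub>0" .
qed

text \<open>As \<open>m\<close> grows, the discount increases to \<open>exp (- c * T)\<close>. The
  maximal bound then follows along increasing events, the energy bound from Fatou's lemma.\<close>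

theorem supermartingale_bounds:
 shows "0 < r ==> prob {w \<in> space M. \<exists>t\<in>dense_times. r < W t w} \<le> exp (c * T) * w\<^sub>0 / r"
  "(\<integral>\<^sup>+w. energy G w \<partial>M) \<le> ennreal (exp (c * T) * w\<^sub>0)"
proof -
 define \<theta> where "\<theta> n w = exp (- c * T - enn2real (energy H w) / Suc n)" for n w
 have \<theta>_pos: "0 < \<theta> n w" for n w by (simp add: \<theta>_def)
 have \<theta>_mono: "\<theta> n w \<le> \<theta> m w" if "n \<le> m" for n m w
  using that by (simp add: \<theta>_def frac_le)
 have \<theta>_lim: "(%n. \<theta> n w) ~> exp (- c * T)" for w
 proof -
  have "(%n. enn2real (energy H w) / Suc n) ~> 0"
   using LIMSEQ_Suc[OF lim_const_over_n[of "enn2real (energy H w)"]] .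
  from tendsto_exp[OF tendsto_diff[OF tendsto_const[of "- c * T"] this]] show ?thesis by (simp add: \<theta>_def)
 qed
 have im: "energy H \<in> borel_measurable M" "energy G \<in> borel_measurable M" by (intro int_square_measurable ito_processD(3)[OF W] G)+
 have \<theta>_meas: "\<theta> n \<in> borel_measurable M" for n
  unfolding \<theta>_def using borel_measurable_enn2real[OF im(1)]
  by (intro measurable_compose[OF _ borel_measurable_exp] borel_measurable_diff borel_measurable_divide borel_measurable_const)
 note b = supermartingale_bounds_discounted[OF zero_less_Suc, folded \<theta>_def]
 show "prob {w \<in> space M. \<exists>t\<in>dense_times. r < W t w} \<le> exp (c * T) * w\<^sub>0 / r" if r: "0 < r"
 proof -
  define l where "l = exp (- c * T) * r"
  have l: "0 < l" using r by (simp add: l_def)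
  let ?A = "%n. {w \<in> space M. \<exists>t\<in>dense_times. l < \<theta> n w * W t w}"
  have A: "?A n \<in> events" for n
   using \<theta>_meas dense_times_subset progressive_section_M[OF ito_processD(1)[OF W]]
   by (intro sets.sets_Collect_countable_Ex' countable_times borel_measurable_less borel_measurable_times) auto
  have "incseq ?A"
  proof (intro incseq_SucI subsetI)
   fix n w assume "w \<in> ?A n"
   then obtain t where t: "w \<in> space M" "t \<in> dense_times" "l < \<theta> n w * W t w" by auto
   hence "0 < \<theta> n w * W t w" using l by linarith
   hence "0 < W t w" using \<theta>_pos[of n w] by (simp add: zero_less_mult_iff)
   hence "\<theta> n w * W t w \<le> \<theta> (Suc n) w * W t w" by (intro mult_right_mono \<theta>_mono) auto
   hence "l < \<theta> (Suc n) w * W t w" using t(3) by linarith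
   thus "w \<in> ?A (Suc n)" using t by blast
  qed
  hence "(%n. prob (?A n)) ~> prob (\<Union>n. ?A n)"
   using A by (intro finite_Lim_measure_incseq) auto
  hence "prob (\<Union>n. ?A n) \<le> w\<^sub>0 / l" by (rule LIMSEQ_le_const2) (use b(1)[OF l] in blast)
  moreover have "prob {w \<in> space M. \<exists>t\<in>dense_times. r < W t w} \<le> prob (\<Union>n. ?A n)"
  proof (rule finite_measure_mono)
   show "(\<Union>n. ?A n) \<in> events" using A by auto
   show "{w \<in> space M. \<exists>t\<in>dense_times. r < W t w} \<subseteq> (\<Union>n. ?A n)"
   proof
    fix w assume "w \<in> {w \<in> space M. \<exists>t\<in>dense_times. r < W t w}"
    then obtain t where t: "w \<in> space M" "t \<in> dense_times" "r < W t w" by auto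
    have "(%n. \<theta> n w * W t w) ~> exp (- c * T) * W t w" by (intro tendsto_mult \<theta>_lim tendsto_const)
    hence "\<forall>\<^sub>F n in sequentially. l < \<theta> n w * W t w"
     by (rule order_tendstoD(1)) (unfold l_def, rule mult_strict_left_mono[OF t(3)], simp)
    then obtain n where "l < \<theta> n w * W t w" by (auto simp: eventually_sequentially)
    thus "w \<in> (\<Union>n. ?A n)" using t by blast
   qed
  qed
  moreover have "w\<^sub>0 / l = exp (c * T) * w\<^sub>0 / r" by (simp add: l_def exp_minus field_simps)
  ultimately show ?thesis by simp
 qed
 \<comment> \<open>Multiplication by an infinite value is not continuous at 0 in
   \<open>ennreal\<close>; finiteness, obtained from the bound for the first discount, lets the
   discount pass to its limit.\<close>
 have fin: "AE w in M. energy G w \<noteq> \<infinity>"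
 proof -
  have "(%w. ennreal (\<theta> 0 w) * energy G w) \<in> borel_measurable M"
   using \<theta>_meas im(2) by (intro borel_measurable_times_ennreal measurable_compose[OF _ measurable_ennreal])
  moreover have "(\<integral>\<^sup>+w. ennreal (\<theta> 0 w) * energy G w \<partial>M) \<noteq> \<infinity>"
   using le_less_trans[OF b(2)[of 0] ennreal_less_top] by (simp add: less_top)
  ultimately have "AE w in M. ennreal (\<theta> 0 w) * energy G w \<noteq> \<infinity>" by (rule nn_integral_PInf_AE)
  thus ?thesis
  proof eventually_elim
   case (elim w)
   moreover have "ennreal (\<theta> 0 w) \<noteq> 0" using \<theta>_pos[of 0 w] by (simp add: not_le)
   ultimately show ?case by (auto simp: ennreal_mult_eq_top_iff)
  qed
 qed
 have "(\<integral>\<^sup>+w. ennreal (exp (- c * T)) * energy G w \<partial>M) = (\<integral>\<^sup>+w. liminf (%n. ennreal (\<theta> n w) * energy G w) \<partial>M)"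
  using fin
 proof (intro nn_integral_cong_AE, eventually_elim)
  case (elim w)
  hence "(%n. energy G w * ennreal (\<theta> n w)) ~> energy G w * ennreal (exp (- c * T))"
   by (intro ennreal_tendsto_cmult tendsto_ennrealI \<theta>_lim) (simp add: less_top)
  from lim_imp_Liminf[OF _ this] show ?case by (simp add: mult.commute)
 qed
 also have "\<dots> \<le> liminf (%n. \<integral>\<^sup>+w. ennreal (\<theta> n w) * energy G w \<partial>M)"
  using \<theta>_meas im(2) by (intro nn_integral_liminf borel_measurable_times_ennreal measurable_compose[OF _ measurable_ennreal])
 also have "\<dots> \<le> limsup (%n. ennreal w\<^sub>0)" by (rule order_trans[OF Liminf_le_Limsup Limsup_mono]) (use b(2) in auto)
 also have "\<dots> = ennreal w\<^sub>0" by (simp add: Limsup_const)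
 finally have "ennreal (exp (- c * T)) * (\<integral>\<^sup>+w. energy G w \<partial>M) \<le> ennreal w\<^sub>0"
  using im(2) by (simp add: nn_integral_cmult)
 hence "ennreal (exp (c * T)) * (ennreal (exp (- c * T)) * (\<integral>\<^sup>+w. energy G w \<partial>M)) \<le> ennreal (exp (c * T)) * ennreal w\<^sub>0"
  by (rule mult_left_mono) simp
 thus "(\<integral>\<^sup>+w. energy G w \<partial>M) \<le> ennreal (exp (c * T) * w\<^sub>0)"
  using w0 by (simp add: mult.assoc[symmetric] ennreal_mult[symmetric] exp_add[symmetric])
qed

end

end

section \<open>A smooth extension of the logarithm\<close>

definition pos_power :: "nat => real => real" where
 "pos_power k y = (max 0 y) ^ k"

lemma pos_power_deriv: "(pos_power (Suc (Suc k)) has_real_derivative real (Suc (Suc k)) * pos_power (Suc k) y) (at y)"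
proof -
 consider "y < 0" | "y = 0" | "0 < y" by linarith
 thus ?thesis
 proof cases
  case 1
  have "((%y::real. 0) has_real_derivative 0) (at y)" by simp
  from has_field_derivative_transform_within_open[OF this open_lessThan[of 0]] 1 show ?thesis by (simp add: pos_power_def max_def)
 next
  case 2
  have "((%h. max 0 h ^ Suc k) \<longlongrightarrow> max 0 (0::real) ^ Suc k) (at 0)" by (intro tendsto_intros)
  hence "((%h. max 0 h ^ Suc k) \<longlongrightarrow> (0::real)) (at 0)" by simp
  hence "((%h. pos_power (Suc (Suc k)) h / h) \<longlongrightarrow> (0::real)) (at 0)"
   by (rule Lim_transform_eventually) (auto simp: pos_power_def eventually_at_filter max_def intro!: always_eventually)
  thus ?thesis unfolding 2 DERIV_def by (simp add: pos_power_def)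
 next
  case 3
  have "((%y::real. y ^ Suc (Suc k)) has_real_derivative real (Suc (Suc k)) * y ^ Suc k) (at y)"
   using DERIV_pow[of "Suc (Suc k)" y] by simp
  from has_field_derivative_transform_within_open[OF this open_greaterThan[of 0]] 3 show ?thesis by (simp add: pos_power_def max_def)
 qed
qed

lemma pos_power_continuous: "continuous_on S (pos_power k)"
 unfolding pos_power_def by (intro continuous_intros)

text \<open>A function of class \<open>C\<^sup>3\<close> on the whole line that extends \<open>ln\<close> from \<open>{a..}\<close>; the quartic term
 keeps the argument of the logarithm positive.\<close>

definition bump :: "real => real => real" where
 "bump a x = x + pos_power 4 (a - x) / a ^ 3"

definition ext_ln :: "real => real => real" where
 "ext_ln a x = ln (bump a x)"

definition ext_ln1 :: "real => real => real" where
 "ext_ln1 a x = (1 - 4 * pos_power 3 (a - x) / a ^ 3) / bump a x"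

definition ext_ln2 :: "real => real => real" where
 "ext_ln2 a x = 12 * pos_power 2 (a - x) / a ^ 3 / bump a x - (ext_ln1 a x)^2"

lemma bump_eq: "a \<le> x ==> bump a x = x"
 by (simp add: bump_def pos_power_def)

lemma ext_ln_eq: "a \<le> x ==> ext_ln a x = ln x" "a \<le> x ==> ext_ln1 a x = 1 / x" "a \<le> x ==> ext_ln2 a x = - (1 / x^2)"
 by (simp_all add: ext_ln_def ext_ln1_def ext_ln2_def bump_eq pos_power_def power_divide)

text \<open>With \<open>v = (a - x) / a\<close> the bound for \<open>- x\<close> amounts to
  \<open>v^4 - 2 * v + 2 \<ge> 0\<close>, whose left side is a sum of squares plus 3/4. The
  comparison with \<open>\<bar>x\<bar>\<close> is what keeps
  \<open>Y * exp (- ext_ln \<delta> X)\<close> bounded by \<open>k\<close> even where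
  \<open>X\<close> is small or negative.\<close>

lemma bump_pos:
 assumes a: "0 < a"
 shows "\<bar>x\<bar> \<le> bump a x" "0 < bump a x"
proof -
 show le: "\<bar>x\<bar> \<le> bump a x"
 proof (cases "a \<le> x")
  case True
  thus ?thesis using a by (simp add: bump_eq)
 next
  case False
  define v where "v = (a - x) / a"
  have v: "0 \<le> v" "x = a * (1 - v)" "a - x = a * v" using a False by (auto simp: v_def field_simps)
  have x: "bump a x = x + a * v ^ 4"
   using a v(1) by (simp add: bump_def pos_power_def v(3) max_def power_mult_distrib power4_eq_xxxx power3_eq_cube)
  have "0 \<le> v ^ 4 - 2 * v + 2"
  proof -
   have "v ^ 4 - 2 * v + 2 = (v^2 - 1/2)^2 + (v - 1)^2 + 3/4" by (simp add: power2_eq_square power_numeral_even algebra_simps)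
   thus ?thesis by (simp add: add_nonneg_nonneg)
  qed
  from mult_left_mono[OF this, of a] a have "- (2 * x) \<le> a * v ^ 4" unfolding v(2) by (simp add: algebra_simps)
  moreover have "0 \<le> a * v ^ 4" using a v by simp
  ultimately show ?thesis unfolding x by linarith
 qed
 show "0 < bump a x"
 proof (cases "x = 0")
  case True
  thus ?thesis using a by (simp add: bump_def pos_power_def)
 qed (use le in linarith)
qed

lemma ext_ln_deriv:
 assumes a: "0 < a"
 shows "(ext_ln a has_real_derivative ext_ln1 a x) (at x)" "(ext_ln1 a has_real_derivative ext_ln2 a x) (at x)"
  "\<exists>f3. continuous_on UNIV f3 \<and> (\<forall>x. (ext_ln2 a has_real_derivative f3 x) (at x))"
proof -
 have p: "((%x. pos_power (Suc (Suc k)) (a - x)) has_real_derivative - (real (Suc (Suc k)) * pos_power (Suc k) (a - x))) (at x)" for k x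
  by (rule DERIV_cong[OF DERIV_chain2[OF pos_power_deriv DERIV_diff[OF DERIV_const DERIV_ident]]]) simp
 have p2: "((%x. pos_power 2 (a - x)) has_real_derivative - (2 * pos_power 1 (a - x))) (at x)" for x
  using p[of 0 x] by (simp add: numeral_2_eq_2)
 have p3: "((%x. pos_power 3 (a - x)) has_real_derivative - (3 * pos_power 2 (a - x))) (at x)" for x
  using p[of 1 x] by (simp add: numeral_2_eq_2 numeral_3_eq_3)
 have p4: "((%x. pos_power 4 (a - x)) has_real_derivative - (4 * pos_power 3 (a - x))) (at x)" for x
  using p[of 2 x] by (simp add: numeral_eq_Suc)
 have b: "bump a x \<noteq> 0" "0 < bump a x" for x using bump_pos(2)[OF a, of x] by simp_all
 have db: "(bump a has_real_derivative 1 - 4 * pos_power 3 (a - x) / a ^ 3) (at x)" for x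
  unfolding bump_def[abs_def] by (rule DERIV_cong[OF DERIV_add[OF DERIV_ident DERIV_cdivide[OF p4]]]) simp
 have db': "1 - 4 * pos_power 3 (a - x) / a ^ 3 = ext_ln1 a x * bump a x" for x
  using b by (simp add: ext_ln1_def)
 show d1: "(ext_ln a has_real_derivative ext_ln1 a x) (at x)"
  unfolding ext_ln_def ext_ln1_def using b(2)[of x] by (auto intro!: derivative_eq_intros db)
 have d2: "(ext_ln1 a has_real_derivative ext_ln2 a x) (at x)" for x
 proof -
  have n: "((%x. 1 - 4 * pos_power 3 (a - x) / a ^ 3) has_real_derivative 12 * pos_power 2 (a - x) / a ^ 3) (at x)"
   by (rule DERIV_cong[OF DERIV_diff[OF DERIV_const DERIV_cdivide[OF DERIV_cmult[OF p3]]]]) simp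
  have "(12 * pos_power 2 (a - x) / a ^ 3 * bump a x - ext_ln1 a x * bump a x * (ext_ln1 a x * bump a x)) / (bump a x * bump a x) = ext_ln2 a x"
   using b(1)[of x] by (simp add: ext_ln2_def power2_eq_square field_simps)
  from DERIV_cong[OF DERIV_divide[OF n db b(1), unfolded db'] this] show ?thesis using b(1) by (simp add: db')
 qed
 thus "(ext_ln1 a has_real_derivative ext_ln2 a x) (at x)" .
 define f3 where "f3 x = 12 * ((- (2 * pos_power 1 (a - x)) / a ^ 3 * bump a x - pos_power 2 (a - x) / a ^ 3 * (1 - 4 * pos_power 3 (a - x) / a ^ 3)) /
   (bump a x * bump a x)) - (ext_ln1 a x * ext_ln2 a x + ext_ln2 a x * ext_ln1 a x)" for x
 have "(ext_ln2 a has_real_derivative f3 x) (at x)" for x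
 proof -
  have "((%x. 12 * (pos_power 2 (a - x) / a ^ 3 / bump a x) - ext_ln1 a x * ext_ln1 a x) has_real_derivative f3 x) (at x)"
   unfolding f3_def by (rule DERIV_cong[OF DERIV_diff[OF DERIV_cmult[OF DERIV_divide[OF DERIV_cdivide[OF p2] db b(1)]] DERIV_mult[OF d2 d2]]]) simp
  thus ?thesis by (simp add: ext_ln2_def[abs_def] power2_eq_square)
 qed
 moreover have "continuous_on UNIV f3" using b(1) a unfolding f3_def ext_ln1_def ext_ln2_def bump_def
  by (intro continuous_intros continuous_on_compose2[OF pos_power_continuous[of UNIV]]) auto
 ultimately show "\<exists>f3. continuous_on UNIV f3 \<and> (\<forall>x. (ext_ln2 a has_real_derivative f3 x) (at x))" by blast
qed

context brownian_filtration
begin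

lemma ito_process_ext_ln:
 assumes X: "ito_process X a H" and r: "0 < r"
 shows "ito_process (%t w. ext_ln r (X t w)) (%s w. ext_ln1 r (X s w) * a s w + ext_ln2 r (X s w) * (H s w)^2 / 2)
  (%s w. ext_ln1 r (X s w) * H s w)"
proof -
 obtain f3 where "continuous_on UNIV f3" "\<And>x. (ext_ln2 r has_real_derivative f3 x) (at x)" using ext_ln_deriv(3)[OF r] by blast
 thus ?thesis by (intro ito_formula[OF X ext_ln_deriv(1,2)[OF r]])
qed

text \<open>Almost every path has a positive minimum, so \<open>ext_ln\<close> with threshold
  \<open>1 / Suc n\<close> agrees with \<open>ln\<close> along it once the threshold is below that
  minimum.\<close>

lemma ito_process_ln:
 assumes X: "ito_process X a H" and pos: "AE w in M. \<forall>t\<in>{0..T}. 0 < X t w"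
 shows "ito_process (%t w. ln (X t w)) (%s w. a s w / X s w - (H s w / X s w)^2 / 2) (%s w. H s w / X s w)"
proof (rule ito_process_eventually[OF ito_process_ext_ln[OF X]])
 note D = ito_processD[OF X]
 show "0 < inverse (real (Suc n))" for n by simp
 show "prog (%t w. ln (X t w))" by (rule progressive_compose[OF D(1)]) simp
 show "prog (%s w. a s w / X s w - (H s w / X s w)^2 / 2)" "prog (%s w. H s w / X s w)" by (intro progressive_intros D)+
 let ?a = "%n. inverse (real (Suc n))"
 show "AE w in M. \<forall>\<^sub>F n in sequentially. (\<forall>t\<in>{0..T}. ext_ln (?a n) (X t w) = ln (X t w)) \<and> (AE s in leb T.
   ext_ln1 (?a n) (X s w) * a s w + ext_ln2 (?a n) (X s w) * (H s w)^2 / 2 = a s w / X s w - (H s w / X s w)^2 / 2 \<and>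
   ext_ln1 (?a n) (X s w) * H s w = H s w / X s w)"
  using pos ito_process_continuous[OF X]
 proof eventually_elim
  case (elim w)
  obtain t0 where t0: "t0 \<in> {0..T}" "\<And>t. t \<in> {0..T} ==> X t0 w \<le> X t w"
   using continuous_attains_inf[OF compact_Icc _ elim(2)] T_pos by auto
  have "\<forall>\<^sub>F n in sequentially. ?a n < X t0 w"
   using elim(1) t0(1) by (intro order_tendstoD(2)[OF LIMSEQ_inverse_real_of_nat]) auto
  thus ?case
  proof (eventually_elim, intro conjI ballI AE_timeI)
   fix n t assume n: "?a n < X t0 w" and t: "t \<in> {0..T}"
   have le: "?a n \<le> X t w" using n t0(2)[OF t] by linarith
   note e = ext_ln_eq[OF le]
   show "ext_ln (?a n) (X t w) = ln (X t w)" "ext_ln1 (?a n) (X t w) * H t w = H t w / X t w"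
    "ext_ln1 (?a n) (X t w) * a t w + ext_ln2 (?a n) (X t w) * (H t w)^2 / 2 = a t w / X t w - (H t w / X t w)^2 / 2"
    unfolding e by (simp_all add: power_divide)
  qed
 qed
qed

end

section \<open>The Lyapunov function\<close>

definition lyapunov :: "real => real => real => real => real => real" where
 "lyapunov c K q l u = K * exp (q * l) - exp (q * l + c * u)"

text \<open>The drift that Ito's formula gives to \<open>lyapunov c K q L U\<close> when
  \<open>L\<close> has drift \<open>a\<close> and diffusion coefficient \<open>\<alpha>\<close>, and
  \<open>U\<close> has drift \<open>d\<close> and diffusion coefficient \<open>z\<close>.\<close>

definition lyapunov_drift :: "real => real => real => real => real => real => real => real => real => real" where
 "lyapunov_drift c K q l u a \<alpha> d z = K * (exp (q * l) * (q * a) + exp (q * l) * (q * \<alpha>)^2 / 2)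
  - (exp (q * l + c * u) * (q * a + c * d) + exp (q * l + c * u) * (q * \<alpha> + c * z)^2 / 2)"

text \<open>\<open>\<beta> - \<alpha>^2 / 2\<close> is the drift of the logarithm of a process with
  relative drift \<open>\<beta>\<close> and relative diffusion \<open>\<alpha>\<close>, and
  \<open>v\<close> is the driver of the bounded component. The growth conditions are those of the
  characteristic equation: linear in \<open>z\<close> for \<open>\<alpha>\<close> and
  \<open>\<beta>\<close>, quadratic for \<open>v\<close>.\<close>

definition lyapunov_bound :: "real => real => real => real => real => real => real => bool" where
 "lyapunov_bound A A0 c K C \<eta> q \<longleftrightarrow>
  (\<forall>l u \<alpha> \<beta> v z. \<bar>u\<bar> \<le> A0 \<longrightarrow> \<bar>\<alpha>\<bar> \<le> A * (1 + \<bar>z\<bar>) \<longrightarrow> \<bar>\<beta>\<bar> \<le> A * (1 + \<bar>z\<bar>) \<longrightarrow> \<bar>v\<bar> \<le> A * (1 + z^2) \<longrightarrow>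
   exp (q * l) \<le> lyapunov c K q l u \<and> lyapunov c K q l u \<le> K * exp (q * l) \<and>
   lyapunov_drift c K q l u (\<beta> - \<alpha>^2 / 2) \<alpha> (- v) z \<le> C * lyapunov c K q l u - \<eta> * exp (q * l) * z^2)"

lemma lyapunov_boundD:
 assumes "lyapunov_bound A A0 c K C \<eta> q" "\<bar>u\<bar> \<le> A0" "\<bar>\<alpha>\<bar> \<le> A * (1 + \<bar>z\<bar>)" "\<bar>\<beta>\<bar> \<le> A * (1 + \<bar>z\<bar>)" "\<bar>v\<bar> \<le> A * (1 + z^2)"
 shows "exp (q * l) \<le> lyapunov c K q l u" "lyapunov c K q l u \<le> K * exp (q * l)"
  "lyapunov_drift c K q l u (\<beta> - \<alpha>^2 / 2) \<alpha> (- v) z \<le> C * lyapunov c K q l u - \<eta> * exp (q * l) * z^2"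
 using assms unfolding lyapunov_bound_def by blast+

text \<open>The weight \<open>c\<close> makes the term \<open>c^2 * z^2 / 2\<close> of the second exponential dominate everything
 quadratic in \<open>z\<close>; the first exponential only restores positivity, and its quadratic contribution
 \<open>K * (q^2 - q) * \<alpha>^2 / 2\<close> is small since \<open>q^2 - q\<close> is.\<close>

lemma lyapunov_estimate:
 assumes A: "1 \<le> A" and A0: "0 \<le> (A0 :: real)"
 shows "\<exists>c K \<epsilon> C \<eta>. 0 < \<epsilon> \<and> \<epsilon> < 1 \<and> 0 < \<eta> \<and> 0 \<le> C \<and> 1 \<le> K \<and>
  lyapunov_bound A A0 c K C \<eta> (1 + \<epsilon>) \<and> lyapunov_bound A A0 c K C \<eta> (- \<epsilon>)"
proof -
 \<comment> \<open>With \<open>c = 20 * A\<close> the gain \<open>c^2 / 2 = 200 * A^2\<close> in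
   front of \<open>z^2\<close> exceeds the contributions \<open>c * A\<close> of the driver and
   \<open>4 * c * A\<close> of the cross variation by \<open>100 * A^2\<close>. For
   \<open>\<bar>u\<bar> \<le> A0\<close> the factor \<open>exp (c * u)\<close> lies between
   \<open>\<eta>\<close> and \<open>K - 1\<close>, so the Lyapunov function is at least
   \<open>exp (q * l)\<close>. Finally \<open>\<epsilon>\<close> makes the contribution of
   \<open>q^2 - q\<close> at most \<open>\<eta> * (1 + z^2)\<close>.\<close>
 define c where "c = 20 * A"
 define \<eta> where "\<eta> = exp (- c * A0)"
 define K where "K = exp (c * A0) + 1"
 define \<epsilon> where "\<epsilon> = \<eta> / (2 * K * A^2)"
 define C where "C = 2 * K * A + (2 * K * A)^2 / \<eta> + \<eta> + 60 * A^2 * K"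
 have c: "0 < c" and \<eta>: "0 < \<eta>" "\<eta> \<le> 1" and K: "2 \<le> K"
  using A A0 by (simp_all add: c_def \<eta>_def K_def)
 have A2: "1 \<le> A^2" using A by simp
 have KA: "4 \<le> 2 * K * A^2" using mult_mono[of 4 "2 * K" 1 "A^2"] K A2 by simp
 have \<epsilon>: "0 < \<epsilon>" "\<epsilon> \<le> 1/4"
 proof -
  have pos: "0 < 2 * K * A^2" using KA by linarith
  thus "0 < \<epsilon>" using \<eta> by (simp add: \<epsilon>_def)
  have "\<eta> * 4 \<le> 2 * K * A^2" using \<eta> KA by linarith
  thus "\<epsilon> \<le> 1/4" using pos by (simp add: \<epsilon>_def divide_le_eq)
 qed
 have C: "0 \<le> C" using K A \<eta> by (simp add: C_def)
 have main: "exp (q * l) \<le> lyapunov c K q l u \<and> lyapunov c K q l u \<le> K * exp (q * l) \<and>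
   lyapunov_drift c K q l u (\<beta> - \<alpha>^2 / 2) \<alpha> (- v) z \<le> C * lyapunov c K q l u - \<eta> * exp (q * l) * z^2"
  if q: "q \<in> {1 + \<epsilon>, - \<epsilon>}" and u: "\<bar>u\<bar> \<le> A0" and \<alpha>: "\<bar>\<alpha>\<bar> \<le> A * (1 + \<bar>z\<bar>)" and \<beta>: "\<bar>\<beta>\<bar> \<le> A * (1 + \<bar>z\<bar>)"
   and v: "\<bar>v\<bar> \<le> A * (1 + z^2)" for q l u \<alpha> \<beta> v z
 proof -
  define E where "E = exp (c * u)"
  have cu: "- (c * A0) \<le> c * u" "c * u \<le> c * A0"
   using mult_left_mono[of "- A0" u c] mult_left_mono[of u A0 c] u c by auto
  have E: "\<eta> \<le> E" "E \<le> K - 1" "0 < E" using cu by (simp_all add: E_def \<eta>_def K_def)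
  have w: "lyapunov c K q l u = exp (q * l) * (K - E)" by (simp add: lyapunov_def E_def exp_add algebra_simps)
  have low: "exp (q * l) \<le> lyapunov c K q l u" and up: "lyapunov c K q l u \<le> K * exp (q * l)"
   unfolding w using E mult_left_mono[of 1 "K - E" "exp (q * l)"] by (simp_all add: algebra_simps)
  have q2: "\<bar>q\<bar> \<le> 2" "0 \<le> q^2 - q" "q^2 - q \<le> 2 * \<epsilon>"
  proof -
   \<comment> \<open>The two exponents are symmetric about 1/2, the axis of \<open>q^2 - q\<close>,
     and so give the same value.\<close>
   have e: "q^2 - q = \<epsilon> + \<epsilon>^2" using q by (auto simp: power2_eq_square algebra_simps)
   have "\<epsilon>^2 \<le> \<epsilon>" using \<epsilon> by (simp add: power2_eq_square mult_left_le)
   thus "\<bar>q\<bar> \<le> 2" "0 \<le> q^2 - q" "q^2 - q \<le> 2 * \<epsilon>" using q \<epsilon> unfolding e by auto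
  qed
  have z1: "\<bar>z\<bar> \<le> (1 + z^2) / 2"
   using zero_le_power2[of "\<bar>z\<bar> - 1"] by (simp add: power2_diff)
  have t1: "(K - E) * (q * \<beta>) \<le> 2 * K * A + \<eta> * z^2 + (2 * K * A)^2 / \<eta>"
  proof -
   have "q * \<beta> \<le> 2 * (A * (1 + \<bar>z\<bar>))"
    using mult_mono[OF q2(1) \<beta>] A by (simp flip: abs_mult)
   hence "(K - E) * (q * \<beta>) \<le> (K - E) * (2 * (A * (1 + \<bar>z\<bar>)))" using E by (intro mult_left_mono) auto
   also have "\<dots> \<le> K * (2 * (A * (1 + \<bar>z\<bar>)))" using E A by (intro mult_right_mono) auto
   also have "\<dots> = 2 * K * A + 2 * K * A * \<bar>z\<bar>" by (simp add: algebra_simps)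
   also have "2 * K * A * \<bar>z\<bar> \<le> \<eta> * z^2 + (2 * K * A)^2 / \<eta>"
   proof -
    have "0 \<le> (\<eta> * \<bar>z\<bar> - K * A)^2 / \<eta>" using \<eta> by simp
    also have "\<dots> = \<eta> * z^2 + (K * A)^2 / \<eta> - 2 * K * A * \<bar>z\<bar>"
     using \<eta> by (simp add: power2_diff power_mult_distrib field_simps) (simp add: power2_eq_square)
    finally have "2 * K * A * \<bar>z\<bar> \<le> \<eta> * z^2 + (K * A)^2 / \<eta>" by simp
    moreover have "(K * A)^2 / \<eta> \<le> (2 * K * A)^2 / \<eta>" using \<eta> by (intro divide_right_mono) (simp_all add: power_mult_distrib)
    ultimately show ?thesis by linarith
   qed
   finally show ?thesis by simp
  qed
  have t2: "(K - E) * ((q^2 - q) * \<alpha>^2 / 2) \<le> \<eta> * (1 + z^2)"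
  proof -
   have "\<alpha>^2 \<le> (A * (1 + \<bar>z\<bar>))^2" using \<alpha> abs_le_square_iff[of \<alpha> "A * (1 + \<bar>z\<bar>)"] A by simp
   also have "\<dots> = A^2 * (1 + \<bar>z\<bar>)^2" by (rule power_mult_distrib)
   also have "\<dots> \<le> A^2 * (2 * (1 + z^2))" using z1 by (intro mult_left_mono) (simp_all add: power2_sum)
   finally have \<alpha>2: "\<alpha>^2 / 2 \<le> A^2 * (1 + z^2)" by (simp add: field_simps)
   have q\<alpha>: "(q^2 - q) * (\<alpha>^2 / 2) \<le> (2 * \<epsilon>) * (A^2 * (1 + z^2))"
    by (intro mult_mono q2 \<alpha>2) (use \<epsilon> in auto)
   have "(K - E) * ((q^2 - q) * (\<alpha>^2 / 2)) \<le> K * ((2 * \<epsilon>) * (A^2 * (1 + z^2)))"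
    by (intro mult_mono q\<alpha>) (use E K q2 in auto)
   also have "\<dots> = (2 * K * A^2 * \<epsilon>) * (1 + z^2)" by simp
   also have "2 * K * A^2 * \<epsilon> = \<eta>" using K A by (simp add: \<epsilon>_def)
   finally show ?thesis by simp
  qed
  have t3: "- (E * (c^2 * z^2 / 2 - c * v + q * c * \<alpha> * z)) \<le> 60 * A^2 * K - 100 * A^2 * \<eta> * z^2"
  proof -
   have "c * v \<le> c * (A * (1 + z^2))" using v c by (intro mult_left_mono) auto
   moreover have "- (q * c * \<alpha> * z) \<le> 2 * c * (A * (1 + 2 * z^2))"
   proof -
    have "\<bar>q * c * \<alpha> * z\<bar> = c * (\<bar>q\<bar> * (\<bar>\<alpha>\<bar> * \<bar>z\<bar>))" using c by (simp add: abs_mult)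
    also have "\<dots> \<le> c * (2 * (A * (1 + \<bar>z\<bar>) * \<bar>z\<bar>))"
     using c q2(1) \<alpha> A by (intro mult_left_mono mult_mono) auto
    also have "A * (1 + \<bar>z\<bar>) * \<bar>z\<bar> = A * (\<bar>z\<bar> + z^2)" by (simp add: power2_eq_square algebra_simps)
    also have "c * (2 * (A * (\<bar>z\<bar> + z^2))) \<le> c * (2 * (A * (1 + 2 * z^2)))"
     using c A z1 by (intro mult_left_mono) auto
    finally show ?thesis by linarith
   qed
   ultimately have "c * v - q * c * \<alpha> * z - c^2 * z^2 / 2 \<le> c * (A * (1 + z^2)) + 2 * c * (A * (1 + 2 * z^2)) - c^2 * z^2 / 2"
    by linarith
   also have "\<dots> = 60 * A^2 - 100 * A^2 * z^2" by (simp add: c_def power2_eq_square algebra_simps)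
   finally have "E * (c * v - q * c * \<alpha> * z - c^2 * z^2 / 2) \<le> E * (60 * A^2 - 100 * A^2 * z^2)"
    using E by (intro mult_left_mono) auto
   also have "\<dots> = 60 * A^2 * E - 100 * A^2 * E * z^2" by (simp add: algebra_simps)
   also have "\<dots> \<le> 60 * A^2 * K - 100 * A^2 * \<eta> * z^2"
    using E by (intro diff_mono mult_left_mono mult_right_mono) auto
   finally show ?thesis by (simp add: algebra_simps)
  qed
  have "lyapunov_drift c K q l u (\<beta> - \<alpha>^2 / 2) \<alpha> (- v) z =
    exp (q * l) * ((K - E) * (q * \<beta>) + (K - E) * ((q^2 - q) * \<alpha>^2 / 2) - E * (c^2 * z^2 / 2 - c * v + q * c * \<alpha> * z))"
   unfolding lyapunov_drift_def exp_add E_def by (simp add: power2_eq_square field_simps)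
  also have "\<dots> \<le> exp (q * l) * (C - \<eta> * z^2)"
  proof (rule mult_left_mono)
   have "1 * (\<eta> * z^2) \<le> A^2 * (\<eta> * z^2)" using A2 \<eta> by (intro mult_right_mono) auto
   thus "(K - E) * (q * \<beta>) + (K - E) * ((q^2 - q) * \<alpha>^2 / 2) - E * (c^2 * z^2 / 2 - c * v + q * c * \<alpha> * z) \<le> C - \<eta> * z^2"
    using t1 t2 t3 mult_nonneg_nonneg[OF less_imp_le[OF \<eta>(1)] zero_le_power2[of z]] unfolding C_def by (simp only: distrib_left mult_1_right)
  qed simp
  also have "\<dots> \<le> C * lyapunov c K q l u - \<eta> * exp (q * l) * z^2"
   using mult_left_mono[OF low C] by (simp add: algebra_simps)
  finally show ?thesis using low up by blast
 qed
 have all: "lyapunov_bound A A0 c K C \<eta> q" if "q \<in> {1 + \<epsilon>, - \<epsilon>}" for q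
  unfolding lyapunov_bound_def by (intro allI impI main that)
 have \<epsilon>K: "\<epsilon> < 1" "1 \<le> K" using \<epsilon> K by simp_all
 show ?thesis by (intro exI[of _ c] exI[of _ K] exI[of _ \<epsilon>] exI[of _ C] exI[of _ \<eta>] conjI \<epsilon> \<epsilon>K \<eta> C all) auto
qed

section \<open>Algebra and growth of the characteristic driver\<close>

definition lin :: "(nat => real) => real => real => real" where
 "lin p y z = p 1 + p 2 * y + p 3 * z"

text \<open>\<open>\<gamma>\<close> is the prospective ratio \<open>Z / X\<close>. The product rule
  for \<open>Y = Yh * X\<close> requires \<open>\<gamma> = z + y * lin s y \<gamma>\<close>, a
  linear equation that is solvable because \<open>1 - s 3 * y \<noteq> 0\<close>; inserting the
  solution into the drift of the product gives the characteristic driver.\<close>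

lemma char_identities:
 fixes b s f :: "nat => real" and y z :: real
 assumes n: "1 - s 3 * y \<noteq> 0"
 defines "\<gamma> \<equiv> (z + y * (s 1 + s 2 * y)) / (1 - s 3 * y)"
 shows "z + y * lin s y \<gamma> = \<gamma>"
  "f 1 + f 2 * y + y * (b 1 + b 2 * y) + (f 3 + b 3 * y) * y * (s 1 + s 2 * y) / (1 - s 3 * y)
   + ((s 1 + f 3) + (s 2 + b 3) * y) / (1 - s 3 * y) * z + s 3 / (1 - s 3 * y) * \<bar>z\<bar>^2
   = lin f y \<gamma> + y * lin b y \<gamma> + z * lin s y \<gamma>"
proof -
 have g: "\<gamma> * (1 - s 3 * y) = z + y * (s 1 + s 2 * y)" using n by (simp add: \<gamma>_def)
 thus "z + y * lin s y \<gamma> = \<gamma>" by (simp add: lin_def algebra_simps)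
 define i where "i = inverse (1 - s 3 * y)"
 have i: "i * (1 - s 3 * y) = 1" using n by (simp add: i_def)
 have gi: "\<gamma> = (z + y * (s 1 + s 2 * y)) * i" by (simp add: \<gamma>_def i_def divide_inverse)
 show "f 1 + f 2 * y + y * (b 1 + b 2 * y) + (f 3 + b 3 * y) * y * (s 1 + s 2 * y) / (1 - s 3 * y)
   + ((s 1 + f 3) + (s 2 + b 3) * y) / (1 - s 3 * y) * z + s 3 / (1 - s 3 * y) * \<bar>z\<bar>^2
   = lin f y \<gamma> + y * lin b y \<gamma> + z * lin s y \<gamma>"
  unfolding divide_inverse i_def[symmetric] lin_def gi power2_abs using i by algebra
qed

text \<open>All powers of \<open>k \<ge> 1\<close> are raised to the sixth, and 16 is 4 times the 4
  in \<open>2 + 3 * \<bar>z\<bar> + z^2 \<le> 4 * (1 + z^2)\<close>. A single constant for all four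
  bounds is wanted, to serve as \<open>A\<close> in the Lyapunov estimate.\<close>

lemma char_bounds:
 fixes b s f :: "nat => real" and y z :: real
 assumes k: "1 \<le> k" and bk: "\<And>i. i \<in> {1, 2, 3} ==> \<bar>b i\<bar> \<le> k" and sk: "\<And>i. i \<in> {1, 2, 3} ==> \<bar>s i\<bar> \<le> k"
  and fk: "\<And>i. i \<in> {1, 2, 3} ==> \<bar>f i\<bar> \<le> k" and y: "\<bar>y\<bar> \<le> k" and n: "\<bar>inverse (1 - s 3 * y)\<bar> \<le> k"
 defines "\<gamma> \<equiv> (z + y * (s 1 + s 2 * y)) / (1 - s 3 * y)"
 shows "\<bar>\<gamma>\<bar> \<le> 16 * k ^ 6 * (1 + \<bar>z\<bar>)" "\<bar>lin s y \<gamma>\<bar> \<le> 16 * k ^ 6 * (1 + \<bar>z\<bar>)" "\<bar>lin b y \<gamma>\<bar> \<le> 16 * k ^ 6 * (1 + \<bar>z\<bar>)"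
  "\<bar>lin f y \<gamma> + y * lin b y \<gamma> + z * lin s y \<gamma>\<bar> \<le> 16 * k ^ 6 * (1 + z^2)"
proof -
 have kp: "k ^ m \<le> k ^ n" if "m \<le> n" for m n using power_increasing[OF that k] .
 let ?w = "1 + \<bar>z\<bar>"
 have \<gamma>: "\<bar>\<gamma>\<bar> \<le> 2 * k ^ 4 * ?w"
 proof -
  have "\<bar>s 1 + s 2 * y\<bar> \<le> k + k * k"
   using sk[of 1] sk[of 2] mult_mono[OF sk[of 2] y] k by (intro order_trans[OF abs_triangle_ineq] add_mono) (auto simp: abs_mult)
  also have "\<dots> \<le> 2 * k ^ 2" using kp[of 1 2] by (simp add: power2_eq_square)
  finally have "\<bar>y * (s 1 + s 2 * y)\<bar> \<le> k * (2 * k ^ 2)" unfolding abs_mult using y k by (intro mult_mono) auto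
  hence "\<bar>z + y * (s 1 + s 2 * y)\<bar> \<le> \<bar>z\<bar> + 2 * k ^ 3"
   using abs_triangle_ineq[of z "y * (s 1 + s 2 * y)"] by (simp add: power3_eq_cube power2_eq_square)
  also have "\<dots> \<le> 2 * k ^ 3 * ?w"
  proof -
   have "1 * \<bar>z\<bar> \<le> (2 * k ^ 3) * \<bar>z\<bar>" using kp[of 0 3] by (intro mult_right_mono) auto
   thus ?thesis by (simp add: distrib_left)
  qed
  finally have "\<bar>\<gamma>\<bar> \<le> (2 * k ^ 3 * ?w) * k"
   unfolding \<gamma>_def divide_inverse abs_mult using n k by (intro mult_mono) auto
  thus ?thesis by (simp add: power_numeral_even power_numeral_odd Let_def mult_ac)
 qed
 have nn: "0 \<le> k ^ n" for n using k by simp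
 have k4: "2 * k ^ 4 \<le> 16 * k ^ 6" "4 * k ^ 5 \<le> 16 * k ^ 6" "k ^ 5 \<le> k ^ 6" "0 \<le> k ^ 5"
  using kp[of 4 6] kp[of 5 6] nn[of 6] nn[of 5] by linarith+
 have lin: "\<bar>lin p y \<gamma>\<bar> \<le> 4 * k ^ 5 * ?w" if p: "\<And>i. i \<in> {1, 2, 3} ==> \<bar>p i\<bar> \<le> k" for p
 proof -
  have "\<bar>p 2 * y\<bar> \<le> k * k" unfolding abs_mult using p[of 2] y k by (intro mult_mono) auto
  moreover have "\<bar>p 3 * \<gamma>\<bar> \<le> k * (2 * k ^ 4 * ?w)" unfolding abs_mult using p[of 3] \<gamma> k by (intro mult_mono) auto
  ultimately have "\<bar>lin p y \<gamma>\<bar> \<le> k + k * k + k * (2 * k ^ 4 * ?w)" using p[of 1] unfolding lin_def by simp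
  also have "\<dots> = k ^ 1 + k ^ 2 + 2 * k ^ 5 * ?w" by (simp add: power_numeral_even power_numeral_odd Let_def power2_eq_square mult_ac)
  also have "\<dots> \<le> 2 * k ^ 5 * 1 + 2 * k ^ 5 * ?w" using kp[of 1 5] kp[of 2 5] by simp
  also have "\<dots> \<le> 2 * k ^ 5 * ?w + 2 * k ^ 5 * ?w" using k4(4) by (intro add_right_mono mult_left_mono) auto
  finally show ?thesis by linarith
 qed
 have up: "4 * k ^ 5 * ?w \<le> 16 * k ^ 6 * ?w" by (intro mult_right_mono k4(2)) simp
 show "\<bar>\<gamma>\<bar> \<le> 16 * k ^ 6 * (1 + \<bar>z\<bar>)" by (rule order_trans[OF \<gamma>], rule mult_right_mono[OF k4(1)]) simp
 show "\<bar>lin s y \<gamma>\<bar> \<le> 16 * k ^ 6 * (1 + \<bar>z\<bar>)" "\<bar>lin b y \<gamma>\<bar> \<le> 16 * k ^ 6 * (1 + \<bar>z\<bar>)"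
  using lin[of s] lin[of b] sk bk up by (blast intro: order_trans)+
 have "\<bar>y * lin b y \<gamma>\<bar> \<le> k * (4 * k ^ 5 * ?w)" unfolding abs_mult using y lin[OF bk] k by (intro mult_mono) auto
 hence yb: "\<bar>y * lin b y \<gamma>\<bar> \<le> 4 * k ^ 6 * ?w" by (simp add: power_numeral_even power_numeral_odd Let_def mult_ac)
 have zs: "\<bar>z * lin s y \<gamma>\<bar> \<le> 4 * k ^ 6 * (?w * \<bar>z\<bar>)"
 proof -
  have "\<bar>z * lin s y \<gamma>\<bar> \<le> \<bar>z\<bar> * (4 * k ^ 5 * ?w)" unfolding abs_mult using lin[OF sk] by (intro mult_left_mono) auto
  also have "\<dots> = 4 * k ^ 5 * (?w * \<bar>z\<bar>)" by simp
  also have "\<dots> \<le> 4 * k ^ 6 * (?w * \<bar>z\<bar>)" using k4 by (intro mult_right_mono) auto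
  finally show ?thesis .
 qed
 have lf: "\<bar>lin f y \<gamma>\<bar> \<le> 4 * k ^ 6 * ?w"
  by (rule order_trans[OF lin[of f, OF fk]], assumption, rule mult_right_mono) (use k4 in simp_all)
 have "\<bar>lin f y \<gamma> + y * lin b y \<gamma> + z * lin s y \<gamma>\<bar> \<le> 4 * k ^ 6 * ?w + 4 * k ^ 6 * ?w + 4 * k ^ 6 * (?w * \<bar>z\<bar>)"
  using yb zs lf by linarith
 also have "\<dots> = 4 * k ^ 6 * (2 + 3 * \<bar>z\<bar> + z^2)" by (simp add: power2_eq_square algebra_simps)
 also have "\<dots> \<le> 4 * k ^ 6 * (4 * (1 + z^2))"
 proof (rule mult_left_mono)
  have z2: "2 * \<bar>z\<bar> \<le> z^2 + 1" using zero_le_power2[of "\<bar>z\<bar> - 1"] by (simp add: power2_diff)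
  have "2 + 3 * p + r \<le> 4 * (1 + r)" if "2 * p \<le> r + 1" "0 \<le> r" for p r :: real using that by simp
  from this[OF z2] show "2 + 3 * \<bar>z\<bar> + z^2 \<le> 4 * (1 + z^2)" by simp
 qed (use k in simp)
 finally show "\<bar>lin f y \<gamma> + y * lin b y \<gamma> + z * lin s y \<gamma>\<bar> \<le> 16 * k ^ 6 * (1 + z^2)" by linarith
qed

context brownian_filtration
begin

lemma ito_process_lyapunov:
 assumes L: "ito_process L a \<alpha>" and U: "ito_process U d \<zeta>"
 shows "\<exists>H. ito_process (%t w. lyapunov c K q (L t w) (U t w))
  (%s w. lyapunov_drift c K q (L s w) (U s w) (a s w) (\<alpha> s w) (d s w) (\<zeta> s w)) H"
proof -
 note E1 = ito_process_cmult[OF ito_process_exp[OF ito_process_cmult[OF L, of q]], of K]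
  and E2 = ito_process_cmult[OF ito_process_exp[OF ito_process_add[OF ito_process_cmult[OF L, of q] ito_process_cmult[OF U, of c]]], of "-1"]
 show ?thesis by (rule exI, rule ito_process_eq[OF ito_process_add[OF E1 E2]]) (simp_all add: lyapunov_def lyapunov_drift_def)
qed

end

lemma lbint_split:
 fixes g :: "real => real"
 assumes g: "integrable (leb T) g" and t: "t \<in> {0..T}"
 shows "(LBINT s:{t..T}. g s) = (LBINT s:{0..T}. g s) - (LBINT s:{0..t}. g s)"
proof -
 have i: "set_integrable lborel A g" if "A \<in> sets borel" "A \<subseteq> {0..T}" for A
  by (rule set_integrable_subset[OF g[folded set_integrable_leb]]) (use that in auto)
 have "(LBINT s:{0..t} \<union> {t..T}. g s) = (LBINT s:{0..t}. g s) + (LBINT s:{t..T}. g s)"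
  using t by (intro set_integral_Un_AE i) (use AE_lborel_singleton[of t] in \<open>auto elim!: eventually_mono\<close>)
 moreover have "{0..t} \<union> {t..T} = {0..T}" using t by auto
 ultimately show ?thesis by simp
qed

lemma linear_growth_integrable:
 fixes z g :: "real => real"
 assumes z: "z \<in> borel_measurable (leb T)" "L2 (leb T) z < \<infinity>"
  and g: "g \<in> borel_measurable (leb T)" "\<And>s. s \<in> {0..T} ==> \<bar>g s\<bar> \<le> A * (1 + \<bar>z s\<bar>)"
 shows "integrable (leb T) (%s. (g s)^2)" "integrable (leb T) g"
proof -
 have iz: "integrable (leb T) (%s. 2 * A^2 * (1 + (z s)^2))"
  using z by (simp add: integrable_square_iff finite_measure.integrable_const[OF finite_leb])
 have sp: "s \<in> space (leb T) ==> s \<in> {0..T}" for s by (simp add: space_restrict_space)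
 have le: "(g s)^2 \<le> 2 * A^2 * (1 + (z s)^2)" if "s \<in> {0..T}" for s
 proof -
  have "(g s)^2 \<le> (A * (1 + \<bar>z s\<bar>))^2" using power_mono[OF g(2)[OF that] abs_ge_zero, of 2] by simp
  also have "\<dots> = A^2 * (1 + \<bar>z s\<bar>)^2" by (rule power_mult_distrib)
  also have "\<dots> \<le> A^2 * (2 * (1 + (z s)^2))"
   using zero_le_power2[of "\<bar>z s\<bar> - 1"] by (intro mult_left_mono) (simp_all add: power2_sum power2_diff)
  finally show ?thesis by (simp add: algebra_simps)
 qed
 show g2: "integrable (leb T) (%s. (g s)^2)"
  by (rule Bochner_Integration.integrable_bound[OF iz]) (use g(1) le sp in \<open>auto intro!: AE_I2\<close>)
 have "\<bar>g s\<bar> \<le> 1 + (g s)^2" for s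
  using zero_le_power2[of "\<bar>g s\<bar> - 1"] by (simp add: power2_diff)
 thus "integrable (leb T) g" by (intro Bochner_Integration.integrable_bound[OF Bochner_Integration.integrable_add[OF
     finite_measure.integrable_const[OF finite_leb[of T], of 1] g2]] AE_I2 g(1)) simp
qed

text \<open>Dyadic layers: with \<open>A n\<close> the event that some \<open>X t\<close> exceeds
  \<open>2 ^ n\<close>, the sum of \<open>2 powr (p * (n + 1))\<close> over the layers reached
  dominates \<open>X t powr p\<close> for all \<open>t\<close> at once; positive values up to 1 are
  covered by the summand 1. The mean of the sum is dominated by a geometric series of ratio
  \<open>2 powr (p - q) < 1\<close>.\<close>

lemma (in prob_space) weak_moment_bound:
 fixes X :: "real => 'a => real"
 assumes R: "countable R" "\<And>t. t \<in> R ==> X t \<in> borel_measurable M" and p: "0 < p" "p < q" and C: "0 \<le> C"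
  and tail: "\<And>r. 0 < r ==> prob {w \<in> space M. \<exists>t\<in>R. r < X t w} \<le> C / r powr q"
 shows "\<exists>N \<in> borel_measurable M. (\<integral>\<^sup>+w. N w \<partial>M) < \<infinity> \<and> (\<forall>w\<in>space M. \<forall>t\<in>R. ennreal (X t w powr p) \<le> 1 + N w \<or> X t w \<le> 0)"
proof -
 define A where "A n = {w \<in> space M. \<exists>t\<in>R. 2 ^ n < X t w}" for n :: nat
 define N where "N w = (\<Sum>n. ennreal (2 powr (p * (n + 1))) * indicator (A n) w)" for w
 have A: "A n \<in> events" for n
  unfolding A_def using R by (intro sets.sets_Collect_countable_Ex' borel_measurable_less) auto
 have N: "N \<in> borel_measurable M"
  unfolding N_def using A by (intro borel_measurable_suminf_order borel_measurable_times_ennreal) auto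
 have "(\<integral>\<^sup>+w. N w \<partial>M) = (\<Sum>n. ennreal (2 powr (p * (n + 1))) * ennreal (prob (A n)))"
  unfolding N_def using A by (subst nn_integral_suminf) (auto simp: nn_integral_cmult emeasure_eq_measure)
 also have "\<dots> \<le> (\<Sum>n. ennreal (C * 2 powr p * (2 powr (p - q)) ^ n))"
 proof (intro suminf_le summableI)
  fix n
  have "2 powr (p * (n + 1)) * prob (A n) \<le> 2 powr (p * (n + 1)) * (C / (2 ^ n) powr q)"
   using tail[of "2 ^ n"] by (intro mult_left_mono) (auto simp: A_def)
  also have "\<dots> = C * 2 powr p * (2 powr (p - q)) ^ n"
   by (simp add: powr_realpow[symmetric] powr_powr powr_add[symmetric] powr_diff[symmetric] divide_powr_uminus) (simp add: algebra_simps)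
  finally show "ennreal (2 powr (p * (n + 1))) * ennreal (prob (A n)) \<le> ennreal (C * 2 powr p * (2 powr (p - q)) ^ n)"
   by (simp add: ennreal_mult[symmetric] ennreal_leI add.commute)
 qed
 also have "\<dots> < \<infinity>"
 proof -
  have "(2 :: real) powr (p - q) < 2 powr 0" using p by (intro powr_less_mono) auto
  hence "summable (%n. C * 2 powr p * (2 powr (p - q)) ^ n)" by (intro summable_mult summable_geometric) simp
  thus ?thesis using C by (subst suminf_ennreal2) auto
 qed
 finally have fin: "(\<integral>\<^sup>+w. N w \<partial>M) < \<infinity>" .
 have "ennreal (X t w powr p) \<le> 1 + N w" if w: "w \<in> space M" and t: "t \<in> R" and pos: "0 < X t w" for w t
 proof (cases "X t w \<le> 1")
  case True
  hence "X t w powr p \<le> 1" using pos p by (simp add: powr_le1)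
  hence "ennreal (X t w powr p) \<le> 1" by (simp add: ennreal_le_1)
  thus ?thesis by (rule order_trans) simp
 next
  case False
  define n where "n = nat (\<lceil>log 2 (X t w)\<rceil> - 1)"
  have l: "0 < log 2 (X t w)" using False by simp
  hence "1 \<le> \<lceil>log 2 (X t w)\<rceil>" by linarith
  hence n: "real n = of_int \<lceil>log 2 (X t w)\<rceil> - 1" by (simp add: n_def)
  have n1: "real n < log 2 (X t w)" "log 2 (X t w) \<le> real n + 1" unfolding n by linarith+
  have "2 powr real n < X t w" using n1(1) pos by (simp add: less_log_iff)
  hence "w \<in> A n" using w t by (auto simp: A_def powr_realpow)
  have "X t w \<le> 2 powr (real n + 1)" using n1(2) pos by (simp add: log_le_iff)
  hence "X t w powr p \<le> (2 powr (real n + 1)) powr p" using pos p by (intro powr_mono2) auto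
  also have "\<dots> = 2 powr (p * (real n + 1))" by (simp add: powr_powr mult.commute)
  finally have "ennreal (X t w powr p) \<le> ennreal (2 powr (p * (n + 1))) * indicator (A n) w"
   using \<open>w \<in> A n\<close> by (simp add: ennreal_leI add.commute)
  also have "\<dots> \<le> N w"
  proof -
   have "(\<Sum>i\<in>{n}. f i) \<le> suminf f" for f :: "nat => ennreal" by (rule sum_le_suminf) auto
   thus ?thesis unfolding N_def by (simp only: sum.insert finite.emptyI empty_iff not_False_eq_True sum.empty add_0_right)
  qed
  finally show ?thesis by (simp add: add_increasing)
 qed
 thus ?thesis using N fin by (intro bexI[of _ N]) (auto simp: not_le)
qed

section \<open>Backward equations as Ito processes\<close>

context brownian_filtration
begin

lemma has_ito_integral_initial:
 assumes "ito_integral H I"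
 shows "AE w in M. I 0 w = 0"
proof -
 obtain S where S: "\<And>n. simple (S n)" "AE w in M. approx S H I w"
  using has_ito_integral_AE[OF assms] by blast
 from S(2) show ?thesis
 proof eventually_elim
  case (elim w)
  have "(%n. SI (S n) 0 w) ~> I 0 w" by (rule tendsto_uniform_limitI[OF conjunct2[OF elim]]) (use T_pos in simp)
  thus ?case unfolding simple_integral_zero[OF S(1)] by (simp add: LIMSEQ_const_iff)
 qed
qed

text \<open>\<open>g'\<close> is the driver as written in the equation, \<open>g\<close> a
  progressive version equal to it on almost every path. The equation at \<open>T\<close> gives the
  terminal value, and subtracting its form at 0 turns it into a forward equation.\<close>

lemma ito_process_of_backward:
 assumes Y: "prog Y" and g: "prog g" and J: "ito_integral Z J"
  and i: "AE w in M. set_integrable lborel {0..T} (%s. g' s w)" and eq: "AE w in M. \<forall>s\<in>{0..T}. g' s w = g s w"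
  and Y_eq: "AE w in M. \<forall>t\<in>{0..T}. Y t w = \<xi> w + (LBINT s:{t..T}. g' s w) - (J T w - J t w)"
 shows "ito_process Y (%s w. - g s w) Z" "AE w in M. Y T w = \<xi> w"
proof -
 have ig: "AE w in M. integrable (leb T) (%s. g s w)" using i eq
 proof eventually_elim
  case (elim w)
  have "set_integrable lborel {0..T} (%s. g' s w) = set_integrable lborel {0..T} (%s. g s w)"
   by (rule set_integrable_cong[OF refl refl bspec[OF elim(2)]])
  with elim(1) show ?case unfolding set_integrable_leb by blast
 qed
 have main: "AE w in M. Y T w = \<xi> w \<and> (\<forall>t\<in>{0..T}. Y t w = Y 0 w + (LBINT s:{0..t}. - g s w) + J t w)"
  using Y_eq eq ig has_ito_integral_initial[OF J]
 proof eventually_elim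
  case (elim w)
  have c: "(LBINT s:{t..T}. g' s w) = (LBINT s:{t..T}. g s w)" if "t \<in> {0..T}" for t
   by (rule set_lebesgue_integral_cong) (use elim(2) that in auto)
  have Yt: "Y t w = \<xi> w + (LBINT s:{0..T}. g s w) - (LBINT s:{0..t}. g s w) - (J T w - J t w)" if t: "t \<in> {0..T}" for t
  proof -
   have "Y t w = \<xi> w + (LBINT s:{t..T}. g' s w) - (J T w - J t w)" by (rule bspec[OF elim(1) t])
   thus ?thesis unfolding c[OF t] lbint_split[OF elim(3) t] by simp
  qed
  have m: "(LBINT s:{0..t}. - g s w) = - (LBINT s:{0..t}. g s w)" for t
   unfolding set_lebesgue_integral_def by simp
  have T: "0 \<in> {0..T}" "T \<in> {0..T}" using T_pos by auto
  have 0: "Y 0 w = \<xi> w + (LBINT s:{0..T}. g s w) - J T w" using Yt[OF T(1)] elim(4) unfolding lbint_point by simp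
  show ?case
  proof (intro conjI ballI)
   show "Y T w = \<xi> w" using Yt[OF T(2)] by simp
   show "Y t w = Y 0 w + (LBINT s:{0..t}. - g s w) + J t w" if t: "t \<in> {0..T}" for t
    unfolding m Yt[OF t] 0 by simp
  qed
 qed
 show "ito_process Y (%s w. - g s w) Z"
 proof (rule ito_process_of_integral[OF J borel_measurable_const[of 0] progressive_uminus[OF g] _ Y])
  show "AE w in M. integrable (leb T) (%s. - g s w)" by (rule eventually_mono[OF ig]) simp
  show "AE w in M. \<forall>t\<in>{0..T}. Y t w = Y 0 w + (LBINT s:{0..t}. - g s w) + J t w" by (rule eventually_mono[OF main]) blast
 qed
 show "AE w in M. Y T w = \<xi> w" using main by (rule eventually_mono) blast
qed

lemma backward_of_ito_process:
 assumes Y: "ito_process Y (%s w. - g s w) Z" and \<xi>: "AE w in M. Y T w = \<xi> w" and eq: "AE w in M. \<forall>s\<in>{0..T}. g' s w = g s w"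
 shows "AE w in M. set_integrable lborel {0..T} (%s. g' s w)"
  "\<exists>J. ito_integral Z J \<and>
   (AE w in M. \<forall>t\<in>{0..T}. Y t w = \<xi> w + (LBINT s:{t..T}. g' s w) - (J T w - J t w))"
proof -
 have ig: "AE w in M. integrable (leb T) (%s. g s w)"
  using ito_processD(4)[OF Y] by eventually_elim simp
 with eq show "AE w in M. set_integrable lborel {0..T} (%s. g' s w)"
 proof eventually_elim
  case (elim w)
  have "set_integrable lborel {0..T} (%s. g' s w) = set_integrable lborel {0..T} (%s. g s w)"
   by (rule set_integrable_cong[OF refl refl bspec[OF elim(1)]])
  with elim(2) show ?case unfolding set_integrable_leb by blast
 qed
 obtain J where J: "ito_integral Z J" "AE w in M. \<forall>t\<in>{0..T}. Y t w = Y 0 w + (LBINT s:{0..t}. - g s w) + J t w"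
  using Y unfolding ito_process_def by blast
 have "AE w in M. \<forall>t\<in>{0..T}. Y t w = \<xi> w + (LBINT s:{t..T}. g' s w) - (J T w - J t w)"
  using J(2) \<xi> eq ig
 proof eventually_elim
  case (elim w)
  have m: "(LBINT s:{0..t}. - g s w) = - (LBINT s:{0..t}. g s w)" for t
   unfolding set_lebesgue_integral_def by simp
  have Yr: "Y r w = Y 0 w - (LBINT s:{0..r}. g s w) + J r w" if "r \<in> {0..T}" for r
   using bspec[OF elim(1) that] unfolding m by simp
  show ?case
  proof
   fix t assume t: "t \<in> {0..T}"
   have "(LBINT s:{t..T}. g' s w) = (LBINT s:{t..T}. g s w)" by (rule set_lebesgue_integral_cong) (use elim(3) t in auto)
   moreover have "T \<in> {0..T}" using T_pos by simp
   ultimately show "Y t w = \<xi> w + (LBINT s:{t..T}. g' s w) - (J T w - J t w)"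
    using Yr[OF t] Yr[of T] elim(2) by (simp only: lbint_split[OF elim(4) t])
  qed
 qed
 thus "\<exists>J. ito_integral Z J \<and>
   (AE w in M. \<forall>t\<in>{0..T}. Y t w = \<xi> w + (LBINT s:{t..T}. g' s w) - (J T w - J t w))" using J(1) by blast
qed

text \<open>For \<open>L\<close> the logarithm of \<open>X\<close> this is the quotient
  \<open>Y / X\<close>; stated with \<open>L\<close>, it applies equally to the smooth extension of
  the logarithm.\<close>

lemma ito_process_quotient:
 assumes L: "ito_process L a \<alpha>" and Y: "ito_process Y d Z"
 shows "ito_process (%t w. Y t w * exp (- L t w))
  (%s w. exp (- L s w) * (d s w - Y s w * a s w + Y s w * (\<alpha> s w)^2 / 2 - Z s w * \<alpha> s w))
  (%s w. exp (- L s w) * (Z s w - Y s w * \<alpha> s w))"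
 by (rule ito_process_eq[OF ito_process_mult[OF Y ito_process_exp[OF ito_process_cmult[OF L, of "-1"]]]])
  (simp_all add: algebra_simps)

end

section \<open>The two implications\<close>

text \<open>Pathwise interpolation. With \<open>m\<close> bounding both \<open>X powr p\<close> and
  the energy of \<open>g\<close>, the energy of \<open>Z\<close> is at most a constant times
  \<open>m powr (2 / p)\<close>, because \<open>(2 - q) / p + 1 \<le> 2 / p\<close> for
  \<open>p \<le> q\<close>. Its power \<open>p / 2\<close> is then linear in \<open>m\<close>, so
  integrability of \<open>m\<close> suffices.\<close>

lemma energy_powr_bound:
 fixes X Z g :: "real => real"
 assumes p: "1 < p" "p < q" "q < 2" and m: "1 \<le> m" and T: "0 < T" and V: "0 \<le> V"
  and X: "\<And>s. s \<in> {0..T} ==> 0 < X s" "\<And>s. s \<in> {0..T} ==> X s powr p \<le> m"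
  and Z: "\<And>s. s \<in> {0..T} ==> (Z s)^2 \<le> V * ((X s)^2 + X s powr (2 - q) * (g s)^2)"
  and g: "g \<in> borel_measurable (leb T)" "L2 (leb T) g \<le> ennreal m"
 shows "ennreal_powr (L2 (leb T) Z) (p / 2) \<le> ennreal ((1 + V * (T + 1)) * m)"
proof -
 define c where "c = V * (T + 1)"
 have c: "0 \<le> c" using V T by (simp add: c_def)
 have Xr: "X s powr r \<le> m powr (r / p)" if "s \<in> {0..T}" "0 \<le> r" for s r
 proof -
  have "(X s powr p) powr (r / p) \<le> m powr (r / p)" using X(2)[OF that(1)] that p by (intro powr_mono2) auto
  thus ?thesis using p by (simp add: powr_powr)
 qed
 have "L2 (leb T) Z \<le>
   (\<integral>\<^sup>+s. ennreal (V * m powr (2 / p)) + ennreal (V * m powr ((2 - q) / p)) * ennreal ((g s)^2) \<partial>leb T)"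
 proof (rule nn_integral_mono)
  fix s assume "s \<in> space (leb T)"
  hence s: "s \<in> {0..T}" by (simp add: space_restrict_space)
  have "(X s)^2 \<le> m powr (2 / p)" using Xr[OF s, of 2] X(1)[OF s] by (simp add: powr_numeral)
  moreover have "X s powr (2 - q) * (g s)^2 \<le> m powr ((2 - q) / p) * (g s)^2" using Xr[OF s, of "2 - q"] p by (intro mult_right_mono) auto
  ultimately have "V * ((X s)^2 + X s powr (2 - q) * (g s)^2) \<le> V * (m powr (2 / p) + m powr ((2 - q) / p) * (g s)^2)"
   using V by (intro mult_left_mono add_mono) auto
  with Z[OF s] have "(Z s)^2 \<le> V * m powr (2 / p) + V * m powr ((2 - q) / p) * (g s)^2" by (simp add: distrib_left mult.assoc)
  hence "ennreal ((Z s)^2) \<le> ennreal (V * m powr (2 / p) + V * m powr ((2 - q) / p) * (g s)^2)" by (rule ennreal_leI)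
  thus "ennreal ((Z s)^2) \<le> ennreal (V * m powr (2 / p)) + ennreal (V * m powr ((2 - q) / p)) * ennreal ((g s)^2)"
   using V by (simp add: ennreal_plus ennreal_mult)
 qed
 also have "\<dots> = ennreal (V * m powr (2 / p)) * ennreal T + ennreal (V * m powr ((2 - q) / p)) * L2 (leb T) g"
 proof -
  have g2: "(%s. ennreal ((g s)^2)) \<in> borel_measurable (leb T)"
   by (rule measurable_compose[OF borel_measurable_power[OF g(1)] measurable_ennreal])
  have "emeasure (leb T) (space (leb T)) = ennreal T"
   using T by (simp add: emeasure_restrict_space space_restrict_space)
  thus ?thesis using g2 by (simp add: nn_integral_add nn_integral_cmult)
 qed
 also have "\<dots> \<le> ennreal (V * m powr (2 / p)) * ennreal T + ennreal (V * m powr ((2 - q) / p)) * ennreal m"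
  by (intro add_left_mono mult_left_mono g(2)) simp
 also have "\<dots> = ennreal (V * m powr (2 / p) * T + V * (m powr ((2 - q) / p) * m))"
  using V T m by (simp add: ennreal_plus ennreal_mult mult.assoc)
 also have "\<dots> \<le> ennreal (c * m powr (2 / p))"
 proof (rule ennreal_leI)
  have "m powr ((2 - q) / p) * m = m powr ((2 - q) / p + 1)" using m by (simp add: powr_add)
  also have "\<dots> \<le> m powr (2 / p)" using m p by (intro powr_mono) (simp_all add: field_simps)
  finally have "V * (m powr ((2 - q) / p) * m) \<le> V * m powr (2 / p)" using V by (rule mult_left_mono)
  thus "V * m powr (2 / p) * T + V * (m powr ((2 - q) / p) * m) \<le> c * m powr (2 / p)" by (simp add: c_def algebra_simps)
 qed
 finally have le: "L2 (leb T) Z \<le> ennreal (c * m powr (2 / p))" .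
 hence fin: "L2 (leb T) Z \<noteq> \<infinity>" by (auto simp: top_unique)
 have "enn2real (L2 (leb T) Z) \<le> c * m powr (2 / p)"
  using enn2real_mono[OF le] c by simp
 hence "enn2real (L2 (leb T) Z) powr (p / 2) \<le> (c * m powr (2 / p)) powr (p / 2)"
  using p by (intro powr_mono2) auto
 also have "\<dots> = c powr (p / 2) * m" using c m p by (simp add: powr_mult powr_powr)
 also have "\<dots> \<le> (1 + c) * m"
 proof (rule mult_right_mono)
  show "c powr (p / 2) \<le> 1 + c"
  proof (cases "c \<le> 1")
   case True
   hence "c powr (p / 2) \<le> 1" using c p by (intro powr_le1) auto
   thus ?thesis using c by simp
  next
   case False
   hence "c powr (p / 2) \<le> c powr 1" using p by (intro powr_mono) auto
   thus ?thesis using False by simp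
  qed
 qed (use m in simp)
 finally show ?thesis unfolding ennreal_powr_def c_def using fin by (simp add: ennreal_leI)
qed

section \<open>From the characteristic equation to the linear system\<close>

context brownian_filtration
begin

lemma ito_process_of_ito_integral:
 assumes I: "ito_integral H I"
 shows "ito_process I (%_ _. 0) H"
proof (rule ito_process_of_integral[OF I borel_measurable_const[of 0] progressive_const _ has_ito_integralD(3)[OF I]])
 show "AE w in M. \<forall>t\<in>{0..T}. I t w = I 0 w + (LBINT s:{0..t}. 0) + I t w"
  using has_ito_integral_initial[OF I] by eventually_elim simp
qed simp

lemma progressive_lin:
 assumes "\<And>i. i \<in> {1, 2, 3} ==> prog (p i)" "prog y" "prog z"
 shows "prog (%s w. lin (%i. p i s w) (y s w) (z s w))"
 unfolding lin_def using assms by (intro progressive_intros) auto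

context
 fixes b \<sigma> f :: "nat => real => 'a => real" and h :: "'a => real" and k :: real
 assumes prog: "\<And>i. i \<in> {1, 2, 3} ==> prog (b i)" "\<And>i. i \<in> {1, 2, 3} ==> prog (\<sigma> i)"
   "\<And>i. i \<in> {1, 2, 3} ==> prog (f i)"
  and k: "1 \<le> k" and bounds: "AE w in M. \<forall>t\<in>{0..T}. \<forall>i\<in>{1, 2, 3}. \<bar>b i t w\<bar> \<le> k \<and> \<bar>\<sigma> i t w\<bar> \<le> k \<and> \<bar>f i t w\<bar> \<le> k"
begin

theorem linear_fbsde_of_char_bsde:
 assumes char: "solves_char_bsde M F B T b \<sigma> f h Yh Zh"
  and Yh: "AE w in M. \<forall>t\<in>{0..T}. \<bar>Yh t w\<bar> \<le> k \<and> 1 - \<sigma> 3 t w * Yh t w \<noteq> 0 \<and> \<bar>inverse (1 - \<sigma> 3 t w * Yh t w)\<bar> \<le> k"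
 shows "\<exists>X Y Z. solves_linear_fbsde M F B T b \<sigma> f h X Y Z \<and> (X, Y, Z) \<in> (\<Union>q\<in>{1<..}. Lq_space M F T q) \<and>
  (\<forall>t w. X t w \<noteq> 0 \<and> Y t w = Yh t w * X t w \<and>
   Z t w = (Zh t w + Yh t w * (\<sigma> 1 t w + \<sigma> 2 t w * Yh t w)) / (1 - \<sigma> 3 t w * Yh t w) * X t w)"
proof -
 define A where "A = 16 * k ^ 6"
 have A: "1 \<le> A" using one_le_power[OF k, of 6] by (simp add: A_def)
 obtain J where prYZ: "prog Yh" "prog Zh" and J: "ito_integral Zh J"
  and drv: "AE w in M. set_integrable lborel {0..T} (%s. char_driver b \<sigma> f s w (Yh s w) (Zh s w))"
  and Y_eq: "AE w in M. \<forall>t\<in>{0..T}. Yh t w = h w + (LBINT s:{t..T}. char_driver b \<sigma> f s w (Yh s w) (Zh s w)) - (J T w - J t w)"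
  using char unfolding solves_char_bsde_def by blast
 define \<gamma> where "\<gamma> s w = (Zh s w + Yh s w * (\<sigma> 1 s w + \<sigma> 2 s w * Yh s w)) / (1 - \<sigma> 3 s w * Yh s w)" for s w
 define \<alpha> where "\<alpha> s w = lin (%i. \<sigma> i s w) (Yh s w) (\<gamma> s w)" for s w
 define \<beta> where "\<beta> s w = lin (%i. b i s w) (Yh s w) (\<gamma> s w)" for s w
 define \<phi> where "\<phi> s w = lin (%i. f i s w) (Yh s w) (\<gamma> s w)" for s w
 define v where "v s w = \<phi> s w + Yh s w * \<beta> s w + Zh s w * \<alpha> s w" for s w
 have \<gamma>: "prog \<gamma>" unfolding \<gamma>_def by (intro progressive_intros prYZ prog) auto
 have p\<alpha>: "prog \<alpha>" and p\<beta>: "prog \<beta>" and p\<phi>: "prog \<phi>"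
  unfolding \<alpha>_def \<beta>_def \<phi>_def by (intro progressive_lin prog prYZ \<gamma>; assumption)+
 have pv: "prog v" unfolding v_def by (intro progressive_intros p\<alpha> p\<beta> p\<phi> prYZ)
 have est: "AE w in M. \<forall>s\<in>{0..T}. \<bar>\<gamma> s w\<bar> \<le> A * (1 + \<bar>Zh s w\<bar>) \<and> \<bar>\<alpha> s w\<bar> \<le> A * (1 + \<bar>Zh s w\<bar>) \<and>
   \<bar>\<beta> s w\<bar> \<le> A * (1 + \<bar>Zh s w\<bar>) \<and> \<bar>v s w\<bar> \<le> A * (1 + (Zh s w)^2) \<and>
   char_driver b \<sigma> f s w (Yh s w) (Zh s w) = v s w \<and> Zh s w + Yh s w * \<alpha> s w = \<gamma> s w"
  using bounds Yh
 proof eventually_elim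
  case (elim w)
  show ?case
  proof
   fix s assume s: "s \<in> {0..T}"
   note e = bspec[OF elim(1) s] bspec[OF elim(2) s]
   note cb = char_bounds[where b = "%i. b i s w" and s = "%i. \<sigma> i s w" and f = "%i. f i s w" and y = "Yh s w" and z = "Zh s w",
     OF k, folded \<gamma>_def, folded \<alpha>_def \<beta>_def \<phi>_def, folded v_def A_def]
   note ci = char_identities(1)[where s = "%i. \<sigma> i s w" and y = "Yh s w" and z = "Zh s w", folded \<gamma>_def, folded \<alpha>_def]
    char_identities(2)[where b = "%i. b i s w" and s = "%i. \<sigma> i s w" and f = "%i. f i s w" and y = "Yh s w" and z = "Zh s w",
     folded \<gamma>_def, folded \<alpha>_def \<beta>_def \<phi>_def, folded v_def]
   have "char_driver b \<sigma> f s w (Yh s w) (Zh s w) = v s w"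
    unfolding char_driver_def char_F_def char_G_def char_Lambda_def using ci(2) e(2) by blast
   thus "\<bar>\<gamma> s w\<bar> \<le> A * (1 + \<bar>Zh s w\<bar>) \<and> \<bar>\<alpha> s w\<bar> \<le> A * (1 + \<bar>Zh s w\<bar>) \<and>
     \<bar>\<beta> s w\<bar> \<le> A * (1 + \<bar>Zh s w\<bar>) \<and> \<bar>v s w\<bar> \<le> A * (1 + (Zh s w)^2) \<and>
     char_driver b \<sigma> f s w (Yh s w) (Zh s w) = v s w \<and> Zh s w + Yh s w * \<alpha> s w = \<gamma> s w"
    using ci(1) e(2) by (intro conjI cb) (use e in blast)+
  qed
 qed
 have intg: "AE w in M. integrable (leb T) (%s. (\<alpha> s w)^2) \<and> integrable (leb T) (%s. \<beta> s w)"
  using est has_ito_integralD(2)[OF J] AE_space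
 proof eventually_elim
  case (elim w)
  note Zp = progressive_path_time[OF prYZ(2) elim(3)] elim(2)[unfolded int_square_eq]
  show ?case by (intro conjI linear_growth_integrable(1)[OF Zp progressive_path_time[OF p\<alpha> elim(3)], of A]
     linear_growth_integrable(2)[OF Zp progressive_path_time[OF p\<beta> elim(3)], of A]) (use elim(1) in blast)+
 qed
 have "AE w in M. energy \<alpha> w < \<infinity>"
  using intg AE_space by eventually_elim (simp add: int_square_eq integrable_square_iff[OF progressive_path_time[OF p\<alpha>]])
 then obtain I where I: "ito_integral \<alpha> I" using has_ito_integral_exists[OF p\<alpha>] by blast
 let ?a = "%s w. \<beta> s w - (\<alpha> s w)^2 / 2"
 have pa: "prog ?a" by (intro progressive_intros p\<alpha> p\<beta>)
 have ia: "AE w in M. integrable (leb T) (%s. ?a s w)"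
  using intg by eventually_elim (intro Bochner_Integration.integrable_diff integrable_divide_zero; blast)
 define L where "L t w = (LBINT s:{0..t}. ?a s w) + I t w" for t w
 have L: "ito_process L ?a \<alpha>"
  by (rule ito_process_eq[OF ito_process_add[OF ito_process_indefinite[OF pa ia] ito_process_of_ito_integral[OF I]]])
   (simp_all add: L_def)
 have L0: "AE w in M. L 0 w = 0"
  using has_ito_integral_initial[OF I] by eventually_elim (simp only: L_def lbint_point add_0_left)
 have U: "ito_process Yh (%s w. - v s w) Zh" and YT: "AE w in M. Yh T w = h w"
  by (rule ito_process_of_backward[OF prYZ(1) pv J drv _ Y_eq], rule eventually_mono[OF est], blast)+
 define X where "X t w = exp (L t w)" for t w
 have X: "ito_process X (%s w. X s w * \<beta> s w) (%s w. X s w * \<alpha> s w)"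
  by (rule ito_process_eq[OF ito_process_exp[OF L]]) (simp_all add: X_def algebra_simps)
 define Y where "Y t w = Yh t w * X t w" for t w
 define Z where "Z t w = \<gamma> t w * X t w" for t w
 note DX = ito_processD[OF X]
 have pY: "prog Y" and pZ: "prog Z" unfolding Y_def Z_def by (intro progressive_intros prYZ \<gamma> DX)+
 have Y: "ito_process Y (%s w. - (X s w * \<phi> s w)) Z"
 proof (rule ito_process_cong[OF ito_process_mult[OF U X] pY _ pZ])
  show "prog (%s w. - (X s w * \<phi> s w))" by (intro progressive_intros DX p\<phi>)
  show "AE w in M. \<forall>t\<in>{0..T}. Yh t w * X t w = Y t w" by (simp add: Y_def)
  show "AE w in M. AE s in leb T. Yh s w * (X s w * \<beta> s w) + X s w * - v s w + Zh s w * (X s w * \<alpha> s w) = - (X s w * \<phi> s w)"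
   by (intro AE_I2) (simp add: v_def algebra_simps)
  show "AE w in M. AE s in leb T. Yh s w * (X s w * \<alpha> s w) + X s w * Zh s w = Z s w" using est
  proof eventually_elim
   case (elim w)
   have "Yh s w * (X s w * \<alpha> s w) + X s w * Zh s w = Z s w" if "s \<in> {0..T}" for s
   proof -
    have "Zh s w + Yh s w * \<alpha> s w = \<gamma> s w" using elim that by blast
    thus ?thesis unfolding Z_def by (simp add: algebra_simps flip: \<open>Zh s w + Yh s w * \<alpha> s w = \<gamma> s w\<close>)
   qed
   thus ?case by (intro AE_timeI) simp
  qed
 qed
 have lin_eq: "p 1 s w * X s w + p 2 s w * Y s w + p 3 s w * Z s w = X s w * lin (%i. p i s w) (Yh s w) (\<gamma> s w)" for p s w
  by (simp add: Y_def Z_def lin_def algebra_simps)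
 have YTX: "AE w in M. Y T w = h w * X T w" using YT by eventually_elim (simp add: Y_def)
 have fbsde: "solves_linear_fbsde M F B T b \<sigma> f h X Y Z"
  unfolding solves_linear_fbsde_def lin_eq \<alpha>_def[symmetric] \<beta>_def[symmetric] \<phi>_def[symmetric]
 proof (intro conjI DX pY pZ)
  show "AE w in M. set_integrable lborel {0..T} (%s. X s w * \<beta> s w)"
   using DX(4) by (simp only: set_integrable_leb)
  note bw = backward_of_ito_process[OF Y YTX, of "%s w. X s w * \<phi> s w"]
  show "AE w in M. set_integrable lborel {0..T} (%s. X s w * \<phi> s w)" by (rule bw(1)) simp
  obtain J' where J': "ito_integral Z J'"
   "AE w in M. \<forall>t\<in>{0..T}. Y t w = h w * X T w + (LBINT s:{t..T}. X s w * \<phi> s w) - (J' T w - J' t w)"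
   using bw(2) by auto
  obtain I' where I': "ito_integral (%s w. X s w * \<alpha> s w) I'"
   "AE w in M. \<forall>t\<in>{0..T}. X t w = X 0 w + (LBINT s:{0..t}. X s w * \<beta> s w) + I' t w"
   using X unfolding ito_process_def by blast
  have "AE w in M. X 0 w = 1" using L0 by eventually_elim (simp add: X_def)
  with I'(2) J'(2) have "AE w in M. \<forall>t\<in>{0..T}. X t w = 1 + (LBINT s:{0..t}. X s w * \<beta> s w) + I' t w \<and>
    Y t w = h w * X T w + (LBINT s:{t..T}. X s w * \<phi> s w) - (J' T w - J' t w)"
  proof eventually_elim
   case (elim w)
   show ?case using elim(1,2) unfolding elim(3) by blast
  qed
  with I'(1) J'(1) show "\<exists>I J. ito_integral (%s w. X s w * \<alpha> s w) I \<and> ito_integral Z J \<and>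
    (AE w in M. \<forall>t\<in>{0..T}. X t w = 1 + (LBINT s:{0..t}. X s w * \<beta> s w) + I t w \<and>
    Y t w = h w * X T w + (LBINT s:{t..T}. X s w * \<phi> s w) - (J T w - J t w))" by blast
 qed
 have "(X, Y, Z) \<in> (\<Union>q\<in>{1<..}. Lq_space M F T q)"
 proof -
  obtain c K \<epsilon> C \<eta> where \<epsilon>: "0 < \<epsilon>" "\<epsilon> < 1" and \<eta>: "0 < \<eta>" and C: "0 \<le> C" and K: "1 \<le> K" and
   lyap: "lyapunov_bound A k c K C \<eta> (1 + \<epsilon>)"
   using lyapunov_estimate[OF A, of k] k by auto
  define q where "q = 1 + \<epsilon>"
  define W where "W t w = lyapunov c K q (L t w) (Yh t w)" for t w
  \<comment> \<open>Its square is the gain term of the Lyapunov drift, so the energy bound controls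
    the integral of \<open>exp (q * L) * Zh^2\<close>.\<close>
  define G where "G s w = sqrt \<eta> * exp (q * L s w / 2) * Zh s w" for s w
  have pL: "prog L" by (rule ito_processD(1)[OF L])
  have pG: "prog G" unfolding G_def by (intro progressive_intros pL prYZ)
  have G2: "(G s w)^2 = \<eta> * (exp (q * L s w) * (Zh s w)^2)" for s w
   using \<eta> by (simp add: G_def power_mult_distrib exp_double[symmetric])
  obtain H where H: "ito_process W (%s w. lyapunov_drift c K q (L s w) (Yh s w) (?a s w) (\<alpha> s w) (- v s w) (Zh s w)) H"
   using ito_process_lyapunov[OF L U] unfolding W_def by blast
  have W: "AE w in M. \<forall>s\<in>{0..T}. exp (q * L s w) \<le> W s w \<and> W s w \<le> K * exp (q * L s w) \<and>
    lyapunov_drift c K q (L s w) (Yh s w) (?a s w) (\<alpha> s w) (- v s w) (Zh s w) \<le> C * W s w - (G s w)^2"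
   using est Yh
  proof eventually_elim
   case (elim w)
   show ?case
   proof
    fix s assume s: "s \<in> {0..T}"
    note e = bspec[OF elim(1) s] bspec[OF elim(2) s]
    have "\<bar>Yh s w\<bar> \<le> k" "\<bar>\<alpha> s w\<bar> \<le> A * (1 + \<bar>Zh s w\<bar>)" "\<bar>\<beta> s w\<bar> \<le> A * (1 + \<bar>Zh s w\<bar>)" "\<bar>v s w\<bar> \<le> A * (1 + (Zh s w)^2)"
     using e by blast+
    note lyapunov_boundD[OF lyap this, of "L s w", folded q_def, folded W_def]
    thus "exp (q * L s w) \<le> W s w \<and> W s w \<le> K * exp (q * L s w) \<and>
     lyapunov_drift c K q (L s w) (Yh s w) (?a s w) (\<alpha> s w) (- v s w) (Zh s w) \<le> C * W s w - (G s w)^2"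
     unfolding G2 by (simp only: mult.assoc)
   qed
  qed
  have Kpos: "0 \<le> K" using K by simp
  have W_pos: "AE w in M. \<forall>t\<in>{0..T}. 0 \<le> W t w" by (rule eventually_mono[OF W]) (meson exp_ge_zero order_trans)
  have W0: "AE w in M. W 0 w \<le> K" using W L0
  proof eventually_elim
   case (elim w)
   have "W 0 w \<le> K * exp (q * L 0 w)" using elim(1) T_pos by auto
   thus ?case unfolding elim(2) by simp
  qed
  have dr: "AE w in M. AE s in leb T.
    lyapunov_drift c K q (L s w) (Yh s w) (?a s w) (\<alpha> s w) (- v s w) (Zh s w) \<le> C * W s w - (G s w)^2"
   using W
  proof eventually_elim
   case (elim w)
   show ?case by (rule AE_timeI) (use elim in simp)
  qed
  note sm = supermartingale_bounds[OF H pG C Kpos W_pos W0 dr]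
  \<comment> \<open>Strictly between 1 and \<open>q\<close>: the weak bound of order
    \<open>q\<close> yields moments of smaller order, and the order must still exceed 1.\<close>
  define p where "p = 1 + \<epsilon> / 2"
  have p: "1 < p" "p < q" "p < 2" "q < 2" using \<epsilon> by (simp_all add: p_def q_def)
  have XM: "t \<in> dense_times ==> X t \<in> borel_measurable M" for t
   using progressive_section_M[OF DX(1)] dense_times_subset by blast
  have tail: "prob {w \<in> space M. \<exists>t\<in>dense_times. r < X t w} \<le> exp (C * T) * K / r powr q" if r: "0 < r" for r
  proof -
   have "prob {w \<in> space M. \<exists>t\<in>dense_times. r < X t w} \<le> prob {w \<in> space M. \<exists>t\<in>dense_times. r powr q < W t w}"
   proof (rule finite_measure_mono_AE)
    show "AE w in M. w \<in> {w \<in> space M. \<exists>t\<in>dense_times. r < X t w} \<longrightarrow> w \<in> {w \<in> space M. \<exists>t\<in>dense_times. r powr q < W t w}"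
     using W
    proof eventually_elim
     case (elim w)
     have "r powr q < W t w" if "t \<in> dense_times" "r < X t w" for t
     proof -
      have "r powr q < X t w powr q" using r that p by (intro powr_less_mono2) auto
      also have "\<dots> = exp (q * L t w)" by (simp add: X_def powr_def)
      also have "\<dots> \<le> W t w" using elim that dense_times_subset by blast
      finally show ?thesis .
     qed
     thus ?case by blast
    qed
    show "{w \<in> space M. \<exists>t\<in>dense_times. r powr q < W t w} \<in> events"
     using progressive_section_M[OF ito_processD(1)[OF H]] dense_times_subset
     by (intro sets.sets_Collect_countable_Ex' countable_times borel_measurable_less) auto
   qed
   also have "\<dots> \<le> exp (C * T) * K / r powr q" using r by (intro sm(1)) simp
   finally show ?thesis .
  qed
  obtain N where N: "N \<in> borel_measurable M" "(\<integral>\<^sup>+w. N w \<partial>M) < \<infinity>"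
   and N_ge: "\<And>w t. w \<in> space M ==> t \<in> dense_times ==> ennreal (X t w powr p) \<le> 1 + N w \<or> X t w \<le> 0"
   using weak_moment_bound[OF countable_times XM _ p(2) _ tail] p(1) K by auto
  define E where "E w = energy (%s w. exp (q * L s w / 2) * Zh s w) w" for w
  have pE: "prog (%s w. exp (q * L s w / 2) * Zh s w)" by (intro progressive_intros pL prYZ)
  have Em: "E \<in> borel_measurable M" unfolding E_def by (rule int_square_measurable[OF pE])
  have "energy G w = ennreal \<eta> * E w" if "w \<in> space M" for w
  proof -
   note m2 = measurable_compose[OF borel_measurable_power[OF progressive_path_time[OF pE that], of 2] measurable_ennreal]
   show ?thesis unfolding E_def int_square_eq nn_integral_cmult[OF m2, symmetric] G_def using \<eta>
    by (intro nn_integral_cong) (simp add: power_mult_distrib ennreal_mult mult.assoc)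
  qed
  hence "(\<integral>\<^sup>+w. energy G w \<partial>M) = ennreal \<eta> * (\<integral>\<^sup>+w. E w \<partial>M)"
   using Em by (simp add: nn_integral_cmult cong: nn_integral_cong)
  hence E_fin: "(\<integral>\<^sup>+w. E w \<partial>M) < \<infinity>"
   using le_less_trans[OF sm(2) ennreal_less_top] \<eta> by (auto simp: ennreal_mult_less_top)
  define D where "D = (1 + k powr p) + (1 + 2 * A^2 * (T + 1))"
  have Dpos: "0 < D" using T_pos by (simp add: D_def add_pos_nonneg add_nonneg_nonneg)
  \<comment> \<open>\<open>1 + N + E\<close> plays the part of \<open>m\<close> in
    \<open>energy_powr_bound\<close>: it dominates \<open>X powr p\<close> at all times and the
    weighted energy of \<open>Zh\<close> simultaneously.\<close>
  have est2: "AE w in M. (SUP t\<in>{0..T}. ennreal (\<bar>X t w\<bar> powr p + \<bar>Y t w\<bar> powr p)) + ennreal_powr (energy Z w) (p / 2)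
    \<le> ennreal D * (1 + N w + E w)"
   using est Yh ito_process_continuous[OF X] AE_space
  proof eventually_elim
   case (elim w)
   show ?case
   proof (cases "N w = \<infinity> \<or> E w = \<infinity>")
    case True
    hence "1 + N w + E w = \<infinity>" by auto
    hence "ennreal D * (1 + N w + E w) = \<infinity>" using Dpos by (simp only: ennreal_mult_eq_top_iff infinity_ennreal_def) simp
    thus ?thesis by (simp only: infinity_ennreal_def top_greatest)
   next
    case False
    define n where "n = enn2real (N w)"
    define e where "e = enn2real (E w)"
    define m where "m = 1 + n + e"
    have n: "N w = ennreal n" "E w = ennreal e" "0 \<le> n" "0 \<le> e" using False by (simp_all add: n_def e_def less_top)
    have m: "1 \<le> m" "1 + N w + E w = ennreal m"
     using n by (simp_all add: m_def ennreal_plus flip: ennreal_1)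
    have Xp: "X t w powr p \<le> m" if t: "t \<in> {0..T}" for t
    proof (rule continuous_le_times[OF _ _ t])
     show "continuous_on {0..T} (%t. X t w powr p)"
      using elim(3) by (intro continuous_on_powr continuous_on_const) (auto simp: X_def)
     fix t assume "t \<in> dense_times"
     hence "ennreal (X t w powr p) \<le> 1 + N w" using N_ge[OF elim(4)] by (force simp: X_def)
     also have "\<dots> = ennreal (1 + n)" using n by (simp add: ennreal_plus flip: ennreal_1)
     finally have "X t w powr p \<le> 1 + n" using n by (subst (asm) ennreal_le_iff) auto
     thus "X t w powr p \<le> m" using n by (simp add: m_def)
    qed
    have "(SUP t\<in>{0..T}. ennreal (\<bar>X t w\<bar> powr p + \<bar>Y t w\<bar> powr p)) \<le> ennreal ((1 + k powr p) * m)"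
    proof (intro SUP_least ennreal_leI)
     fix t assume t: "t \<in> {0..T}"
     have X0: "0 < X t w" by (simp add: X_def)
     have "\<bar>Y t w\<bar> powr p \<le> (k * X t w) powr p"
      using bspec[OF elim(2) t] X0 p by (intro powr_mono2) (auto simp: Y_def abs_mult)
     also have "\<dots> = k powr p * X t w powr p" using k X0 by (simp add: powr_mult)
     also have "\<dots> \<le> k powr p * m" using Xp[OF t] by (intro mult_left_mono) auto
     finally show "\<bar>X t w\<bar> powr p + \<bar>Y t w\<bar> powr p \<le> (1 + k powr p) * m"
      using Xp[OF t] X0 by (simp add: distrib_right)
    qed
    moreover have "ennreal_powr (energy Z w) (p / 2) \<le> ennreal ((1 + 2 * A^2 * (T + 1)) * m)"
     unfolding int_square_eq
    proof (rule energy_powr_bound[OF p(1,2,4) m(1) T_pos _ _ Xp _ progressive_path_time[OF pE elim(4)]])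
     show "L2 (leb T) (%s. exp (q * L s w / 2) * Zh s w) \<le> ennreal m"
      using n unfolding E_def int_square_eq by (simp add: m_def ennreal_leI)
     fix s assume s: "s \<in> {0..T}"
     have "\<bar>\<gamma> s w\<bar> \<le> A * (1 + \<bar>Zh s w\<bar>)" using elim(1) s by blast
     hence "(\<gamma> s w)^2 \<le> (A * (1 + \<bar>Zh s w\<bar>))^2" using power_mono[OF _ abs_ge_zero, of "\<gamma> s w" _ 2] by simp
     also have "\<dots> = A^2 * (1 + \<bar>Zh s w\<bar>)^2" by (rule power_mult_distrib)
     also have "\<dots> \<le> A^2 * (2 * (1 + (Zh s w)^2))"
      using zero_le_power2[of "\<bar>Zh s w\<bar> - 1"] by (intro mult_left_mono) (simp_all add: power2_sum power2_diff)
     finally have "(\<gamma> s w)^2 * (X s w)^2 \<le> A^2 * (2 * (1 + (Zh s w)^2)) * (X s w)^2" by (rule mult_right_mono) simp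
     \<comment> \<open>Since \<open>X = exp L\<close>, the weight satisfies
       \<open>X powr (2 - q) * exp (q * L) = X^2\<close>.\<close>
     also have "\<dots> = 2 * A^2 * ((X s w)^2 + X s w powr (2 - q) * (exp (q * L s w / 2) * Zh s w)^2)"
     proof -
      have "X s w powr (2 - q) * (exp (q * L s w / 2))^2 = (X s w)^2"
       by (simp add: X_def powr_def exp_double[symmetric] exp_add[symmetric] algebra_simps)
      thus ?thesis by (simp add: power_mult_distrib algebra_simps)
     qed
     finally show "(Z s w)^2 \<le> 2 * A^2 * ((X s w)^2 + X s w powr (2 - q) * (exp (q * L s w / 2) * Zh s w)^2)"
      by (simp add: Z_def power_mult_distrib)
    qed (simp_all add: X_def)
    ultimately have "(SUP t\<in>{0..T}. ennreal (\<bar>X t w\<bar> powr p + \<bar>Y t w\<bar> powr p)) + ennreal_powr (energy Z w) (p / 2)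
      \<le> ennreal ((1 + k powr p) * m) + ennreal ((1 + 2 * A^2 * (T + 1)) * m)"
     by (rule add_mono)
    also have "\<dots> = ennreal (D * m)"
     using m T_pos by (simp add: D_def distrib_right ennreal_plus[symmetric] del: ennreal_plus)
    finally show ?thesis using m Dpos by (simp add: ennreal_mult)
   qed
  qed
  have "(\<integral>\<^sup>+w. (SUP t\<in>{0..T}. ennreal (\<bar>X t w\<bar> powr p + \<bar>Y t w\<bar> powr p)) + ennreal_powr (energy Z w) (p / 2) \<partial>M)
    \<le> (\<integral>\<^sup>+w. ennreal D * (1 + N w + E w) \<partial>M)"
   by (rule nn_integral_mono_AE[OF est2])
  also have "\<dots> = ennreal D * (1 + (\<integral>\<^sup>+w. N w \<partial>M) + (\<integral>\<^sup>+w. E w \<partial>M))"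
   using N(1) Em by (simp add: nn_integral_cmult nn_integral_add emeasure_space_1)
  also have "\<dots> < \<infinity>" using N(2) E_fin by (simp add: ennreal_mult_less_top)
  finally have "(X, Y, Z) \<in> Lq_space M F T p" unfolding Lq_space_def using DX(1) pY pZ by blast
  thus ?thesis using p by blast
 qed
 moreover have "\<forall>t w. X t w \<noteq> 0 \<and> Y t w = Yh t w * X t w \<and>
   Z t w = (Zh t w + Yh t w * (\<sigma> 1 t w + \<sigma> 2 t w * Yh t w)) / (1 - \<sigma> 3 t w * Yh t w) * X t w"
  by (simp add: X_def Y_def Z_def \<gamma>_def)
 ultimately show ?thesis using fbsde by blast
qed

end

end

section \<open>From the linear system to the characteristic equation\<close>

lemma first_hitting:
 fixes X :: "real => real"
 assumes X: "continuous_on {0..T} X" "\<delta> \<le> X 0" and t: "t \<in> {0..T}" "X t < \<delta>"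
 shows "\<exists>t0\<in>{0..T}. X t0 = \<delta> \<and> (\<forall>s\<in>{0..t0}. \<delta> \<le> X s)"
proof -
 let ?S = "{0..T} \<inter> X -` {..\<delta>}"
 have S: "closed ?S" "t \<in> ?S" "bdd_below ?S" using continuous_closed_preimage[OF X(1)] t by auto
 define t0 where "t0 = Inf ?S"
 have t0: "t0 \<in> ?S" unfolding t0_def using closed_contains_Inf[OF _ S(3,1)] S(2) by blast
 have low: "\<delta> < X s" if "s \<in> {0..<t0}" for s
  using cInf_lower[OF _ S(3), of s] that t0 by (fastforce simp: t0_def[symmetric])
 have "X t0 = \<delta>"
 proof (rule ccontr)
  assume "X t0 \<noteq> \<delta>"
  hence lt: "X t0 < \<delta>" using t0 by simp
  obtain s where s: "0 \<le> s" "s \<le> t0" "X s = \<delta>"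
   using IVT2'[of X t0 \<delta> 0] t0 lt X continuous_on_subset[OF X(1), of "{0..t0}"] by auto
  hence "s < t0" using lt by (cases "s = t0") auto
  thus False using low[of s] s by simp
 qed
 hence "\<delta> \<le> X s" if "s \<in> {0..t0}" for s using low[of s] that by (cases "s = t0") auto
 thus ?thesis using t0 \<open>X t0 = \<delta>\<close> by blast
qed

context brownian_filtration
begin

context
 fixes b \<sigma> f :: "nat => real => 'a => real" and h :: "'a => real" and k :: real
 assumes prog: "\<And>i. i \<in> {1, 2, 3} ==> prog (b i)" "\<And>i. i \<in> {1, 2, 3} ==> prog (\<sigma> i)"
   "\<And>i. i \<in> {1, 2, 3} ==> prog (f i)"
  and k: "1 \<le> k" and bounds: "AE w in M. \<forall>t\<in>{0..T}. \<forall>i\<in>{1, 2, 3}. \<bar>b i t w\<bar> \<le> k \<and> \<bar>\<sigma> i t w\<bar> \<le> k \<and> \<bar>f i t w\<bar> \<le> k"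
begin

theorem char_bsde_of_linear_fbsde:
 assumes fbsde: "solves_linear_fbsde M F B T b \<sigma> f h X Y Z"
  and cone: "AE w in M. \<forall>t\<in>{0..T}. \<bar>Y t w\<bar> \<le> k * \<bar>X t w\<bar> \<and> \<bar>X t w\<bar> \<le> k * \<bar>X t w - \<sigma> 3 t w * Y t w\<bar>"
 shows "AE w in M. \<forall>t\<in>{0..T}. 0 < X t w"
  and "solves_char_bsde M F B T b \<sigma> f h (%t w. Y t w / X t w)
   (%t w. (Z t w - Y t w / X t w * (\<sigma> 1 t w * X t w + \<sigma> 2 t w * Y t w + \<sigma> 3 t w * Z t w)) / X t w)"
proof -
 define bX where "bX s w = b 1 s w * X s w + b 2 s w * Y s w + b 3 s w * Z s w" for s w
 define sX where "sX s w = \<sigma> 1 s w * X s w + \<sigma> 2 s w * Y s w + \<sigma> 3 s w * Z s w" for s w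
 define fX where "fX s w = f 1 s w * X s w + f 2 s w * Y s w + f 3 s w * Z s w" for s w
 obtain I J where pX: "prog X" and pY: "prog Y" and pZ: "prog Z"
  and iX: "AE w in M. set_integrable lborel {0..T} (%s. bX s w)" and iY: "AE w in M. set_integrable lborel {0..T} (%s. fX s w)"
  and I: "ito_integral sX I" and J: "ito_integral Z J"
  and eq: "AE w in M. \<forall>t\<in>{0..T}. X t w = 1 + (LBINT s:{0..t}. bX s w) + I t w \<and>
   Y t w = h w * X T w + (LBINT s:{t..T}. fX s w) - (J T w - J t w)"
  using fbsde unfolding solves_linear_fbsde_def bX_def sX_def fX_def by blast
 have p: "prog bX" "prog sX" "prog fX"
  unfolding bX_def sX_def fX_def by (intro progressive_intros prog pX pY pZ; simp)+
 have X0: "AE w in M. X 0 w = 1" using eq has_ito_integral_initial[OF I]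
 proof eventually_elim
  case (elim w)
  have "X 0 w = 1 + (LBINT s:{0..0}. bX s w) + I 0 w" using elim(1) T_pos by auto
  thus ?case unfolding lbint_point elim(2) by simp
 qed
 have X: "ito_process X bX sX"
 proof (rule ito_process_of_integral[OF I borel_measurable_const[of 0] p(1) _ pX])
  show "AE w in M. integrable (leb T) (%s. bX s w)" using iX by (simp only: set_integrable_leb)
  show "AE w in M. \<forall>t\<in>{0..T}. X t w = X 0 w + (LBINT s:{0..t}. bX s w) + I t w" using eq X0
  proof eventually_elim
   case (elim w)
   show ?case unfolding elim(2) using elim(1) by blast
  qed
 qed
 have Y: "ito_process Y (%s w. - fX s w) Z" and YT: "AE w in M. Y T w = h w * X T w"
  by (rule ito_process_of_backward[OF pY p(3) J iY], simp, rule eventually_mono[OF eq], blast)+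
 \<comment> \<open>Division by 0 gives 0, so these processes are progressive before anything is
   known about the zeros of \<open>X\<close>; the identities relating them are claimed only where
   \<open>X \<noteq> 0\<close>.\<close>
 define y where "y s w = Y s w / X s w" for s w
 define z where "z s w = (Z s w - y s w * sX s w) / X s w" for s w
 define \<alpha> where "\<alpha> s w = lin (%i. \<sigma> i s w) (y s w) (Z s w / X s w)" for s w
 define \<beta> where "\<beta> s w = lin (%i. b i s w) (y s w) (Z s w / X s w)" for s w
 define \<phi> where "\<phi> s w = lin (%i. f i s w) (y s w) (Z s w / X s w)" for s w
 define v where "v s w = \<phi> s w + y s w * \<beta> s w + z s w * \<alpha> s w" for s w
 have py: "prog y" unfolding y_def by (intro progressive_intros pX pY)
 have pz: "prog z" unfolding z_def by (intro progressive_intros pX pZ py p)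
 have pZX: "prog (%s w. Z s w / X s w)" by (intro progressive_intros pX pZ)
 have "prog \<alpha>" "prog \<beta>" "prog \<phi>"
  unfolding \<alpha>_def \<beta>_def \<phi>_def by (intro progressive_lin prog py pZX; assumption)+
 hence pv: "prog v" unfolding v_def by (intro progressive_intros py pz)
 have scale: "bX s w = X s w * \<beta> s w" "sX s w = X s w * \<alpha> s w" "fX s w = X s w * \<phi> s w" "Y s w = X s w * y s w"
  "Z s w - X s w * y s w * \<alpha> s w = X s w * z s w" if "X s w \<noteq> 0" for s w
 proof -
  show *: "bX s w = X s w * \<beta> s w" "sX s w = X s w * \<alpha> s w" "fX s w = X s w * \<phi> s w" "Y s w = X s w * y s w"
   using that by (simp_all add: bX_def sX_def fX_def \<alpha>_def \<beta>_def \<phi>_def y_def lin_def algebra_simps)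
  show "Z s w - X s w * y s w * \<alpha> s w = X s w * z s w" using that *(2) by (simp add: z_def)
 qed
 define A where "A = 16 * k ^ 6"
 have A: "1 \<le> A" using one_le_power[OF k, of 6] by (simp add: A_def)
 have est: "AE w in M. \<forall>s\<in>{0..T}. X s w \<noteq> 0 \<longrightarrow> \<bar>y s w\<bar> \<le> k \<and> \<bar>\<alpha> s w\<bar> \<le> A * (1 + \<bar>z s w\<bar>) \<and>
   \<bar>\<beta> s w\<bar> \<le> A * (1 + \<bar>z s w\<bar>) \<and> \<bar>v s w\<bar> \<le> A * (1 + (z s w)^2) \<and> char_driver b \<sigma> f s w (y s w) (z s w) = v s w"
  using bounds cone
 proof (eventually_elim, intro ballI impI)
  fix w s
  assume *: "\<forall>t\<in>{0..T}. \<forall>i\<in>{1, 2, 3}. \<bar>b i t w\<bar> \<le> k \<and> \<bar>\<sigma> i t w\<bar> \<le> k \<and> \<bar>f i t w\<bar> \<le> k"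
   "\<forall>t\<in>{0..T}. \<bar>Y t w\<bar> \<le> k * \<bar>X t w\<bar> \<and> \<bar>X t w\<bar> \<le> k * \<bar>X t w - \<sigma> 3 t w * Y t w\<bar>" "s \<in> {0..T}" and X: "X s w \<noteq> 0"
  note e = bspec[OF *(1,3)] bspec[OF *(2,3)]
  define g where "g = (z s w + y s w * (\<sigma> 1 s w + \<sigma> 2 s w * y s w)) / (1 - \<sigma> 3 s w * y s w)"
  have yk: "\<bar>y s w\<bar> \<le> k" using e(2) X by (simp add: y_def abs_divide divide_le_eq)
  have "\<bar>X s w\<bar> * 1 \<le> \<bar>X s w\<bar> * (k * \<bar>1 - \<sigma> 3 s w * y s w\<bar>)"
  proof -
   have "X s w - \<sigma> 3 s w * Y s w = X s w * (1 - \<sigma> 3 s w * y s w)" unfolding scale(4)[OF X] by (simp add: algebra_simps)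
   thus ?thesis using e(2) by (simp add: abs_mult mult_ac)
  qed
  hence n: "1 \<le> k * \<bar>1 - \<sigma> 3 s w * y s w\<bar>" by (rule mult_left_le_imp_le) (use X in simp)
  hence n0: "1 - \<sigma> 3 s w * y s w \<noteq> 0" by auto
  have nk: "\<bar>inverse (1 - \<sigma> 3 s w * y s w)\<bar> \<le> k" using n n0 by (simp add: abs_inverse inverse_eq_divide divide_le_eq)
  have gz: "g = Z s w / X s w"
  proof -
   have "z s w = Z s w / X s w - y s w * \<alpha> s w" using scale(5)[OF X] X by (simp add: field_simps)
   hence "z s w + y s w * (\<sigma> 1 s w + \<sigma> 2 s w * y s w) = Z s w / X s w * (1 - \<sigma> 3 s w * y s w)"
    by (simp add: \<alpha>_def lin_def algebra_simps)
   thus ?thesis unfolding g_def using n0 by simp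
  qed
  note cb = char_bounds[where b = "%i. b i s w" and s = "%i. \<sigma> i s w" and f = "%i. f i s w" and y = "y s w" and z = "z s w",
    OF k _ _ _ yk nk, folded g_def, unfolded gz, folded \<alpha>_def \<beta>_def \<phi>_def, folded v_def A_def]
  have "char_driver b \<sigma> f s w (y s w) (z s w) = v s w"
   unfolding char_driver_def char_F_def char_G_def char_Lambda_def
   using char_identities(2)[where b = "%i. b i s w" and s = "%i. \<sigma> i s w" and f = "%i. f i s w" and y = "y s w" and z = "z s w",
     OF n0, folded g_def, unfolded gz, folded \<alpha>_def \<beta>_def \<phi>_def, folded v_def] .
  thus "\<bar>y s w\<bar> \<le> k \<and> \<bar>\<alpha> s w\<bar> \<le> A * (1 + \<bar>z s w\<bar>) \<and> \<bar>\<beta> s w\<bar> \<le> A * (1 + \<bar>z s w\<bar>) \<and>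
    \<bar>v s w\<bar> \<le> A * (1 + (z s w)^2) \<and> char_driver b \<sigma> f s w (y s w) (z s w) = v s w"
   by (intro conjI cb yk) (use e(1) in blast)+
 qed
 \<comment> \<open>The coefficients of \<open>Y * exp (- L)\<close> at a point where
   \<open>exp L = X\<close> are those of the characteristic equation. This is used for the extended
   logarithm above \<open>\<delta>\<close> and, once positivity is known, for
   \<open>ln X\<close>.\<close>
 have drift_U: "exp (- l) * (- fX s w - Y s w * (\<beta> s w - (\<alpha> s w)^2 / 2) + Y s w * (\<alpha> s w)^2 / 2 - Z s w * \<alpha> s w) = - v s w"
  "exp (- l) * (Z s w - Y s w * \<alpha> s w) = z s w" if "exp l = X s w" for l s w
 proof -
  have X: "X s w \<noteq> 0" using that exp_not_eq_zero[of l] by simp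
  have l: "exp (- l) * X s w = 1" using that[symmetric] by (simp add: exp_minus)
  show "exp (- l) * (Z s w - Y s w * \<alpha> s w) = z s w" using l unfolding scale(4)[OF X] scale(5)[OF X] by (simp add: mult.assoc[symmetric])
  have "- fX s w - Y s w * (\<beta> s w - (\<alpha> s w)^2 / 2) + Y s w * (\<alpha> s w)^2 / 2 - Z s w * \<alpha> s w =
    - fX s w - Y s w * \<beta> s w - (Z s w - Y s w * \<alpha> s w) * \<alpha> s w"
   by (simp add: power2_eq_square algebra_simps)
  also have "\<dots> = X s w * - v s w"
   unfolding scale(3)[OF X] scale(4)[OF X] scale(5)[OF X] v_def by (simp add: algebra_simps)
  finally show "exp (- l) * (- fX s w - Y s w * (\<beta> s w - (\<alpha> s w)^2 / 2) + Y s w * (\<alpha> s w)^2 / 2 - Z s w * \<alpha> s w) = - v s w"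
   using l by (simp add: mult.assoc[symmetric])
 qed
 obtain c K \<epsilon> C \<eta> where \<epsilon>: "0 < \<epsilon>" and \<eta>: "0 < \<eta>" and C: "0 \<le> C" and K: "1 \<le> K" and lyap: "lyapunov_bound A k c K C \<eta> (- \<epsilon>)"
  using lyapunov_estimate[OF A, of k] k by auto
 have XM: "t \<in> dense_times ==> X t \<in> borel_measurable M" for t
  using progressive_section_M[OF pX] dense_times_subset by blast
 have hit: "prob {w \<in> space M. \<exists>t\<in>dense_times. X t w < \<delta>} \<le> 2 * exp (C * T) * K * \<delta> powr \<epsilon>" if \<delta>: "0 < \<delta>" "\<delta> \<le> 1" for \<delta>
 proof -
  \<comment> \<open>Defined before positivity of \<open>X\<close> is known. It equals
    \<open>ln X\<close> where \<open>X \<ge> \<delta>\<close>; below \<open>\<delta>\<close> only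
    the boundedness of \<open>U\<close> is retained.\<close>
  define L where "L t w = ext_ln \<delta> (X t w)" for t w
  define a where "a s w = ext_ln1 \<delta> (X s w) * bX s w + ext_ln2 \<delta> (X s w) * (sX s w)^2 / 2" for s w
  define \<kappa> where "\<kappa> s w = ext_ln1 \<delta> (X s w) * sX s w" for s w
  have L: "ito_process L a \<kappa>" unfolding L_def a_def \<kappa>_def by (rule ito_process_ext_ln[OF X \<delta>(1)])
  define U where "U t w = Y t w * exp (- L t w)" for t w
  define d where "d s w = exp (- L s w) * (- fX s w - Y s w * a s w + Y s w * (\<kappa> s w)^2 / 2 - Z s w * \<kappa> s w)" for s w
  define \<zeta> where "\<zeta> s w = exp (- L s w) * (Z s w - Y s w * \<kappa> s w)" for s w
  have U: "ito_process U d \<zeta>" unfolding U_def d_def \<zeta>_def by (rule ito_process_quotient[OF L Y])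
  define W where "W t w = lyapunov c K (- \<epsilon>) (L t w) (U t w)" for t w
  define D where "D s w = lyapunov_drift c K (- \<epsilon>) (L s w) (U s w) (a s w) (\<kappa> s w) (d s w) (\<zeta> s w)" for s w
  obtain H where W: "ito_process W D H" using ito_process_lyapunov[OF L U] unfolding W_def D_def by blast
  note DW = ito_processD[OF W]
  have W_bounds: "AE w in M. \<forall>t\<in>{0..T}. exp (- \<epsilon> * L t w) \<le> W t w \<and> W t w \<le> K * exp (- \<epsilon> * L t w) \<and> (\<delta> \<le> X t w \<longrightarrow> D t w \<le> C * W t w)"
   using cone est
  proof (eventually_elim, intro ballI)
   fix w t
   assume *: "\<forall>t\<in>{0..T}. \<bar>Y t w\<bar> \<le> k * \<bar>X t w\<bar> \<and> \<bar>X t w\<bar> \<le> k * \<bar>X t w - \<sigma> 3 t w * Y t w\<bar>"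
    "\<forall>s\<in>{0..T}. X s w \<noteq> 0 \<longrightarrow> \<bar>y s w\<bar> \<le> k \<and> \<bar>\<alpha> s w\<bar> \<le> A * (1 + \<bar>z s w\<bar>) \<and>
    \<bar>\<beta> s w\<bar> \<le> A * (1 + \<bar>z s w\<bar>) \<and> \<bar>v s w\<bar> \<le> A * (1 + (z s w)^2) \<and> char_driver b \<sigma> f s w (y s w) (z s w) = v s w"
    and t: "t \<in> {0..T}"
   have bp: "0 < bump \<delta> (X t w)" by (rule bump_pos(2)[OF \<delta>(1)])
   have eL: "exp (- L t w) = inverse (bump \<delta> (X t w))" using bp by (simp add: L_def ext_ln_def exp_minus)
   have "\<bar>Y t w\<bar> \<le> k * bump \<delta> (X t w)"
    using bspec[OF *(1) t] mult_left_mono[OF bump_pos(1)[OF \<delta>(1), of "X t w"], of k] k by linarith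
   hence Uk: "\<bar>U t w\<bar> \<le> k" using bp unfolding U_def eL by (simp add: abs_mult divide_inverse[symmetric] divide_le_eq)
   have "D t w \<le> C * W t w" if X\<delta>: "\<delta> \<le> X t w"
   proof -
    have X0: "X t w \<noteq> 0" "0 < X t w" using X\<delta> \<delta> by auto
    have l: "exp (L t w) = X t w" using X0 by (simp add: L_def ext_ln_eq[OF X\<delta>])
    have \<kappa>: "\<kappa> t w = \<alpha> t w" using X0 by (simp add: \<kappa>_def ext_ln_eq[OF X\<delta>] scale(2))
    have a: "a t w = \<beta> t w - (\<alpha> t w)^2 / 2"
     using X0 by (simp add: a_def ext_ln_eq[OF X\<delta>] scale(1,2) power_mult_distrib)
    have "d t w = - v t w" "\<zeta> t w = z t w"
     unfolding d_def \<zeta>_def \<kappa> a by (rule drift_U[OF l])+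
    moreover have "lyapunov_drift c K (- \<epsilon>) (L t w) (U t w) (\<beta> t w - (\<alpha> t w)^2 / 2) (\<alpha> t w) (- v t w) (z t w)
      \<le> C * W t w - \<eta> * exp (- \<epsilon> * L t w) * (z t w)^2"
     unfolding W_def by (rule lyapunov_boundD(3)[OF lyap Uk]) (use bspec[OF *(2) t] X0 in blast)+
    moreover have "0 \<le> \<eta> * exp (- \<epsilon> * L t w) * (z t w)^2" using \<eta> by simp
    ultimately show ?thesis unfolding D_def a \<kappa> by simp
   qed
   \<comment> \<open>The two-sided bound on \<open>W\<close> does not involve the coefficients, so
     it is read off with all of them 0 and holds below \<open>\<delta>\<close> as well.\<close>
   moreover have "exp (- \<epsilon> * L t w) \<le> W t w" "W t w \<le> K * exp (- \<epsilon> * L t w)"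
    unfolding W_def by (rule lyapunov_boundD(1,2)[OF lyap Uk, of 0 0 0 0]; use A in simp)+
   ultimately show "exp (- \<epsilon> * L t w) \<le> W t w \<and> W t w \<le> K * exp (- \<epsilon> * L t w) \<and> (\<delta> \<le> X t w \<longrightarrow> D t w \<le> C * W t w)" by blast
  qed
  \<comment> \<open>Below \<open>\<delta>\<close> nothing is known about the drift \<open>D\<close>.
    Discounting there at rate \<open>\<bar>D\<bar> / W\<close> cancels any positive drift, and since
    the rate vanishes above \<open>\<delta>\<close> the discount factor is still 1 when
    \<open>X\<close> first reaches \<open>\<delta>\<close>.\<close>
  define \<rho> where "\<rho> s w = indicator {..<\<delta>} (X s w) * (\<bar>D s w\<bar> / W s w)" for s w
  have p\<rho>: "prog \<rho>"
   unfolding \<rho>_def by (intro progressive_intros progressive_compose[OF pX, of "indicator {..<\<delta>}"] progressive_compose[OF DW(2), of abs] DW) simp_all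
  have W_pos: "AE w in M. \<forall>t\<in>{0..T}. 0 < W t w" by (rule eventually_mono[OF W_bounds]) (meson exp_gt_zero less_le_trans)
  have i\<rho>: "AE w in M. integrable (leb T) (%s. \<rho> s w)"
   using W_pos ito_process_continuous[OF W] DW(4) AE_space
  proof eventually_elim
   case (elim w)
   \<comment> \<open>\<open>W\<close> is positive and continuous, so its minimum on the path bounds
     \<open>\<rho>\<close> by a multiple of \<open>\<bar>D\<bar>\<close>.\<close>
   obtain t0 where t0: "t0 \<in> {0..T}" "\<And>t. t \<in> {0..T} ==> W t0 w \<le> W t w"
    using continuous_attains_inf[OF compact_Icc _ elim(2)] T_pos by auto
   have m: "0 < W t0 w" using elim(1) t0 by blast
   show ?case
   proof (rule Bochner_Integration.integrable_bound)
    show "integrable (leb T) (%s. inverse (W t0 w) * D s w)" using elim(3) by simp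
    show "(%s. \<rho> s w) \<in> borel_measurable (leb T)" by (rule progressive_path_time[OF p\<rho> elim(4)])
    show "AE s in leb T. norm (\<rho> s w) \<le> norm (inverse (W t0 w) * D s w)"
    proof (rule AE_timeI)
     fix s assume s: "s \<in> {0..T}"
     have "inverse (W s w) \<le> inverse (W t0 w)" using t0(2)[OF s] m by (rule le_imp_inverse_le)
     hence "\<bar>D s w\<bar> * inverse (W s w) \<le> \<bar>D s w\<bar> * inverse (W t0 w)" by (rule mult_left_mono) simp
     moreover have "0 < W s w" using elim(1) s by blast
     ultimately show "norm (\<rho> s w) \<le> norm (inverse (W t0 w) * D s w)"
      using m by (simp add: \<rho>_def abs_mult indicator_def divide_inverse mult.commute)
    qed
   qed
  qed
  define V where "V t w = (LBINT s:{0..t}. \<rho> s w)" for t w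
  have V: "ito_process V \<rho> (%_ _. 0)" unfolding V_def by (rule ito_process_indefinite[OF p\<rho> i\<rho>])
  define W' where "W' t w = W t w * exp (- V t w)" for t w
  define D' where "D' s w = exp (- V s w) * (D s w - W s w * \<rho> s w)" for s w
  have W': "ito_process W' D' (%s w. exp (- V s w) * H s w)"
   by (rule ito_process_eq[OF ito_process_quotient[OF V W]]) (simp_all add: W'_def D'_def)
  have W'_pos: "AE w in M. \<forall>t\<in>{0..T}. 0 \<le> W' t w" by (rule eventually_mono[OF W_pos]) (simp add: W'_def less_imp_le)
  have W'_init: "AE w in M. W' 0 w \<le> K" using W_bounds X0
  proof eventually_elim
   case (elim w)
   have "W 0 w \<le> K * exp (- \<epsilon> * L 0 w)" using elim(1) T_pos by auto
   moreover have "L 0 w = 0" using elim(2) \<delta> by (simp add: L_def ext_ln_eq)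
   moreover have "V 0 w = 0" unfolding V_def by (rule lbint_point)
   ultimately show ?case by (simp add: W'_def)
  qed
  have dr: "AE w in M. AE s in leb T. D' s w \<le> C * W' s w - 0^2" using W_bounds W_pos
  proof eventually_elim
   case (elim w)
   show ?case
   proof (rule AE_timeI)
    fix s assume s: "s \<in> {0..T}"
    have Wp: "0 < W s w" using elim(2) s by blast
    have "D s w - W s w * \<rho> s w \<le> C * W s w"
    proof (cases "\<delta> \<le> X s w")
     case True
     thus ?thesis using elim(1) s by (simp add: \<rho>_def)
    next
     case False
     hence "W s w * \<rho> s w = \<bar>D s w\<bar>" using Wp by (simp add: \<rho>_def)
     moreover have "0 \<le> C * W s w" using C Wp by simp
     ultimately show ?thesis by linarith
    qed
    from mult_left_mono[OF this, of "exp (- V s w)"] show "D' s w \<le> C * W' s w - 0^2" by (simp add: D'_def W'_def mult_ac)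
   qed
  qed
  \<comment> \<open>At the first hit of \<open>\<delta>\<close> the discounted process is at least
    \<open>\<delta> powr (- \<epsilon>)\<close>. Half of that is exceeded strictly, hence by
    continuity already at some dense time.\<close>
  define r where "r = \<delta> powr (- \<epsilon>) / 2"
  have r: "0 < r" using \<delta> by (simp add: r_def)
  have "prob {w \<in> space M. \<exists>t\<in>dense_times. X t w < \<delta>} \<le> prob {w \<in> space M. \<exists>t\<in>dense_times. r < W' t w}"
  proof (rule finite_measure_mono_AE)
   show "{w \<in> space M. \<exists>t\<in>dense_times. r < W' t w} \<in> events"
    using progressive_section_M[OF ito_processD(1)[OF W']] dense_times_subset
    by (intro sets.sets_Collect_countable_Ex' countable_times borel_measurable_less) auto
   show "AE w in M. w \<in> {w \<in> space M. \<exists>t\<in>dense_times. X t w < \<delta>} \<longrightarrow> w \<in> {w \<in> space M. \<exists>t\<in>dense_times. r < W' t w}"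
    using W_bounds X0 ito_process_continuous[OF X] ito_process_continuous[OF W']
   proof (eventually_elim, intro impI)
    fix w
    assume *: "\<forall>t\<in>{0..T}. exp (- \<epsilon> * L t w) \<le> W t w \<and> W t w \<le> K * exp (- \<epsilon> * L t w) \<and> (\<delta> \<le> X t w \<longrightarrow> D t w \<le> C * W t w)"
     "X 0 w = 1" "continuous_on {0..T} (%t. X t w)" "continuous_on {0..T} (%t. W' t w)"
     and w: "w \<in> {w \<in> space M. \<exists>t\<in>dense_times. X t w < \<delta>}"
    then obtain t where t: "t \<in> {0..T}" "X t w < \<delta>" using dense_times_subset by blast
    obtain t0 where t0: "t0 \<in> {0..T}" "X t0 w = \<delta>" "\<forall>s\<in>{0..t0}. \<delta> \<le> X s w"
     using first_hitting[OF *(3) _ t] *(2) \<delta> by auto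
    have "V t0 w = (LBINT s:{0..t0}. 0)"
     unfolding V_def by (rule set_lebesgue_integral_cong) (use t0(3) in \<open>auto simp: \<rho>_def not_less\<close>)
    hence "V t0 w = 0" by simp
    hence "W' t0 w = W t0 w" by (simp add: W'_def)
    moreover have "exp (- \<epsilon> * L t0 w) \<le> W t0 w" using *(1) t0(1) by blast
    moreover have "exp (- \<epsilon> * L t0 w) = \<delta> powr (- \<epsilon>)" using t0(2) \<delta> by (simp add: L_def ext_ln_eq powr_def)
    moreover have "0 < \<delta> powr (- \<epsilon>)" using \<delta> by simp
    ultimately have "r < W' t0 w" unfolding r_def by linarith
    hence "\<exists>t\<in>dense_times. r < W' t w"
     using continuous_le_times[OF *(4) _ t0(1), of r] by (meson not_le)
    thus "w \<in> {w \<in> space M. \<exists>t\<in>dense_times. r < W' t w}" using w by blast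
   qed
  qed
  also have "\<dots> \<le> exp (C * T) * K / r" by (rule supermartingale_bounds(1)[OF W' progressive_const C _ W'_pos W'_init dr r]) (use K in simp)
  also have "\<dots> = 2 * exp (C * T) * K * \<delta> powr \<epsilon>" using \<delta> by (simp add: r_def powr_minus field_simps)
  finally show ?thesis .
 qed
 show pos: "AE w in M. \<forall>t\<in>{0..T}. 0 < X t w"
 proof -
  \<comment> \<open>A path outside some \<open>?P n\<close> stays at or above
    \<open>1 / Suc n\<close> at all dense times, hence at all times; the hitting estimate makes the
    intersection of the \<open>?P n\<close> null.\<close>
  let ?P = "%n. {w \<in> space M. \<exists>t\<in>dense_times. X t w < inverse (real (Suc n))}"
  have P: "?P n \<in> events" for n
   using XM by (intro sets.sets_Collect_countable_Ex' countable_times borel_measurable_less) auto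
  have "(%n. 2 * exp (C * T) * K * inverse (real (Suc n)) powr \<epsilon>) ~> 2 * exp (C * T) * K * 0 powr \<epsilon>"
   by (intro tendsto_mult tendsto_const tendsto_powr' LIMSEQ_inverse_real_of_nat) (use \<epsilon> in \<open>auto intro!: always_eventually\<close>)
  moreover have "prob (\<Inter>n. ?P n) \<le> 2 * exp (C * T) * K * inverse (real (Suc n)) powr \<epsilon>" for n
  proof -
   have "prob (\<Inter>n. ?P n) \<le> prob (?P n)" using P by (intro finite_measure_mono) auto
   also have "\<dots> \<le> 2 * exp (C * T) * K * inverse (real (Suc n)) powr \<epsilon>" by (rule hit) (simp_all add: inverse_le_1_iff)
   finally show ?thesis .
  qed
  ultimately have "prob (\<Inter>n. ?P n) \<le> 2 * exp (C * T) * K * 0 powr \<epsilon>" by (intro LIMSEQ_le_const) auto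
  hence "prob (\<Inter>n. ?P n) = 0" by (intro antisym measure_nonneg) simp
  hence "AE w in M. w \<notin> (\<Inter>n. ?P n)" using P by (intro AE_not_in) (auto simp: null_sets_def emeasure_eq_measure)
  thus ?thesis using ito_process_continuous[OF X] AE_space
  proof eventually_elim
   case (elim w)
   then obtain n where n: "\<And>t. t \<in> dense_times ==> inverse (real (Suc n)) \<le> X t w" by (auto simp: not_less)
   show ?case
   proof
    fix t assume t: "t \<in> {0..T}"
    have "- X t w \<le> - inverse (real (Suc n))" by (rule continuous_le_times[OF continuous_on_minus[OF elim(2)] _ t]) (use n in simp)
    moreover have "0 < inverse (real (Suc n))" by simp
    ultimately show "0 < X t w" by linarith
   qed
  qed
 qed
 have "ito_process y (%s w. - v s w) z"
 proof (rule ito_process_cong[OF ito_process_quotient[OF ito_process_ln[OF X pos] Y] py progressive_uminus[OF pv] pz])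
  have a: "bX s w / X s w - (sX s w / X s w)^2 / 2 = \<beta> s w - (\<alpha> s w)^2 / 2" "sX s w / X s w = \<alpha> s w" if "0 < X s w" for s w
   using that by (simp_all add: scale)
  show "AE w in M. \<forall>t\<in>{0..T}. Y t w * exp (- ln (X t w)) = y t w"
   using pos by eventually_elim (simp add: y_def exp_minus divide_inverse)
  show "AE w in M. AE s in leb T. exp (- ln (X s w)) * (- fX s w - Y s w * (bX s w / X s w - (sX s w / X s w)^2 / 2) +
    Y s w * (sX s w / X s w)^2 / 2 - Z s w * (sX s w / X s w)) = - v s w"
   using pos
  proof eventually_elim
   case (elim w)
   show ?case
   proof (rule AE_timeI)
    fix s assume "s \<in> {0..T}"
    hence Xp: "0 < X s w" using elim by simp
    show "exp (- ln (X s w)) * (- fX s w - Y s w * (bX s w / X s w - (sX s w / X s w)^2 / 2) +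
     Y s w * (sX s w / X s w)^2 / 2 - Z s w * (sX s w / X s w)) = - v s w"
     unfolding a(1)[OF Xp] unfolding a(2)[OF Xp] by (rule drift_U) (use Xp in simp)
   qed
  qed
  show "AE w in M. AE s in leb T. exp (- ln (X s w)) * (Z s w - Y s w * (sX s w / X s w)) = z s w" using pos
  proof eventually_elim
   case (elim w)
   show ?case
   proof (rule AE_timeI)
    fix s assume "s \<in> {0..T}"
    hence Xp: "0 < X s w" using elim by simp
    show "exp (- ln (X s w)) * (Z s w - Y s w * (sX s w / X s w)) = z s w"
     unfolding a[OF Xp] by (rule drift_U) (use Xp in simp)
   qed
  qed
 qed
 moreover have "AE w in M. y T w = h w"
  using YT pos by eventually_elim (use T_pos in \<open>auto simp: y_def dest!: bspec[of _ _ T]\<close>)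
 moreover have "AE w in M. \<forall>s\<in>{0..T}. char_driver b \<sigma> f s w (y s w) (z s w) = v s w"
  using est pos
 proof eventually_elim
  case (elim w)
  show ?case
  proof
   fix s assume s: "s \<in> {0..T}"
   have "X s w \<noteq> 0" using bspec[OF elim(2) s] by simp
   thus "char_driver b \<sigma> f s w (y s w) (z s w) = v s w" using bspec[OF elim(1) s] by blast
  qed
 qed
 ultimately have "solves_char_bsde M F B T b \<sigma> f h y z"
  unfolding solves_char_bsde_def by (intro conjI py pz backward_of_ito_process)
 thus "solves_char_bsde M F B T b \<sigma> f h (%t w. Y t w / X t w)
   (%t w. (Z t w - Y t w / X t w * (\<sigma> 1 t w * X t w + \<sigma> 2 t w * Y t w + \<sigma> 3 t w * Z t w)) / X t w)"
  unfolding y_def[abs_def] z_def[abs_def] sX_def .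
qed

end

end

theorem theorem4p2:
  fixes M :: "'a measure" and T :: real and B :: "real \<Rightarrow> 'a \<Rightarrow> real"
    and b \<sigma> f :: "nat \<Rightarrow> real \<Rightarrow> 'a \<Rightarrow> real" and h :: "'a \<Rightarrow> real"
    and \<F> :: "real \<Rightarrow> 'a measure"
  assumes T_pos: "0 < T"
    and BM: "brownian_motion M T B"
    and filt: "\<F> = augmented_filtration M B"
    and b: "\<And>i. i \<in> {1, 2, 3} \<Longrightarrow> progressive \<F> T (b i) \<and> bounded_process M T (b i)"
    and \<sigma>: "\<And>i. i \<in> {1, 2, 3} \<Longrightarrow> progressive \<F> T (\<sigma> i) \<and> bounded_process M T (\<sigma> i)"
    and f: "\<And>i. i \<in> {1, 2, 3} \<Longrightarrow> progressive \<F> T (f i) \<and> bounded_process M T (f i)"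
    and h_meas: "h \<in> borel_measurable (\<F> T)"
    and h_bdd: "\<exists>K. AE \<omega> in M. \<bar>h \<omega>\<bar> \<le> K"
  shows
    "(\<forall>Yh Zh.
        solves_char_bsde M \<F> B T b \<sigma> f h Yh Zh \<and>
        bounded_process M T Yh \<and>
        bounded_inverse M T (\<lambda>t \<omega>. 1 - \<sigma> 3 t \<omega> * Yh t \<omega>) \<longrightarrow>
        (\<exists>X Y Z.
           solves_linear_fbsde M \<F> B T b \<sigma> f h X Y Z \<and>
           (X, Y, Z) \<in> (\<Union>q\<in>{1<..}. Lq_space M \<F> T q) \<and>
           nonzero_process M T X \<and>
           (AE \<omega> in M. \<forall>t\<in>{0..T}.
              Y t \<omega> = Yh t \<omega> * X t \<omega> \<and>
              Z t \<omega> = (Zh t \<omega> + Yh t \<omega> * (\<sigma> 1 t \<omega> + \<sigma> 2 t \<omega> * Yh t \<omega>))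
                        / (1 - \<sigma> 3 t \<omega> * Yh t \<omega>) * X t \<omega>)))
     \<and>
     (\<forall>X Y Z C.
        solves_linear_fbsde M \<F> B T b \<sigma> f h X Y Z \<and>
        (X, Y, Z) \<in> (\<Union>q\<in>{1<..}. Lq_space M \<F> T q) \<and>
        (AE \<omega> in M. \<forall>t\<in>{0..T}.
           \<bar>Y t \<omega>\<bar> \<le> C * \<bar>X t \<omega>\<bar> \<and>
           \<bar>X t \<omega>\<bar> \<le> C * \<bar>X t \<omega> - \<sigma> 3 t \<omega> * Y t \<omega>\<bar>) \<longrightarrow>
        nonzero_process M T X \<and>
        (let Yh = (\<lambda>t \<omega>. Y t \<omega> / X t \<omega>);
             Zh = (\<lambda>t \<omega>. (Z t \<omega> - Yh t \<omega> *
                     (\<sigma> 1 t \<omega> * X t \<omega> + \<sigma> 2 t \<omega> * Y t \<omega> + \<sigma> 3 t \<omega> * Z t \<omega>)) / X t \<omega>)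
         in solves_char_bsde M \<F> B T b \<sigma> f h Yh Zh \<and>
            bounded_process M T Yh \<and>
            bounded_inverse M T (\<lambda>t \<omega>. 1 - \<sigma> 3 t \<omega> * Yh t \<omega>)))"
proof -
 interpret brownian_filtration M T \<F> B
  unfolding filt by (rule brownian_motion.brownian_filtration_augmented[OF BM T_pos])
 have bnd: "\<exists>K. AE w in M. \<forall>t\<in>{0..T}. \<forall>i\<in>{1, 2, 3}. \<bar>p i t w\<bar> \<le> K"
  if p: "\<And>i. i \<in> {1, 2, 3} ==> bounded_process M T (p i)" for p :: "nat => real => 'a => real"
 proof -
  obtain K1 K2 K3 where "AE w in M. \<forall>t\<in>{0..T}. \<bar>p 1 t w\<bar> \<le> K1" "AE w in M. \<forall>t\<in>{0..T}. \<bar>p 2 t w\<bar> \<le> K2"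
   "AE w in M. \<forall>t\<in>{0..T}. \<bar>p 3 t w\<bar> \<le> K3"
   using p[of 1] p[of 2] p[of 3] unfolding bounded_process_def by auto
  hence "AE w in M. \<forall>t\<in>{0..T}. \<forall>i\<in>{1, 2, 3}. \<bar>p i t w\<bar> \<le> max K1 (max K2 K3)"
   by eventually_elim (simp add: le_max_iff_disj)
  thus ?thesis by blast
 qed
 from bnd[of b] bnd[of \<sigma>] bnd[of f] obtain Kb K\<sigma> Kf where K: "AE w in M. \<forall>t\<in>{0..T}. \<forall>i\<in>{1, 2, 3}. \<bar>b i t w\<bar> \<le> Kb"
  "AE w in M. \<forall>t\<in>{0..T}. \<forall>i\<in>{1, 2, 3}. \<bar>\<sigma> i t w\<bar> \<le> K\<sigma>" "AE w in M. \<forall>t\<in>{0..T}. \<forall>i\<in>{1, 2, 3}. \<bar>f i t w\<bar> \<le> Kf"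
  using b \<sigma> f by blast
 have coeff: "AE w in M. \<forall>t\<in>{0..T}. \<forall>i\<in>{1, 2, 3}. \<bar>b i t w\<bar> \<le> k \<and> \<bar>\<sigma> i t w\<bar> \<le> k \<and> \<bar>f i t w\<bar> \<le> k"
  if "Kb \<le> k" "K\<sigma> \<le> k" "Kf \<le> k" for k
  using K
 proof eventually_elim
  case (elim w)
  show ?case
  proof (intro ballI)
   fix t i assume "t \<in> {0..T}" "i \<in> {1, 2, 3 :: nat}"
   hence "\<bar>b i t w\<bar> \<le> Kb" "\<bar>\<sigma> i t w\<bar> \<le> K\<sigma>" "\<bar>f i t w\<bar> \<le> Kf" using elim by blast+
   thus "\<bar>b i t w\<bar> \<le> k \<and> \<bar>\<sigma> i t w\<bar> \<le> k \<and> \<bar>f i t w\<bar> \<le> k" using that by linarith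
  qed
 qed
 have prog: "i \<in> {1, 2, 3} ==> progressive \<F> T (b i)" "i \<in> {1, 2, 3} ==> progressive \<F> T (\<sigma> i)"
  "i \<in> {1, 2, 3} ==> progressive \<F> T (f i)" for i using b \<sigma> f by blast+
 show ?thesis
 proof (intro conjI allI impI; (elim conjE)?)
  fix Yh Zh
  assume char: "solves_char_bsde M \<F> B T b \<sigma> f h Yh Zh" and bY: "bounded_process M T Yh"
   and bI: "bounded_inverse M T (%t w. 1 - \<sigma> 3 t w * Yh t w)"
  obtain K1 K2 where K12: "AE w in M. \<forall>t\<in>{0..T}. \<bar>Yh t w\<bar> \<le> K1" "AE w in M. \<forall>t\<in>{0..T}. 1 - \<sigma> 3 t w * Yh t w \<noteq> 0"
   "AE w in M. \<forall>t\<in>{0..T}. \<bar>inverse (1 - \<sigma> 3 t w * Yh t w)\<bar> \<le> K2"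
   using bY bI unfolding bounded_inverse_def bounded_process_def nonzero_process_def by blast
  define k where "k = Max {1, Kb, K\<sigma>, Kf, K1, K2}"
  have k: "1 \<le> k" "Kb \<le> k" "K\<sigma> \<le> k" "Kf \<le> k" "K1 \<le> k" "K2 \<le> k" by (simp_all add: k_def)
  have "AE w in M. \<forall>t\<in>{0..T}. \<bar>Yh t w\<bar> \<le> k \<and> 1 - \<sigma> 3 t w * Yh t w \<noteq> 0 \<and> \<bar>inverse (1 - \<sigma> 3 t w * Yh t w)\<bar> \<le> k"
   using K12 by eventually_elim (use k in \<open>auto intro: order_trans\<close>)
  from linear_fbsde_of_char_bsde[OF prog k(1) coeff[OF k(2-4)] char this] obtain X Y Z where
   "solves_linear_fbsde M \<F> B T b \<sigma> f h X Y Z" "(X, Y, Z) \<in> (\<Union>q\<in>{1<..}. Lq_space M \<F> T q)"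
   "\<forall>t w. X t w \<noteq> 0 \<and> Y t w = Yh t w * X t w \<and>
    Z t w = (Zh t w + Yh t w * (\<sigma> 1 t w + \<sigma> 2 t w * Yh t w)) / (1 - \<sigma> 3 t w * Yh t w) * X t w"
   by blast
  thus "\<exists>X Y Z. solves_linear_fbsde M \<F> B T b \<sigma> f h X Y Z \<and> (X, Y, Z) \<in> (\<Union>q\<in>{1<..}. Lq_space M \<F> T q) \<and>
      nonzero_process M T X \<and>
      (AE w in M. \<forall>t\<in>{0..T}. Y t w = Yh t w * X t w \<and>
       Z t w = (Zh t w + Yh t w * (\<sigma> 1 t w + \<sigma> 2 t w * Yh t w)) / (1 - \<sigma> 3 t w * Yh t w) * X t w)"
   unfolding nonzero_process_def by (intro exI[of _ X] exI[of _ Y] exI[of _ Z] conjI AE_I2) auto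
 next
  fix X Y Z C
  assume fbsde: "solves_linear_fbsde M \<F> B T b \<sigma> f h X Y Z"
   and cone: "AE w in M. \<forall>t\<in>{0..T}. \<bar>Y t w\<bar> \<le> C * \<bar>X t w\<bar> \<and> \<bar>X t w\<bar> \<le> C * \<bar>X t w - \<sigma> 3 t w * Y t w\<bar>"
  define k where "k = Max {1, Kb, K\<sigma>, Kf, C}"
  have k: "1 \<le> k" "Kb \<le> k" "K\<sigma> \<le> k" "Kf \<le> k" "C \<le> k" by (simp_all add: k_def)
  have cone': "AE w in M. \<forall>t\<in>{0..T}. \<bar>Y t w\<bar> \<le> k * \<bar>X t w\<bar> \<and> \<bar>X t w\<bar> \<le> k * \<bar>X t w - \<sigma> 3 t w * Y t w\<bar>"
   using cone
  proof eventually_elim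
   case (elim w)
   show ?case
   proof
    fix t assume t: "t \<in> {0..T}"
    have "C * \<bar>x\<bar> \<le> k * \<bar>x\<bar>" for x :: real using k(5) by (rule mult_right_mono) simp
    thus "\<bar>Y t w\<bar> \<le> k * \<bar>X t w\<bar> \<and> \<bar>X t w\<bar> \<le> k * \<bar>X t w - \<sigma> 3 t w * Y t w\<bar>"
     using bspec[OF elim t] order_trans by blast
   qed
  qed
  have pos: "AE w in M. \<forall>t\<in>{0..T}. 0 < X t w" by (rule char_bsde_of_linear_fbsde(1)[OF prog k(1) coeff[OF k(2-4)] fbsde cone'])
  have main: "solves_char_bsde M \<F> B T b \<sigma> f h (%t w. Y t w / X t w)
   (%t w. (Z t w - Y t w / X t w * (\<sigma> 1 t w * X t w + \<sigma> 2 t w * Y t w + \<sigma> 3 t w * Z t w)) / X t w)"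
   by (rule char_bsde_of_linear_fbsde(2)[OF prog k(1) coeff[OF k(2-4)] fbsde cone'])
  show "nonzero_process M T X"
   unfolding nonzero_process_def using pos by (rule eventually_mono) (metis less_irrefl)
  have quot: "AE w in M. \<forall>t\<in>{0..T}. \<bar>Y t w / X t w\<bar> \<le> k \<and> 1 - \<sigma> 3 t w * (Y t w / X t w) \<noteq> 0 \<and>
    \<bar>inverse (1 - \<sigma> 3 t w * (Y t w / X t w))\<bar> \<le> k"
   using pos cone'
  proof (eventually_elim, intro ballI)
   fix w t
   assume *: "\<forall>t\<in>{0..T}. 0 < X t w" "\<forall>t\<in>{0..T}. \<bar>Y t w\<bar> \<le> k * \<bar>X t w\<bar> \<and> \<bar>X t w\<bar> \<le> k * \<bar>X t w - \<sigma> 3 t w * Y t w\<bar>"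
    and t: "t \<in> {0..T}"
   have X: "0 < X t w" using *(1) t by blast
   have eq: "1 - \<sigma> 3 t w * (Y t w / X t w) = (X t w - \<sigma> 3 t w * Y t w) / X t w" using X by (simp add: field_simps)
   have "X t w \<le> k * \<bar>X t w - \<sigma> 3 t w * Y t w\<bar>" "\<bar>Y t w\<bar> \<le> k * X t w" using bspec[OF *(2) t] X by auto
   moreover from this have "X t w - \<sigma> 3 t w * Y t w \<noteq> 0" using X by auto
   ultimately show "\<bar>Y t w / X t w\<bar> \<le> k \<and> 1 - \<sigma> 3 t w * (Y t w / X t w) \<noteq> 0 \<and>
     \<bar>inverse (1 - \<sigma> 3 t w * (Y t w / X t w))\<bar> \<le> k"
    unfolding eq using X by (simp add: divide_le_eq)
  qed
  have "bounded_process M T (%t w. Y t w / X t w)" "bounded_inverse M T (%t w. 1 - \<sigma> 3 t w * (Y t w / X t w))"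
   unfolding bounded_inverse_def bounded_process_def nonzero_process_def by (intro conjI exI[of _ k]; rule eventually_mono[OF quot]; blast)+
  thus "let Yh = (%t w. Y t w / X t w);
       Zh = (%t w. (Z t w - Yh t w *
           (\<sigma> 1 t w * X t w + \<sigma> 2 t w * Y t w + \<sigma> 3 t w * Z t w)) / X t w)
     in solves_char_bsde M \<F> B T b \<sigma> f h Yh Zh \<and>
      bounded_process M T Yh \<and>
      bounded_inverse M T (%t w. 1 - \<sigma> 3 t w * Yh t w)"
   unfolding Let_def using main by blast
 qed
qed

end
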